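(* Let $\mathcal{S}$ be a symmetric free domain in $\mathbb{M}^2$. Assume that for all $w_1,w_2\in\mathcal{S}$: if $\pi(w_1)$ is similar to $\pi(w_2)$ (i.e. $\pi(w_1)=s^{-1}\pi(w_2)s$ for some invertible matrix $s$), then $w_1\oplus w_2\in\mathcal{S}$. Let $\mathcal{S}_o$, $\mathcal{S}_{oo}$, the Zariski-free manifold $\mathfrak{G}_{oo}$ and $\mathfrak{G}_o=\pi(\mathcal{S}_o)$ be as defined in the context. Then there are canonical bijections between the following five sets of graded functions: (i) bounded symmetric conditionally nc functions $f$ on $\mathcal{S}$; (ii) bounded symmetric conditionally nc functions $f_o$ on $\mathcal{S}_o$; (iii) bounded symmetric Zariski-freely holomorphic functions $f_{oo}$ on $\mathcal{S}_{oo}$ that are conditionally nc; (iv) bounded holomorphic functions $F_{oo}$ on the Zariski-free manifold $\mathfrak{G}_{oo}$ that are conditionally nc (when $\mathfrak{G}_{oo}$ is viewed as a subset of $\mathbb{M}^3$); (v) bounded functions $F_o$ on $\mathfrak{G}_o$ that are conditionally nc. Moreover, if $f,f_o,f_{oo},F_o,F_{oo}$ correspond under these bijections, then $f_o=f|_{\mathcal{S}_o}$, $f_{oo}=f_o|_{\mathcal{S}_{oo}}$, $F_{oo}=F_o|_{\mathfrak{G}_{oo}}$, $f_o=F_o\circ\pi$ on $\mathcal{S}_o$ and $f_{oo}=F_{oo}\circ\pi$ on $\mathcal{S}_{oo}$.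
   Context: **Basics.** $\mathbb{M}_n$ is the algebra of $n\times n$ complex matrices, $\mathbb{M}^d=\bigcup_{n\ge1}\mathbb{M}_n^d$ (disjoint union), with points $x=(x^1,\dots,x^d)$. Direct sums $x\oplus y$ and similarities $s^{-1}xs$ are taken componentwise. An *nc-set* is a subset of $\mathbb{M}^d$ closed under direct sums. A function $f:D\to\mathbb{M}^1$, $D\subseteq\mathbb{M}^d$, is *graded* if $f(x)\in\mathbb{M}_n$ whenever $x\in D\cap\mathbb{M}_n^d$. An *nc-function* is a graded function $f$ on an nc-set $D$ such that $f(x\oplus y)=f(x)\oplus f(y)$ for $x,y\in D$, and $f(s^{-1}xs)=s^{-1}f(x)s$ whenever $x\in D\cap\mathbb{M}_n^d$, $s\in\mathbb{M}_n$ is invertible and $s^{-1}xs\in D$. A function is bounded if the operator norms of its values are uniformly bounded (over all levels $n$). For $w=(w^1,w^2)\in\mathbb{M}^2$, $w^f=(w^2,w^1)$; a set is *symmetric* if it is invariant under $w\mapsto w^f$, and a function $f$ on a symmetric set is *symmetric* if $f(w^f)=f(w)$. **Topologies.** A set $D\subseteq\mathbb{M}^d$ is finitely open if $D\cap\mathbb{M}_n^d$ is open in $\mathbb{M}_n^d$ for every $n$. A topology on $\mathbb{M}^d$ is *admissible* if it has a basis of finitely open nc-sets. The *free topology* has as base the sets $B_\delta=\{x:\|[\delta_{ij}(x)]\|<1\}$, $\delta$ a (rectangular) matrix of free polynomials (polynomials over $\mathbb{C}$ in non-commuting variables); freely open sets are free domains. For an admissible topology $\tau$, a graded function $f$ on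 $D$ is *$\tau$-holomorphic* if $D\in\tau$, every $x\in D$ has a neighborhood $U\in\tau$, $U\subseteq D$, that is an nc-set on which $f$ is an nc-function, and every $x\in D$ has a $\tau$-neighborhood on which $f$ is bounded. One says freely (resp. Zariski-freely) holomorphic when $\tau$ is the free (resp. Zariski-free) topology. A *free variety* in a free domain $D$ is a set $\{x\in D: g(x)=0\ \forall g\in E\}$, $E$ a set of freely holomorphic functions on $D$. The *Zariski-free topology* has as base the sets $D\setminus T$, $D$ a free domain and $T$ a finite union of free varieties in $D$; it is admissible. **Constructions.** $\pi:\mathbb{M}^2\to\mathbb{M}^3$ is $\pi(w^1,w^2)=(\tfrac12(w^1+w^2),\tfrac14(w^1-w^2)^2,\tfrac18(w^1-w^2)(w^1+w^2)(w^1-w^2))$. Let $\Gamma$ be the set of finite subsets of $\mathbb{C}\setminus\{0\}$. For each $\gamma\in\Gamma$ fix $r_\gamma>0$ with $r_\gamma<\min\{\min_{c\in\gamma}|c|,\ \tfrac14\min_{c\ne d\in\gamma}|c-d|\}$, let $\Delta_\gamma=\bigcup_{c\in\gamma}\{z:|z-c|<r_\gamma\}$, and fix a holomorphic branch $s_\gamma$ of $\sqrt z$ on $\Delta_\gamma$. For $\tau\in\{-1,1\}^\gamma$ let $\iota_{\gamma\tau}(z)=\tau(c)$ if $|z-c|<r_\gamma$, $c\in\gamma$. Let $D_\gamma=\{x\in\mathbb{M}^1:\sigma(x)\subseteq\Delta_\gamma\}$ and, via the holomorphic functional calculus, $I_{\gamma\tau}(x)=\iota_{\gamma\tau}(x)$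 and $S_{\gamma\tau}(x)=s_\gamma(x)\iota_{\gamma\tau}(x)$ for $x\in D_\gamma$. Let $\mathcal{W}_\gamma=\{(u,x)\in\mathbb{M}^2:x\in D_\gamma\}$ and $\mathcal{U}_\gamma=\{(u,x)\in\mathcal{W}_\gamma:\ uI_{\gamma\tau}(x)\ne I_{\gamma\tau}(x)u$ for every nonconstant $\tau\in\{-1,1\}^\gamma\}$. Put $\omega_{\gamma\tau}(u,x)=(u+S_{\gamma\tau}(x),u-S_{\gamma\tau}(x))$ on $\mathcal{W}_\gamma$ and $\Phi_{\gamma\tau}(u,x)=(u,x,S_{\gamma\tau}(x)uS_{\gamma\tau}(x))$ on $\mathcal{U}_\gamma$. Unions below are over $\gamma\in\Gamma$, $\tau\in\{-1,1\}^\gamma$: $\mathcal{S}_o=\bigcup_{\gamma,\tau}(\omega_{\gamma\tau}(\mathcal{W}_\gamma)\cap\mathcal{S})$; $\mathcal{S}_{oo}=\bigcup_{\gamma,\tau}(\omega_{\gamma\tau}(\mathcal{U}_\gamma)\cap\mathcal{S})\subseteq\mathcal{S}_o$; $\mathcal{U}_{\gamma\tau}(\mathcal{S})=\{(u,x)\in\mathcal{U}_\gamma:\omega_{\gamma\tau}(u,x)\in\mathcal{S}\}$ (Zariski-freely open); $\mathfrak{G}_{oo}=\bigcup_{\gamma,\tau}\Phi_{\gamma\tau}(\mathcal{U}_{\gamma\tau}(\mathcal{S}))=\pi(\mathcal{S}_{oo})\subseteq\mathbb{M}^3$. $\mathfrak{G}_{oo}$ is a Zariski-free manifold: its topology has as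 base the sets $\Phi_{\gamma\tau}(U)$, $U\subseteq\mathcal{U}_{\gamma\tau}(\mathcal{S})$ Zariski-freely open, and its charts are $\Phi_{\gamma\tau}^{-1}:\Phi_{\gamma\tau}(\mathcal{U}_{\gamma\tau}(\mathcal{S}))\to\mathcal{U}_{\gamma\tau}(\mathcal{S})$. A function $F:\mathfrak{G}_{oo}\to\mathbb{M}^1$ is *holomorphic* if $F\circ\Phi_{\gamma\tau}$ is Zariski-freely holomorphic on $\mathcal{U}_{\gamma\tau}(\mathcal{S})$ for all $\gamma,\tau$. **Conditionally nc.** A graded function $f$ on an arbitrary set $D\subseteq\mathbb{M}^d$ is *conditionally nc* if (i) $f(s^{-1}xs)=s^{-1}f(x)s$ whenever $x,s^{-1}xs\in D$, and (ii) there is a graded function $\hat f$ on $\hat D=\{y:\exists x\in D,\ x\oplus y\in D\}$ such that $f(x\oplus y)=f(x)\oplus\hat f(y)$ whenever $x\in D$ and $x\oplus y\in D$. *)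

theory Defs
  imports
    "HOL-Complex_Analysis.Complex_Analysis"
    "HOL-Library.FuncSet"
    "HOL-Library.Poly_Mapping"
    "Jordan_Normal_Form.Matrix"
    "Jordan_Normal_Form.Gauss_Jordan_Elimination"
    "Jordan_Normal_Form.Spectral_Radius"
begin

text \<open>
  A point of \<open>M_n^d\<close> is a list of \<open>d\<close> complex \<open>n \<times> n\<close> matrices, \<open>n \<ge> 1\<close>.  The matrices carry their
  dimension, so for \<open>d \<ge> 1\<close> the union over \<open>n\<close> is disjoint.  Elements of \<open>M^1\<close> are written as
  plain matrices when they are values of functions or arguments of the functional calculus.
\<close>

type_synonym point = "complex mat list"
type_synonym ncfun = "point \<Rightarrow> complex mat"

definition level :: "nat \<Rightarrow> nat \<Rightarrow> point set" where
  "level d n = {x. length x = d \<and> set x \<subseteq> carrier_mat n n}"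

definition nc_space :: "nat \<Rightarrow> point set" where
  "nc_space d = (\<Union>n\<in>{1..}. level d n)"

definition lvl :: "point \<Rightarrow> nat" where
  "lvl x = dim_row (hd x)"

definition mat_dsum :: "complex mat \<Rightarrow> complex mat \<Rightarrow> complex mat" where
  "mat_dsum A B = four_block_mat A (0\<^sub>m (dim_row A) (dim_col B)) (0\<^sub>m (dim_row B) (dim_col A)) B"

definition pt_dsum :: "point \<Rightarrow> point \<Rightarrow> point" where
  "pt_dsum x y = map2 mat_dsum x y"

text \<open>Only meaningful for invertible square matrices.\<close>
definition minv :: "complex mat \<Rightarrow> complex mat" where
  "minv s = the (mat_inverse s)"

text \<open>\<open>GLn n\<close> is the set of invertible elements of \<open>M_n\<close>; \<open>mat_conj s A\<close> is \<open>s\<^sup>-\<^sup>1 A s\<close>.\<close>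
definition GLn :: "nat \<Rightarrow> complex mat set" where
  "GLn n = {s \<in> carrier_mat n n. invertible_mat s}"

definition mat_conj :: "complex mat \<Rightarrow> complex mat \<Rightarrow> complex mat" where
  "mat_conj s A = minv s * A * s"

definition pt_conj :: "complex mat \<Rightarrow> point \<Rightarrow> point" where
  "pt_conj s x = map (mat_conj s) x"

definition similar_points :: "point \<Rightarrow> point \<Rightarrow> bool" where
  "similar_points x y \<longleftrightarrow>
     (\<exists>n d s. x \<in> level d n \<and> y \<in> level d n \<and> s \<in> GLn n \<and> x = pt_conj s y)"

definition flip :: "point \<Rightarrow> point" where
  "flip w = [w ! 1, w ! 0]"

definition opnorm :: "complex mat \<Rightarrow> real" where
  "opnorm A = (SUP v\<in>{v \<in> carrier_vec (dim_col A). L2_set (\<lambda>i. cmod (vec_index v i)) {..<dim_vec v} \<le> 1}.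
     L2_set (\<lambda>i. cmod (vec_index (A *\<^sub>v v) i)) {..<dim_row A})"

definition nc_set :: "nat \<Rightarrow> point set \<Rightarrow> bool" where
  "nc_set d D \<longleftrightarrow> D \<subseteq> nc_space d \<and> (\<forall>x\<in>D. \<forall>y\<in>D. pt_dsum x y \<in> D)"

definition graded :: "nat \<Rightarrow> point set \<Rightarrow> ncfun \<Rightarrow> bool" where
  "graded d D f \<longleftrightarrow> (\<forall>n\<ge>1. \<forall>x \<in> D \<inter> level d n. f x \<in> carrier_mat n n)"

definition similarity_preserving :: "nat \<Rightarrow> point set \<Rightarrow> ncfun \<Rightarrow> bool" where
  "similarity_preserving d D f \<longleftrightarrow>
     (\<forall>n\<ge>1. \<forall>x \<in> D \<inter> level d n. \<forall>s \<in> GLn n. pt_conj s x \<in> D \<longrightarrow> f (pt_conj s x) = mat_conj s (f x))"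

definition nc_function :: "nat \<Rightarrow> point set \<Rightarrow> ncfun \<Rightarrow> bool" where
  "nc_function d D f \<longleftrightarrow>
     nc_set d D \<and> graded d D f \<and>
     (\<forall>x\<in>D. \<forall>y\<in>D. f (pt_dsum x y) = mat_dsum (f x) (f y)) \<and>
     similarity_preserving d D f"

definition bounded_on :: "point set \<Rightarrow> ncfun \<Rightarrow> bool" where
  "bounded_on D f \<longleftrightarrow> (\<exists>C. \<forall>x\<in>D. opnorm (f x) \<le> C)"

definition symmetric_set :: "point set \<Rightarrow> bool" where
  "symmetric_set D \<longleftrightarrow> (\<forall>w\<in>D. flip w \<in> D)"

definition symmetric_on :: "point set \<Rightarrow> ncfun \<Rightarrow> bool" where
  "symmetric_on D f \<longleftrightarrow> symmetric_set D \<and> (\<forall>w\<in>D. f (flip w) = f w)"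

definition hat :: "nat \<Rightarrow> point set \<Rightarrow> point set" where
  "hat d D = {y \<in> nc_space d. \<exists>x\<in>D. pt_dsum x y \<in> D}"

definition cond_nc :: "nat \<Rightarrow> point set \<Rightarrow> ncfun \<Rightarrow> bool" where
  "cond_nc d D f \<longleftrightarrow>
     graded d D f \<and> similarity_preserving d D f \<and>
     (\<exists>fh. graded d (hat d D) fh \<and>
        (\<forall>x\<in>D. \<forall>y\<in>nc_space d. pt_dsum x y \<in> D \<longrightarrow> f (pt_dsum x y) = mat_dsum (f x) (fh y)))"

text \<open>
  A free polynomial is a finitely supported function from words to coefficients; the word
  \<open>[i, j, ...]\<close> stands for the monomial \<open>x^i x^j ...\<close>, with the variables indexed from 0.
\<close>

type_synonym free_poly = "nat list \<Rightarrow>\<^sub>0 complex"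

definition free_polys :: "nat \<Rightarrow> free_poly set" where
  "free_polys d = {p. Poly_Mapping.keys p \<subseteq> lists {..<d}}"

definition word_eval :: "point \<Rightarrow> nat list \<Rightarrow> complex mat" where
  "word_eval x w = foldr (\<lambda>i A. x ! i * A) w (1\<^sub>m (lvl x))"

definition fp_eval :: "free_poly \<Rightarrow> point \<Rightarrow> complex mat" where
  "fp_eval p x = Matrix.mat (lvl x) (lvl x)
     (\<lambda>(i, j). \<Sum>w\<in>Poly_Mapping.keys p. Poly_Mapping.lookup p w * word_eval x w $$ (i, j))"

text \<open>For \<open>x\<close> at level \<open>n\<close>, the \<open>k \<times> l\<close> matrix of \<open>n \<times> n\<close> blocks \<open>\<delta>_{ij}(x)\<close>, as a \<open>kn \<times> ln\<close> matrix.\<close>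
definition fpmat_eval :: "free_poly mat \<Rightarrow> point \<Rightarrow> complex mat" where
  "fpmat_eval \<delta> x = (let n = lvl x in
     Matrix.mat (dim_row \<delta> * n) (dim_col \<delta> * n)
       (\<lambda>(i, j). fp_eval (\<delta> $$ (i div n, j div n)) x $$ (i mod n, j mod n)))"

definition B_delta :: "nat \<Rightarrow> free_poly mat \<Rightarrow> point set" where
  "B_delta d \<delta> = {x \<in> nc_space d. opnorm (fpmat_eval \<delta> x) < 1}"

definition free_base :: "nat \<Rightarrow> point set set" where
  "free_base d = {B_delta d \<delta> | \<delta>. 0 < dim_row \<delta> \<and> 0 < dim_col \<delta> \<and> elements_mat \<delta> \<subseteq> free_polys d}"

text \<open>A topology is represented by the family of its open sets, here the unions of basic sets.\<close>
definition opens_of_base :: "point set set \<Rightarrow> point set set" where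
  "opens_of_base \<B> = Collect (arbitrary union_of (\<lambda>B. B \<in> \<B>))"

definition free_top :: "nat \<Rightarrow> point set set" where
  "free_top d = opens_of_base (free_base d)"

definition holo :: "nat \<Rightarrow> point set set \<Rightarrow> point set \<Rightarrow> ncfun \<Rightarrow> bool" where
  "holo d \<T> D f \<longleftrightarrow>
     D \<in> \<T> \<and> graded d D f \<and>
     (\<forall>x\<in>D. \<exists>U\<in>\<T>. x \<in> U \<and> U \<subseteq> D \<and> nc_set d U \<and> nc_function d U f) \<and>
     (\<forall>x\<in>D. \<exists>U\<in>\<T>. x \<in> U \<and> U \<subseteq> D \<and> bounded_on U f)"

definition free_variety :: "nat \<Rightarrow> point set \<Rightarrow> point set \<Rightarrow> bool" where
  "free_variety d D V \<longleftrightarrow>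
     (\<exists>E. (\<forall>g\<in>E. holo d (free_top d) D g) \<and> V = {x\<in>D. \<forall>g\<in>E. g x = 0\<^sub>m (lvl x) (lvl x)})"

definition zariski_base :: "nat \<Rightarrow> point set set" where
  "zariski_base d = {D - \<Union>\<V> | D \<V>. D \<in> free_top d \<and> finite \<V> \<and> (\<forall>V\<in>\<V>. free_variety d D V)}"

definition zariski_top :: "nat \<Rightarrow> point set set" where
  "zariski_top d = opens_of_base (zariski_base d)"

text \<open>
  The Riesz-Dunford integral \<open>1/(2\<pi>i) \<integral> g(z) (z - x)\<^sup>-\<^sup>1 dz\<close>, taken entrywise, over the cycle
  consisting of one sufficiently small positively oriented circle around each point of the
  spectrum of \<open>x\<close>.  The library's \<open>residue\<close> is by definition such a normalised circle integral.
\<close>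
definition resolvent :: "complex mat \<Rightarrow> complex \<Rightarrow> complex mat" where
  "resolvent x z = minv (z \<cdot>\<^sub>m 1\<^sub>m (dim_row x) - x)"

definition hfc :: "(complex \<Rightarrow> complex) \<Rightarrow> complex mat \<Rightarrow> complex mat" where
  "hfc g x = Matrix.mat (dim_row x) (dim_row x)
     (\<lambda>(i, j). \<Sum>\<mu>\<in>spectrum x. residue (\<lambda>z. g z * resolvent x z $$ (i, j)) \<mu>)"

text \<open>
  Below, \<open>r\<close> and \<open>sq\<close> are the fixed choices of radii \<open>r_\<gamma>\<close> and of branches \<open>s_\<gamma>\<close> of the square root.
\<close>

definition pi_map :: "point \<Rightarrow> point" where
  "pi_map w = (let a = w ! 0; b = w ! 1 in
     [(1/2) \<cdot>\<^sub>m (a + b),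
      (1/4) \<cdot>\<^sub>m ((a - b) * (a - b)),
      (1/8) \<cdot>\<^sub>m ((a - b) * (a + b) * (a - b))])"

definition Gam :: "complex set set" where
  "Gam = {\<gamma>. finite \<gamma> \<and> \<gamma> \<subseteq> - {0}}"

definition discs :: "(complex set \<Rightarrow> real) \<Rightarrow> complex set \<Rightarrow> complex set" where
  "discs r \<gamma> = (\<Union>c\<in>\<gamma>. ball c (r \<gamma>))"

definition admissible_radii :: "(complex set \<Rightarrow> real) \<Rightarrow> bool" where
  "admissible_radii r \<longleftrightarrow>
     (\<forall>\<gamma>\<in>Gam. 0 < r \<gamma> \<and> (\<forall>c\<in>\<gamma>. r \<gamma> < cmod c) \<and>
        (\<forall>c\<in>\<gamma>. \<forall>e\<in>\<gamma>. c \<noteq> e \<longrightarrow> r \<gamma> < cmod (c - e) / 4))"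

definition sqrt_branches ::
  "(complex set \<Rightarrow> real) \<Rightarrow> (complex set \<Rightarrow> complex \<Rightarrow> complex) \<Rightarrow> bool" where
  "sqrt_branches r sq \<longleftrightarrow>
     (\<forall>\<gamma>\<in>Gam. sq \<gamma> holomorphic_on discs r \<gamma> \<and> (\<forall>z\<in>discs r \<gamma>. (sq \<gamma> z)\<^sup>2 = z))"

definition signs :: "complex set \<Rightarrow> (complex \<Rightarrow> complex) set" where
  "signs \<gamma> = \<gamma> \<rightarrow>\<^sub>E {-1, 1}"

definition nonconst_signs :: "complex set \<Rightarrow> (complex \<Rightarrow> complex) set" where
  "nonconst_signs \<gamma> = {\<tau> \<in> signs \<gamma>. \<exists>c\<in>\<gamma>. \<exists>e\<in>\<gamma>. \<tau> c \<noteq> \<tau> e}"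

definition iota :: "(complex set \<Rightarrow> real) \<Rightarrow> complex set \<Rightarrow> (complex \<Rightarrow> complex) \<Rightarrow> complex \<Rightarrow> complex" where
  "iota r \<gamma> \<tau> z = \<tau> (THE c. c \<in> \<gamma> \<and> z \<in> ball c (r \<gamma>))"

definition D_gam :: "(complex set \<Rightarrow> real) \<Rightarrow> complex set \<Rightarrow> complex mat set" where
  "D_gam r \<gamma> = {x. (\<exists>n\<ge>1. x \<in> carrier_mat n n) \<and> spectrum x \<subseteq> discs r \<gamma>}"

definition I_mat :: "(complex set \<Rightarrow> real) \<Rightarrow> complex set \<Rightarrow> (complex \<Rightarrow> complex) \<Rightarrow> complex mat \<Rightarrow> complex mat" where
  "I_mat r \<gamma> \<tau> x = hfc (iota r \<gamma> \<tau>) x"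

definition S_mat ::
  "(complex set \<Rightarrow> real) \<Rightarrow> (complex set \<Rightarrow> complex \<Rightarrow> complex) \<Rightarrow> complex set \<Rightarrow> (complex \<Rightarrow> complex) \<Rightarrow>
     complex mat \<Rightarrow> complex mat" where
  "S_mat r sq \<gamma> \<tau> x = hfc (sq \<gamma>) x * hfc (iota r \<gamma> \<tau>) x"

definition W_gam :: "(complex set \<Rightarrow> real) \<Rightarrow> complex set \<Rightarrow> point set" where
  "W_gam r \<gamma> = {[u, x] | u x. [u, x] \<in> nc_space 2 \<and> x \<in> D_gam r \<gamma>}"

definition U_gam :: "(complex set \<Rightarrow> real) \<Rightarrow> complex set \<Rightarrow> point set" where
  "U_gam r \<gamma> = {[u, x] | u x. [u, x] \<in> W_gam r \<gamma> \<and>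
     (\<forall>\<tau>\<in>nonconst_signs \<gamma>. u * I_mat r \<gamma> \<tau> x \<noteq> I_mat r \<gamma> \<tau> x * u)}"

definition omega ::
  "(complex set \<Rightarrow> real) \<Rightarrow> (complex set \<Rightarrow> complex \<Rightarrow> complex) \<Rightarrow> complex set \<Rightarrow> (complex \<Rightarrow> complex) \<Rightarrow>
     point \<Rightarrow> point" where
  "omega r sq \<gamma> \<tau> p = (let u = p ! 0; x = p ! 1 in [u + S_mat r sq \<gamma> \<tau> x, u - S_mat r sq \<gamma> \<tau> x])"

definition Phi ::
  "(complex set \<Rightarrow> real) \<Rightarrow> (complex set \<Rightarrow> complex \<Rightarrow> complex) \<Rightarrow> complex set \<Rightarrow> (complex \<Rightarrow> complex) \<Rightarrow>
     point \<Rightarrow> point" where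
  "Phi r sq \<gamma> \<tau> p = (let u = p ! 0; x = p ! 1 in [u, x, S_mat r sq \<gamma> \<tau> x * u * S_mat r sq \<gamma> \<tau> x])"

context
  fixes r :: "complex set \<Rightarrow> real"
    and sq :: "complex set \<Rightarrow> complex \<Rightarrow> complex"
    and S :: "point set"
begin

definition S_o :: "point set" where
  "S_o = (\<Union>\<gamma>\<in>Gam. \<Union>\<tau>\<in>signs \<gamma>. omega r sq \<gamma> \<tau> ` W_gam r \<gamma> \<inter> S)"

definition S_oo :: "point set" where
  "S_oo = (\<Union>\<gamma>\<in>Gam. \<Union>\<tau>\<in>signs \<gamma>. omega r sq \<gamma> \<tau> ` U_gam r \<gamma> \<inter> S)"

definition U_chart :: "complex set \<Rightarrow> (complex \<Rightarrow> complex) \<Rightarrow> point set" where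
  "U_chart \<gamma> \<tau> = {p \<in> U_gam r \<gamma>. omega r sq \<gamma> \<tau> p \<in> S}"

definition G_oo :: "point set" where
  "G_oo = (\<Union>\<gamma>\<in>Gam. \<Union>\<tau>\<in>signs \<gamma>. Phi r sq \<gamma> \<tau> ` U_chart \<gamma> \<tau>)"

definition G_o :: "point set" where
  "G_o = pi_map ` S_o"

definition manifold_holo :: "ncfun \<Rightarrow> bool" where
  "manifold_holo F \<longleftrightarrow>
     (\<forall>\<gamma>\<in>Gam. \<forall>\<tau>\<in>signs \<gamma>. holo 2 (zariski_top 2) (U_chart \<gamma> \<tau>) (F \<circ> Phi r sq \<gamma> \<tau>))"

text \<open>A function on a set \<open>D\<close> is represented by a total function with a fixed value outside \<open>D\<close>.\<close>

definition funs_S :: "ncfun set" where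
  "funs_S = {f \<in> extensional S. bounded_on S f \<and> symmetric_on S f \<and> cond_nc 2 S f}"

definition funs_So :: "ncfun set" where
  "funs_So = {f \<in> extensional S_o. bounded_on S_o f \<and> symmetric_on S_o f \<and> cond_nc 2 S_o f}"

definition funs_Soo :: "ncfun set" where
  "funs_Soo = {f \<in> extensional S_oo. bounded_on S_oo f \<and> symmetric_on S_oo f \<and>
     holo 2 (zariski_top 2) S_oo f \<and> cond_nc 2 S_oo f}"

definition funs_Goo :: "ncfun set" where
  "funs_Goo = {F \<in> extensional G_oo. bounded_on G_oo F \<and> manifold_holo F \<and> cond_nc 3 G_oo F}"

definition funs_Go :: "ncfun set" where
  "funs_Go = {F \<in> extensional G_o. bounded_on G_o F \<and> cond_nc 3 G_o F}"

end

end

theory Submission imports Defs begin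

text \<open>A bounded conditionally nc function \<open>f\<close> is locally Cauchy: conjugating \<open>v \<oplus> v'\<close> by a unipotent matrix with
  off-diagonal block \<open>c\<close> produces the off-diagonal block \<open>c (f v - f v')\<close>, so boundedness of \<open>f\<close> for large \<open>c\<close>
  forces \<open>f v\<close> and \<open>f v'\<close> to be close whenever \<open>v\<close> and \<open>v'\<close> are.  The generic points \<open>S_oo\<close> are dense in \<open>S\<close>
  level by level (shift \<open>w\<^sup>1 - w\<^sup>2\<close> by a small scalar, then perturb \<open>w\<^sup>1 + w\<^sup>2\<close>), hence a function on \<open>S_oo\<close>
  extends uniquely to \<open>S\<close> by limits, and restriction gives the first three bijections.

  For the quotient by \<open>\<pi>\<close>, write \<open>u = (w\<^sup>1 + w\<^sup>2) / 2\<close> and \<open>d = (w\<^sup>1 - w\<^sup>2) / 2\<close>.  If \<open>(u, d)\<close> and \<open>(u, e)\<close>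
  have the same image under \<open>\<pi>\<close>, then \<open>J = d\<^sup>-\<^sup>1 e\<close> commutes with \<open>u\<close>, and \<open>1 + J\<close> and \<open>1 - J\<close> intertwine
  \<open>(u, d)\<close> with \<open>(u, e)\<close> and with its flip.  A symmetric conditionally nc function respects intertwiners and
  does not see the flip, so adding the two relations shows that it takes the same value at both points.\<close>

section \<open>Invertible matrices, polynomials of a matrix, direct sums\<close>

text \<open>Two obstacles shape the argument. The generic points do not form an nc-set, so direct
  sums have to be arranged inside one chart image: with \<open>\<gamma>\<close> and
  \<open>\<tau>\<close> fixed, a single generic summand makes a sum generic, provided that the
  spectra of all half differences lie in one set \<open>VV \<gamma> \<tau>\<close>. Auxiliary points
  are therefore chosen jointly.

  The other obstacle is uniformity in the level. Free openness and local boundedness concern all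
  matrix sizes at once, while a polynomial interpolating the square root at one matrix matches it
  only there. Near that matrix the two are compared through an operator-norm fixed point whose
  constants do not involve the size.

  Membership in \<open>S_o\<close> means membership in \<open>S\<close> together with a spectrum of
  \<open>(w\<^sup>1 - w\<^sup>2) / 2\<close> that is disjoint from its negative. There
  \<open>d\<close> is a polynomial of \<open>d\<^sup>2\<close>, so that two such roots of one square
  commute. The assumption on similar images enters when values over one fibre are compared: it puts
  the sums of \<open>w1\<close> with \<open>w2\<close> and with the flip of \<open>w2\<close> into
  \<open>S\<close>.\<close>

lemma GLnD:
  assumes "s \<in> GLn n"
  shows "s \<in> carrier_mat n n" "minv s \<in> carrier_mat n n" "s * minv s = 1\<^sub>m n" "minv s * s = 1\<^sub>m n"
proof -
  show s: "s \<in> carrier_mat n n" using assms by (auto simp: GLn_def)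
  from assms obtain B where B: "s * B = 1\<^sub>m (dim_row s)" "B * s = 1\<^sub>m (dim_row B)"
    by (auto simp: GLn_def invertible_mat_def inverts_mat_def)
  have "dim_row B = n"
    using arg_cong[OF B(2), of dim_col] s by simp
  moreover have "dim_col B = n"
    using arg_cong[OF B(1), of dim_col] s by simp
  ultimately have Bc: "B \<in> carrier_mat n n" by auto
  have "s \<in> Units (ring_mat TYPE(complex) n ())"
    using s B Bc by (auto simp: Units_def ring_mat_simps)
  then obtain C where C: "mat_inverse s = Some C"
    using mat_inverse(1)[OF s, of "()"] by (cases "mat_inverse s") auto
  note * = mat_inverse(2)[OF s C]
  show "minv s \<in> carrier_mat n n" "s * minv s = 1\<^sub>m n" "minv s * s = 1\<^sub>m n"
    using * C by (auto simp: minv_def)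
qed

lemma GLnI:
  assumes "A \<in> carrier_mat n n" "B \<in> carrier_mat n n" "A * B = 1\<^sub>m n"
  shows "A \<in> GLn n" "minv A = B"
proof -
  have BA: "B * A = 1\<^sub>m n" using mat_mult_left_right_inverse[OF assms] .
  then show A: "A \<in> GLn n"
    using assms by (auto simp: GLn_def invertible_mat_def inverts_mat_def intro!: exI[of _ B])
  have "minv A = minv A * (A * B)" using GLnD[OF A] assms by simp
  also have "\<dots> = (minv A * A) * B" using GLnD[OF A] assms by (metis assoc_mult_mat)
  finally show "minv A = B" using GLnD[OF A] assms by simp
qed

lemma minv_GLn: "s \<in> GLn n \<Longrightarrow> minv s \<in> GLn n"
  and minv_minv: "s \<in> GLn n \<Longrightarrow> minv (minv s) = s"
  using GLnI[of "minv s" n s] GLnD[of s n] by auto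

lemma one_GLn: "1\<^sub>m n \<in> GLn n" and minv_one: "minv (1\<^sub>m n) = 1\<^sub>m n"
  using GLnI[of "1\<^sub>m n" n "1\<^sub>m n"] by auto

lemma kernel_vector:
  assumes "A \<in> carrier_mat n n" "A \<notin> GLn n"
  obtains v where "v \<in> carrier_vec n" "v \<noteq> 0\<^sub>v n" "A *\<^sub>v v = 0\<^sub>v n"
proof -
  have "Determinant.det A = 0"
  proof (rule ccontr)
    assume "Determinant.det A \<noteq> 0"
    then have "A \<in> Units (ring_mat TYPE(complex) n ())"
      using det_non_zero_imp_unit[OF assms(1), where b = "()"] by blast
    then obtain B where "B \<in> carrier_mat n n" "A * B = 1\<^sub>m n"
      by (auto simp: Units_def ring_mat_simps)
    then show False using GLnI(1)[OF assms(1)] assms(2) by blast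
  qed
  then show thesis using det_0_iff_vec_prod_zero[OF assms(1)] that by blast
qed

lemma mat_eq_by_vec:
  assumes "A \<in> carrier_mat n m" "B \<in> carrier_mat n m"
    and "\<And>v. v \<in> carrier_vec m \<Longrightarrow> A *\<^sub>v v = B *\<^sub>v (v :: complex vec)"
  shows "A = B"
proof (rule eq_matI)
  fix i j assume ij: "i < dim_row B" "j < dim_col B"
  then have "A *\<^sub>v unit_vec m j = B *\<^sub>v unit_vec m j" by (intro assms(3)) auto
  then have "vec_index (A *\<^sub>v unit_vec m j) i = vec_index (B *\<^sub>v unit_vec m j) i" by simp
  moreover have "row A i \<bullet> unit_vec m j = A $$ (i, j)" "row B i \<bullet> unit_vec m j = B $$ (i, j)"
    using ij assms(1,2) by (auto simp: scalar_prod_right_unit)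
  ultimately show "A $$ (i, j) = B $$ (i, j)" using ij assms(1,2) by simp
qed (use assms in auto)

text \<open>Meant for the uniqueness of square roots: commuting roots \<open>b\<close>,
  \<open>c\<close> of one matrix satisfy \<open>(b + c) * (b - c) = 0\<close>, and injectivity of
  \<open>b + c\<close> then forces \<open>b = c\<close>.\<close>

lemma inj_cancel:
  assumes "A \<in> carrier_mat n n" "B \<in> carrier_mat n m" "A * B = 0\<^sub>m n m"
    and "\<And>v. v \<in> carrier_vec n \<Longrightarrow> v \<noteq> 0\<^sub>v n \<Longrightarrow> A *\<^sub>v v \<noteq> 0\<^sub>v n"
  shows "B = (0\<^sub>m n m :: complex mat)"
proof (rule mat_eq_by_vec[of _ n m])
  fix v :: "complex vec" assume v: "v \<in> carrier_vec m"
  have "A *\<^sub>v (B *\<^sub>v v) = (A * B) *\<^sub>v v" using assms(1,2) v by (simp add: assoc_mult_mat_vec)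
  also have "\<dots> = 0\<^sub>v n" unfolding assms(3) using v by (intro eq_vecI) auto
  finally have "B *\<^sub>v v = 0\<^sub>v n" using assms(2,4) v mult_mat_vec_carrier by blast
  then show "B *\<^sub>v v = 0\<^sub>m n m *\<^sub>v v" using v by (auto intro!: eq_vecI)
qed (use assms in auto)

section \<open>Polynomials of a matrix\<close>

text \<open>Horner's scheme, the recursion of \<open>poly\<close>, so that induction over
  \<open>pCons\<close> applies.\<close>

definition pm :: "complex poly \<Rightarrow> complex mat \<Rightarrow> complex mat" where
  "pm p x = fold_coeffs (\<lambda>a B. a \<cdot>\<^sub>m 1\<^sub>m (dim_row x) + x * B) p (0\<^sub>m (dim_row x) (dim_row x))"

lemma pm_0 [simp]: "pm 0 x = 0\<^sub>m (dim_row x) (dim_row x)"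
  by (simp add: pm_def)

lemma pm_pCons: "x \<in> carrier_mat n n \<Longrightarrow> pm (pCons a p) x = a \<cdot>\<^sub>m 1\<^sub>m n + x * pm p x"
proof (cases "p = 0 \<and> a = 0")
  case True
  assume "x \<in> carrier_mat n n"
  then show ?thesis using True by (auto simp: pm_def)
next
  case False
  assume "x \<in> carrier_mat n n"
  then show ?thesis using False by (auto simp: pm_def)
qed

lemma pm_carrier [simp, intro]: "x \<in> carrier_mat n n \<Longrightarrow> pm p x \<in> carrier_mat n n"
  by (induction p) (auto simp: pm_pCons)

lemma pm_dim [simp]: "dim_row (pm p x) = dim_row x" "dim_row x = dim_col x \<Longrightarrow> dim_col (pm p x) = dim_col x"
proof -
  show "dim_row (pm p x) = dim_row x"
    by (cases "p = 0") (simp, cases p, auto simp: pm_def)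
  show "dim_row x = dim_col x \<Longrightarrow> dim_col (pm p x) = dim_col x"
    using pm_carrier[of x "dim_row x" p] by (metis carrier_matD(2) carrier_matI)
qed

lemma pm_add: "x \<in> carrier_mat n n \<Longrightarrow> pm (p + q) x = pm p x + pm q x"
proof (induction p q rule: poly_induct2)
  case (pCons a p b q)
  then have c: "x \<in> carrier_mat n n" "pm p x \<in> carrier_mat n n" "pm q x \<in> carrier_mat n n" by auto
  show ?case using pCons c
    by (simp add: pm_pCons mult_add_distrib_mat[of _ n n _ n])
       (rule eq_matI, auto simp: algebra_simps simp del: assoc_add_mat)
qed auto

lemma pm_smult: "x \<in> carrier_mat n n \<Longrightarrow> pm (Polynomial.smult c p) x = c \<cdot>\<^sub>m pm p x"
proof (induction p)
  case (pCons a p)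
  then have c: "x \<in> carrier_mat n n" "pm p x \<in> carrier_mat n n" by auto
  show ?case using pCons c
    by (simp add: pm_pCons mult_smult_distrib[of _ n n _ n] add_smult_distrib_left_mat[of _ n n])
       (rule eq_matI, auto simp: algebra_simps)
qed auto

lemma pm_mult: "x \<in> carrier_mat n n \<Longrightarrow> pm (p * q) x = pm p x * pm q x"
proof (induction p)
  case (pCons a p)
  then have c: "x \<in> carrier_mat n n" "pm p x \<in> carrier_mat n n" "pm q x \<in> carrier_mat n n" by auto
  have "pm (pCons a p * q) x = a \<cdot>\<^sub>m pm q x + (0 \<cdot>\<^sub>m 1\<^sub>m n + x * (pm p x * pm q x))"
    using pCons c by (simp add: pm_add pm_smult pm_pCons)
  also have "0 \<cdot>\<^sub>m 1\<^sub>m n + x * (pm p x * pm q x) = x * (pm p x * pm q x)"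
    by (rule eq_matI) (use c in auto)
  also have "x * (pm p x * pm q x) = x * pm p x * pm q x"
    by (rule assoc_mult_mat[symmetric, OF c])
  also have "a \<cdot>\<^sub>m pm q x = (a \<cdot>\<^sub>m 1\<^sub>m n) * pm q x"
    using mult_smult_assoc_mat[of "1\<^sub>m n" n n "pm q x" n a] c by simp
  finally show ?case using c by (simp add: pm_pCons add_mult_distrib_mat[of _ n n _ _ n] assoc_mult_mat[OF c])
qed auto

lemma pm_1: "x \<in> carrier_mat n n \<Longrightarrow> pm 1 x = 1\<^sub>m n"
  by (auto simp add: one_pCons pm_pCons intro!: eq_matI)

lemma pm_const: "x \<in> carrier_mat n n \<Longrightarrow> pm [:a:] x = a \<cdot>\<^sub>m 1\<^sub>m n"
  by (auto simp add: pm_pCons)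

lemma pm_linear: "x \<in> carrier_mat n n \<Longrightarrow> pm [:a, b:] x = a \<cdot>\<^sub>m 1\<^sub>m n + b \<cdot>\<^sub>m x"
  by (simp add: pm_pCons) (rule eq_matI, auto simp: mult_smult_distrib[of _ n n])

lemma pm_X: "x \<in> carrier_mat n n \<Longrightarrow> pm [:0, 1:] x = x"
  by (simp add: pm_linear) (rule eq_matI, auto)

lemma pm_uminus: "x \<in> carrier_mat n n \<Longrightarrow> pm (- p) x = - pm p x"
  using pm_smult[of x n "-1" p] by (auto intro!: eq_matI simp: pm_carrier)

lemma pm_minus: "x \<in> carrier_mat n n \<Longrightarrow> pm (p - q) x = pm p x - pm q x"
proof -
  assume x: "x \<in> carrier_mat n n"
  have "pm (p - q) x = pm (p + (- q)) x" by simp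
  also have "\<dots> = pm p x + (- pm q x)" using x by (simp only: pm_add[OF x] pm_uminus[OF x])
  finally show ?thesis using pm_carrier[OF x, of p] pm_carrier[OF x, of q]
    by (simp add: add_uminus_minus_mat)
qed

text \<open>Stated for a rectangular intertwiner: the case \<open>x = y\<close> gives commutation,
  an invertible \<open>A\<close> gives similarity invariance.\<close>

lemma pm_commute:
  assumes "A \<in> carrier_mat n m" "x \<in> carrier_mat m m" "y \<in> carrier_mat n n" "A * x = y * A"
  shows "A * pm p x = pm p y * A"
proof (induction p)
  case (pCons a p)
  note c = assms pm_carrier[OF assms(2), of p] pm_carrier[OF assms(3), of p]
  have "A * (x * pm p x) = (A * x) * pm p x"
    by (rule assoc_mult_mat[symmetric]) (use c in auto)
  also have "\<dots> = y * (A * pm p x)" unfolding assms(4) by (rule assoc_mult_mat) (use c in auto)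
  also have "\<dots> = y * pm p y * A" unfolding pCons(2) by (rule assoc_mult_mat[symmetric]) (use c in auto)
  finally have 1: "A * (x * pm p x) = y * pm p y * A" .
  show ?case using c 1
    by (simp add: pm_pCons mult_add_distrib_mat[of _ n m _ m] add_mult_distrib_mat[of _ n n _ _ m]
        mult_smult_distrib[of _ n m _ m] mult_smult_assoc_mat[of _ n n _ m])
qed (use assms in auto)

lemma pm_commute_self:
  assumes "x \<in> carrier_mat n n" shows "pm p x * x = x * pm p x" "pm p x * pm q x = pm q x * pm p x"
  using pm_commute[of x n n x x p] pm_mult[OF assms, of p q] pm_mult[OF assms, of q p] assms
  by (auto simp: mult.commute)

lemma pm_eigen:
  assumes "x \<in> carrier_mat n n" "v \<in> carrier_vec n" "x *\<^sub>v v = l \<cdot>\<^sub>v v"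
  shows "pm p x *\<^sub>v v = poly p l \<cdot>\<^sub>v v"
proof (induction p)
  case 0
  then show ?case using assms by (auto intro!: eq_vecI)
next
  case (pCons a p)
  note c = assms pm_carrier[OF assms(1), of p]
  have "pm (pCons a p) x *\<^sub>v v = (a \<cdot>\<^sub>m 1\<^sub>m n) *\<^sub>v v + x *\<^sub>v (pm p x *\<^sub>v v)"
    using c by (simp add: pm_pCons add_mult_distrib_mat_vec[of _ n n] assoc_mult_mat_vec[of _ n n _ n])
  also have "x *\<^sub>v (pm p x *\<^sub>v v) = (l * poly p l) \<cdot>\<^sub>v v"
    using c pCons by (simp add: mult_mat_vec[of _ n n] smult_smult_assoc mult.commute)
  also have "(a \<cdot>\<^sub>m 1\<^sub>m n) *\<^sub>v v = a \<cdot>\<^sub>v v" using c by (auto intro!: eq_vecI)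
  finally show ?case using c by (auto intro!: eq_vecI simp: algebra_simps)
qed

lemma pm_sum_monom_index:
  assumes "x \<in> carrier_mat n n" "i < n" "j < n"
  shows "pm (\<Sum>k<N. monom (c k) k) x $$ (i, j) = (\<Sum>k<N. c k * pm (monom 1 k) x $$ (i, j))"
proof (induction N)
  case (Suc N)
  have "monom (c N) N = Polynomial.smult (c N) (monom 1 N)" by (simp add: smult_monom)
  then show ?case using Suc assms by (simp add: pm_add pm_smult del: smult_monom)
qed (use assms in auto)

section \<open>Direct sums of matrices\<close>

lemma mat_dsum_carrier [simp, intro]:
  "A \<in> carrier_mat n n \<Longrightarrow> B \<in> carrier_mat m m \<Longrightarrow> mat_dsum A B \<in> carrier_mat (n + m) (n + m)"
  by (auto simp: mat_dsum_def)

lemma mat_dsum_dim [simp]: "dim_row (mat_dsum A B) = dim_row A + dim_row B"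
  "dim_col (mat_dsum A B) = dim_col A + dim_col B"
  by (auto simp: mat_dsum_def)

lemma mat_dsum_mult:
  assumes "A \<in> carrier_mat n n" "B \<in> carrier_mat m m" "C \<in> carrier_mat n n" "D \<in> carrier_mat m m"
  shows "mat_dsum A B * mat_dsum C D = mat_dsum (A * C) (B * D)"
proof -
  have "A * C \<in> carrier_mat n n" "B * D \<in> carrier_mat m m" using assms by auto
  then show ?thesis using assms unfolding mat_dsum_def
    by (subst mult_four_block_mat[of _ n n _ m _ m _ _ n _ m]) (auto intro!: cong_four_block_mat)
qed

lemma mat_dsum_add:
  assumes "A \<in> carrier_mat n n" "B \<in> carrier_mat m m" "C \<in> carrier_mat n n" "D \<in> carrier_mat m m"
  shows "mat_dsum A B + mat_dsum C D = mat_dsum (A + C) (B + D)"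
    "mat_dsum A B - mat_dsum C D = mat_dsum (A - C) (B - D)"
  using assms by (auto simp: mat_dsum_def intro!: eq_matI)

lemma mat_dsum_smult: "c \<cdot>\<^sub>m mat_dsum A B = mat_dsum (c \<cdot>\<^sub>m A) (c \<cdot>\<^sub>m B)"
  for c :: complex
  by (auto simp: mat_dsum_def intro!: eq_matI)

lemma mat_dsum_one: "mat_dsum (1\<^sub>m n) (1\<^sub>m m) = 1\<^sub>m (n + m)"
  by (auto simp: mat_dsum_def intro!: eq_matI)

lemma mat_dsum_zero: "mat_dsum (0\<^sub>m n n) (0\<^sub>m m m) = 0\<^sub>m (n + m) (n + m)"
  by (auto simp: mat_dsum_def intro!: eq_matI)

lemma mat_dsum_inject:
  assumes "A \<in> carrier_mat n n" "B \<in> carrier_mat m m" "C \<in> carrier_mat n n" "D \<in> carrier_mat m m"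
  shows "mat_dsum A B = mat_dsum C D \<longleftrightarrow> A = C \<and> B = D"
proof
  assume eq: "mat_dsum A B = mat_dsum C D"
  have "A $$ (i, j) = C $$ (i, j)" if "i < n" "j < n" for i j
    using arg_cong[OF eq, of "\<lambda>M. M $$ (i, j)"] that assms by (auto simp: mat_dsum_def)
  moreover have "B $$ (i, j) = D $$ (i, j)" if "i < m" "j < m" for i j
    using arg_cong[OF eq, of "\<lambda>M. M $$ (i + n, j + n)"] that assms by (auto simp: mat_dsum_def)
  ultimately show "A = C \<and> B = D" using assms by (auto intro!: eq_matI)
qed simp

lemma mat_dsum_assoc: "mat_dsum A (mat_dsum B C) = mat_dsum (mat_dsum A B) C"
  unfolding mat_dsum_def by (rule assoc_four_block_mat)

lemma pm_dsum:
  assumes "x \<in> carrier_mat n n" "y \<in> carrier_mat m m"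
  shows "pm p (mat_dsum x y) = mat_dsum (pm p x) (pm p y)"
proof (induction p)
  case 0
  then show ?case using assms by (auto simp: mat_dsum_zero)
next
  case (pCons a p)
  have c: "mat_dsum x y \<in> carrier_mat (n + m) (n + m)" using assms by auto
  have "pm (pCons a p) (mat_dsum x y) = a \<cdot>\<^sub>m 1\<^sub>m (n + m) + mat_dsum x y * mat_dsum (pm p x) (pm p y)"
    using pCons c by (simp add: pm_pCons)
  also have "\<dots> = mat_dsum (pm (pCons a p) x) (pm (pCons a p) y)"
    using assms
    by (simp add: mat_dsum_mult[of _ n _ m] mat_dsum_one[symmetric] mat_dsum_smult pm_pCons mat_dsum_add[of _ n _ m])
  finally show ?case .
qed

declare minus_carrier_mat [simp]

section \<open>Annihilating polynomials and eigenvalues\<close>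

lemma poly_factorization_list:
  fixes p :: "complex poly"
  assumes "p \<noteq> 0"
  obtains as c where "c \<noteq> 0" "p = Polynomial.smult c (\<Prod>a\<leftarrow>as. [:-a, 1:])"
proof -
  obtain A where A: "p = Polynomial.smult (lead_coeff p) (\<Prod>x\<in>#A. [:-x, 1:])"
    using alg_closed_imp_factorization[OF assms] by blast
  obtain as where as: "mset as = A" by (metis ex_mset)
  have "(\<Prod>x\<in>#A. [:-x, 1:]) = (\<Prod>a\<leftarrow>as. [:-a, 1:])"
    unfolding as[symmetric] by (metis mset_map prod_mset_prod_list)
  then show thesis using A assms that[of "lead_coeff p" as] by simp
qed

text \<open>The n^2 + 1 powers of \<open>x\<close> with exponents 0 to n^2 are linearly dependent; a
  kernel vector of their coordinate matrix holds the coefficients.\<close>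

lemma annihilating_poly:
  assumes x: "x \<in> carrier_mat n n"
  shows "\<exists>p. p \<noteq> 0 \<and> pm p x = 0\<^sub>m n n"
proof -
  define m where "m = n * n"
  \<comment> \<open>The last row is zero: it makes the system square and singular, so that
    \<open>kernel_vector\<close> applies.\<close>
  define M where "M = Matrix.mat (Suc m) (Suc m)
    (\<lambda>(r, k). if r < m then pm (monom 1 k) x $$ (r div n, r mod n) else 0)"
  have M: "M \<in> carrier_mat (Suc m) (Suc m)" by (simp add: M_def)
  have "M \<notin> GLn (Suc m)"
  proof
    assume *: "M \<in> GLn (Suc m)"
    have "row M m = 0\<^sub>v (Suc m)" by (rule eq_vecI) (auto simp: M_def)
    moreover have "(M * minv M) $$ (m, m) = row M m \<bullet> col (minv M) m"
      using GLnD[OF *] by (intro index_mult_mat) auto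
    moreover have "col (minv M) m \<in> carrier_vec (Suc m)"
      by (intro carrier_vecI) (simp add: carrier_matD[OF GLnD(2)[OF *]])
    ultimately have "(M * minv M) $$ (m, m) = 0" by simp
    then show False unfolding GLnD(3)[OF *] by simp
  qed
  obtain v where v: "v \<in> carrier_vec (Suc m)" "v \<noteq> 0\<^sub>v (Suc m)" "M *\<^sub>v v = 0\<^sub>v (Suc m)"
    by (rule kernel_vector[OF M \<open>M \<notin> GLn (Suc m)\<close>])
  define p where "p = (\<Sum>k<Suc m. monom (vec_index v k) k)"
  have cf: "coeff p k = vec_index v k" if "k < Suc m" for k
    using that by (simp add: p_def coeff_sum del: sum.lessThan_Suc)
  have "p \<noteq> 0"
  proof
    assume "p = 0"
    then have "v = 0\<^sub>v (Suc m)" using cf v(1) by (intro eq_vecI) auto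
    with v(2) show False by simp
  qed
  moreover have "pm p x = 0\<^sub>m n n"
  proof (rule eq_matI)
    fix i j assume "i < dim_row (0\<^sub>m n n :: complex mat)" "j < dim_col (0\<^sub>m n n :: complex mat)"
    then have ij: "i < n" "j < n" by auto
    define r where "r = i * n + j"
    have "r < Suc i * n" using ij by (simp add: r_def)
    also have "\<dots> \<le> m" unfolding m_def using ij by (intro mult_le_mono1) simp
    finally have r: "r < m" "r div n = i" "r mod n = j" using ij by (auto simp: r_def)
    have "pm p x $$ (i, j) = (\<Sum>k<Suc m. vec_index v k * pm (monom 1 k) x $$ (i, j))"
      unfolding p_def by (rule pm_sum_monom_index[OF x ij])
    also have "\<dots> = row M r \<bullet> v"
      using r v(1) by (auto simp: scalar_prod_def M_def atLeast0LessThan mult.commute intro!: sum.cong simp del: sum.lessThan_Suc)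
    also have "\<dots> = vec_index (M *\<^sub>v v) r" using r M by simp
    also have "\<dots> = 0" using r by (simp add: v(3))
    finally show "pm p x $$ (i, j) = 0\<^sub>m n n $$ (i, j)" using ij by simp
  qed (use x in auto)
  ultimately show ?thesis by blast
qed

lemma annihilating_list:
  assumes x: "x \<in> carrier_mat n n"
  obtains as where "pm (\<Prod>a\<leftarrow>as. [:-a, 1:]) x = 0\<^sub>m n n"
proof -
  obtain p where p: "p \<noteq> 0" "pm p x = 0\<^sub>m n n" using annihilating_poly[OF x] by blast
  obtain as c where c: "c \<noteq> 0" "p = Polynomial.smult c (\<Prod>a\<leftarrow>as. [:-a, 1:])"
    using poly_factorization_list[OF p(1)] .
  have "(\<Prod>a\<leftarrow>as. [:-a, 1:]) = Polynomial.smult (inverse c) p" using c by simp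
  then have "pm (\<Prod>a\<leftarrow>as. [:-a, 1:]) x = inverse c \<cdot>\<^sub>m pm p x" using x by (simp add: pm_smult)
  then show thesis using p that by simp
qed

lemma spectrumI: "x \<in> carrier_mat n n \<Longrightarrow> v \<in> carrier_vec n \<Longrightarrow> v \<noteq> 0\<^sub>v n \<Longrightarrow> x *\<^sub>v v = l \<cdot>\<^sub>v v \<Longrightarrow> l \<in> spectrum x"
  by (auto simp: spectrum_def eigenvalue_def eigenvector_def)

lemma spectrumE:
  assumes "l \<in> spectrum x" "x \<in> carrier_mat n n"
  obtains v where "v \<in> carrier_vec n" "v \<noteq> 0\<^sub>v n" "x *\<^sub>v v = l \<cdot>\<^sub>v v"
  using assms by (auto simp: spectrum_def eigenvalue_def eigenvector_def)

lemma finite_spectrum: "x \<in> carrier_mat n n \<Longrightarrow> finite (spectrum x)" for x :: "complex mat"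
  using card_finite_spectrum by blast

lemma pm_linear_vec:
  assumes "x \<in> carrier_mat n n" "v \<in> carrier_vec n" "pm [:-a, 1:] x *\<^sub>v v = 0\<^sub>v n"
  shows "x *\<^sub>v v = a \<cdot>\<^sub>v v"
proof -
  have "pm [:-a, 1:] x *\<^sub>v v = (- a) \<cdot>\<^sub>v v + x *\<^sub>v v"
    using assms(1,2) by (simp add: pm_linear add_mult_distrib_mat_vec[of _ n n]) (rule eq_vecI, auto)
  then have *: "(- a) \<cdot>\<^sub>v v + x *\<^sub>v v = 0\<^sub>v n" using assms by simp
  show ?thesis
  proof (rule eq_vecI)
    fix i assume "i < dim_vec (a \<cdot>\<^sub>v v)"
    then have i: "i < n" using assms by simp
    then have "vec_index ((- a) \<cdot>\<^sub>v v + x *\<^sub>v v) i = 0" by (simp add: *)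
    then show "vec_index (x *\<^sub>v v) i = vec_index (a \<cdot>\<^sub>v v) i" using i assms
      by (simp add: add_eq_0_iff2)
  qed (use assms in auto)
qed

text \<open>Apply the linear factors of an annihilating polynomial of \<open>x\<close> to
  \<open>v\<close> one after another. The last nonzero vector is an eigenvector of \<open>x\<close>,
  and it stays in the kernel of \<open>M\<close> because \<open>M\<close> commutes with polynomials
  of \<open>x\<close>.\<close>

lemma common_eigenvector:
  fixes x :: "complex mat"
  assumes x: "x \<in> carrier_mat n n" and M: "M \<in> carrier_mat n n" "M * x = x * M"
    and v: "v \<in> carrier_vec n" "v \<noteq> 0\<^sub>v n" "M *\<^sub>v v = 0\<^sub>v n"
  obtains w l where "w \<in> carrier_vec n" "w \<noteq> 0\<^sub>v n" "x *\<^sub>v w = l \<cdot>\<^sub>v w" "M *\<^sub>v w = 0\<^sub>v n" "l \<in> spectrum x"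
proof -
  obtain as where as: "pm (\<Prod>a\<leftarrow>as. [:-a, 1:]) x = 0\<^sub>m n n" using annihilating_list[OF x] .
  have key: "\<exists>w l. w \<in> carrier_vec n \<and> w \<noteq> 0\<^sub>v n \<and> x *\<^sub>v w = l \<cdot>\<^sub>v w \<and> M *\<^sub>v w = 0\<^sub>v n"
    if "pm (\<Prod>a\<leftarrow>as. [:-a, 1:]) x *\<^sub>v v = 0\<^sub>v n" for as
    using that
  proof (induction as)
    case Nil
    then show ?case using v x by (simp add: pm_1)
  next
    case (Cons a as)
    define p where "p = (\<Prod>a\<leftarrow>as. [:-a, 1:])"
    define w where "w = pm p x *\<^sub>v v"
    have w: "w \<in> carrier_vec n" unfolding w_def using v(1) pm_carrier[OF x] by (rule mult_mat_vec_carrier[rotated])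
    have "pm ([:-a, 1:] * p) x *\<^sub>v v = 0\<^sub>v n" using Cons.prems by (simp add: p_def)
    then have 0: "pm [:-a, 1:] x *\<^sub>v w = 0\<^sub>v n"
      unfolding w_def pm_mult[OF x] using assoc_mult_mat_vec[of "pm [:-a, 1:] x" n n "pm p x" n v] x v by simp
    show ?case
    proof (cases "w = 0\<^sub>v n")
      case True
      then show ?thesis using Cons.IH by (simp add: w_def p_def)
    next
      case False
      have "M *\<^sub>v w = (M * pm p x) *\<^sub>v v"
        unfolding w_def using assoc_mult_mat_vec[of M n n "pm p x" n v] x v M by simp
      also have "\<dots> = (pm p x * M) *\<^sub>v v" using pm_commute[of M n n x x p] x M by simp
      also have "\<dots> = pm p x *\<^sub>v (M *\<^sub>v v)" using assoc_mult_mat_vec[of "pm p x" n n M n v] x v M by simp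
      also have "\<dots> = 0\<^sub>v n" using v x by (auto intro!: eq_vecI)
      finally show ?thesis using False w pm_linear_vec[OF x w 0] by blast
    qed
  qed
  have zero_vec: "0\<^sub>m n n *\<^sub>v v = 0\<^sub>v n" using v(1) by (intro eq_vecI) auto
  have "\<exists>w l. w \<in> carrier_vec n \<and> w \<noteq> 0\<^sub>v n \<and> x *\<^sub>v w = l \<cdot>\<^sub>v w \<and> M *\<^sub>v w = 0\<^sub>v n"
    by (rule key[of as]) (simp add: as zero_vec)
  then obtain w l where w: "w \<in> carrier_vec n" "w \<noteq> 0\<^sub>v n" "x *\<^sub>v w = l \<cdot>\<^sub>v w" "M *\<^sub>v w = 0\<^sub>v n"
    by (elim exE conjE) rule
  show thesis by (rule that[OF w spectrumI[OF x w(1-3)]])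
qed

lemma not_spectrum_GLn:
  assumes x: "x \<in> carrier_mat n n" and "l \<notin> spectrum x"
  shows "l \<cdot>\<^sub>m 1\<^sub>m n - x \<in> GLn n"
proof (rule ccontr)
  assume sing: "\<not> ?thesis"
  have c: "l \<cdot>\<^sub>m 1\<^sub>m n - x \<in> carrier_mat n n" using x by simp
  obtain v where v: "v \<in> carrier_vec n" "v \<noteq> 0\<^sub>v n" "(l \<cdot>\<^sub>m 1\<^sub>m n - x) *\<^sub>v v = 0\<^sub>v n"
    by (rule kernel_vector[OF c sing])
  have "(l \<cdot>\<^sub>m 1\<^sub>m n - x) *\<^sub>v v = l \<cdot>\<^sub>v v - x *\<^sub>v v"
    using x v(1) by (simp add: minus_mult_distrib_mat_vec[of _ n n]) (auto intro!: eq_vecI)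
  then have *: "l \<cdot>\<^sub>v v - x *\<^sub>v v = 0\<^sub>v n" unfolding v(3) by (rule sym)
  have "x *\<^sub>v v = l \<cdot>\<^sub>v v"
  proof (rule eq_vecI)
    fix i assume i: "i < dim_vec (l \<cdot>\<^sub>v v)"
    then have "vec_index (l \<cdot>\<^sub>v v - x *\<^sub>v v) i = 0" using v by (simp add: *)
    then show "vec_index (x *\<^sub>v v) i = vec_index (l \<cdot>\<^sub>v v) i" using i x v by simp
  qed (use x v in auto)
  then show False using assms spectrumI[OF x v(1,2)] by blast
qed

text \<open>An eigenvector of \<open>p(x)\<close> need not be one of \<open>x\<close>, but the
  kernel of \<open>p(x) - l\<close> contains an eigenvector of \<open>x\<close>, on which
  \<open>p(x)\<close> acts as the value of \<open>p\<close> at the eigenvalue.\<close>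

lemma spectrum_pm:
  assumes x: "x \<in> carrier_mat n n"
  shows "spectrum (pm p x) = poly p ` spectrum x"
proof safe
  fix l assume "l \<in> spectrum (pm p x)"
  then obtain v where v: "v \<in> carrier_vec n" "v \<noteq> 0\<^sub>v n" "pm p x *\<^sub>v v = l \<cdot>\<^sub>v v"
    by (rule spectrumE[OF _ pm_carrier[OF x]])
  have "pm (p - [:l:]) x *\<^sub>v v = pm p x *\<^sub>v v - l \<cdot>\<^sub>v v"
    using x v(1) by (simp add: pm_minus pm_const minus_mult_distrib_mat_vec[of _ n n]) (auto intro!: eq_vecI)
  then have 0: "pm (p - [:l:]) x *\<^sub>v v = 0\<^sub>v n" using v by (auto intro!: eq_vecI)
  obtain w m where w: "w \<in> carrier_vec n" "w \<noteq> 0\<^sub>v n" "x *\<^sub>v w = m \<cdot>\<^sub>v w" "pm (p - [:l:]) x *\<^sub>v w = 0\<^sub>v n" "m \<in> spectrum x"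
    by (rule common_eigenvector[OF x pm_carrier[OF x] pm_commute_self(1)[OF x] v(1,2) 0])
  have "(poly p m - l) \<cdot>\<^sub>v w = 0\<^sub>v n" using pm_eigen[OF x w(1,3), of "p - [:l:]"] w by simp
  moreover obtain i where i: "i < n" "vec_index w i \<noteq> 0"
    using w(1,2) by (metis carrier_vecD eq_vecI index_zero_vec)
  ultimately have "(poly p m - l) * vec_index w i = 0"
    using w(1) by (metis carrier_vecD index_smult_vec(1) index_zero_vec(1))
  then have "l = poly p m" using i by simp
  then show "l \<in> poly p ` spectrum x" using w by blast
next
  fix l assume "l \<in> spectrum x"
  then obtain v where v: "v \<in> carrier_vec n" "v \<noteq> 0\<^sub>v n" "x *\<^sub>v v = l \<cdot>\<^sub>v v"
    by (rule spectrumE[OF _ x])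
  then show "poly p l \<in> spectrum (pm p x)"
    using pm_eigen[OF x v(1,3)] spectrumI[of "pm p x" n v] x by auto
qed

lemma pm_GLn:
  assumes x: "x \<in> carrier_mat n n" and "\<And>l. l \<in> spectrum x \<Longrightarrow> poly p l \<noteq> 0"
  shows "pm p x \<in> GLn n"
proof -
  have "0 \<notin> spectrum (pm p x)" using assms by (auto simp: spectrum_pm[OF x])
  then have *: "0 \<cdot>\<^sub>m 1\<^sub>m n - pm p x \<in> GLn n" using not_spectrum_GLn[of "pm p x" n 0] x by auto
  have eq: "pm p x = 0\<^sub>m n n - (0 \<cdot>\<^sub>m 1\<^sub>m n - pm p x)" using x by (intro eq_matI) auto
  have "pm p x * (- minv (0 \<cdot>\<^sub>m 1\<^sub>m n - pm p x)) = (0 \<cdot>\<^sub>m 1\<^sub>m n - pm p x) * minv (0 \<cdot>\<^sub>m 1\<^sub>m n - pm p x)"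
  proof -
    have "0 \<cdot>\<^sub>m 1\<^sub>m n - pm p x = - pm p x" using x by (intro eq_matI) auto
    then show ?thesis using GLnD[OF *] x by simp
  qed
  then have "pm p x * (- minv (0 \<cdot>\<^sub>m 1\<^sub>m n - pm p x)) = 1\<^sub>m n" unfolding GLnD(3)[OF *] .
  then show ?thesis by (rule GLnI(1)[rotated 2]) (use GLnD[OF *] x in auto)
qed

section \<open>Jets at the eigenvalues\<close>

text \<open>\<open>N\<close> bounds the multiplicity of every root of the minimal polynomial, that
  is, the size of the Jordan blocks. The exponent is uniform over the spectrum, so that jets of one
  order suffice.\<close>

definition kills :: "nat \<Rightarrow> complex mat \<Rightarrow> bool" where
  "kills N x \<longleftrightarrow> pm (\<Prod>\<mu>\<in>spectrum x. [:-\<mu>, 1:] ^ N) x = 0\<^sub>m (dim_row x) (dim_row x)"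

lemma pm_dvd: "x \<in> carrier_mat n n \<Longrightarrow> pm p x = 0\<^sub>m n n \<Longrightarrow> p dvd q \<Longrightarrow> pm q x = 0\<^sub>m n n"
  by (auto simp: dvd_def pm_mult)

text \<open>Linear factors at points outside the spectrum are invertible at \<open>x\<close> and
  cancel from an annihilating product; the product of the remaining ones divides a common power
  product.\<close>

lemma ex_kills:
  assumes x: "x \<in> carrier_mat n n"
  shows "\<exists>N. kills N x"
proof -
  obtain as where as: "pm (\<Prod>a\<leftarrow>as. [:-a, 1:]) x = 0\<^sub>m n n" using annihilating_list[OF x] .
  define A where "A = (\<Prod>a\<leftarrow>filter (\<lambda>a. a \<in> spectrum x) as. [:-a, 1:])"
  define B where "B = (\<Prod>a\<leftarrow>filter (\<lambda>a. a \<notin> spectrum x) as. [:-a, 1:])"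
  have prod: "(\<Prod>a\<leftarrow>as. [:-a, 1:]) = B * A"
    unfolding A_def B_def by (induction as) (auto simp: algebra_simps)
  have "poly B l \<noteq> 0" if "l \<in> spectrum x" for l
    unfolding B_def using that by (induction as) auto
  then have B: "pm B x \<in> GLn n" by (rule pm_GLn[OF x])
  have "pm A x = (minv (pm B x) * pm B x) * pm A x" using GLnD[OF B] x by simp
  also have "\<dots> = minv (pm B x) * (pm B x * pm A x)" using GLnD[OF B] x by (intro assoc_mult_mat) auto
  also have "pm B x * pm A x = 0\<^sub>m n n" using as x by (simp add: prod pm_mult)
  finally have A0: "pm A x = 0\<^sub>m n n" using GLnD[OF B] by simp
  have "(\<Prod>a\<leftarrow>bs. [:-a, 1:]) dvd (\<Prod>\<mu>\<in>spectrum x. [:-\<mu>, 1:] ^ length bs)"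
    if "set bs \<subseteq> spectrum x" for bs
    using that
  proof (induction bs)
    case (Cons b bs)
    have "[:-b, 1:] dvd (\<Prod>\<mu>\<in>spectrum x. [:-\<mu>, 1:])"
      using Cons.prems finite_spectrum[OF x] by (intro dvd_prodI) auto
    then show ?case using Cons by (auto simp: prod.distrib simp del: mult_pCons_left intro!: mult_dvd_mono)
  qed simp
  from this[of "filter (\<lambda>a. a \<in> spectrum x) as"]
  have "A dvd (\<Prod>\<mu>\<in>spectrum x. [:-\<mu>, 1:] ^ length (filter (\<lambda>a. a \<in> spectrum x) as))"
    by (auto simp: A_def)
  then show ?thesis using pm_dvd[OF x A0] x unfolding kills_def by auto
qed

lemma kills_mono: assumes "x \<in> carrier_mat n n" "kills N x" "N \<le> M" shows "kills M x"
proof -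
  have "(\<Prod>\<mu>\<in>spectrum x. [:-\<mu>, 1:] ^ N) dvd (\<Prod>\<mu>\<in>spectrum x. [:-\<mu>, 1:] ^ M)"
    using assms(3) by (intro prod_dvd_prod le_imp_power_dvd)
  then show ?thesis using assms pm_dvd[of x n] by (auto simp: kills_def)
qed

text \<open>The Taylor expansion at \<open>\<mu>\<close>: its coefficients are the scaled
  derivatives of \<open>P\<close> there.\<close>

definition tay :: "complex \<Rightarrow> complex poly \<Rightarrow> complex poly" where
  "tay \<mu> P = P \<circ>\<^sub>p [:\<mu>, 1:]"

lemma tay_simps: "tay \<mu> (P + Q) = tay \<mu> P + tay \<mu> Q" "tay \<mu> (P * Q) = tay \<mu> P * tay \<mu> Q"
  "tay \<mu> (P - Q) = tay \<mu> P - tay \<mu> Q" "tay \<mu> 1 = 1" "poly (tay \<mu> P) z = poly P (\<mu> + z)"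
  "tay \<mu> (sum f A) = (\<Sum>i\<in>A. tay \<mu> (f i))" "tay \<mu> (prod f A) = (\<Prod>i\<in>A. tay \<mu> (f i))"
  by (auto simp: tay_def pcompose_add pcompose_mult pcompose_diff pcompose_1 poly_pcompose pcompose_sum pcompose_prod)

lemma tay_power: "tay \<mu> (P ^ n) = tay \<mu> P ^ n"
  by (induction n) (auto simp: tay_simps)

lemma tay_linear: "tay \<mu> [:a, 1:] = [:a + \<mu>, 1:]"
  by (simp add: tay_def pcompose_pCons)

lemma tay_low_coeffs_dvd:
  assumes "\<And>k. k < N \<Longrightarrow> coeff (tay \<mu> P) k = 0"
  shows "[:-\<mu>, 1:] ^ N dvd P"
proof -
  have "monom 1 N dvd tay \<mu> P" using assms by (simp add: monom_1_dvd_iff')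
  then obtain R where R: "tay \<mu> P = [:0, 1:] ^ N * R" by (auto simp: dvd_def monom_altdef)
  have "P = tay (- \<mu>) (tay \<mu> P)"
    by (simp add: tay_def pcompose_assoc[symmetric] pcompose_pCons)
  also have "\<dots> = [:-\<mu>, 1:] ^ N * tay (- \<mu>) R"
    unfolding R by (simp add: tay_simps tay_power tay_linear)
  finally show ?thesis by (rule dvdI)
qed

lemma linear_power_dvd_cancel:
  fixes M R :: "complex poly"
  assumes "[:-a, 1:] ^ N dvd M * R" "poly M a \<noteq> 0"
  shows "[:-a, 1:] ^ N dvd R"
proof (cases "R = 0")
  case False
  have M: "M \<noteq> 0" using assms(2) by auto
  have "order a M = 0" using assms(2) order_root by blast
  then have "order a (M * R) = order a R" using M False by (simp add: order_mult)
  then show ?thesis using assms(1) M False by (simp add: order_divides)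
qed simp

lemma prod_linear_power_dvd:
  assumes "finite Z" "\<And>\<mu>. \<mu> \<in> Z \<Longrightarrow> [:-\<mu>, 1:] ^ N dvd P"
  shows "(\<Prod>\<mu>\<in>Z. [:-\<mu>, 1:] ^ N) dvd (P :: complex poly)"
  using assms
proof (induction Z)
  case (insert a Z)
  then obtain R where R: "P = (\<Prod>\<mu>\<in>Z. [:-\<mu>, 1:] ^ N) * R" by (auto simp: dvd_def)
  have "[:-a, 1:] ^ N dvd P" using insert.prems by simp
  moreover have "poly (\<Prod>\<mu>\<in>Z. [:-\<mu>, 1:] ^ N) a \<noteq> 0" using insert.hyps by (auto simp: poly_prod)
  ultimately have "[:-a, 1:] ^ N dvd R" unfolding R by (rule linear_power_dvd_cancel)
  then show ?case using insert.hyps unfolding R by (simp add: mult.commute mult_dvd_mono)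
qed simp

lemma pm_kills:
  assumes x: "x \<in> carrier_mat n n" and "kills N x"
    and "\<And>\<mu> k. \<mu> \<in> spectrum x \<Longrightarrow> k < N \<Longrightarrow> coeff (tay \<mu> P) k = 0"
  shows "pm P x = 0\<^sub>m n n"
proof (rule pm_dvd[OF x])
  show "pm (\<Prod>\<mu>\<in>spectrum x. [:-\<mu>, 1:] ^ N) x = 0\<^sub>m n n" using assms by (simp add: kills_def)
  show "(\<Prod>\<mu>\<in>spectrum x. [:-\<mu>, 1:] ^ N) dvd P"
    by (intro prod_linear_power_dvd finite_spectrum[OF x] tay_low_coeffs_dvd) (use assms in auto)
qed

text \<open>The difference is divisible by a power product that annihilates \<open>x\<close>, so
  \<open>pm\<close> sees only the jets below order \<open>N\<close> at the eigenvalues.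
  Interpolation can therefore replace a holomorphic function.\<close>

lemma pm_eqI_jets:
  assumes x: "x \<in> carrier_mat n n" and "kills N x"
    and "\<And>\<mu> k. \<mu> \<in> spectrum x \<Longrightarrow> k < N \<Longrightarrow> coeff (tay \<mu> P) k = coeff (tay \<mu> Q) k"
  shows "pm P x = pm Q x"
proof -
  have "pm P x - pm Q x = 0\<^sub>m n n"
    using pm_kills[OF assms(1,2), of "P - Q"] assms(3) by (simp add: tay_simps pm_minus[OF x])
  then have "(pm P x - pm Q x) $$ (i, j) = 0" if "i < n" "j < n" for i j using that by simp
  then show ?thesis using x by (intro eq_matI) auto
qed

text \<open>Newton's scheme: a new node \<open>a\<close> is handled by adding \<open>M * Q\<close>,
  where \<open>M\<close> vanishes to order \<open>N\<close> at the old nodes and is invertible as a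
  power series at \<open>a\<close>.\<close>

lemma hermite_interpolation:
  fixes F :: "complex \<Rightarrow> complex fps"
  assumes "finite Z"
  shows "\<exists>P. \<forall>\<mu>\<in>Z. \<forall>k<N. coeff (tay \<mu> P) k = fps_nth (F \<mu>) k"
  using assms
proof (induction Z)
  case (insert a Z)
  then obtain P where P: "\<forall>\<mu>\<in>Z. \<forall>k<N. coeff (tay \<mu> P) k = fps_nth (F \<mu>) k" by blast
  define M where "M = (\<Prod>\<mu>\<in>Z. [:-\<mu>, 1:] ^ N :: complex poly)"
  define G where "G = (F a - fps_of_poly (tay a P)) * inverse (fps_of_poly (tay a M))"
  \<comment> \<open>The truncated quotient of \<open>F a - P\<close> by \<open>M\<close> at
    \<open>a\<close>, moved back from the local coordinate.\<close>
  define Q where "Q = tay (-a) (truncate_fps N G)"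
  have "poly M a \<noteq> 0" using insert.hyps by (auto simp: M_def poly_prod)
  then have "coeff (tay a M) 0 \<noteq> 0" by (metis add.right_neutral poly_0_coeff_0 tay_simps(5))
  then have inv: "fps_of_poly (tay a M) * inverse (fps_of_poly (tay a M)) = 1"
    by (intro inverse_mult_eq_1') auto
  have taQ: "tay a Q = truncate_fps N G"
    by (simp add: Q_def tay_def pcompose_assoc[symmetric] pcompose_pCons)
  have "coeff (tay a (P + M * Q)) k = fps_nth (F a) k" if k: "k < N" for k
  proof -
    have "coeff (tay a M * tay a Q) k = fps_nth (fps_of_poly (tay a M) * G) k"
      using k by (auto simp: coeff_mult fps_mult_nth taQ coeff_truncate_fps atLeast0AtMost intro!: sum.cong)
    also have "fps_of_poly (tay a M) * G = F a - fps_of_poly (tay a P)"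
      unfolding G_def using inv by (simp add: mult.left_commute)
    finally show ?thesis by (simp add: tay_simps)
  qed
  moreover have "coeff (tay \<mu> (P + M * Q)) k = fps_nth (F \<mu>) k" if "\<mu> \<in> Z" "k < N" for \<mu> k
  proof -
    have "[:-\<mu>, 1:] ^ N dvd M" unfolding M_def using that insert.hyps by (intro dvd_prodI) auto
    then obtain R where R: "M = [:-\<mu>, 1:] ^ N * R" by (auto simp: dvd_def)
    have "tay \<mu> M = monom 1 N * tay \<mu> R"
      unfolding R by (simp add: tay_simps monom_altdef tay_power tay_linear)
    then have "coeff (tay \<mu> M * tay \<mu> Q) k = 0" using that(2)
      by (metis dvd_triv_left monom_1_dvd_iff' mult.assoc)
    then show ?thesis using P that by (simp add: tay_simps)
  qed
  ultimately show ?case by blast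
qed simp

section \<open>The functional calculus as polynomial interpolation\<close>

text \<open>Jets are compared through power series; asking for an expansion also records that
  \<open>g\<close> is analytic at the points of \<open>Z\<close>.\<close>

definition matches :: "nat \<Rightarrow> complex set \<Rightarrow> (complex \<Rightarrow> complex) \<Rightarrow> complex poly \<Rightarrow> bool" where
  "matches N Z g P \<longleftrightarrow> (\<forall>\<mu>\<in>Z. \<exists>F. (\<lambda>z. g (\<mu> + z)) has_fps_expansion F \<and> (\<forall>k<N. fps_nth F k = coeff (tay \<mu> P) k))"

lemma matches_subset: "matches N Z g P \<Longrightarrow> Y \<subseteq> Z \<Longrightarrow> M \<le> N \<Longrightarrow> matches M Y g P"
  unfolding matches_def by (meson order_less_le_trans subset_iff)

lemma matches_poly: "matches N Z (poly P) P"
  unfolding matches_def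
proof (intro ballI exI conjI allI impI)
  fix \<mu>
  show "(\<lambda>z. poly P (\<mu> + z)) has_fps_expansion fps_of_poly (tay \<mu> P)"
    by (auto simp: has_fps_expansion_def tay_simps)
qed auto

lemma matches_mult:
  assumes "matches N Z f P" "matches N Z g Q"
  shows "matches N Z (\<lambda>z. f z * g z) (P * Q)"
  unfolding matches_def
proof
  fix \<mu> assume \<mu>: "\<mu> \<in> Z"
  obtain F G where F: "(\<lambda>z. f (\<mu> + z)) has_fps_expansion F" "\<forall>k<N. fps_nth F k = coeff (tay \<mu> P) k"
    and G: "(\<lambda>z. g (\<mu> + z)) has_fps_expansion G" "\<forall>k<N. fps_nth G k = coeff (tay \<mu> Q) k"
    using assms \<mu> unfolding matches_def by meson
  show "\<exists>H. (\<lambda>z. f (\<mu> + z) * g (\<mu> + z)) has_fps_expansion H \<and> (\<forall>k<N. fps_nth H k = coeff (tay \<mu> (P * Q)) k)"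
    by (rule exI[of _ "F * G"])
      (use F G in \<open>auto intro!: has_fps_expansion_mult sum.cong simp: tay_simps fps_mult_nth coeff_mult atLeast0AtMost\<close>)
qed

lemma matches_cong:
  assumes "matches N Z f P" "open V" "Z \<subseteq> V" "\<And>z. z \<in> V \<Longrightarrow> f z = g z"
  shows "matches N Z g P"
  unfolding matches_def
proof
  fix \<mu> assume \<mu>: "\<mu> \<in> Z"
  obtain F where F: "(\<lambda>z. f (\<mu> + z)) has_fps_expansion F" "\<forall>k<N. fps_nth F k = coeff (tay \<mu> P) k"
    using assms \<mu> unfolding matches_def by meson
  have "open ((\<lambda>z. \<mu> + z) -` V)" using assms(2) by (intro continuous_open_vimage continuous_intros)
  then have "eventually (\<lambda>z. \<mu> + z \<in> V) (nhds 0)"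
    using eventually_nhds_in_open[of "(\<lambda>z. \<mu> + z) -` V" 0] assms(3) \<mu> by auto
  then have "eventually (\<lambda>z. g (\<mu> + z) = f (\<mu> + z)) (nhds 0)"
    by eventually_elim (use assms in auto)
  then have "(\<lambda>z. g (\<mu> + z)) has_fps_expansion F"
    using F(1) by (subst has_fps_expansion_cong) auto
  then show "\<exists>F. (\<lambda>z. g (\<mu> + z)) has_fps_expansion F \<and> (\<forall>k<N. fps_nth F k = coeff (tay \<mu> P) k)"
    using F by blast
qed

lemma ex_matches:
  assumes "finite Z" "open V" "Z \<subseteq> V" "g holomorphic_on V"
  shows "\<exists>P. matches N Z g P"
proof -
  have "\<exists>F. (\<lambda>z. g (\<mu> + z)) has_fps_expansion F" if "\<mu> \<in> Z" for \<mu>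
  proof -
    have "g analytic_on {\<mu>}" using assms that analytic_at by blast
    then show ?thesis using analytic_at_imp_has_fps_expansion by blast
  qed
  then obtain F where F: "\<And>\<mu>. \<mu> \<in> Z \<Longrightarrow> (\<lambda>z. g (\<mu> + z)) has_fps_expansion F \<mu>" by metis
  obtain P where "\<forall>\<mu>\<in>Z. \<forall>k<N. coeff (tay \<mu> P) k = fps_nth (F \<mu>) k"
    using hermite_interpolation[OF assms(1)] by blast
  then show ?thesis unfolding matches_def using F by metis
qed

lemma fps_expansion_nth_unique:
  fixes f :: "complex \<Rightarrow> complex"
  shows "f has_fps_expansion F \<Longrightarrow> f has_fps_expansion G \<Longrightarrow> fps_nth F n = fps_nth G n"
  by (simp add: fps_nth_fps_expansion)

lemma matches_unique:
  assumes "x \<in> carrier_mat n n" "kills N x" "matches N (spectrum x) g P" "matches N (spectrum x) g Q"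
  shows "pm P x = pm Q x"
proof (rule pm_eqI_jets[OF assms(1,2)])
  fix \<mu> k assume k: "\<mu> \<in> spectrum x" "k < N"
  obtain F where F: "(\<lambda>z. g (\<mu> + z)) has_fps_expansion F" "fps_nth F k = coeff (tay \<mu> P) k"
    using assms(3) k unfolding matches_def by meson
  obtain G where G: "(\<lambda>z. g (\<mu> + z)) has_fps_expansion G" "fps_nth G k = coeff (tay \<mu> Q) k"
    using assms(4) k unfolding matches_def by meson
  show "coeff (tay \<mu> P) k = coeff (tay \<mu> Q) k"
    using fps_expansion_nth_unique[OF F(1) G(1), of k] F(2) G(2) by simp
qed

lemma matches_value:
  assumes "matches N Z g P" "\<mu> \<in> Z" "N > 0"
  shows "poly P \<mu> = g \<mu>"
proof -
  obtain F where F: "(\<lambda>z. g (\<mu> + z)) has_fps_expansion F" "\<forall>k<N. fps_nth F k = coeff (tay \<mu> P) k"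
    using assms unfolding matches_def by meson
  have "poly P \<mu> = coeff (tay \<mu> P) 0" by (metis add.right_neutral poly_0_coeff_0 tay_simps(5))
  also have "\<dots> = fps_nth F 0" using F assms by simp
  also have "\<dots> = g \<mu>" using fps_nth_fps_expansion[OF F(1), of 0] by simp
  finally show ?thesis .
qed

lemma pm_sum_index:
  assumes "x \<in> carrier_mat n n" "i < n" "j < n"
  shows "pm (sum f A) x $$ (i, j) = (\<Sum>a\<in>A. pm (f a) x $$ (i, j))"
  by (induction A rule: infinite_finite_induct) (use assms in \<open>auto simp: pm_add\<close>)

lemma tay_smult: "tay \<mu> (Polynomial.smult c P) = Polynomial.smult c (tay \<mu> P)"
  by (simp add: tay_def pcompose_smult)

text \<open>The truncated geometric series of \<open>1 / (z - X)\<close> about \<open>\<nu>\<close>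
  in the polynomial variable \<open>X\<close>; the error term disappears where
  \<open>(X - \<nu>) ^ N\<close> is annihilated.\<close>

lemma geometric_poly:
  assumes "z \<noteq> (\<nu>::complex)"
  shows "[:z, -1:] * (\<Sum>k<N. Polynomial.smult (inverse (z - \<nu>) ^ Suc k) ([:-\<nu>, 1:] ^ k))
    = 1 - Polynomial.smult (inverse (z - \<nu>) ^ N) ([:-\<nu>, 1:] ^ N)"
proof (induction N)
  case (Suc N)
  define L where "L = [:-\<nu>, 1:]"
  define c where "c = inverse (z - \<nu>)"
  have zL: "[:z, -1:] = [:z - \<nu>:] - L" by (simp add: L_def)
  have c1: "c ^ N = c ^ Suc N * (z - \<nu>)" using assms by (simp add: c_def)
  have "[:z, -1:] * Polynomial.smult (c ^ Suc N) (L ^ N) = Polynomial.smult (c ^ Suc N * (z - \<nu>)) (L ^ N) - Polynomial.smult (c ^ Suc N) (L ^ Suc N)"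
    unfolding zL left_diff_distrib by (simp add: mult.commute)
  then have "[:z, -1:] * Polynomial.smult (c ^ Suc N) (L ^ N) = Polynomial.smult (c ^ N) (L ^ N) - Polynomial.smult (c ^ Suc N) (L ^ Suc N)"
    unfolding c1 .
  then show ?case using Suc unfolding L_def[symmetric] c_def[symmetric] sum.lessThan_Suc distrib_left
    by simp
qed simp

lemma residue_sum_poles:
  assumes "open A" "\<mu> \<in> A" "g holomorphic_on A"
  shows "residue (\<lambda>z. \<Sum>k<N. M k * (g z / (z - \<mu>) ^ Suc k)) \<mu> = (\<Sum>k<N. M k * ((deriv ^^ k) g \<mu> / fact k))"
proof (induction N)
  case 0
  then show ?case by (simp add: residue_const)
next
  case (Suc N)
  have h: "(\<lambda>z. M k * (g z / (z - \<mu>) ^ Suc k)) holomorphic_on A - {\<mu>}" for k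
    by (intro holomorphic_intros holomorphic_on_subset[OF assms(3)]) auto
  have "residue (\<lambda>z. (\<Sum>k<N. M k * (g z / (z - \<mu>) ^ Suc k)) + M N * (g z / (z - \<mu>) ^ Suc N)) \<mu>
    = residue (\<lambda>z. (\<Sum>k<N. M k * (g z / (z - \<mu>) ^ Suc k))) \<mu> + residue (\<lambda>z. M N * (g z / (z - \<mu>) ^ Suc N)) \<mu>"
    by (intro residue_add[OF assms(1,2)] holomorphic_on_sum h)
  also have "residue (\<lambda>z. M N * (g z / (z - \<mu>) ^ Suc N)) \<mu> = M N * residue (\<lambda>z. g z / (z - \<mu>) ^ Suc N) \<mu>"
    by (intro residue_lmul[OF assms(1,2)] holomorphic_intros holomorphic_on_subset[OF assms(3)]) auto
  also have "residue (\<lambda>z. g z / (z - \<mu>) ^ Suc N) \<mu> = (deriv ^^ N) g \<mu> / fact N"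
    by (rule residue_holomorphic_over_power[OF assms])
  finally show ?case using Suc by simp
qed

text \<open>Partial fractions of the resolvent: it is a finite sum of poles whose coefficients are
  polynomials of \<open>x\<close>, hence each residue produces the Taylor polynomial of
  \<open>g\<close> times a spectral projection. Summed over the spectrum, these recombine to
  \<open>P\<close>.\<close>

lemma hfc_eq_pm:
  assumes x: "x \<in> carrier_mat n n" and kills: "kills N x" and P: "matches N (spectrum x) g P"
  shows "hfc g x = pm P x"
proof -
  define Z where "Z = spectrum x"
  have Z: "finite Z" unfolding Z_def by (rule finite_spectrum[OF x])
  define L where "L \<mu> = [:-\<mu>, 1 :: complex:]" for \<mu>
  have "\<exists>e. \<forall>\<mu>\<in>Z. \<forall>k<N. coeff (tay \<mu> e) k = fps_nth (if \<mu> = \<nu> then 1 else 0) k" for \<nu>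
    using hermite_interpolation[OF Z, of N "\<lambda>\<mu>. if \<mu> = \<nu> then 1 else 0"] by simp
  \<comment> \<open>\<open>e \<nu>\<close> has jet 1 at \<open>\<nu>\<close> and jet 0 at the other
    eigenvalues; \<open>pm (e \<nu>) x\<close> is the Riesz projection.\<close>
  then obtain e where e: "\<And>\<mu> \<nu> k. \<mu> \<in> Z \<Longrightarrow> k < N \<Longrightarrow> coeff (tay \<mu> (e \<nu>)) k = fps_nth (if \<mu> = \<nu> then 1 else 0) k"
    by metis
  define low where "low \<mu> Q \<longleftrightarrow> monom 1 N dvd tay \<mu> Q" for \<mu> and Q :: "complex poly"
  have low0: "low \<mu> (e \<nu>)" if "\<mu> \<in> Z" "\<mu> \<noteq> \<nu>" for \<mu> \<nu>
    using that e by (simp add: low_def monom_1_dvd_iff')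
  have low_mult: "low \<mu> A \<Longrightarrow> low \<mu> (A * B)" "low \<mu> A \<Longrightarrow> low \<mu> (B * A)" for \<mu> A B
    by (auto simp: low_def tay_simps)
  have lowL: "low \<mu> (L \<mu> ^ N)" for \<mu>
    by (simp add: low_def L_def tay_power tay_linear monom_altdef)
  have pm0: "pm A x = 0\<^sub>m n n" if "\<And>\<mu>. \<mu> \<in> Z \<Longrightarrow> low \<mu> A" for A
    by (rule pm_kills[OF x kills]) (use that in \<open>auto simp: low_def monom_1_dvd_iff' Z_def\<close>)
  have pmL: "pm (L \<nu> ^ N * e \<nu>) x = 0\<^sub>m n n" for \<nu>
  proof (rule pm0)
    fix \<mu> assume "\<mu> \<in> Z"
    then show "low \<mu> (L \<nu> ^ N * e \<nu>)" using low0 low_mult lowL by (cases "\<mu> = \<nu>") auto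
  qed
  have pm1: "pm (\<Sum>\<nu>\<in>Z. e \<nu>) x = 1\<^sub>m n"
  proof -
    have "pm (\<Sum>\<nu>\<in>Z. e \<nu>) x = pm 1 x"
    proof (rule pm_eqI_jets[OF x kills])
      fix \<mu> k assume k: "\<mu> \<in> spectrum x" "k < N"
      have "coeff (tay \<mu> (\<Sum>\<nu>\<in>Z. e \<nu>)) k = (\<Sum>\<nu>\<in>Z. fps_nth (if \<mu> = \<nu> then 1 else 0) k)"
        using e k by (simp add: tay_simps coeff_sum Z_def)
      also have "\<dots> = (\<Sum>\<nu>\<in>Z. if \<mu> = \<nu> then fps_nth 1 k else 0)" by (intro sum.cong) auto
      also have "\<dots> = fps_nth 1 k" using Z k by (simp add: Z_def)
      finally show "coeff (tay \<mu> (\<Sum>\<nu>\<in>Z. e \<nu>)) k = coeff (tay \<mu> 1) k" by (simp add: tay_simps)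
    qed
    then show ?thesis using x by (simp add: pm_1)
  qed
  define M where "M \<nu> k i j = pm (L \<nu> ^ k * e \<nu>) x $$ (i, j)" for \<nu> k i j
  have res: "resolvent x z $$ (i, j) = (\<Sum>\<nu>\<in>Z. \<Sum>k<N. inverse (z - \<nu>) ^ Suc k * M \<nu> k i j)"
    if z: "z \<notin> Z" and ij: "i < n" "j < n" for z i j
  proof -
    \<comment> \<open>Candidate for the resolvent: on each generalized eigenspace, the geometric
      series about its eigenvalue.\<close>
    define b where "b = (\<Sum>\<nu>\<in>Z. (\<Sum>k<N. Polynomial.smult (inverse (z - \<nu>) ^ Suc k) (L \<nu> ^ k)) * e \<nu>)"
    have "[:z, -1:] * b = (\<Sum>\<nu>\<in>Z. ([:z, -1:] * (\<Sum>k<N. Polynomial.smult (inverse (z - \<nu>) ^ Suc k) (L \<nu> ^ k))) * e \<nu>)"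
      unfolding b_def by (subst sum_distrib_left) (simp only: mult.assoc)
    also have "\<dots> = (\<Sum>\<nu>\<in>Z. (1 - Polynomial.smult (inverse (z - \<nu>) ^ N) (L \<nu> ^ N)) * e \<nu>)"
      unfolding L_def using z by (intro sum.cong refl arg_cong2[where f = "(*)"] geometric_poly) auto
    also have "\<dots> = (\<Sum>\<nu>\<in>Z. e \<nu>) - (\<Sum>\<nu>\<in>Z. Polynomial.smult (inverse (z - \<nu>) ^ N) (L \<nu> ^ N * e \<nu>))"
      by (simp add: sum_subtractf[symmetric] left_diff_distrib)
    finally have "pm ([:z, -1:] * b) x = 1\<^sub>m n - pm (\<Sum>\<nu>\<in>Z. Polynomial.smult (inverse (z - \<nu>) ^ N) (L \<nu> ^ N * e \<nu>)) x"
      by (simp only: pm_minus[OF x] pm1)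
    also have "pm (\<Sum>\<nu>\<in>Z. Polynomial.smult (inverse (z - \<nu>) ^ N) (L \<nu> ^ N * e \<nu>)) x = 0\<^sub>m n n"
      by (rule eq_matI) (use x in \<open>auto simp: pm_sum_index[OF x] pm_smult[OF x] pmL\<close>)
    finally have "pm [:z, -1:] x * pm b x = 1\<^sub>m n - 0\<^sub>m n n" unfolding pm_mult[OF x] .
    also have "\<dots> = 1\<^sub>m n" by (intro eq_matI) auto
    finally have "pm [:z, -1:] x * pm b x = 1\<^sub>m n" .
    moreover have "pm [:z, -1:] x = z \<cdot>\<^sub>m 1\<^sub>m n - x" using x by (auto simp: pm_linear intro!: eq_matI)
    ultimately have "(z \<cdot>\<^sub>m 1\<^sub>m n - x) * pm b x = 1\<^sub>m n" by simp
    then have "resolvent x z = pm b x"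
      unfolding resolvent_def using x by (intro GLnI(2)[of _ n]) auto
    also have "\<dots> $$ (i, j) = (\<Sum>\<nu>\<in>Z. \<Sum>k<N. inverse (z - \<nu>) ^ Suc k * M \<nu> k i j)"
      unfolding b_def pm_sum_index[OF x ij] sum_distrib_right M_def
      using ij x by (intro sum.cong refl) (simp add: pm_smult[OF x] pm_carrier[OF x])
    finally show ?thesis .
  qed
  have "\<exists>F. (\<lambda>z. g (\<mu> + z)) has_fps_expansion F \<and> (\<forall>k<N. fps_nth F k = coeff (tay \<mu> P) k)" if "\<mu> \<in> Z" for \<mu>
    using P that unfolding matches_def Z_def by blast
  then obtain F where F: "\<And>\<mu>. \<mu> \<in> Z \<Longrightarrow> (\<lambda>z. g (\<mu> + z)) has_fps_expansion F \<mu>"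
    "\<And>\<mu> k. \<mu> \<in> Z \<Longrightarrow> k < N \<Longrightarrow> fps_nth (F \<mu>) k = coeff (tay \<mu> P) k" by metis
  have rsd: "residue (\<lambda>z. g z * resolvent x z $$ (i, j)) \<mu> = (\<Sum>k<N. coeff (tay \<mu> P) k * M \<mu> k i j)"
    if \<mu>: "\<mu> \<in> Z" and ij: "i < n" "j < n" for \<mu> i j
  proof -
    have "g analytic_on {\<mu>}" by (rule has_fps_expansion_imp_analytic[OF F(1)[OF \<mu>]])
    then obtain A where A: "open A" "\<mu> \<in> A" "g holomorphic_on A" using analytic_at by blast
    \<comment> \<open>Removing the other eigenvalues leaves \<open>\<mu>\<close> as the only pole,
      so the remaining terms \<open>h\<close> contribute no residue.\<close>
    define B where "B = A - (Z - {\<mu>})"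
    have B: "open B" "\<mu> \<in> B" "g holomorphic_on B"
      using A Z by (auto simp: B_def intro!: open_Diff finite_imp_closed holomorphic_on_subset[OF A(3)])
    define h where "h z = g z * (\<Sum>\<nu>\<in>Z - {\<mu>}. \<Sum>k<N. inverse (z - \<nu>) ^ Suc k * M \<nu> k i j)" for z
    have h: "h holomorphic_on B"
      unfolding h_def by (intro holomorphic_intros B(3)) (auto simp: B_def)
    define f where "f z = (\<Sum>k<N. M \<mu> k i j * (g z / (z - \<mu>) ^ Suc k))" for z
    have f: "f holomorphic_on B - {\<mu>}"
      unfolding f_def by (intro holomorphic_intros holomorphic_on_subset[OF B(3)]) auto
    have "eventually (\<lambda>z. z \<in> B - {\<mu>}) (at \<mu>)"
      using B eventually_at_in_open by blast
    then have "eventually (\<lambda>z. g z * resolvent x z $$ (i, j) = f z + h z) (at \<mu>)"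
    proof eventually_elim
      case (elim z)
      show ?case
      proof (cases "z \<in> Z")
        case True
        then show ?thesis using elim by (auto simp: B_def)
      next
        case False
        have "resolvent x z $$ (i, j) = (\<Sum>k<N. inverse (z - \<mu>) ^ Suc k * M \<mu> k i j) + (\<Sum>\<nu>\<in>Z - {\<mu>}. \<Sum>k<N. inverse (z - \<nu>) ^ Suc k * M \<nu> k i j)"
          unfolding res[OF False ij] by (rule sum.remove[OF Z \<mu>])
        then show ?thesis unfolding f_def h_def distrib_left
          by (simp add: sum_distrib_left field_simps)
      qed
    qed
    then have "residue (\<lambda>z. g z * resolvent x z $$ (i, j)) \<mu> = residue (\<lambda>z. f z + h z) \<mu>"
      by (intro residue_cong) auto
    also have "\<dots> = residue f \<mu> + residue h \<mu>"
      using h by (intro residue_add[OF B(1,2) f] holomorphic_on_subset[OF h]) auto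
    also have "residue h \<mu> = 0" by (rule residue_holo[OF B(1,2) h])
    also have "residue f \<mu> = (\<Sum>k<N. M \<mu> k i j * ((deriv ^^ k) g \<mu> / fact k))"
      unfolding f_def by (rule residue_sum_poles[OF B])
    also have "\<dots> = (\<Sum>k<N. coeff (tay \<mu> P) k * M \<mu> k i j)"
    proof (intro sum.cong refl)
      fix k assume "k \<in> {..<N}"
      then have "coeff (tay \<mu> P) k = fps_nth (F \<mu>) k" using F(2)[OF \<mu>] by simp
      also have "\<dots> = (deriv ^^ k) (\<lambda>z. g (\<mu> + z)) 0 / fact k" by (rule fps_nth_fps_expansion[OF F(1)[OF \<mu>]])
      also have "(deriv ^^ k) (\<lambda>z. g (\<mu> + z)) 0 = (deriv ^^ k) g \<mu>"
        using higher_deriv_shift_0[of k g \<mu>] by (simp add: o_def)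
      finally show "M \<mu> k i j * ((deriv ^^ k) g \<mu> / fact k) = coeff (tay \<mu> P) k * M \<mu> k i j"
        by (simp add: mult.commute)
    qed
    finally show ?thesis by simp
  qed
  \<comment> \<open>The Taylor polynomial of \<open>P\<close> at \<open>\<mu>\<close>,
    interchangeable with \<open>P\<close> after multiplication by \<open>e \<mu>\<close>.\<close>
  define T where "T \<mu> = (\<Sum>k<N. Polynomial.smult (coeff (tay \<mu> P) k) (L \<mu> ^ k))" for \<mu>
  have tayT: "low \<mu> (T \<mu> - P)" for \<mu>
  proof -
    have "tay \<mu> (T \<mu>) = (\<Sum>k<N. monom (coeff (tay \<mu> P) k) k)"
      by (simp add: T_def tay_simps(6) tay_smult L_def tay_power tay_linear monom_altdef)
    then have "coeff (tay \<mu> (T \<mu>)) k = coeff (tay \<mu> P) k" if "k < N" for k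
      using that by (simp add: coeff_sum)
    then show ?thesis by (simp add: low_def monom_1_dvd_iff' tay_simps)
  qed
  show ?thesis
  proof (rule eq_matI)
    fix i j assume "i < dim_row (pm P x)" "j < dim_col (pm P x)"
    then have ij: "i < n" "j < n" using x by auto
    have "hfc g x $$ (i, j) = (\<Sum>\<mu>\<in>Z. \<Sum>k<N. coeff (tay \<mu> P) k * M \<mu> k i j)"
      using x ij rsd by (simp add: hfc_def Z_def)
    also have "\<dots> = (\<Sum>\<mu>\<in>Z. pm (T \<mu> * e \<mu>) x $$ (i, j))"
      unfolding T_def sum_distrib_right pm_sum_index[OF x ij] M_def
      using ij x by (intro sum.cong refl) (simp add: pm_smult[OF x])
    also have "\<dots> = (\<Sum>\<mu>\<in>Z. pm (P * e \<mu>) x $$ (i, j))"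
    proof (intro sum.cong refl)
      fix \<mu> assume "\<mu> \<in> Z"
      have "pm ((T \<mu> - P) * e \<mu>) x = 0\<^sub>m n n"
      proof (rule pm0)
        fix \<nu> assume "\<nu> \<in> Z"
        then show "low \<nu> ((T \<mu> - P) * e \<mu>)" using tayT low0 low_mult by (cases "\<mu> = \<nu>") auto
      qed
      then have "pm (T \<mu> * e \<mu>) x - pm (P * e \<mu>) x = 0\<^sub>m n n" by (simp add: left_diff_distrib pm_minus[OF x])
      then have "(pm (T \<mu> * e \<mu>) x - pm (P * e \<mu>) x) $$ (i, j) = 0" using ij by simp
      then show "pm (T \<mu> * e \<mu>) x $$ (i, j) = pm (P * e \<mu>) x $$ (i, j)" using ij x by simp
    qed
    also have "\<dots> = pm (P * (\<Sum>\<mu>\<in>Z. e \<mu>)) x $$ (i, j)"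
      by (simp add: pm_sum_index[OF x ij, symmetric] sum_distrib_left)
    also have "pm (P * (\<Sum>\<mu>\<in>Z. e \<mu>)) x = pm P x" using x by (simp add: pm_mult[OF x] pm1)
    finally show "hfc g x $$ (i, j) = pm P x $$ (i, j)" .
  qed (use x in \<open>auto simp: hfc_def\<close>)
qed

text \<open>One polynomial represents \<open>g\<close> at several matrices at once, even of
  different sizes. This transfers direct sums and similarities from polynomials to the functional
  calculus.\<close>

lemma ex_common_poly:
  assumes "finite X" "\<And>x. x \<in> X \<Longrightarrow> \<exists>n. x \<in> carrier_mat n n"
    and "open V" "\<And>x. x \<in> X \<Longrightarrow> spectrum x \<subseteq> V" "g holomorphic_on V"
  obtains P N where "N > 0" "\<And>x. x \<in> X \<Longrightarrow> kills N x" "matches N (\<Union>(spectrum ` X)) g P"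
    "\<And>x. x \<in> X \<Longrightarrow> hfc g x = pm P x" "\<And>x l. x \<in> X \<Longrightarrow> l \<in> spectrum x \<Longrightarrow> poly P l = g l"
proof -
  obtain K where K: "\<And>x. x \<in> X \<Longrightarrow> kills (K x) x" using assms(2) ex_kills by metis
  \<comment> \<open>The successor keeps \<open>N\<close> positive, so that the values of
    \<open>g\<close> are interpolated and the jet is not empty.\<close>
  define N where "N = Suc (\<Sum>x\<in>X. K x)"
  have N: "kills N x" if "x \<in> X" for x
  proof -
    have "K x \<le> N" unfolding N_def using member_le_sum[OF that _ assms(1), of K] by simp
    then show ?thesis using assms(2)[OF that] kills_mono K[OF that] by blast
  qed
  have fin: "finite (\<Union>(spectrum ` X))" using assms(1,2) finite_spectrum by blast
  obtain P where P: "matches N (\<Union>(spectrum ` X)) g P"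
    using ex_matches[OF fin assms(3) _ assms(5)] assms(4) by blast
  show thesis
  proof (rule that[of N P])
    fix x assume x: "x \<in> X"
    then obtain n where n: "x \<in> carrier_mat n n" using assms(2) by blast
    show "hfc g x = pm P x"
      by (rule hfc_eq_pm[OF n N[OF x] matches_subset[OF P]]) (use x in auto)
  next
    fix x l assume "x \<in> X" "l \<in> spectrum x"
    then show "poly P l = g l" by (intro matches_value[OF P]) (auto simp: N_def)
  qed (use P N in \<open>auto simp: N_def\<close>)
qed

lemma hfc_carrier [simp, intro]: "x \<in> carrier_mat n n \<Longrightarrow> hfc g x \<in> carrier_mat n n"
  by (auto simp: hfc_def)

lemma hfc_mult:
  assumes x: "x \<in> carrier_mat n n" and V: "open V" "spectrum x \<subseteq> V"
    and "f holomorphic_on V" "g holomorphic_on V"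
  shows "hfc (\<lambda>z. f z * g z) x = hfc f x * hfc g x"
proof -
  obtain N where N: "kills N x" using ex_kills[OF x] by blast
  obtain P where P: "matches N (spectrum x) f P" using ex_matches[OF finite_spectrum[OF x] V assms(4)] by blast
  obtain Q where Q: "matches N (spectrum x) g Q" using ex_matches[OF finite_spectrum[OF x] V assms(5)] by blast
  show ?thesis
    using hfc_eq_pm[OF x N P] hfc_eq_pm[OF x N Q] hfc_eq_pm[OF x N matches_mult[OF P Q]] pm_mult[OF x] by simp
qed

lemma hfc_cong_poly:
  assumes x: "x \<in> carrier_mat n n" and V: "open V" "spectrum x \<subseteq> V" "\<And>z. z \<in> V \<Longrightarrow> g z = poly P z"
  shows "hfc g x = pm P x"
proof -
  obtain N where N: "kills N x" using ex_kills[OF x] by blast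
  show ?thesis using hfc_eq_pm[OF x N matches_cong[OF matches_poly V(1,2)]] V(3) by simp
qed

lemma hfc_cong:
  assumes x: "x \<in> carrier_mat n n" and V: "open V" "spectrum x \<subseteq> V" "\<And>z. z \<in> V \<Longrightarrow> f z = g z" "f holomorphic_on V"
  shows "hfc f x = hfc g x"
proof -
  obtain N where N: "kills N x" using ex_kills[OF x] by blast
  obtain P where P: "matches N (spectrum x) f P" using ex_matches[OF finite_spectrum[OF x] V(1,2,4)] by blast
  show ?thesis using hfc_eq_pm[OF x N P] hfc_eq_pm[OF x N matches_cong[OF P V(1,2,3)]] by simp
qed

section \<open>The operator norm\<close>

definition vnorm :: "complex vec \<Rightarrow> real" where
  "vnorm v = L2_set (\<lambda>i. cmod (vec_index v i)) {..<dim_vec v}"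

lemma vnorm_nonneg [simp]: "0 \<le> vnorm v" by (simp add: vnorm_def)

lemma vnorm_power2: "(vnorm v)\<^sup>2 = (\<Sum>i<dim_vec v. (cmod (vec_index v i))\<^sup>2)"
  by (simp add: vnorm_def L2_set_def sum_nonneg)

lemma vnorm_smult: "vnorm (c \<cdot>\<^sub>v v) = cmod c * vnorm v"
proof -
  have "vnorm (c \<cdot>\<^sub>v v) = L2_set (\<lambda>i. cmod c * cmod (vec_index v i)) {..<dim_vec v}"
    unfolding vnorm_def by (rule L2_set_cong) (auto simp: norm_mult)
  then show ?thesis by (simp add: vnorm_def L2_set_right_distrib)
qed

lemma vnorm_add: "dim_vec v = dim_vec w \<Longrightarrow> vnorm (v + w) \<le> vnorm v + vnorm w"
proof -
  assume d: "dim_vec v = dim_vec w"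
  have "vnorm (v + w) \<le> L2_set (\<lambda>i. cmod (vec_index v i) + cmod (vec_index w i)) {..<dim_vec w}"
    unfolding vnorm_def using d by (auto intro!: L2_set_mono norm_triangle_ineq)
  also have "\<dots> \<le> vnorm v + vnorm w" unfolding vnorm_def d by (rule L2_set_triangle_ineq)
  finally show ?thesis .
qed

lemma vnorm_zero [simp]: "vnorm (0\<^sub>v n) = 0"
  by (simp add: vnorm_def L2_set_def)

lemma vnorm_entry: "i < dim_vec v \<Longrightarrow> cmod (vec_index v i) \<le> vnorm v"
  unfolding vnorm_def by (rule member_le_L2_set) auto

lemma vnorm_eq_0: "v \<in> carrier_vec n \<Longrightarrow> vnorm v = 0 \<Longrightarrow> v = 0\<^sub>v n"
  using vnorm_entry[of _ v] by (intro eq_vecI) (fastforce simp: le_less)+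

lemma vnorm_pos: "v \<in> carrier_vec n \<Longrightarrow> v \<noteq> 0\<^sub>v n \<Longrightarrow> vnorm v > 0"
  using vnorm_eq_0[of v n] vnorm_nonneg[of v] by (auto simp: less_le)

lemma vnorm_le_sum: "vnorm v \<le> (\<Sum>i<dim_vec v. cmod (vec_index v i))"
  unfolding vnorm_def by (rule L2_set_le_sum) auto

lemma sum_lessThan_add: "sum f {..<m + n} = sum f {..<m} + (\<Sum>i<n. f (m + i))"
  for f :: "nat \<Rightarrow> 'a :: comm_monoid_add" and m n :: nat
  by (induction n) (auto simp: add.assoc)

lemma vnorm_append: "(vnorm (v @\<^sub>v w))\<^sup>2 = (vnorm v)\<^sup>2 + (vnorm w)\<^sup>2"
proof -
  let ?f = "\<lambda>i. (cmod (vec_index (v @\<^sub>v w) i))\<^sup>2"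
  have "(\<Sum>i<dim_vec v + dim_vec w. ?f i) = (\<Sum>i<dim_vec v. ?f i) + (\<Sum>i<dim_vec w. ?f (dim_vec v + i))"
    by (rule sum_lessThan_add)
  then show ?thesis by (simp add: vnorm_power2)
qed

lemma opnorm_alt: "opnorm A = (SUP v\<in>{v \<in> carrier_vec (dim_col A). vnorm v \<le> 1}. vnorm (A *\<^sub>v v))"
  by (simp add: opnorm_def vnorm_def)

lemma vnorm_mult_mat_vec:
  assumes "v \<in> carrier_vec (dim_col A)"
  shows "vnorm (A *\<^sub>v v) \<le> (\<Sum>i<dim_row A. \<Sum>j<dim_col A. cmod (A $$ (i, j))) * vnorm v"
proof -
  have "vnorm (A *\<^sub>v v) \<le> (\<Sum>i<dim_row A. cmod (vec_index (A *\<^sub>v v) i))"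
    using vnorm_le_sum[of "A *\<^sub>v v"] by simp
  also have "\<dots> \<le> (\<Sum>i<dim_row A. \<Sum>j<dim_col A. cmod (A $$ (i, j)) * vnorm v)"
  proof (rule sum_mono)
    fix i assume i: "i \<in> {..<dim_row A}"
    have "vec_index (A *\<^sub>v v) i = (\<Sum>j<dim_col A. A $$ (i, j) * vec_index v j)"
      using i assms by (auto simp: scalar_prod_def atLeast0LessThan)
    also have "cmod \<dots> \<le> (\<Sum>j<dim_col A. cmod (A $$ (i, j) * vec_index v j))" by (rule norm_sum)
    also have "\<dots> \<le> (\<Sum>j<dim_col A. cmod (A $$ (i, j)) * vnorm v)"
      using assms by (intro sum_mono) (auto simp: norm_mult intro!: mult_left_mono vnorm_entry)
    finally show "cmod (vec_index (A *\<^sub>v v) i) \<le> (\<Sum>j<dim_col A. cmod (A $$ (i, j)) * vnorm v)" .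
  qed
  finally show ?thesis by (simp add: sum_distrib_right)
qed

lemma opnorm_bdd: "bdd_above ((\<lambda>v. vnorm (A *\<^sub>v v)) ` {v \<in> carrier_vec (dim_col A). vnorm v \<le> 1})"
proof (rule bdd_aboveI2)
  let ?K = "\<Sum>i<dim_row A. \<Sum>j<dim_col A. cmod (A $$ (i, j))"
  fix v :: "complex vec" assume v: "v \<in> {v \<in> carrier_vec (dim_col A). vnorm v \<le> 1}"
  have "vnorm (A *\<^sub>v v) \<le> ?K * vnorm v" using v by (intro vnorm_mult_mat_vec) auto
  also have "\<dots> \<le> ?K * 1" using v by (intro mult_left_mono sum_nonneg) auto
  finally show "vnorm (A *\<^sub>v v) \<le> ?K" by simp
qed

lemma opnorm_unit: "v \<in> carrier_vec (dim_col A) \<Longrightarrow> vnorm v \<le> 1 \<Longrightarrow> vnorm (A *\<^sub>v v) \<le> opnorm A"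
  unfolding opnorm_alt by (rule cSUP_upper[OF _ opnorm_bdd]) auto

lemma opnorm_nonneg [simp]: "0 \<le> opnorm A"
  by (rule order_trans[OF vnorm_nonneg opnorm_unit[of "0\<^sub>v (dim_col A)" A]]) auto

lemma opnorm_bound:
  assumes "v \<in> carrier_vec (dim_col A)"
  shows "vnorm (A *\<^sub>v v) \<le> opnorm A * vnorm v"
proof (cases "vnorm v = 0")
  case True
  then have "v = 0\<^sub>v (dim_col A)" using vnorm_eq_0 assms by blast
  moreover have "A *\<^sub>v 0\<^sub>v (dim_col A) = 0\<^sub>v (dim_row A)" by (intro eq_vecI) auto
  ultimately show ?thesis by simp
next
  case False
  then have pos: "vnorm v > 0" using vnorm_nonneg[of v] by linarith
  define w where "w = complex_of_real (1 / vnorm v) \<cdot>\<^sub>v v"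
  have w: "w \<in> carrier_vec (dim_col A)" using assms by (simp add: w_def)
  have "vnorm w = 1" using pos by (simp add: w_def vnorm_smult norm_divide)
  then have "vnorm (A *\<^sub>v w) \<le> opnorm A" using opnorm_unit[OF w] by simp
  moreover have "A *\<^sub>v w = complex_of_real (1 / vnorm v) \<cdot>\<^sub>v (A *\<^sub>v v)"
    unfolding w_def by (rule mult_mat_vec[of A "dim_row A" "dim_col A"]) (use assms in auto)
  ultimately have "vnorm (A *\<^sub>v v) / vnorm v \<le> opnorm A"
    using pos by (simp add: vnorm_smult norm_divide)
  then show ?thesis using pos by (simp add: field_simps)
qed

lemma opnorm_leI:
  assumes "0 \<le> C" "\<And>v. v \<in> carrier_vec (dim_col A) \<Longrightarrow> vnorm (A *\<^sub>v v) \<le> C * vnorm v"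
  shows "opnorm A \<le> C"
  unfolding opnorm_alt
proof (rule cSUP_least)
  show "{v \<in> carrier_vec (dim_col A). vnorm v \<le> 1} \<noteq> {}"
    using vnorm_zero[of "dim_col A"] by (auto intro!: exI[of _ "0\<^sub>v (dim_col A)"])
next
  fix v :: "complex vec" assume v: "v \<in> {v \<in> carrier_vec (dim_col A). vnorm v \<le> 1}"
  have "vnorm (A *\<^sub>v v) \<le> C * vnorm v" using v assms(2) by simp
  also have "\<dots> \<le> C * 1" using v assms(1) by (intro mult_left_mono) auto
  finally show "vnorm (A *\<^sub>v v) \<le> C" by simp
qed

lemma opnorm_entry:
  assumes "i < dim_row A" "j < dim_col A"
  shows "cmod (A $$ (i, j)) \<le> opnorm A"
proof -
  have u: "vnorm (unit_vec (dim_col A) j) = 1"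
  proof -
    have "(vnorm (unit_vec (dim_col A) j))\<^sup>2 = (\<Sum>i<dim_col A. if i = j then 1 else 0)"
      unfolding vnorm_power2 using assms by (intro sum.cong) auto
    also have "\<dots> = 1" using assms by simp
    finally show ?thesis using vnorm_nonneg[of "unit_vec (dim_col A) j"] unfolding power2_eq_1_iff by linarith
  qed
  have "vec_index (A *\<^sub>v unit_vec (dim_col A) j) i = A $$ (i, j)"
    using assms by (simp add: scalar_prod_right_unit)
  then have "cmod (A $$ (i, j)) \<le> vnorm (A *\<^sub>v unit_vec (dim_col A) j)"
    using vnorm_entry[of i "A *\<^sub>v unit_vec (dim_col A) j"] assms by simp
  also have "\<dots> \<le> opnorm A" using u by (intro opnorm_unit) auto
  finally show ?thesis .
qed

lemma opnorm_mult:
  assumes "A \<in> carrier_mat n m" "B \<in> carrier_mat m k"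
  shows "opnorm (A * B) \<le> opnorm A * opnorm B"
proof (rule opnorm_leI)
  fix v :: "complex vec" assume "v \<in> carrier_vec (dim_col (A * B))"
  then have v: "v \<in> carrier_vec k" using assms by simp
  have Bv: "B *\<^sub>v v \<in> carrier_vec m" using assms v by simp
  have "(A * B) *\<^sub>v v = A *\<^sub>v (B *\<^sub>v v)"
    by (rule assoc_mult_mat_vec[OF assms v])
  then have "vnorm ((A * B) *\<^sub>v v) = vnorm (A *\<^sub>v (B *\<^sub>v v))" by (rule arg_cong)
  also have "\<dots> \<le> opnorm A * vnorm (B *\<^sub>v v)"
    by (rule opnorm_bound) (use Bv assms in simp)
  also have "\<dots> \<le> opnorm A * (opnorm B * vnorm v)"
    by (intro mult_left_mono opnorm_bound) (use v assms in simp_all)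
  finally show "vnorm (A * B *\<^sub>v v) \<le> opnorm A * opnorm B * vnorm v" by (simp only: mult.assoc)
qed simp

lemma opnorm_add:
  assumes "A \<in> carrier_mat n m" "B \<in> carrier_mat n m"
  shows "opnorm (A + B) \<le> opnorm A + opnorm B"
proof (rule opnorm_leI)
  fix v :: "complex vec" assume "v \<in> carrier_vec (dim_col (A + B))"
  then have v: "v \<in> carrier_vec m" using assms by simp
  have "(A + B) *\<^sub>v v = A *\<^sub>v v + B *\<^sub>v v"
    by (rule add_mult_distrib_mat_vec[OF assms v])
  then have "vnorm ((A + B) *\<^sub>v v) = vnorm (A *\<^sub>v v + B *\<^sub>v v)" by (rule arg_cong)
  also have "\<dots> \<le> vnorm (A *\<^sub>v v) + vnorm (B *\<^sub>v v)"
    by (rule vnorm_add) (use assms in simp)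
  also have "\<dots> \<le> opnorm A * vnorm v + opnorm B * vnorm v"
    by (intro add_mono opnorm_bound) (use v assms in simp_all)
  finally show "vnorm ((A + B) *\<^sub>v v) \<le> (opnorm A + opnorm B) * vnorm v" by (simp only: distrib_right)
qed simp

lemma opnorm_smult_le: "opnorm (c \<cdot>\<^sub>m A) \<le> cmod c * opnorm A"
proof (rule opnorm_leI)
  fix v :: "complex vec" assume v: "v \<in> carrier_vec (dim_col (c \<cdot>\<^sub>m A))"
  then have "(c \<cdot>\<^sub>m A) *\<^sub>v v = c \<cdot>\<^sub>v (A *\<^sub>v v)" by (intro eq_vecI) auto
  then show "vnorm ((c \<cdot>\<^sub>m A) *\<^sub>v v) \<le> cmod c * opnorm A * vnorm v"
    using opnorm_bound[of v A] v by (simp add: vnorm_smult mult.assoc mult_left_mono)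
qed simp

lemma opnorm_smult: "opnorm (c \<cdot>\<^sub>m A) = cmod c * opnorm A"
proof (cases "c = 0")
  case True
  then show ?thesis using opnorm_smult_le[of 0 A] opnorm_nonneg[of "0 \<cdot>\<^sub>m A"] by (auto intro: antisym)
next
  case False
  have "inverse c \<cdot>\<^sub>m (c \<cdot>\<^sub>m A) = A" using False by (intro eq_matI) auto
  then have "opnorm A \<le> cmod (inverse c) * opnorm (c \<cdot>\<^sub>m A)" using opnorm_smult_le[of "inverse c" "c \<cdot>\<^sub>m A"] by simp
  then have "cmod c * opnorm A \<le> cmod c * (cmod (inverse c) * opnorm (c \<cdot>\<^sub>m A))" by (rule mult_left_mono) simp
  also have "\<dots> = opnorm (c \<cdot>\<^sub>m A)" using False by (simp flip: mult.assoc norm_mult)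
  finally have "cmod c * opnorm A \<le> opnorm (c \<cdot>\<^sub>m A)" .
  then show ?thesis using opnorm_smult_le[of c A] by simp
qed

lemma opnorm_uminus: "opnorm (- A) = opnorm A"
proof -
  have "- A = (-1) \<cdot>\<^sub>m A" by (intro eq_matI) auto
  then show ?thesis by (simp add: opnorm_smult)
qed

lemma opnorm_diff:
  assumes "A \<in> carrier_mat n m" "B \<in> carrier_mat n m"
  shows "opnorm (A - B) \<le> opnorm A + opnorm B"
proof -
  have "A - B = A + (- B)" by (rule eq_matI) (use assms in auto)
  then show ?thesis using opnorm_add[of A n m "- B"] assms by (simp add: opnorm_uminus)
qed

lemma opnorm_zero [simp]: "opnorm (0\<^sub>m n m) = 0"
  using opnorm_smult[of 0 "0\<^sub>m n m"] by simp

lemma opnorm_one: "opnorm (1\<^sub>m n) \<le> 1"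
  by (rule opnorm_leI) auto

lemma spectrum_opnorm:
  assumes "x \<in> carrier_mat n n" "l \<in> spectrum x"
  shows "cmod l \<le> opnorm x"
proof -
  obtain v where v: "v \<in> carrier_vec n" "v \<noteq> 0\<^sub>v n" "x *\<^sub>v v = l \<cdot>\<^sub>v v" by (rule spectrumE[OF assms(2,1)])
  have "cmod l * vnorm v \<le> opnorm x * vnorm v"
    using opnorm_bound[of v x] v assms(1) by (simp add: vnorm_smult)
  then show ?thesis using vnorm_pos[OF v(1,2)] by simp
qed

lemma opnorm_dsum: "opnorm (mat_dsum A B) = max (opnorm A) (opnorm B)"
proof (rule antisym)
  have mv: "mat_dsum A B *\<^sub>v (a @\<^sub>v b) = (A *\<^sub>v a) @\<^sub>v (B *\<^sub>v b)"
    if "a \<in> carrier_vec (dim_col A)" "b \<in> carrier_vec (dim_col B)" for a b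
  proof -
    have z: "0\<^sub>m (dim_row A) (dim_col B) *\<^sub>v b = 0\<^sub>v (dim_row A)" "0\<^sub>m (dim_row B) (dim_col A) *\<^sub>v a = 0\<^sub>v (dim_row B)"
      using that by (auto intro!: eq_vecI)
    have "mat_dsum A B *\<^sub>v (a @\<^sub>v b) = (A *\<^sub>v a + 0\<^sub>m (dim_row A) (dim_col B) *\<^sub>v b) @\<^sub>v (0\<^sub>m (dim_row B) (dim_col A) *\<^sub>v a + B *\<^sub>v b)"
      unfolding mat_dsum_def
      by (rule four_block_mat_mult_vec[of _ "dim_row A" "dim_col A" _ "dim_col B" _ "dim_row B"]) (use that in auto)
    also have "A *\<^sub>v a + 0\<^sub>m (dim_row A) (dim_col B) *\<^sub>v b = A *\<^sub>v a"
      unfolding z(1) by (rule eq_vecI) auto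
    also have "0\<^sub>m (dim_row B) (dim_col A) *\<^sub>v a + B *\<^sub>v b = B *\<^sub>v b"
      unfolding z(2) by (rule eq_vecI) auto
    finally show ?thesis .
  qed
  let ?M = "max (opnorm A) (opnorm B)"
  show "opnorm (mat_dsum A B) \<le> ?M"
  proof (rule opnorm_leI)
    show M0: "0 \<le> ?M" by (simp add: le_max_iff_disj)
    fix v :: "complex vec" assume v: "v \<in> carrier_vec (dim_col (mat_dsum A B))"
    define a where "a = vec_first v (dim_col A)"
    define b where "b = vec_last v (dim_col B)"
    have ab: "a \<in> carrier_vec (dim_col A)" "b \<in> carrier_vec (dim_col B)" "v = a @\<^sub>v b"
      using v by (auto simp: a_def b_def)
    have "(vnorm (mat_dsum A B *\<^sub>v v))\<^sup>2 = (vnorm (A *\<^sub>v a))\<^sup>2 + (vnorm (B *\<^sub>v b))\<^sup>2"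
      unfolding ab(3) mv[OF ab(1,2)] vnorm_append ..
    also have "\<dots> \<le> (?M * vnorm a)\<^sup>2 + (?M * vnorm b)\<^sup>2"
    proof (intro add_mono power_mono vnorm_nonneg)
      show "vnorm (A *\<^sub>v a) \<le> ?M * vnorm a"
        by (rule order_trans[OF opnorm_bound[OF ab(1)]]) (auto intro: mult_right_mono)
      show "vnorm (B *\<^sub>v b) \<le> ?M * vnorm b"
        by (rule order_trans[OF opnorm_bound[OF ab(2)]]) (auto intro: mult_right_mono)
    qed
    also have "\<dots> = (?M * vnorm v)\<^sup>2" unfolding ab(3) power_mult_distrib vnorm_append by (simp add: algebra_simps)
    finally show "vnorm (mat_dsum A B *\<^sub>v v) \<le> ?M * vnorm v"
      by (rule power2_le_imp_le) (rule mult_nonneg_nonneg[OF M0 vnorm_nonneg])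
  qed
  have sq: "vnorm (v @\<^sub>v 0\<^sub>v k) = vnorm v" "vnorm (0\<^sub>v k @\<^sub>v v) = vnorm v" for v k
    using vnorm_append[of v "0\<^sub>v k"] vnorm_append[of "0\<^sub>v k" v] by (auto simp: power2_eq_iff_nonneg)
  have z: "C *\<^sub>v 0\<^sub>v (dim_col C) = 0\<^sub>v (dim_row C)" for C :: "complex mat" by (intro eq_vecI) auto
  have "opnorm A \<le> opnorm (mat_dsum A B)"
  proof (rule opnorm_leI)
    fix v :: "complex vec" assume v: "v \<in> carrier_vec (dim_col A)"
    have "vnorm (mat_dsum A B *\<^sub>v (v @\<^sub>v 0\<^sub>v (dim_col B))) \<le> opnorm (mat_dsum A B) * vnorm (v @\<^sub>v 0\<^sub>v (dim_col B))"
      using v by (intro opnorm_bound) auto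
    then show "vnorm (A *\<^sub>v v) \<le> opnorm (mat_dsum A B) * vnorm v"
      using v by (simp add: mv sq z)
  qed simp
  moreover have "opnorm B \<le> opnorm (mat_dsum A B)"
  proof (rule opnorm_leI)
    fix v :: "complex vec" assume v: "v \<in> carrier_vec (dim_col B)"
    have "vnorm (mat_dsum A B *\<^sub>v (0\<^sub>v (dim_col A) @\<^sub>v v)) \<le> opnorm (mat_dsum A B) * vnorm (0\<^sub>v (dim_col A) @\<^sub>v v)"
      using v by (intro opnorm_bound) auto
    then show "vnorm (B *\<^sub>v v) \<le> opnorm (mat_dsum A B) * vnorm v"
      using v by (simp add: mv sq z)
  qed simp
  ultimately show "?M \<le> opnorm (mat_dsum A B)" by simp
qed

section \<open>Matrices of blocks\<close>

text \<open>Has the index convention of \<open>fpmat_eval\<close>, with the blocks given by a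
  function instead of a matrix of free polynomials.\<close>

definition blockm :: "nat \<Rightarrow> nat \<Rightarrow> nat \<Rightarrow> (nat \<Rightarrow> nat \<Rightarrow> complex mat) \<Rightarrow> complex mat" where
  "blockm k l n G = Matrix.mat (k * n) (l * n) (\<lambda>(i, j). G (i div n) (j div n) $$ (i mod n, j mod n))"

lemma blockm_dim [simp]: "dim_row (blockm k l n G) = k * n" "dim_col (blockm k l n G) = l * n"
  by (simp_all add: blockm_def)

lemma blockm_carrier [simp, intro]: "blockm k l n G \<in> carrier_mat (k * n) (l * n)"
  by (simp add: blockm_def)

lemma block_index_less: "a < k \<Longrightarrow> b < n \<Longrightarrow> a * n + b < k * (n :: nat)"
proof -
  assume "a < k" "b < n"
  then have "a * n + b < Suc a * n" by simp
  also have "\<dots> \<le> k * n" using \<open>a < k\<close> by (intro mult_le_mono1) simp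
  finally show ?thesis .
qed

lemma sum_block: "(\<Sum>j<l * n. h j) = (\<Sum>c<l. \<Sum>d<n. h (c * n + d))"
  for h :: "nat \<Rightarrow> 'a :: comm_monoid_add" and n :: nat
proof (induction l)
  case (Suc l)
  have "(\<Sum>j<Suc l * n. h j) = (\<Sum>j<l * n + n. h j)" by (simp add: add.commute)
  then show ?case using Suc by (simp add: sum_lessThan_add)
qed simp

definition vblock :: "nat \<Rightarrow> complex vec \<Rightarrow> nat \<Rightarrow> complex vec" where
  "vblock n v a = vec n (\<lambda>b. vec_index v (a * n + b))"

lemma vnorm_vblock_power2: "v \<in> carrier_vec (k * n) \<Longrightarrow> (vnorm v)\<^sup>2 = (\<Sum>a<k. (vnorm (vblock n v a))\<^sup>2)"
  by (simp add: vnorm_power2 sum_block vblock_def)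

lemma vnorm_vblock:
  assumes "v \<in> carrier_vec (k * n)" "a < k"
  shows "vnorm (vblock n v a) \<le> vnorm v"
proof (rule power2_le_imp_le)
  have "(vnorm (vblock n v a))\<^sup>2 \<le> (\<Sum>a<k. (vnorm (vblock n v a))\<^sup>2)"
    by (rule member_le_sum) (use assms in auto)
  then show "(vnorm (vblock n v a))\<^sup>2 \<le> (vnorm v)\<^sup>2"
    unfolding vnorm_vblock_power2[OF assms(1), symmetric] .
qed simp

lemma vnorm_le_vblocks:
  assumes "v \<in> carrier_vec (k * n)"
  shows "vnorm v \<le> (\<Sum>a<k. vnorm (vblock n v a))"
proof -
  have "vnorm v = L2_set (\<lambda>a. vnorm (vblock n v a)) {..<k}"
    using vnorm_vblock_power2[OF assms] by (simp add: L2_set_def) (metis real_sqrt_unique vnorm_nonneg)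
  also have "\<dots> \<le> (\<Sum>a<k. vnorm (vblock n v a))" by (rule L2_set_le_sum) simp
  finally show ?thesis .
qed

lemma vnorm_sum_vec:
  "vnorm (vec n (\<lambda>b. \<Sum>c<l. f c b)) \<le> (\<Sum>c<(l::nat). vnorm (vec n (f c)))"
proof (induction l)
  case 0
  have "vec n (\<lambda>b. 0) = (0\<^sub>v n :: complex vec)" by (intro eq_vecI) auto
  then show ?case by simp
next
  case (Suc l)
  have "vec n (\<lambda>b. \<Sum>c<Suc l. f c b) = vec n (\<lambda>b. \<Sum>c<l. f c b) + vec n (f l)" by (intro eq_vecI) auto
  then show ?case using Suc vnorm_add[of "vec n (\<lambda>b. \<Sum>c<l. f c b)" "vec n (f l)"] by simp
qed

text \<open>Crude, but the number of terms does not depend on the block size \<open>n\<close>, as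
  estimates valid at all levels require.\<close>

lemma opnorm_blockm_le:
  assumes n: "n \<ge> 1" and G: "\<And>a c. a < k \<Longrightarrow> c < l \<Longrightarrow> G a c \<in> carrier_mat n n"
  shows "opnorm (blockm k l n G) \<le> (\<Sum>a<k. \<Sum>c<l. opnorm (G a c))"
proof (rule opnorm_leI)
  show "0 \<le> (\<Sum>a<k. \<Sum>c<l. opnorm (G a c))" by (intro sum_nonneg) auto
  fix v :: "complex vec" assume "v \<in> carrier_vec (dim_col (blockm k l n G))"
  then have v: "v \<in> carrier_vec (l * n)" by simp
  let ?w = "blockm k l n G *\<^sub>v v"
  have w: "?w \<in> carrier_vec (k * n)" using v by (intro mult_mat_vec_carrier[OF blockm_carrier])
  have "vnorm ?w \<le> (\<Sum>a<k. vnorm (vblock n ?w a))" by (rule vnorm_le_vblocks[OF w])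
  also have "\<dots> \<le> (\<Sum>a<k. \<Sum>c<l. opnorm (G a c) * vnorm v)"
  proof (rule sum_mono)
    fix a assume a: "a \<in> {..<k}"
    have "vblock n ?w a = vec n (\<lambda>b. \<Sum>c<l. vec_index (G a c *\<^sub>v vblock n v c) b)"
    proof (rule eq_vecI)
      fix b assume "b < dim_vec (vec n (\<lambda>b. \<Sum>c<l. vec_index (G a c *\<^sub>v vblock n v c) b))"
      then have b: "b < n" by simp
      have i: "a * n + b < k * n" using a b block_index_less by simp
      have "vec_index (vblock n ?w a) b = (\<Sum>j<l * n. blockm k l n G $$ (a * n + b, j) * vec_index v j)"
        using b i v by (simp add: vblock_def scalar_prod_def atLeast0LessThan)
      also have "\<dots> = (\<Sum>c<l. \<Sum>d<n. G a c $$ (b, d) * vec_index v (c * n + d))"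
        unfolding sum_block using b i n by (intro sum.cong refl) (simp add: blockm_def block_index_less)
      also have "\<dots> = (\<Sum>c<l. vec_index (G a c *\<^sub>v vblock n v c) b)"
      proof (intro sum.cong refl)
        fix c assume "c \<in> {..<l}"
        then have "G a c \<in> carrier_mat n n" using G a by simp
        then show "(\<Sum>d<n. G a c $$ (b, d) * vec_index v (c * n + d)) = vec_index (G a c *\<^sub>v vblock n v c) b"
          using b by (simp add: scalar_prod_def vblock_def atLeast0LessThan)
      qed
      finally show "vec_index (vblock n ?w a) b = vec_index (vec n (\<lambda>b. \<Sum>c<l. vec_index (G a c *\<^sub>v vblock n v c) b)) b"
        using b by simp
    qed (simp add: vblock_def)
    then have "vnorm (vblock n ?w a) \<le> (\<Sum>c<l. vnorm (vec n (\<lambda>b. vec_index (G a c *\<^sub>v vblock n v c) b)))"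
      using vnorm_sum_vec[of n "\<lambda>c b. vec_index (G a c *\<^sub>v vblock n v c) b" l] by simp
    also have "\<dots> \<le> (\<Sum>c<l. opnorm (G a c) * vnorm v)"
    proof (rule sum_mono)
      fix c assume c: "c \<in> {..<l}"
      then have Gc: "G a c \<in> carrier_mat n n" using G a by simp
      have "vec n (\<lambda>b. vec_index (G a c *\<^sub>v vblock n v c) b) = G a c *\<^sub>v vblock n v c"
        using Gc by (intro eq_vecI) auto
      then have "vnorm (vec n (\<lambda>b. vec_index (G a c *\<^sub>v vblock n v c) b)) = vnorm (G a c *\<^sub>v vblock n v c)" by simp
      also have "\<dots> \<le> opnorm (G a c) * vnorm (vblock n v c)"
        using Gc by (intro opnorm_bound) (simp add: vblock_def)
      also have "\<dots> \<le> opnorm (G a c) * vnorm v"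
        using v c by (intro mult_left_mono vnorm_vblock[of v l]) auto
      finally show "vnorm (vec n (\<lambda>b. vec_index (G a c *\<^sub>v vblock n v c) b)) \<le> opnorm (G a c) * vnorm v" .
    qed
    finally show "vnorm (vblock n ?w a) \<le> (\<Sum>c<l. opnorm (G a c) * vnorm v)" .
  qed
  also have "\<dots> = (\<Sum>a<k. \<Sum>c<l. opnorm (G a c)) * vnorm v" by (simp add: sum_distrib_right)
  finally show "vnorm ?w \<le> (\<Sum>a<k. \<Sum>c<l. opnorm (G a c)) * vnorm v" .
qed

text \<open>A permutation of coordinates preserves the Euclidean norm, so a vector can be carried
  along with the columns.\<close>

lemma opnorm_reindex_le:
  assumes A: "A \<in> carrier_mat nr nc" and B: "B \<in> carrier_mat nr nc"
    and s: "bij_betw s {..<nr} {..<nr}" and t: "bij_betw t {..<nc} {..<nc}"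
    and AB: "\<And>i j. i < nr \<Longrightarrow> j < nc \<Longrightarrow> A $$ (i, j) = B $$ (s i, t j)"
  shows "opnorm A \<le> opnorm B"
proof (rule opnorm_leI)
  fix v :: "complex vec" assume "v \<in> carrier_vec (dim_col A)"
  then have v: "v \<in> carrier_vec nc" using A by simp
  define w where "w = vec nc (\<lambda>j. vec_index v (inv_into {..<nc} t j))"
  have wt: "vec_index w (t j) = vec_index v j" "t j < nc" if "j < nc" for j
  proof -
    show tj: "t j < nc" using that t by (auto simp: bij_betw_def)
    have "inv_into {..<nc} t (t j) = j" using that t by (intro inv_into_f_f) (auto simp: bij_betw_def)
    then show "vec_index w (t j) = vec_index v j" using tj by (simp add: w_def)
  qed
  have sl: "s i < nr" if "i < nr" for i using that s by (auto simp: bij_betw_def)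
  have "(vnorm w)\<^sup>2 = (\<Sum>j<nc. (cmod (vec_index w j))\<^sup>2)" by (simp add: vnorm_power2 w_def)
  also have "\<dots> = (\<Sum>j<nc. (cmod (vec_index w (t j)))\<^sup>2)"
    by (rule sum.reindex_bij_betw[symmetric, OF t])
  also have "\<dots> = (vnorm v)\<^sup>2" using v wt by (simp add: vnorm_power2)
  finally have vw: "vnorm w = vnorm v" by (simp add: power2_eq_iff_nonneg)
  have "(vnorm (A *\<^sub>v v))\<^sup>2 = (\<Sum>i<nr. (cmod (vec_index (A *\<^sub>v v) i))\<^sup>2)" using A by (simp add: vnorm_power2)
  also have "\<dots> = (\<Sum>i<nr. (cmod (vec_index (B *\<^sub>v w) (s i)))\<^sup>2)"
  proof (intro sum.cong refl)
    fix i assume "i \<in> {..<nr}"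
    then have i: "i < nr" by simp
    have "vec_index (A *\<^sub>v v) i = (\<Sum>j<nc. B $$ (s i, t j) * vec_index w (t j))"
      using i A v wt AB by (simp add: scalar_prod_def atLeast0LessThan)
    also have "\<dots> = (\<Sum>j<nc. B $$ (s i, j) * vec_index w j)"
      by (rule sum.reindex_bij_betw[OF t])
    also have "\<dots> = vec_index (B *\<^sub>v w) (s i)"
      using sl[OF i] B by (simp add: scalar_prod_def atLeast0LessThan w_def)
    finally show "(cmod (vec_index (A *\<^sub>v v) i))\<^sup>2 = (cmod (vec_index (B *\<^sub>v w) (s i)))\<^sup>2" by simp
  qed
  also have "\<dots> = (\<Sum>i<nr. (cmod (vec_index (B *\<^sub>v w) i))\<^sup>2)" by (rule sum.reindex_bij_betw[OF s])
  also have "\<dots> = (vnorm (B *\<^sub>v w))\<^sup>2" using B by (simp add: vnorm_power2)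
  finally have "vnorm (A *\<^sub>v v) = vnorm (B *\<^sub>v w)" by (simp add: power2_eq_iff_nonneg)
  also have "\<dots> \<le> opnorm B * vnorm w" by (rule opnorm_bound) (use B in \<open>simp add: w_def\<close>)
  finally show "vnorm (A *\<^sub>v v) \<le> opnorm B * vnorm v" by (simp add: vw)
qed simp

lemma opnorm_reindex:
  assumes A: "A \<in> carrier_mat nr nc" and B: "B \<in> carrier_mat nr nc"
    and s: "bij_betw s {..<nr} {..<nr}" and t: "bij_betw t {..<nc} {..<nc}"
    and AB: "\<And>i j. i < nr \<Longrightarrow> j < nc \<Longrightarrow> A $$ (i, j) = B $$ (s i, t j)"
  shows "opnorm A = opnorm B"
proof (rule antisym)
  show "opnorm A \<le> opnorm B" by (rule opnorm_reindex_le[OF assms])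
  show "opnorm B \<le> opnorm A"
  proof (rule opnorm_reindex_le[OF B A bij_betw_inv_into[OF s] bij_betw_inv_into[OF t]])
    fix i j assume ij: "i < nr" "j < nc"
    let ?s = "inv_into {..<nr} s" and ?t = "inv_into {..<nc} t"
    have "?s i < nr" "?t j < nc" "s (?s i) = i" "t (?t j) = j"
      using ij s t bij_betw_inv_into[OF s] bij_betw_inv_into[OF t]
      by (auto simp: bij_betw_def f_inv_into_f)
    then show "B $$ (i, j) = A $$ (?s i, ?t j)" using AB by simp
  qed
qed

text \<open>Reorders \<open>k\<close> blocks of size \<open>n + m\<close> into \<open>k\<close> blocks of size \<open>n\<close> followed by \<open>k\<close> of size \<open>m\<close>.\<close>
definition unshuffle :: "nat \<Rightarrow> nat \<Rightarrow> nat \<Rightarrow> nat \<Rightarrow> nat" where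
  "unshuffle k n m i = (let a = i div (n + m); b = i mod (n + m) in
     if b < n then a * n + b else k * n + (a * m + (b - n)))"

lemma bij_unshuffle:
  assumes "n \<ge> 1"
  shows "bij_betw (unshuffle k n m) {..<k * (n + m)} {..<k * (n + m)}"
proof -
  let ?u = "unshuffle k n m"
  have div_less: "i div (n + m) < k" if "i < k * (n + m)" for i
    using that by (simp add: less_mult_imp_div_less)
  have mod_less: "i mod (n + m) < n + m" for i using assms by simp
  have "inj_on ?u {..<k * (n + m)}"
  proof (rule inj_onI)
    fix i j assume ij: "i \<in> {..<k * (n + m)}" "j \<in> {..<k * (n + m)}" "?u i = ?u j"
    define a b c d where "a = i div (n + m)" "b = i mod (n + m)" "c = j div (n + m)" "d = j mod (n + m)"
    note abcd = this
    have lt: "a < k" "c < k" "b < n + m" "d < n + m" using ij div_less mod_less by (auto simp: abcd)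
    have eq: "i = a * (n + m) + b" "j = c * (n + m) + d"
      unfolding abcd by (rule div_mult_mod_eq[symmetric])+
    have u: "(if b < n then a * n + b else k * n + (a * m + (b - n))) = (if d < n then c * n + d else k * n + (c * m + (d - n)))"
      using ij(3) unfolding unshuffle_def Let_def abcd .
    have "a = c \<and> b = d"
    proof (cases "b < n"; cases "d < n")
      assume "b < n" "d < n"
      then have e: "a * n + b = c * n + d" using u by simp
      have "(a * n + b) div n = a" "(a * n + b) mod n = b" "(c * n + d) div n = c" "(c * n + d) mod n = d"
        using \<open>b < n\<close> \<open>d < n\<close> by auto
      then show ?thesis using e by metis
    next
      assume "b < n" "\<not> d < n"
      then show ?thesis using u block_index_less[of a k b n] lt by simp
    next
      assume "\<not> b < n" "d < n"
      then show ?thesis using u block_index_less[of c k d n] lt by simp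
    next
      assume nb: "\<not> b < n" "\<not> d < n"
      then have e: "a * m + (b - n) = c * m + (d - n)" using u by simp
      have lt': "b - n < m" "d - n < m" using nb lt by auto
      have "(a * m + (b - n)) div m = a" "(a * m + (b - n)) mod m = b - n" "(c * m + (d - n)) div m = c" "(c * m + (d - n)) mod m = d - n"
        using lt' by auto
      then have "a = c" "b - n = d - n" using e by metis+
      then show ?thesis using nb by simp
    qed
    then show "i = j" using eq by simp
  qed
  moreover have "?u ` {..<k * (n + m)} \<subseteq> {..<k * (n + m)}"
  proof
    fix y assume "y \<in> ?u ` {..<k * (n + m)}"
    then obtain i where i: "i < k * (n + m)" "y = ?u i" by auto
    define a b where "a = i div (n + m)" "b = i mod (n + m)"
    note ab = this
    have lt: "a < k" "b < n + m" using i div_less mod_less by (auto simp: ab)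
    have y: "y = (if b < n then a * n + b else k * n + (a * m + (b - n)))"
      using i by (simp add: unshuffle_def Let_def ab)
    show "y \<in> {..<k * (n + m)}"
    proof (cases "b < n")
      case True
      then have "y < k * n" using y block_index_less[of a k b n] lt by simp
      then show ?thesis by (simp add: distrib_left)
    next
      case False
      then have "b - n < m" using lt by simp
      then have "a * m + (b - n) < k * m" using block_index_less[of a k "b - n" m] lt by simp
      then show ?thesis using y False by (simp add: distrib_left)
    qed
  qed
  ultimately show ?thesis
    using endo_inj_surj[of "{..<k * (n + m)}" ?u] by (simp add: bij_betw_def)
qed

text \<open>Reordering rows and columns turns a matrix of block-diagonal entries into a
  block-diagonal matrix. This is why a basic free set contains a direct sum exactly when it contains
  both summands.\<close>

lemma opnorm_blockm_dsum:
  assumes n: "n \<ge> 1" and m: "m \<ge> 1"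
    and G: "\<And>a c. a < k \<Longrightarrow> c < l \<Longrightarrow> G a c \<in> carrier_mat n n"
    and H: "\<And>a c. a < k \<Longrightarrow> c < l \<Longrightarrow> H a c \<in> carrier_mat m m"
  shows "opnorm (blockm k l (n + m) (\<lambda>a c. mat_dsum (G a c) (H a c)))
    = max (opnorm (blockm k l n G)) (opnorm (blockm k l m H))"
proof -
  let ?D = "mat_dsum (blockm k l n G) (blockm k l m H)"
  have "opnorm (blockm k l (n + m) (\<lambda>a c. mat_dsum (G a c) (H a c))) = opnorm ?D"
  proof (rule opnorm_reindex[OF _ _ bij_unshuffle[OF n] bij_unshuffle[OF n]])
    show "?D \<in> carrier_mat (k * (n + m)) (l * (n + m))"
      by (intro carrier_matI) (simp_all add: distrib_left)
    fix i j assume ij: "i < k * (n + m)" "j < l * (n + m)"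
    define a b c d where "a = i div (n + m)" "b = i mod (n + m)" "c = j div (n + m)" "d = j mod (n + m)"
    note abcd = this
    have lt: "a < k" "c < l" using ij by (auto simp: abcd less_mult_imp_div_less)
    have lt2: "b < n + m" "d < n + m" using n by (auto simp: abcd)
    have lhs: "blockm k l (n + m) (\<lambda>a c. mat_dsum (G a c) (H a c)) $$ (i, j) = mat_dsum (G a c) (H a c) $$ (b, d)"
      using ij by (simp add: blockm_def abcd)
    have u: "unshuffle k n m i = (if b < n then a * n + b else k * n + (a * m + (b - n)))"
      "unshuffle l n m j = (if d < n then c * n + d else l * n + (c * m + (d - n)))"
      by (simp_all add: unshuffle_def Let_def abcd)
    note c1 = G[OF lt] H[OF lt]
    have b1: "b < n \<Longrightarrow> a * n + b < k * n" "\<not> b < n \<Longrightarrow> a * m + (b - n) < k * m"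
      "d < n \<Longrightarrow> c * n + d < l * n" "\<not> d < n \<Longrightarrow> c * m + (d - n) < l * m"
      using lt lt2 block_index_less[of a k b n] block_index_less[of c l d n]
        block_index_less[of a k "b - n" m] block_index_less[of c l "d - n" m] by linarith+
    show "blockm k l (n + m) (\<lambda>a c. mat_dsum (G a c) (H a c)) $$ (i, j) = ?D $$ (unshuffle k n m i, unshuffle l n m j)"
    proof -
      have "b < n \<or> (\<exists>b'<m. b = n + b')" "d < n \<or> (\<exists>d'<m. d = n + d')"
        using lt2 by presburger+
      then show ?thesis
        unfolding lhs u using c1 b1 n m by (elim disjE exE conjE) (auto simp: mat_dsum_def blockm_def)
    qed
  qed simp
  then show ?thesis by (simp add: opnorm_dsum)
qed

text \<open>Puts two polynomial matrices into one whose norm is the larger of the two norms; this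
  yields intersections of basic free sets.\<close>

lemma blockm_diag:
  assumes "n \<ge> 1"
  shows "blockm (k + k') (l + l') n (\<lambda>a c. if a < k then if c < l then G a c else 0\<^sub>m n n
      else if c < l then 0\<^sub>m n n else H (a - k) (c - l)) = mat_dsum (blockm k l n G) (blockm k' l' n H)"
proof (rule eq_matI)
  fix i j assume "i < dim_row (mat_dsum (blockm k l n G) (blockm k' l' n H))" "j < dim_col (mat_dsum (blockm k l n G) (blockm k' l' n H))"
  then have ij: "i < k * n + k' * n" "j < l * n + l' * n" by auto
  have d: "(x div n < y) = (x < y * n)" for x y using assms by (simp add: div_less_iff_less_mult)
  have s: "(x - y * n) div n = x div n - y" "(x - y * n) mod n = x mod n" if "\<not> x < y * n" for x y
  proof -
    from that obtain z where z: "x = y * n + z" by (metis le_add_diff_inverse not_less)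
    show "(x - y * n) div n = x div n - y" "(x - y * n) mod n = x mod n"
      using assms by (simp_all add: z)
  qed
  show "blockm (k + k') (l + l') n (\<lambda>a c. if a < k then if c < l then G a c else 0\<^sub>m n n
      else if c < l then 0\<^sub>m n n else H (a - k) (c - l)) $$ (i, j) = mat_dsum (blockm k l n G) (blockm k' l' n H) $$ (i, j)"
    using ij assms by (auto simp: blockm_def mat_dsum_def d s distrib_right)
qed (simp_all add: distrib_right)

section \<open>Entrywise limits and square roots\<close>

definition mlim :: "nat \<Rightarrow> (nat \<Rightarrow> complex mat) \<Rightarrow> complex mat \<Rightarrow> bool" where
  "mlim n X L \<longleftrightarrow> L \<in> carrier_mat n n \<and> (\<forall>k. X k \<in> carrier_mat n n) \<and>
     (\<forall>i<n. \<forall>j<n. (\<lambda>k. X k $$ (i, j)) \<longlonglongrightarrow> L $$ (i, j))"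

lemma mlimD:
  assumes "mlim n X L"
  shows "L \<in> carrier_mat n n" "X k \<in> carrier_mat n n"
    "i < n \<Longrightarrow> j < n \<Longrightarrow> (\<lambda>k. X k $$ (i, j)) \<longlonglongrightarrow> L $$ (i, j)"
  using assms by (auto simp: mlim_def)

lemma mlimI:
  assumes "L \<in> carrier_mat n n" "\<And>k. X k \<in> carrier_mat n n"
    "\<And>i j. i < n \<Longrightarrow> j < n \<Longrightarrow> (\<lambda>k. X k $$ (i, j)) \<longlonglongrightarrow> L $$ (i, j)"
  shows "mlim n X L"
  using assms by (auto simp: mlim_def)

lemma mlim_const: "A \<in> carrier_mat n n \<Longrightarrow> mlim n (\<lambda>_. A) A"
  by (simp add: mlim_def)

lemma mlim_diff:
  assumes "mlim n X L" "mlim n Y M"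
  shows "mlim n (\<lambda>k. X k - Y k) (L - M)"
proof (rule mlimI)
  fix i j assume ij: "i < n" "j < n"
  have "(A - B) $$ (i, j) = A $$ (i, j) - B $$ (i, j)" if "B \<in> carrier_mat n n" for A B :: "complex mat"
    using that ij by simp
  from this[OF mlimD(2)[OF assms(2)]] this[OF mlimD(1)[OF assms(2)]]
  show "(\<lambda>k. (X k - Y k) $$ (i, j)) \<longlonglongrightarrow> (L - M) $$ (i, j)"
    using mlimD(3)[OF assms(1) ij] mlimD(3)[OF assms(2) ij] by (simp add: tendsto_diff)
qed (use mlimD[OF assms(2)] in auto)

lemma mlim_smult:
  assumes "mlim n X L" shows "mlim n (\<lambda>k. c \<cdot>\<^sub>m X k) (c \<cdot>\<^sub>m L)"
proof (rule mlimI)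
  fix i j assume ij: "i < n" "j < n"
  have "(c \<cdot>\<^sub>m A) $$ (i, j) = c * A $$ (i, j)" if "A \<in> carrier_mat n n" for A :: "complex mat"
    using that ij by simp
  from this[OF mlimD(2)[OF assms]] this[OF mlimD(1)[OF assms]]
  show "(\<lambda>k. (c \<cdot>\<^sub>m X k) $$ (i, j)) \<longlonglongrightarrow> (c \<cdot>\<^sub>m L) $$ (i, j)"
    using mlimD(3)[OF assms ij] by (simp add: tendsto_mult_left)
qed (use mlimD[OF assms] in auto)

lemma mlim_mult: 
  assumes "mlim n X L" "mlim n Y M"
  shows "mlim n (\<lambda>k. X k * Y k) (L * M)"
proof -
  have c: "L \<in> carrier_mat n n" "M \<in> carrier_mat n n" "\<And>k. X k \<in> carrier_mat n n" "\<And>k. Y k \<in> carrier_mat n n"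
    using assms by (auto simp: mlim_def)
  have idx: "(A * B) $$ (i, j) = (\<Sum>l<n. A $$ (i, l) * B $$ (l, j))"
    if "A \<in> carrier_mat n n" "B \<in> carrier_mat n n" "i < n" "j < n" for A B :: "complex mat" and i j
    using that by (simp add: scalar_prod_def atLeast0LessThan)
  have "(\<lambda>k. (X k * Y k) $$ (i, j)) \<longlonglongrightarrow> (L * M) $$ (i, j)" if "i < n" "j < n" for i j
    unfolding idx[OF c(1,2) that] idx[OF c(3,4) that]
    by (intro tendsto_sum tendsto_mult) (use assms that in \<open>auto simp: mlim_def\<close>)
  then show ?thesis using mult_carrier_mat[OF c(1,2)] mult_carrier_mat[OF c(3,4)] by (intro mlimI)
qed

lemma mlim_unique: assumes "mlim n X L" "mlim n X M" shows "L = M"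
proof (rule eq_matI)
  fix i j assume "i < dim_row M" "j < dim_col M"
  then have "i < n" "j < n" using mlimD(1)[OF assms(2)] by auto
  then show "L $$ (i, j) = M $$ (i, j)"
    using mlimD(3)[OF assms(1)] mlimD(3)[OF assms(2)] LIMSEQ_unique by blast
qed (use mlimD(1)[OF assms(1)] mlimD(1)[OF assms(2)] in auto)

lemma mlim_Suc: "mlim n X L \<Longrightarrow> mlim n (\<lambda>k. X (Suc k)) L"
  unfolding mlim_def by (auto intro: LIMSEQ_Suc)

lemma mlim_opnorm_le:
  assumes "mlim n X L" "\<And>k. opnorm (X k) \<le> C"
  shows "opnorm L \<le> C"
proof (rule opnorm_leI)
  show "0 \<le> C" using opnorm_nonneg assms(2) by (rule order_trans)
  have c: "L \<in> carrier_mat n n" "\<And>k. X k \<in> carrier_mat n n" using assms by (auto simp: mlim_def)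
  fix v :: "complex vec" assume "v \<in> carrier_vec (dim_col L)"
  then have v: "v \<in> carrier_vec n" using c by simp
  have nv: "vnorm (A *\<^sub>v v) = sqrt (\<Sum>i<n. (cmod (\<Sum>j<n. A $$ (i, j) * vec_index v j))\<^sup>2)"
    if "A \<in> carrier_mat n n" for A
    using that v by (simp add: vnorm_def L2_set_def scalar_prod_def atLeast0LessThan)
  have "(\<lambda>k. vnorm (X k *\<^sub>v v)) \<longlonglongrightarrow> vnorm (L *\<^sub>v v)"
    unfolding nv[OF c(1)] nv[OF c(2)]
    by (intro tendsto_intros) (use assms in \<open>auto simp: mlim_def\<close>)
  moreover have "vnorm (X k *\<^sub>v v) \<le> C * vnorm v" for k
  proof -
    have "vnorm (X k *\<^sub>v v) \<le> opnorm (X k) * vnorm v" by (rule opnorm_bound) (use v carrier_matD(2)[OF c(2)] in simp)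
    also have "\<dots> \<le> C * vnorm v" by (intro mult_right_mono assms) simp
    finally show ?thesis .
  qed
  ultimately show "vnorm (L *\<^sub>v v) \<le> C * vnorm v"
    by (intro LIMSEQ_le_const2[of "\<lambda>k. vnorm (X k *\<^sub>v v)"]) auto
qed

lemma geometric_increments_convergent:
  fixes a :: "nat \<Rightarrow> complex"
  assumes "\<And>k. cmod (a (Suc k) - a k) \<le> (1/2) ^ k"
  shows "convergent a"
proof -
  have "summable (\<lambda>k. a (Suc k) - a k)"
    by (rule summable_comparison_test[of _ "\<lambda>k. (1/2) ^ k"]) (use assms in \<open>auto intro: summable_geometric\<close>)
  then have "(\<lambda>n. \<Sum>k<n. (a (Suc k) - a k)) \<longlonglongrightarrow> suminf (\<lambda>k. a (Suc k) - a k)" by (rule summable_LIMSEQ)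
  then have "(\<lambda>n. (a n - a 0) + a 0) \<longlonglongrightarrow> suminf (\<lambda>k. a (Suc k) - a k) + a 0"
    unfolding sum_lessThan_telescope by (intro tendsto_add tendsto_const)
  then show ?thesis by (auto simp: convergent_def)
qed

text \<open>The binomial series is replaced by the contraction \<open>Y \<mapsto> (E - Y\<^sup>2) / 2\<close>.\<close>

lemma matrix_sqrt_near_one:
  assumes E: "E \<in> carrier_mat n n" and e: "opnorm E \<le> 1/2"
  obtains Y where "Y \<in> carrier_mat n n" "opnorm Y \<le> opnorm E" "Y * Y + 2 \<cdot>\<^sub>m Y = E"
    "\<And>A. A \<in> carrier_mat n n \<Longrightarrow> A * E = E * A \<Longrightarrow> A * Y = Y * A"
proof -
  define Y where "Y = rec_nat (0\<^sub>m n n) (\<lambda>_ y. (1/2) \<cdot>\<^sub>m (E - y * y))"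
  have Y: "Y 0 = 0\<^sub>m n n" "\<And>k. Y (Suc k) = (1/2) \<cdot>\<^sub>m (E - Y k * Y k)" by (simp_all add: Y_def)
  have c: "Y k \<in> carrier_mat n n" for k by (induction k) (use E in \<open>auto simp: Y\<close>)
  have Yle: "opnorm (Y k) \<le> opnorm E" for k
  proof (induction k)
    case (Suc k)
    have "opnorm (Y (Suc k)) = opnorm (E - Y k * Y k) / 2" by (simp add: Y opnorm_smult)
    also have "\<dots> \<le> (opnorm E + opnorm (Y k * Y k)) / 2"
      using opnorm_diff[OF E mult_carrier_mat[OF c c], of k k] by simp
    also have "\<dots> \<le> (opnorm E + opnorm (Y k) * opnorm (Y k)) / 2"
      using opnorm_mult[OF c c, of k k] by simp
    also have "\<dots> \<le> (opnorm E + opnorm E * 1) / 2"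
      using Suc e by (intro divide_right_mono add_left_mono mult_mono) auto
    finally show ?case by simp
  qed (simp add: Y)
  have inc: "opnorm (Y (Suc k) - Y k) \<le> (1/2) ^ k" for k
  proof (induction k)
    case 0
    have "Y (Suc 0) - Y 0 = Y (Suc 0)" using c[of "Suc 0"] by (intro eq_matI) (auto simp: Y(1))
    then show ?case using Yle[of "Suc 0"] e by simp
  next
    case (Suc k)
    define D where "D = Y (Suc k) - Y k"
    have D: "D \<in> carrier_mat n n" using c[of k] by (simp add: D_def)
    \<comment> \<open>The difference of squares is split as
      \<open>A * (A - B) + (A - B) * B\<close>, valid without commutativity; with both norms at most
      1/2, the increments shrink by the factor 1/2.\<close>
    have "Y (Suc (Suc k)) - Y (Suc k) = (-1/2) \<cdot>\<^sub>m (Y (Suc k) * D + D * Y k)"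
    proof -
      have "Y (Suc k) * D = Y (Suc k) * Y (Suc k) - Y (Suc k) * Y k" "D * Y k = Y (Suc k) * Y k - Y k * Y k"
        unfolding D_def by (rule mult_minus_distrib_mat[OF c c c], rule minus_mult_distrib_mat[OF c c c])
      then show ?thesis unfolding Y(2)[of "Suc k"] Y(2)[of k, symmetric]
        using E c[of k] c[of "Suc k"] mult_carrier_mat[OF c c, of k k] mult_carrier_mat[OF c c, of "Suc k" "Suc k"] mult_carrier_mat[OF c c, of "Suc k" k]
        by (subst (3) Y(2)) (intro eq_matI, auto simp del: index_mult_mat(1) simp: field_simps)
    qed
    then have "opnorm (Y (Suc (Suc k)) - Y (Suc k)) = opnorm (Y (Suc k) * D + D * Y k) / 2"
      by (simp add: opnorm_smult)
    also have "\<dots> \<le> (opnorm (Y (Suc k) * D) + opnorm (D * Y k)) / 2"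
      using opnorm_add[OF mult_carrier_mat[OF c D] mult_carrier_mat[OF D c], of "Suc k" k] by simp
    also have "\<dots> \<le> (opnorm (Y (Suc k)) * opnorm D + opnorm D * opnorm (Y k)) / 2"
      using opnorm_mult[OF c D, of "Suc k"] opnorm_mult[OF D c, of k] by simp
    also have "\<dots> \<le> ((1/2) * opnorm D + opnorm D * (1/2)) / 2"
      using Yle[of k] Yle[of "Suc k"] e by (intro divide_right_mono add_mono mult_mono) auto
    also have "\<dots> \<le> (1/2) ^ Suc k" using Suc by (simp add: D_def)
    finally show ?case .
  qed
  define L where "L = Matrix.mat n n (\<lambda>(i, j). lim (\<lambda>k. Y k $$ (i, j)))"
  have lim: "mlim n Y L"
    unfolding mlim_def
  proof (intro conjI allI impI)
    fix i j assume ij: "i < n" "j < n"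
    have "convergent (\<lambda>k. Y k $$ (i, j))"
    proof (rule geometric_increments_convergent)
      fix k
      have "cmod (Y (Suc k) $$ (i, j) - Y k $$ (i, j)) = cmod ((Y (Suc k) - Y k) $$ (i, j))"
        using ij c[of k] by simp
      also have "\<dots> \<le> opnorm (Y (Suc k) - Y k)" by (rule opnorm_entry) (use ij c[of k] in auto)
      finally show "cmod (Y (Suc k) $$ (i, j) - Y k $$ (i, j)) \<le> (1/2) ^ k" using inc[of k] by simp
    qed
    then show "(\<lambda>k. Y k $$ (i, j)) \<longlonglongrightarrow> L $$ (i, j)" using ij by (simp add: L_def convergent_LIMSEQ_iff)
  qed (use c in \<open>auto simp: L_def\<close>)
  have Lc: "L \<in> carrier_mat n n" by (simp add: L_def)
  have "mlim n (\<lambda>k. Y (Suc k)) ((1/2) \<cdot>\<^sub>m (E - L * L))"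
    unfolding Y(2) by (intro mlim_smult mlim_diff mlim_mult mlim_const lim E)
  then have fixpoint: "L = (1/2) \<cdot>\<^sub>m (E - L * L)" using mlim_Suc[OF lim] mlim_unique by blast
  show thesis
  proof (rule that[OF Lc])
    show "opnorm L \<le> opnorm E" by (rule mlim_opnorm_le[OF lim Yle])
    have "L $$ (i, j) = (1/2) * (E $$ (i, j) - (L * L) $$ (i, j))" if "i < n" "j < n" for i j
      using that Lc E by (subst fixpoint) simp
    then show "L * L + 2 \<cdot>\<^sub>m L = E" using E Lc by (intro eq_matI) (auto simp: field_simps)
    fix A assume A: "A \<in> carrier_mat n n" "A * E = E * A"
    have AY: "A * Y k = Y k * A" for k
    proof (induction k)
      case (Suc k)
      have 1: "A * (Y k * Y k) = Y k * Y k * A"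
      proof -
        have "A * (Y k * Y k) = A * Y k * Y k" by (rule assoc_mult_mat[symmetric, OF A(1) c c])
        also have "A * Y k = Y k * A" by (rule Suc)
        also have "Y k * A * Y k = Y k * (A * Y k)" by (rule assoc_mult_mat[OF c A(1) c])
        also have "A * Y k = Y k * A" by (rule Suc)
        also have "Y k * (Y k * A) = Y k * Y k * A" by (rule assoc_mult_mat[symmetric, OF c c A(1)])
        finally show ?thesis .
      qed
      have YY: "Y k * Y k \<in> carrier_mat n n" by (rule mult_carrier_mat[OF c c])
      have "A * Y (Suc k) = (1/2) \<cdot>\<^sub>m (A * E - A * (Y k * Y k))"
        unfolding Y(2) mult_smult_distrib[OF A(1) minus_carrier_mat[OF YY]] mult_minus_distrib_mat[OF A(1) E YY] ..
      also have "\<dots> = Y (Suc k) * A"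
        unfolding 1 A(2) Y(2) minus_mult_distrib_mat[OF E YY A(1), symmetric]
        by (rule mult_smult_assoc_mat[symmetric, OF minus_carrier_mat[OF YY] A(1)])
      finally show ?case .
    qed (use A in \<open>simp add: Y\<close>)
    have "mlim n (\<lambda>k. A * Y k) (A * L)" by (intro mlim_mult mlim_const A lim)
    moreover have "mlim n (\<lambda>k. A * Y k) (L * A)" unfolding AY by (intro mlim_mult mlim_const A lim)
    ultimately show "A * L = L * A" by (rule mlim_unique)
  qed
qed

text \<open>Think of \<open>P\<close> as the interpolated square root of \<open>a\<close> at
  \<open>X\<close>, of \<open>q\<close> as a fixed polynomial near it, and of \<open>m\<close> as an
  approximate inverse of both. Then \<open>P * m\<close> squares to nearly 1 and has spectrum near
  1, hence equals the root \<open>1 + Y\<close> of the fixed-point lemma and is near 1 in norm.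
  Closeness of the spectrum alone would not control the norm, and the resulting bound does not
  depend on \<open>n\<close>.\<close>

lemma sqrt_poly_approx:
  assumes X: "X \<in> carrier_mat n n" and sq: "pm (P * P) X = pm a X"
    and spec: "\<And>l. l \<in> spectrum X \<Longrightarrow> cmod (poly P l * poly m l - 1) < 1/2"
    and E1: "opnorm (pm (a * m * m - 1) X) \<le> \<epsilon>" and E3: "opnorm (pm (m * q - 1) X) \<le> \<epsilon>"
    and R: "opnorm (pm q X) \<le> R" and eps: "\<epsilon> \<le> 1/2"
  shows "opnorm (pm P X - pm q X) \<le> 4 * R * \<epsilon>"
proof -
  define E where "E = pm (a * m * m - 1) X"
  define B where "B = pm (P * m) X"
  have Ec: "E \<in> carrier_mat n n" and Bc: "B \<in> carrier_mat n n" using X by (auto simp: E_def B_def)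
  have Ehalf: "opnorm E \<le> 1/2" using E1 eps by (simp add: E_def)
  obtain Y where Y: "Y \<in> carrier_mat n n" "opnorm Y \<le> opnorm E" "Y * Y + 2 \<cdot>\<^sub>m Y = E"
    "\<And>A. A \<in> carrier_mat n n \<Longrightarrow> A * E = E * A \<Longrightarrow> A * Y = Y * A"
    by (rule matrix_sqrt_near_one[OF Ec Ehalf]) (rule that)
  have Ye: "opnorm Y \<le> \<epsilon>" using Y(2) E1 by (simp add: E_def)
  have BY: "B * Y = Y * B" by (rule Y(4)[OF Bc]) (simp add: B_def E_def pm_commute_self(2)[OF X])
  have XY: "X * Y = Y * X" by (rule Y(4)[OF X]) (simp add: E_def pm_commute_self(1)[OF X])
  define Y1 where "Y1 = 1\<^sub>m n + Y"
  have Y1c: "Y1 \<in> carrier_mat n n" using Y by (simp add: Y1_def)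
  have BB: "B * B = 1\<^sub>m n + E"
  proof -
    have "B * B = pm (P * P * (m * m)) X" by (simp add: B_def pm_mult[OF X, symmetric] mult_ac)
    also have "\<dots> = pm (P * P) X * pm (m * m) X" by (rule pm_mult[OF X])
    also have "\<dots> = pm (a * (m * m)) X" unfolding sq by (rule pm_mult[OF X, symmetric])
    also have "a * (m * m) = 1 + (a * m * m - 1)" by (simp add: mult_ac)
    also have "pm (1 + (a * m * m - 1)) X = 1\<^sub>m n + E" unfolding E_def pm_add[OF X] pm_1[OF X] ..
    finally show ?thesis .
  qed
  have YY: "Y1 * Y1 = 1\<^sub>m n + E"
  proof -
    have "Y1 * Y1 = (1\<^sub>m n + Y) + (Y + Y * Y)" unfolding Y1_def
      using Y(1) by (simp add: add_mult_distrib_mat[of _ n n _ _ n] mult_add_distrib_mat[of _ n n _ n])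
    also have "\<dots> = 1\<^sub>m n + (Y * Y + 2 \<cdot>\<^sub>m Y)" using Y(1) mult_carrier_mat[OF Y(1) Y(1)]
      by (intro eq_matI) (auto simp del: index_mult_mat(1))
    finally show ?thesis unfolding Y(3) .
  qed
  have BY1: "B * Y1 = Y1 * B" unfolding Y1_def
    using Bc Y(1) BY by (simp add: add_mult_distrib_mat[of _ n n _ _ n] mult_add_distrib_mat[of _ n n _ n])
  have XB: "B * X = X * B" unfolding B_def by (rule pm_commute_self[OF X])
  \<comment> \<open>\<open>B\<close> and \<open>1 + Y\<close> are commuting roots of
    \<open>1 + E\<close>; they agree once their sum is injective. On an eigenvector of
    \<open>X\<close> in the kernel of the sum, \<open>B\<close> acts by a number near 1, while
    \<open>B + 1\<close> acts as \<open>- Y\<close>, of norm at most 1/2.\<close>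
  define M where "M = B + Y1"
  have Mc: "M \<in> carrier_mat n n" using Bc Y1c by (simp add: M_def)
  have MX: "M * X = X * M"
    unfolding M_def Y1_def using Bc Y(1) XY XB X
    by (simp add: add_mult_distrib_mat[of _ n n _ _ n] mult_add_distrib_mat[of _ n n _ n])
  have prod0: "M * (B - Y1) = 0\<^sub>m n n"
  proof -
    have "M * (B - Y1) = (B * B + Y1 * B) - (B * Y1 + Y1 * Y1)"
      unfolding M_def using Bc Y1c
      by (simp add: add_mult_distrib_mat[of _ n n _ _ n] mult_minus_distrib_mat[of _ n n _ n])
    also have "\<dots> = 0\<^sub>m n n" unfolding BY1 BB YY using Ec Y1c Bc
      by (intro eq_matI) (auto simp del: index_mult_mat(1))
    finally show ?thesis .
  qed
  have "M *\<^sub>v v \<noteq> 0\<^sub>v n" if v: "v \<in> carrier_vec n" "v \<noteq> 0\<^sub>v n" for v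
  proof
    assume Mv: "M *\<^sub>v v = 0\<^sub>v n"
    obtain w l where w: "w \<in> carrier_vec n" "w \<noteq> 0\<^sub>v n" "X *\<^sub>v w = l \<cdot>\<^sub>v w" "M *\<^sub>v w = 0\<^sub>v n" "l \<in> spectrum X"
      by (rule common_eigenvector[OF X Mc MX v Mv])
    define b where "b = poly (P * m) l"
    have Bw: "B *\<^sub>v w = b \<cdot>\<^sub>v w" unfolding B_def b_def by (rule pm_eigen[OF X w(1,3)])
    have "M *\<^sub>v w = B *\<^sub>v w + Y1 *\<^sub>v w" unfolding M_def by (rule add_mult_distrib_mat_vec[OF Bc Y1c w(1)])
    also have "Y1 *\<^sub>v w = 1\<^sub>m n *\<^sub>v w + Y *\<^sub>v w" unfolding Y1_def by (rule add_mult_distrib_mat_vec[OF one_carrier_mat Y(1) w(1)])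
    finally have 0: "b \<cdot>\<^sub>v w + (w + Y *\<^sub>v w) = 0\<^sub>v n" unfolding Bw w(4) using w(1) by simp
    have Yw: "Y *\<^sub>v w = (- (b + 1)) \<cdot>\<^sub>v w"
    proof (rule eq_vecI)
      fix i assume "i < dim_vec ((- (b + 1)) \<cdot>\<^sub>v w)"
      then have i: "i < n" using w(1) by simp
      have "vec_index (b \<cdot>\<^sub>v w + (w + Y *\<^sub>v w)) i = 0" unfolding 0 using i by simp
      then have "b * vec_index w i + (vec_index w i + vec_index (Y *\<^sub>v w) i) = 0"
        using i w(1) Y(1) by (simp del: index_mult_mat_vec)
      then have "vec_index (Y *\<^sub>v w) i = - (b + 1) * vec_index w i" by (simp add: algebra_simps eq_neg_iff_add_eq_0)
      then show "vec_index (Y *\<^sub>v w) i = vec_index ((- (b + 1)) \<cdot>\<^sub>v w) i" using i w(1) by simp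
    qed (use w(1) Y(1) in auto)
    have "cmod (b + 1) * vnorm w = vnorm (Y *\<^sub>v w)" unfolding Yw vnorm_smult by (simp only: norm_minus_cancel)
    also have "\<dots> \<le> opnorm Y * vnorm w" by (rule opnorm_bound) (use w(1) Y(1) in simp)
    finally have "cmod (b + 1) \<le> opnorm Y" using vnorm_pos[OF w(1,2)] by simp
    then have "cmod (b + 1) \<le> 1/2" using Ye eps by simp
    moreover have "cmod (b - 1) < 1/2" using spec[OF w(5)] by (simp add: b_def)
    moreover have "cmod 2 \<le> cmod (b + 1) + cmod (b - 1)"
      using norm_triangle_ineq4[of "b + 1" "b - 1"] by simp
    ultimately show False by simp
  qed
  then have "B - Y1 = 0\<^sub>m n n" by (intro inj_cancel[OF Mc _ prod0]) (use Y1c in auto)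
  then have BeqY1: "B = Y1"
  proof -
    assume 0: "B - Y1 = 0\<^sub>m n n"
    have "(B - Y1) $$ (i, j) = 0" if "i < n" "j < n" for i j unfolding 0 using that by simp
    then show ?thesis using Bc Y1c by (intro eq_matI) auto
  qed
  define S where "S = pm P X"
  define Q where "Q = pm q X"
  define E' where "E' = pm (m * q - 1) X"
  have c: "S \<in> carrier_mat n n" "Q \<in> carrier_mat n n" "E' \<in> carrier_mat n n" using X by (auto simp: S_def Q_def E'_def)
  \<comment> \<open>Evaluates \<open>P * m * q\<close> in two ways: as \<open>P\<close> times
    \<open>m * q\<close>, and as \<open>P * m\<close> times \<open>q\<close>.\<close>
  have diff: "S - Q = Y * Q - S * E'"
  proof -
    have "S + S * E' = pm (P + P * (m * q - 1)) X" unfolding S_def E'_def pm_add[OF X] pm_mult[OF X] ..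
    also have "P + P * (m * q - 1) = P * m * q" by (simp add: algebra_simps)
    also have "pm (P * m * q) X = B * Q" unfolding B_def Q_def by (rule pm_mult[OF X])
    also have "\<dots> = Q + Y * Q" unfolding BeqY1 Y1_def
      using Y(1) c by (simp add: add_mult_distrib_mat[of _ n n _ _ n])
    finally have eq: "S + S * E' = Q + Y * Q" .
    have "(S - Q) $$ (i, j) = (Y * Q - S * E') $$ (i, j)" if ij: "i < n" "j < n" for i j
    proof -
      have "(S + S * E') $$ (i, j) = (Q + Y * Q) $$ (i, j)" unfolding eq ..
      then have "S $$ (i, j) + (S * E') $$ (i, j) = Q $$ (i, j) + (Y * Q) $$ (i, j)"
        using ij Y(1) c by (simp del: index_mult_mat(1))
      then show ?thesis using ij Y(1) c
        by (simp del: index_mult_mat(1) add: algebra_simps)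
    qed
    then show ?thesis using c Y(1) by (intro eq_matI) (auto simp del: index_mult_mat(1))
  qed
  have eps0: "0 \<le> \<epsilon>" using E3 opnorm_nonneg by (rule order_trans[rotated])
  have R0: "0 \<le> R" using R opnorm_nonneg by (rule order_trans[rotated])
  have YQ: "opnorm (Y * Q) \<le> \<epsilon> * R"
    using opnorm_mult[OF Y(1) c(2)] mult_mono[OF Ye R eps0 opnorm_nonneg] by (simp add: Q_def)
  have SE: "opnorm (S * E') \<le> opnorm S * \<epsilon>"
    using opnorm_mult[OF c(1,3)] mult_left_mono[OF E3 opnorm_nonneg, of S] by (simp add: E'_def)
  have le1: "opnorm (S - Q) \<le> \<epsilon> * R + opnorm S * \<epsilon>"
    unfolding diff using opnorm_diff[OF mult_carrier_mat[OF Y(1) c(2)] mult_carrier_mat[OF c(1,3)]] YQ SE by linarith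
  have "S = (S - Q) + Q" using c by (intro eq_matI) auto
  then have "opnorm S \<le> opnorm (S - Q) + opnorm Q"
    using opnorm_add[OF minus_carrier_mat[OF c(2)] c(2), of S] by simp
  \<comment> \<open>The unknown norm of \<open>S\<close> occurs on both sides;
    \<open>\<epsilon> \<le> 1/2\<close> allows it to be absorbed on the left.\<close>
  then have "opnorm S \<le> \<epsilon> * R + opnorm S * \<epsilon> + R" using le1 R by (simp add: Q_def)
  moreover have "\<epsilon> * R \<le> (1/2) * R" "opnorm S * \<epsilon> \<le> opnorm S * (1/2)"
    by (rule mult_right_mono[OF eps R0], rule mult_left_mono[OF eps opnorm_nonneg])
  ultimately have "opnorm S \<le> 3 * R" by simp
  then have "opnorm S * \<epsilon> \<le> 3 * R * \<epsilon>" using eps0 by (rule mult_right_mono)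
  then show ?thesis using le1 by (simp add: S_def Q_def algebra_simps)
qed

section \<open>Free polynomials\<close>

lemma levelD: "x \<in> level d n \<Longrightarrow> length x = d" "x \<in> level d n \<Longrightarrow> i < d \<Longrightarrow> x ! i \<in> carrier_mat n n"
  by (auto simp: level_def)

lemma levelI: "length x = d \<Longrightarrow> (\<And>i. i < d \<Longrightarrow> x ! i \<in> carrier_mat n n) \<Longrightarrow> x \<in> level d n"
  by (auto simp: level_def in_set_conv_nth)

lemma lvl_level: "x \<in> level d n \<Longrightarrow> 0 < d \<Longrightarrow> lvl x = n"
  by (cases x) (auto simp: level_def lvl_def)

lemma nc_spaceE:
  assumes "x \<in> nc_space d" obtains n where "n \<ge> 1" "x \<in> level d n"
  using assms by (auto simp: nc_space_def)

lemma nc_spaceI: "n \<ge> 1 \<Longrightarrow> x \<in> level d n \<Longrightarrow> x \<in> nc_space d"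
  by (auto simp: nc_space_def)

lemma nc_space_lvl: "x \<in> nc_space d \<Longrightarrow> 0 < d \<Longrightarrow> x \<in> level d (lvl x) \<and> lvl x \<ge> 1"
  by (auto simp: nc_space_def lvl_level)

lemma pt_dsum_level: "x \<in> level d n \<Longrightarrow> y \<in> level d m \<Longrightarrow> pt_dsum x y \<in> level d (n + m)"
  by (rule levelI) (auto simp: pt_dsum_def levelD)

lemma pt_dsum_nth: "x \<in> level d n \<Longrightarrow> y \<in> level d m \<Longrightarrow> i < d \<Longrightarrow> pt_dsum x y ! i = mat_dsum (x ! i) (y ! i)"
  by (auto simp: pt_dsum_def levelD)

lemma pt_dsum_nc_space: "x \<in> nc_space d \<Longrightarrow> y \<in> nc_space d \<Longrightarrow> pt_dsum x y \<in> nc_space d"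
  by (elim nc_spaceE) (rule nc_spaceI[OF _ pt_dsum_level], auto)

lemma mat_conj_carrier [simp, intro]: "s \<in> GLn n \<Longrightarrow> A \<in> carrier_mat n n \<Longrightarrow> mat_conj s A \<in> carrier_mat n n"
  unfolding mat_conj_def using GLnD[of s n] by (intro mult_carrier_mat[of _ n n]) auto

lemma pt_conj_level: "s \<in> GLn n \<Longrightarrow> x \<in> level d n \<Longrightarrow> pt_conj s x \<in> level d n"
  by (rule levelI) (auto simp: pt_conj_def levelD)

lemma pt_conj_nth: "x \<in> level d n \<Longrightarrow> i < d \<Longrightarrow> pt_conj s x ! i = mat_conj s (x ! i)"
  by (auto simp: pt_conj_def levelD)

lemma mat_conj_mult:
  assumes "s \<in> GLn n" "A \<in> carrier_mat n n" "B \<in> carrier_mat n n"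
  shows "mat_conj s A * mat_conj s B = mat_conj s (A * B)"
proof -
  note s = GLnD[OF assms(1)] and c = assms(2,3)
  have "mat_conj s A * mat_conj s B = minv s * A * (s * (minv s * B * s))"
    unfolding mat_conj_def by (rule assoc_mult_mat[of _ n n _ n _ n]) (use s c in auto)
  also have "s * (minv s * B * s) = s * (minv s * B) * s"
    by (rule assoc_mult_mat[symmetric, of _ n n _ n _ n]) (use s c in auto)
  also have "s * (minv s * B) = (s * minv s) * B"
    by (rule assoc_mult_mat[symmetric, of _ n n _ n _ n]) (use s c in auto)
  also have "\<dots> = B" using s c by simp
  also have "minv s * A * (B * s) = minv s * A * B * s"
    by (rule assoc_mult_mat[symmetric, of _ n n _ n _ n]) (use s c in auto)
  also have "minv s * A * B = minv s * (A * B)"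
    by (rule assoc_mult_mat[of _ n n _ n _ n]) (use s c in auto)
  finally show ?thesis unfolding mat_conj_def .
qed

lemma mat_conj_add:
  assumes "s \<in> GLn n" "A \<in> carrier_mat n n" "B \<in> carrier_mat n n"
  shows "mat_conj s (A + B) = mat_conj s A + mat_conj s B" "mat_conj s (A - B) = mat_conj s A - mat_conj s B"
proof -
  note s = GLnD[OF assms(1)] and c = assms(2,3)
  have p: "minv s * A \<in> carrier_mat n n" "minv s * B \<in> carrier_mat n n" using s c by auto
  show "mat_conj s (A + B) = mat_conj s A + mat_conj s B"
    unfolding mat_conj_def mult_add_distrib_mat[OF s(2) c] by (rule add_mult_distrib_mat[OF p s(1)])
  show "mat_conj s (A - B) = mat_conj s A - mat_conj s B"
    unfolding mat_conj_def mult_minus_distrib_mat[OF s(2) c] by (rule minus_mult_distrib_mat[OF p s(1)])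
qed

lemma mat_conj_smult:
  assumes "s \<in> GLn n" "A \<in> carrier_mat n n"
  shows "mat_conj s (c \<cdot>\<^sub>m A) = c \<cdot>\<^sub>m mat_conj s A"
proof -
  note s = GLnD[OF assms(1)]
  have p: "minv s * A \<in> carrier_mat n n" using s assms by auto
  show ?thesis unfolding mat_conj_def mult_smult_distrib[OF s(2) assms(2)] by (rule mult_smult_assoc_mat[OF p s(1)])
qed

lemma mat_conj_one: "s \<in> GLn n \<Longrightarrow> mat_conj s (1\<^sub>m n) = 1\<^sub>m n"
  using GLnD[of s n] by (simp add: mat_conj_def)

lemma mat_conj_zero: "s \<in> GLn n \<Longrightarrow> mat_conj s (0\<^sub>m n n) = 0\<^sub>m n n"
  using GLnD[of s n] by (simp add: mat_conj_def)

lemma word_eval_Nil: "word_eval x [] = 1\<^sub>m (lvl x)"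
  and word_eval_Cons: "word_eval x (i # w) = x ! i * word_eval x w"
  by (simp_all add: word_eval_def)

lemma word_eval_carrier:
  "x \<in> level d n \<Longrightarrow> 0 < d \<Longrightarrow> w \<in> lists {..<d} \<Longrightarrow> word_eval x w \<in> carrier_mat n n"
proof (induction w)
  case (Cons i w)
  then show ?case unfolding word_eval_Cons by (intro mult_carrier_mat[of _ n n]) (auto simp: levelD)
qed (simp add: word_eval_Nil lvl_level)

lemma word_eval_append:
  assumes x: "x \<in> level d n" "0 < d" and v: "v \<in> lists {..<d}" and w: "w \<in> lists {..<d}"
  shows "word_eval x (w @ v) = word_eval x w * word_eval x v"
  using w
proof (induction w)
  case Nil
  then show ?case using word_eval_carrier[OF x v] x by (simp add: word_eval_Nil lvl_level)
next
  case (Cons i w)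
  have "x ! i * (word_eval x w * word_eval x v) = x ! i * word_eval x w * word_eval x v"
    by (rule assoc_mult_mat[symmetric, of _ n n _ n _ n]) (use Cons x v word_eval_carrier in \<open>auto simp: levelD\<close>)
  then show ?case using Cons by (simp add: word_eval_Cons)
qed

text \<open>Polynomial functions are handled as lists of terms: coefficient and word.\<close>

fun tev :: "(complex \<times> nat list) list \<Rightarrow> point \<Rightarrow> complex mat" where
  "tev [] x = 0\<^sub>m (lvl x) (lvl x)"
| "tev ((c, w) # ts) x = c \<cdot>\<^sub>m word_eval x w + tev ts x"

definition terms :: "nat \<Rightarrow> (complex \<times> nat list) list set" where
  "terms d = {ts. snd ` set ts \<subseteq> lists {..<d}}"

text \<open>Semantic on purpose: agreement is required only on \<open>nc_space d\<close>, so closure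
  under products and substitution needs no multiplication on \<open>free_poly\<close>.\<close>

definition polyfun :: "nat \<Rightarrow> ncfun \<Rightarrow> bool" where
  "polyfun d G \<longleftrightarrow> (\<exists>ts\<in>terms d. \<forall>x\<in>nc_space d. G x = tev ts x)"

lemma terms_Cons: "(c, w) # ts \<in> terms d \<longleftrightarrow> w \<in> lists {..<d} \<and> ts \<in> terms d"
  by (auto simp: terms_def)

lemma tev_carrier: "x \<in> level d n \<Longrightarrow> 0 < d \<Longrightarrow> ts \<in> terms d \<Longrightarrow> tev ts x \<in> carrier_mat n n"
  by (induction ts x rule: tev.induct) (auto simp: terms_Cons lvl_level)

lemma polyfun_carrier:
  assumes "polyfun d G" "x \<in> level d n" "0 < d" "n \<ge> 1" shows "G x \<in> carrier_mat n n"
  using assms tev_carrier nc_spaceI unfolding polyfun_def by metis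

lemma tev_append: "x \<in> level d n \<Longrightarrow> 0 < d \<Longrightarrow> ts \<in> terms d \<Longrightarrow> us \<in> terms d \<Longrightarrow> tev (ts @ us) x = tev ts x + tev us x"
proof (induction ts x rule: tev.induct)
  case (1 x)
  then show ?case using tev_carrier[of x d n us] by (simp add: lvl_level)
next
  case (2 c w ts x)
  have "c \<cdot>\<^sub>m word_eval x w + (tev ts x + tev us x) = (c \<cdot>\<^sub>m word_eval x w + tev ts x) + tev us x"
    using 2 word_eval_carrier[of x d n w] tev_carrier[of x d n ts] tev_carrier[of x d n us]
    by (intro assoc_add_mat[symmetric, of _ n n]) (auto simp: terms_Cons)
  then show ?case using 2 by (simp add: terms_Cons)
qed

lemma tev_smult: "x \<in> level d n \<Longrightarrow> 0 < d \<Longrightarrow> ts \<in> terms d \<Longrightarrow> tev (map (\<lambda>(b, v). (a * b, v)) ts) x = a \<cdot>\<^sub>m tev ts x"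
proof (induction ts x rule: tev.induct)
  case (2 c w ts x)
  have c: "word_eval x w \<in> carrier_mat n n" "tev ts x \<in> carrier_mat n n"
    using 2 word_eval_carrier[of x d n w] tev_carrier[of x d n ts] by (auto simp: terms_Cons)
  show ?case using 2 c by (auto simp: terms_Cons algebra_simps intro!: eq_matI)
qed simp

lemma tev_word_mult: "x \<in> level d n \<Longrightarrow> 0 < d \<Longrightarrow> w \<in> lists {..<d} \<Longrightarrow> ts \<in> terms d \<Longrightarrow>
  tev (map (\<lambda>(b, v). (b, w @ v)) ts) x = word_eval x w * tev ts x"
proof (induction ts x rule: tev.induct)
  case (1 x)
  then show ?case using word_eval_carrier[of x d n w] by (simp add: lvl_level)
next
  case (2 c v ts x)
  have c: "word_eval x w \<in> carrier_mat n n" "word_eval x v \<in> carrier_mat n n" "tev ts x \<in> carrier_mat n n"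
    using 2 word_eval_carrier[of x d n] tev_carrier[of x d n ts] by (auto simp: terms_Cons)
  have "word_eval x w * (c \<cdot>\<^sub>m word_eval x v + tev ts x) = c \<cdot>\<^sub>m (word_eval x w * word_eval x v) + word_eval x w * tev ts x"
    using c by (simp add: mult_add_distrib_mat[of _ n n _ n] mult_smult_distrib[of _ n n _ n])
  then show ?case using 2 word_eval_append[of x d n v w] by (simp add: terms_Cons)
qed

lemma polyfun_add: assumes "polyfun d G" "polyfun d H" "0 < d" shows "polyfun d (\<lambda>x. G x + H x)"
proof -
  obtain ts us where t: "ts \<in> terms d" "\<forall>x\<in>nc_space d. G x = tev ts x" and u: "us \<in> terms d" "\<forall>x\<in>nc_space d. H x = tev us x"
    using assms by (auto simp: polyfun_def)
  have "ts @ us \<in> terms d" using t u by (auto simp: terms_def)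
  moreover have "G x + H x = tev (ts @ us) x" if "x \<in> nc_space d" for x
    using that t u tev_append[of x d _ ts us] nc_space_lvl[OF that assms(3)] assms(3) by metis
  ultimately show ?thesis unfolding polyfun_def by blast
qed

lemma polyfun_smult: assumes "polyfun d G" "0 < d" shows "polyfun d (\<lambda>x. c \<cdot>\<^sub>m G x)"
proof -
  obtain ts where t: "ts \<in> terms d" "\<forall>x\<in>nc_space d. G x = tev ts x" using assms by (auto simp: polyfun_def)
  have "map (\<lambda>(b, v). (c * b, v)) ts \<in> terms d" using t by (auto simp: terms_def)
  moreover have "c \<cdot>\<^sub>m G x = tev (map (\<lambda>(b, v). (c * b, v)) ts) x" if "x \<in> nc_space d" for x
    using that t tev_smult[of x d _ ts c] nc_space_lvl[OF that assms(2)] assms(2) by metis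
  ultimately show ?thesis unfolding polyfun_def by blast
qed

lemma polyfun_cong: "polyfun d G \<Longrightarrow> (\<And>x. x \<in> nc_space d \<Longrightarrow> H x = G x) \<Longrightarrow> polyfun d H"
  by (auto simp: polyfun_def)

lemma polyfun_zero: "polyfun d (\<lambda>x. 0\<^sub>m (lvl x) (lvl x))"
  unfolding polyfun_def by (rule bexI[of _ "[]"]) (auto simp: terms_def)

lemma polyfun_word: assumes "w \<in> lists {..<d}" "0 < d" shows "polyfun d (\<lambda>x. word_eval x w)"
  unfolding polyfun_def
proof (rule bexI[of _ "[(1, w)]"], rule ballI)
  fix x assume "x \<in> nc_space d"
  then have "x \<in> level d (lvl x)" using nc_space_lvl assms by blast
  then have "word_eval x w \<in> carrier_mat (lvl x) (lvl x)" using word_eval_carrier assms by blast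
  then show "word_eval x w = tev [(1, w)] x" by (auto intro!: eq_matI)
qed (use assms in \<open>auto simp: terms_def\<close>)

lemma polyfun_one: "0 < d \<Longrightarrow> polyfun d (\<lambda>x. 1\<^sub>m (lvl x))"
  using polyfun_word[of "[]" d] by (simp add: word_eval_Nil)

lemma polyfun_coord: assumes "i < d" shows "polyfun d (\<lambda>x. x ! i)"
proof (rule polyfun_cong)
  show "polyfun d (\<lambda>x. word_eval x [i])" using assms by (intro polyfun_word) auto
  fix x assume "x \<in> nc_space d"
  then have "x \<in> level d (lvl x)" using nc_space_lvl assms by auto
  then have "x ! i \<in> carrier_mat (lvl x) (lvl x)" using levelD assms by blast
  then show "x ! i = word_eval x [i]" by (simp add: word_eval_Cons word_eval_Nil)
qed

lemma polyfun_mult: assumes "polyfun d G" "polyfun d H" "0 < d" shows "polyfun d (\<lambda>x. G x * H x)"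
proof -
  obtain ts us where t: "ts \<in> terms d" "\<forall>x\<in>nc_space d. G x = tev ts x" and u: "us \<in> terms d" "\<forall>x\<in>nc_space d. H x = tev us x"
    using assms by (auto simp: polyfun_def)
  have "polyfun d (\<lambda>x. tev ts x * tev us x)" using t(1)
  proof (induction ts)
    case Nil
    show ?case
    proof (rule polyfun_cong[OF polyfun_zero])
      fix x assume "x \<in> nc_space d"
      then have "tev us x \<in> carrier_mat (lvl x) (lvl x)" using tev_carrier u nc_space_lvl assms(3) by blast
      then show "tev [] x * tev us x = 0\<^sub>m (lvl x) (lvl x)" by simp
    qed
  next
    case (Cons cw ts)
    obtain c w where cw: "cw = (c, w)" by (cases cw)
    have w: "w \<in> lists {..<d}" "ts \<in> terms d" using Cons.prems by (auto simp: cw terms_Cons)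
    have m: "map (\<lambda>(b, v). (b, w @ v)) us \<in> terms d" using u w by (force simp: terms_def)
    have 1: "polyfun d (tev (map (\<lambda>(b, v). (b, w @ v)) us))" unfolding polyfun_def using m by blast
    show ?case
    proof (rule polyfun_cong[OF polyfun_add[OF polyfun_smult[OF 1 assms(3)] Cons.IH[OF w(2)] assms(3)]])
      fix x assume x: "x \<in> nc_space d"
      define n where "n = lvl x"
      have xl: "x \<in> level d n" using nc_space_lvl x assms(3) by (auto simp: n_def)
      have cc: "word_eval x w \<in> carrier_mat n n" "tev ts x \<in> carrier_mat n n" "tev us x \<in> carrier_mat n n"
        using xl w u assms(3) by (auto intro: word_eval_carrier tev_carrier)
      show "tev (cw # ts) x * tev us x = c \<cdot>\<^sub>m tev (map (\<lambda>(b, v). (b, w @ v)) us) x + tev ts x * tev us x"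
        unfolding cw tev_word_mult[OF xl assms(3) w(1) u(1)] using cc
        by (simp add: add_mult_distrib_mat[of _ n n _ _ n] mult_smult_assoc_mat[of _ n n _ n])
    qed
  qed
  then show ?thesis by (rule polyfun_cong) (use t u in auto)
qed

lemma polyfun_diff: assumes "polyfun d G" "polyfun d H" "0 < d" shows "polyfun d (\<lambda>x. G x - H x)"
proof (rule polyfun_cong[OF polyfun_add[OF assms(1) polyfun_smult[OF assms(2,3), of "-1"] assms(3)]])
  fix x assume "x \<in> nc_space d"
  then have "x \<in> level d (lvl x)" "lvl x \<ge> 1" using nc_space_lvl assms by auto
  then have "G x \<in> carrier_mat (lvl x) (lvl x)" "H x \<in> carrier_mat (lvl x) (lvl x)"
    using polyfun_carrier assms by blast+
  then show "G x - H x = G x + (-1) \<cdot>\<^sub>m H x" by (intro eq_matI) auto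
qed

lemma polyfun_pm: assumes "polyfun d G" "0 < d" shows "polyfun d (\<lambda>x. pm p (G x))"
proof (induction p)
  case 0
  show ?case
  proof (rule polyfun_cong[OF polyfun_zero])
    fix x assume "x \<in> nc_space d"
    then have "G x \<in> carrier_mat (lvl x) (lvl x)" using polyfun_carrier[OF assms(1)] nc_space_lvl assms(2) by blast
    then show "pm 0 (G x) = 0\<^sub>m (lvl x) (lvl x)" by simp
  qed
next
  case (pCons a p)
  show ?case
  proof (rule polyfun_cong[OF polyfun_add[OF polyfun_smult[OF polyfun_one[OF assms(2)] assms(2), of a] polyfun_mult[OF assms(1) pCons(2) assms(2)] assms(2)]])
    fix x assume "x \<in> nc_space d"
    then have "G x \<in> carrier_mat (lvl x) (lvl x)" using polyfun_carrier[OF assms(1)] nc_space_lvl assms(2) by blast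
    then show "pm (pCons a p) (G x) = a \<cdot>\<^sub>m 1\<^sub>m (lvl x) + G x * pm p (G x)" by (rule pm_pCons)
  qed
qed

text \<open>Used to compose the polynomials of a basic set with a polynomial stand-in for
  \<open>omega\<close>.\<close>

lemma polyfun_subst2:
  assumes F: "polyfun 2 F" and G: "polyfun d G" and H: "polyfun d H" and d: "0 < d"
  shows "polyfun d (\<lambda>x. F [G x, H x])"
proof -
  obtain ts where t: "ts \<in> terms 2" "\<forall>x\<in>nc_space 2. F x = tev ts x" using F by (auto simp: polyfun_def)
  have lv: "[G x, H x] \<in> level 2 (lvl x)" "lvl [G x, H x] = lvl x" "lvl x \<ge> 1" if "x \<in> nc_space d" for x
  proof -
    have "G x \<in> carrier_mat (lvl x) (lvl x)" "H x \<in> carrier_mat (lvl x) (lvl x)"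
      using polyfun_carrier nc_space_lvl that G H d by blast+
    then show "[G x, H x] \<in> level 2 (lvl x)" "lvl [G x, H x] = lvl x" by (auto simp: level_def lvl_def)
    show "lvl x \<ge> 1" using nc_space_lvl that d by blast
  qed
  have w: "polyfun d (\<lambda>x. word_eval [G x, H x] w)" if "w \<in> lists {..<2}" for w
    using that
  proof (induction w)
    case Nil
    show ?case by (rule polyfun_cong[OF polyfun_one[OF d]]) (simp add: word_eval_Nil lv)
  next
    case (Cons i w)
    then have "i = 0 \<or> i = 1" by auto
    then have "polyfun d (\<lambda>x. [G x, H x] ! i)" using G H by auto
    then show ?case unfolding word_eval_Cons using Cons by (intro polyfun_mult d) auto
  qed
  have "polyfun d (\<lambda>x. tev ts [G x, H x])" using t(1)
  proof (induction ts)
    case Nil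
    show ?case by (rule polyfun_cong[OF polyfun_zero]) (simp add: lv)
  next
    case (Cons cw ts)
    obtain c v where cw: "cw = (c, v)" by (cases cw)
    show ?case unfolding cw tev.simps
      by (intro polyfun_add polyfun_smult w Cons d) (use Cons.prems in \<open>auto simp: cw terms_Cons\<close>)
  qed
  then show ?thesis by (rule polyfun_cong) (use t lv nc_spaceI in blast)
qed

section \<open>Polynomials under direct sums, similarities and perturbations\<close>

lemma word_eval_dsum:
  assumes "x \<in> level d n" "y \<in> level d m" "0 < d" "w \<in> lists {..<d}"
  shows "word_eval (pt_dsum x y) w = mat_dsum (word_eval x w) (word_eval y w)"
  using assms(4)
proof (induction w)
  case Nil
  then show ?case using assms by (simp add: word_eval_Nil lvl_level[OF pt_dsum_level] lvl_level mat_dsum_one)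
next
  case (Cons i w)
  then show ?case unfolding word_eval_Cons using assms
    by (subst mat_dsum_mult[of _ n _ m, symmetric]) (auto simp: levelD word_eval_carrier pt_dsum_nth)
qed

lemma polyfun_dsum:
  assumes "polyfun d G" "x \<in> level d n" "y \<in> level d m" "0 < d" "n \<ge> 1" "m \<ge> 1"
  shows "G (pt_dsum x y) = mat_dsum (G x) (G y)"
proof -
  obtain ts where t: "ts \<in> terms d" "\<forall>x\<in>nc_space d. G x = tev ts x" using assms by (auto simp: polyfun_def)
  have "tev ts (pt_dsum x y) = mat_dsum (tev ts x) (tev ts y)" using t(1)
  proof (induction ts)
    case Nil
    then show ?case using assms by (simp add: lvl_level[OF pt_dsum_level] lvl_level mat_dsum_zero)
  next
    case (Cons cw ts)
    obtain c v where cw: "cw = (c, v)" by (cases cw)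
    have v: "v \<in> lists {..<d}" "ts \<in> terms d" using Cons.prems by (auto simp: cw terms_Cons)
    show ?case unfolding cw tev.simps word_eval_dsum[OF assms(2-4) v(1)] Cons.IH[OF v(2)] mat_dsum_smult
      by (rule mat_dsum_add(1)[of _ n _ m]) (use assms v in \<open>auto intro!: smult_carrier_mat word_eval_carrier tev_carrier simp del: smult_carrier_mat\<close>)
  qed
  moreover have "x \<in> nc_space d" "y \<in> nc_space d" using assms nc_spaceI by blast+
  ultimately show ?thesis using t(2) pt_dsum_nc_space by metis
qed

lemma word_eval_conj:
  assumes "x \<in> level d n" "s \<in> GLn n" "0 < d" "w \<in> lists {..<d}"
  shows "word_eval (pt_conj s x) w = mat_conj s (word_eval x w)"
  using assms(4)
proof (induction w)
  case Nil
  then show ?case using assms by (simp add: word_eval_Nil lvl_level[OF pt_conj_level] lvl_level mat_conj_one)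
next
  case (Cons i w)
  then show ?case unfolding word_eval_Cons using assms
    by (subst mat_conj_mult[of _ n, symmetric]) (auto simp: levelD word_eval_carrier pt_conj_nth)
qed

lemma polyfun_conj:
  assumes "polyfun d G" "x \<in> level d n" "s \<in> GLn n" "0 < d" "n \<ge> 1"
  shows "G (pt_conj s x) = mat_conj s (G x)"
proof -
  obtain ts where t: "ts \<in> terms d" "\<forall>x\<in>nc_space d. G x = tev ts x" using assms by (auto simp: polyfun_def)
  have "tev ts (pt_conj s x) = mat_conj s (tev ts x)" using t(1)
  proof (induction ts)
    case Nil
    then show ?case using assms by (simp add: lvl_level[OF pt_conj_level] lvl_level mat_conj_zero)
  next
    case (Cons cw ts)
    obtain c v where cw: "cw = (c, v)" by (cases cw)
    have v: "v \<in> lists {..<d}" "ts \<in> terms d" using Cons.prems by (auto simp: cw terms_Cons)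
    have cc: "word_eval x v \<in> carrier_mat n n" "tev ts x \<in> carrier_mat n n"
      using assms v by (auto intro!: word_eval_carrier tev_carrier)
    show ?case unfolding cw tev.simps word_eval_conj[OF assms(2-4) v(1)] Cons.IH[OF v(2)]
      using cc by (simp add: mat_conj_add[OF assms(3)] mat_conj_smult[OF assms(3)])
  qed
  moreover have "x \<in> nc_space d" "pt_conj s x \<in> nc_space d" using assms nc_spaceI pt_conj_level by blast+
  ultimately show ?thesis using t(2) by metis
qed

definition pclose :: "real \<Rightarrow> point \<Rightarrow> point \<Rightarrow> bool" where
  "pclose e x y \<longleftrightarrow> (\<forall>i<length x. opnorm (x ! i - y ! i) \<le> e)"

definition pbounded :: "real \<Rightarrow> point \<Rightarrow> bool" where
  "pbounded R x \<longleftrightarrow> (\<forall>i<length x. opnorm (x ! i) \<le> R)"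

text \<open>The order of quantifiers matters: both constants are fixed before the level
  \<open>n\<close>, so the estimate is uniform over all matrix sizes.\<close>

lemma word_eval_lipschitz:
  assumes "w \<in> lists {..<d}" "0 < d" "0 \<le> R"
  shows "\<exists>K\<ge>0. \<exists>L\<ge>0. \<forall>n x y e. x \<in> level d n \<longrightarrow> y \<in> level d n \<longrightarrow> pbounded R x \<longrightarrow> pbounded R y \<longrightarrow> 0 \<le> e \<longrightarrow> pclose e x y \<longrightarrow>
    opnorm (word_eval x w) \<le> K \<and> opnorm (word_eval x w - word_eval y w) \<le> L * e"
  using assms(1)
proof (induction w)
  case Nil
  show ?case by (rule exI[of _ 1], simp, rule exI[of _ 0]) (auto simp: word_eval_Nil lvl_level assms opnorm_one minus_r_inv_mat[OF one_carrier_mat])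
next
  case (Cons i w)
  then obtain K L where K: "K \<ge> 0" "L \<ge> 0" and KL: "\<And>n x y e. x \<in> level d n \<Longrightarrow> y \<in> level d n \<Longrightarrow> pbounded R x \<Longrightarrow> pbounded R y \<Longrightarrow> 0 \<le> e \<Longrightarrow> pclose e x y \<Longrightarrow>
    opnorm (word_eval x w) \<le> K \<and> opnorm (word_eval x w - word_eval y w) \<le> L * e" by auto
  have i: "i < d" "w \<in> lists {..<d}" using Cons.hyps by auto
  have "opnorm (word_eval x (i # w)) \<le> R * K \<and> opnorm (word_eval x (i # w) - word_eval y (i # w)) \<le> (K + R * L) * e"
    if A: "x \<in> level d n" "y \<in> level d n" "pbounded R x" "pbounded R y" "0 \<le> e" "pclose e x y" for n x y e
  proof -
    have c: "x ! i \<in> carrier_mat n n" "y ! i \<in> carrier_mat n n" "word_eval x w \<in> carrier_mat n n" "word_eval y w \<in> carrier_mat n n"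
      using A i assms(2) by (auto simp: levelD word_eval_carrier)
    note IH = KL[OF A]
    have b: "opnorm (x ! i) \<le> R" "opnorm (y ! i) \<le> R" "opnorm (x ! i - y ! i) \<le> e"
      using A i by (auto simp: pbounded_def pclose_def levelD)
    have "opnorm (x ! i * word_eval x w) \<le> R * K"
      using opnorm_mult[OF c(1,3)] mult_mono[OF b(1), of "opnorm (word_eval x w)" K] IH assms(3) by simp
    moreover have "opnorm (x ! i * word_eval x w - y ! i * word_eval y w) \<le> (K + R * L) * e"
    proof -
      have cc: "(x ! i - y ! i) * word_eval x w \<in> carrier_mat n n" "y ! i * (word_eval x w - word_eval y w) \<in> carrier_mat n n"
        using mult_carrier_mat[OF minus_carrier_mat[OF c(2)] c(3)] mult_carrier_mat[OF c(2) minus_carrier_mat[OF c(4)]] by auto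
      have "x ! i * word_eval x w - y ! i * word_eval y w = (x ! i - y ! i) * word_eval x w + y ! i * (word_eval x w - word_eval y w)"
        unfolding minus_mult_distrib_mat[OF c(1,2,3)] mult_minus_distrib_mat[OF c(2,3,4)]
        using c by (intro eq_matI) (auto simp del: index_mult_mat(1))
      then have "opnorm (x ! i * word_eval x w - y ! i * word_eval y w) \<le> opnorm ((x ! i - y ! i) * word_eval x w) + opnorm (y ! i * (word_eval x w - word_eval y w))"
        using opnorm_add[OF cc] by simp
      also have "opnorm ((x ! i - y ! i) * word_eval x w) \<le> e * K"
        using opnorm_mult[OF minus_carrier_mat[OF c(2)] c(3), of "x ! i"] mult_mono[OF b(3), of "opnorm (word_eval x w)" K] IH A(5) by simp
      also have "opnorm (y ! i * (word_eval x w - word_eval y w)) \<le> R * (L * e)"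
        using opnorm_mult[OF c(2) minus_carrier_mat[OF c(4)], of "word_eval x w"] mult_mono[OF b(2), of "opnorm (word_eval x w - word_eval y w)" "L * e"] IH assms(3) by simp
      finally show ?thesis by (simp add: algebra_simps)
    qed
    ultimately show ?thesis by (simp add: word_eval_Cons)
  qed
  then show ?case using K assms(3) by (intro exI[of _ "R * K"] conjI exI[of _ "K + R * L"]) auto
qed

lemma polyfun_lipschitz:
  assumes G: "polyfun d G" and d: "0 < d" and R: "0 \<le> R"
  shows "\<exists>L\<ge>0. \<forall>n\<ge>1. \<forall>x\<in>level d n. \<forall>y\<in>level d n. \<forall>e\<ge>0. pbounded R x \<longrightarrow> pbounded R y \<longrightarrow> pclose e x y \<longrightarrow> opnorm (G x - G y) \<le> L * e"
proof -
  obtain ts where t: "ts \<in> terms d" "\<forall>x\<in>nc_space d. G x = tev ts x" using G by (auto simp: polyfun_def)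
  have "\<exists>L\<ge>0. \<forall>n. \<forall>x\<in>level d n. \<forall>y\<in>level d n. \<forall>e\<ge>0. pbounded R x \<longrightarrow> pbounded R y \<longrightarrow> pclose e x y \<longrightarrow> opnorm (tev ts x - tev ts y) \<le> L * e"
    using t(1)
  proof (induction ts)
    case Nil
    show ?case by (rule exI[of _ 0]) (auto simp: lvl_level d minus_r_inv_mat[OF zero_carrier_mat])
  next
    case (Cons cw ts)
    obtain c v where cw: "cw = (c, v)" by (cases cw)
    have v: "v \<in> lists {..<d}" "ts \<in> terms d" using Cons.prems by (auto simp: cw terms_Cons)
    obtain L where L: "L \<ge> 0" "\<And>n x y e. x \<in> level d n \<Longrightarrow> y \<in> level d n \<Longrightarrow> 0 \<le> e \<Longrightarrow> pbounded R x \<Longrightarrow> pbounded R y \<Longrightarrow> pclose e x y \<Longrightarrow> opnorm (tev ts x - tev ts y) \<le> L * e"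
      using Cons.IH[OF v(2)] by blast
    obtain M where M: "M \<ge> 0" "\<And>n x y e. x \<in> level d n \<Longrightarrow> y \<in> level d n \<Longrightarrow> 0 \<le> e \<Longrightarrow> pbounded R x \<Longrightarrow> pbounded R y \<Longrightarrow> pclose e x y \<Longrightarrow> opnorm (word_eval x v - word_eval y v) \<le> M * e"
      using word_eval_lipschitz[OF v(1) d R] by blast
    have "opnorm (tev (cw # ts) x - tev (cw # ts) y) \<le> (cmod c * M + L) * e"
      if A: "x \<in> level d n" "y \<in> level d n" "0 \<le> e" "pbounded R x" "pbounded R y" "pclose e x y" for n x y e
    proof -
      have cc: "word_eval x v \<in> carrier_mat n n" "word_eval y v \<in> carrier_mat n n" "tev ts x \<in> carrier_mat n n" "tev ts y \<in> carrier_mat n n"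
        using A v d by (auto intro!: word_eval_carrier tev_carrier)
      have "tev (cw # ts) x - tev (cw # ts) y = c \<cdot>\<^sub>m (word_eval x v - word_eval y v) + (tev ts x - tev ts y)"
        unfolding cw using cc by (intro eq_matI) (auto simp: algebra_simps)
      then have "opnorm (tev (cw # ts) x - tev (cw # ts) y) \<le> opnorm (c \<cdot>\<^sub>m (word_eval x v - word_eval y v)) + opnorm (tev ts x - tev ts y)"
        using cc by (simp add: opnorm_add[of _ n n])
      also have "\<dots> \<le> cmod c * (M * e) + L * e"
        unfolding opnorm_smult by (intro add_mono mult_left_mono M(2)[OF A] L(2)[OF A]) auto
      finally show ?thesis by (simp add: algebra_simps)
    qed
    then show ?case using L(1) M(1) by (intro exI[of _ "cmod c * M + L"]) auto
  qed
  then show ?thesis using t(2) nc_spaceI by (metis)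
qed

lemma polyfun_fp_eval:
  assumes p: "p \<in> free_polys d" and d: "0 < d"
  shows "polyfun d (fp_eval p)"
proof -
  obtain ws where ws: "set ws = Poly_Mapping.keys p" "distinct ws"
    using finite_distinct_list[of "Poly_Mapping.keys p"] by auto
  have sub: "set ws \<subseteq> lists {..<d}" using p ws by (auto simp: free_polys_def)
  define ts where "ts = map (\<lambda>w. (Poly_Mapping.lookup p w, w)) ws"
  have "fp_eval p x = tev ts x" if "x \<in> nc_space d" for x
  proof (rule eq_matI)
    have x: "x \<in> level d (lvl x)" using that nc_space_lvl d by blast
    have idx: "tev (map (\<lambda>w. (Poly_Mapping.lookup p w, w)) ws) x $$ (i, j) = (\<Sum>w\<leftarrow>ws. Poly_Mapping.lookup p w * word_eval x w $$ (i, j))"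
      if "set ws \<subseteq> lists {..<d}" "i < lvl x" "j < lvl x" for ws i j
      using that(1)
    proof (induction ws)
      case (Cons w ws)
      have "word_eval x w \<in> carrier_mat (lvl x) (lvl x)" using word_eval_carrier[OF x d] Cons.prems by simp
      moreover have "tev (map (\<lambda>w. (Poly_Mapping.lookup p w, w)) ws) x \<in> carrier_mat (lvl x) (lvl x)"
        by (rule tev_carrier[OF x d]) (use Cons.prems in \<open>auto simp: terms_def\<close>)
      ultimately show ?case using Cons that by simp
    qed (use that in simp)
    have tc: "tev ts x \<in> carrier_mat (lvl x) (lvl x)"
      by (rule tev_carrier[OF x d]) (use sub in \<open>auto simp: terms_def ts_def\<close>)
    fix i j assume "i < dim_row (tev ts x)" "j < dim_col (tev ts x)"
    then have ij: "i < lvl x" "j < lvl x" using tc by auto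
    show "fp_eval p x $$ (i, j) = tev ts x $$ (i, j)"
      unfolding ts_def idx[OF sub ij] using ij ws by (simp add: fp_eval_def sum_list_distinct_conv_sum_set)
  next
    have x: "x \<in> level d (lvl x)" using that nc_space_lvl d by blast
    have tc: "tev ts x \<in> carrier_mat (lvl x) (lvl x)"
      by (rule tev_carrier[OF x d]) (use sub in \<open>auto simp: terms_def ts_def\<close>)
    then show "dim_row (fp_eval p x) = dim_row (tev ts x)" "dim_col (fp_eval p x) = dim_col (tev ts x)"
      by (auto simp: fp_eval_def)
  qed
  moreover have "ts \<in> terms d" using sub by (auto simp: terms_def ts_def)
  ultimately show ?thesis unfolding polyfun_def by blast
qed

lemma fp_eval_superset:
  assumes "finite K" "Poly_Mapping.keys p \<subseteq> K"
  shows "fp_eval p x = Matrix.mat (lvl x) (lvl x) (\<lambda>(i, j). \<Sum>w\<in>K. Poly_Mapping.lookup p w * word_eval x w $$ (i, j))"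
  unfolding fp_eval_def
  by (rule eq_matI) (auto intro!: sum.mono_neutral_left assms simp: in_keys_iff)

text \<open>Converse of \<open>polyfun_fp_eval\<close>; together they allow basic sets to be
  described by either kind of polynomial.\<close>

lemma polyfun_imp_free_poly:
  assumes "polyfun d G"
  obtains p where "p \<in> free_polys d" "\<And>x. x \<in> nc_space d \<Longrightarrow> G x = fp_eval p x"
proof -
  obtain ts where t: "ts \<in> terms d" "\<forall>x\<in>nc_space d. G x = tev ts x" using assms by (auto simp: polyfun_def)
  have "\<exists>p\<in>free_polys d. \<forall>x. (\<forall>w\<in>snd ` set ts. word_eval x w \<in> carrier_mat (lvl x) (lvl x)) \<longrightarrow> fp_eval p x = tev ts x" using t(1)
  proof (induction ts)
    case Nil
    show ?case by (rule bexI[of _ 0]) (auto simp: free_polys_def fp_eval_def intro!: eq_matI)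
  next
    case (Cons cw ts)
    obtain c v where cw: "cw = (c, v)" by (cases cw)
    have v: "v \<in> lists {..<d}" "ts \<in> terms d" using Cons.prems by (auto simp: cw terms_Cons)
    obtain p where p: "p \<in> free_polys d" "\<forall>x. (\<forall>w\<in>snd ` set ts. word_eval x w \<in> carrier_mat (lvl x) (lvl x)) \<longrightarrow> fp_eval p x = tev ts x"
      using Cons.IH[OF v(2)] by blast
    define q where "q = Poly_Mapping.single v c + p"
    define K where "K = insert v (Poly_Mapping.keys p)"
    have K: "finite K" "Poly_Mapping.keys q \<subseteq> K" "Poly_Mapping.keys p \<subseteq> K"
      using Poly_Mapping.keys_add[of "Poly_Mapping.single v c" p] by (auto simp: K_def q_def split: if_splits)
    show ?case
    proof (rule bexI[of _ q], intro allI impI)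
      fix x assume x: "\<forall>w\<in>snd ` set (cw # ts). word_eval x w \<in> carrier_mat (lvl x) (lvl x)"
      then have px: "fp_eval p x = tev ts x" and vx: "word_eval x v \<in> carrier_mat (lvl x) (lvl x)" using p(2) by (auto simp: cw)
      have "fp_eval q x = c \<cdot>\<^sub>m word_eval x v + fp_eval p x"
        unfolding fp_eval_superset[OF K(1,2)] fp_eval_superset[OF K(1,3)]
      proof (rule eq_matI, goal_cases)
        case (1 i j)
        then have ij: "i < lvl x" "j < lvl x" by auto
        have "(\<Sum>w\<in>K. Poly_Mapping.lookup q w * word_eval x w $$ (i, j)) =
          (\<Sum>w\<in>K. (if w = v then c * word_eval x w $$ (i, j) else 0) + Poly_Mapping.lookup p w * word_eval x w $$ (i, j))"
          by (intro sum.cong refl) (auto simp: q_def lookup_add lookup_single when_def algebra_simps)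
        also have "\<dots> = c * word_eval x v $$ (i, j) + (\<Sum>w\<in>K. Poly_Mapping.lookup p w * word_eval x w $$ (i, j))"
          using K(1) by (simp add: sum.distrib) (simp add: K_def)
        finally show ?case using ij vx by simp
      qed (use vx in auto)
      then show "fp_eval q x = tev (cw # ts) x" by (simp add: cw px)
    next
      have "K \<subseteq> lists {..<d}" using p v by (auto simp: K_def free_polys_def)
      then show "q \<in> free_polys d" unfolding free_polys_def using order_trans[OF K(2)] by simp
    qed
  qed
  then obtain p where p: "p \<in> free_polys d" "\<forall>x. (\<forall>w\<in>snd ` set ts. word_eval x w \<in> carrier_mat (lvl x) (lvl x)) \<longrightarrow> fp_eval p x = tev ts x" by blast
  show thesis
  proof (rule that[OF p(1)])
    fix x assume x: "x \<in> nc_space d"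
    have "\<forall>w\<in>snd ` set ts. word_eval x w \<in> carrier_mat (lvl x) (lvl x)"
    proof
      fix w assume "w \<in> snd ` set ts"
      then have "w \<in> lists {..<d}" using t(1) by (auto simp: terms_def)
      then show "word_eval x w \<in> carrier_mat (lvl x) (lvl x)"
      proof (cases "d = 0")
        case True
        then have "w = []" using \<open>w \<in> lists {..<d}\<close> by (cases w) auto
        then show ?thesis by (simp add: word_eval_Nil)
      next
        case False
        then show ?thesis using word_eval_carrier nc_space_lvl x \<open>w \<in> lists {..<d}\<close> by blast
      qed
    qed
    then show "G x = fp_eval p x" using t(2) p(2) x by auto
  qed
qed

section \<open>The free topology\<close>

definition base_set :: "nat \<Rightarrow> nat \<Rightarrow> nat \<Rightarrow> (nat \<Rightarrow> nat \<Rightarrow> ncfun) \<Rightarrow> point set" where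
  "base_set d k l G = {x \<in> nc_space d. opnorm (blockm k l (lvl x) (\<lambda>a c. G a c x)) < 1}"

lemma fpmat_eval_blockm:
  "lvl x \<ge> 1 \<Longrightarrow> fpmat_eval \<delta> x = blockm (dim_row \<delta>) (dim_col \<delta>) (lvl x) (\<lambda>a c. fp_eval (\<delta> $$ (a, c)) x)"
  by (auto simp: fpmat_eval_def blockm_def Let_def intro!: eq_matI)

lemma blockm_cong:
  assumes "\<And>a c. a < k \<Longrightarrow> c < l \<Longrightarrow> G a c = H a c"
  shows "blockm k l n G = blockm k l n H"
  using assms by (auto simp: blockm_def less_mult_imp_div_less intro!: eq_matI)

lemma base_set_in_free_base:
  assumes "0 < d" "0 < k" "0 < l" "\<And>a c. a < k \<Longrightarrow> c < l \<Longrightarrow> polyfun d (G a c)"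
  shows "base_set d k l G \<in> free_base d"
proof -
  have "\<exists>p\<in>free_polys d. \<forall>x\<in>nc_space d. G a c x = fp_eval p x" if "a < k" "c < l" for a c
    using polyfun_imp_free_poly[OF assms(4)[OF that]] by metis
  then obtain p where p: "\<And>a c. a < k \<Longrightarrow> c < l \<Longrightarrow> p a c \<in> free_polys d \<and> (\<forall>x\<in>nc_space d. G a c x = fp_eval (p a c) x)"
    by metis
  define \<delta> where "\<delta> = Matrix.mat k l (\<lambda>(a, c). p a c)"
  have "base_set d k l G = B_delta d \<delta>"
  proof -
    have "opnorm (blockm k l (lvl x) (\<lambda>a c. G a c x)) = opnorm (fpmat_eval \<delta> x)" if "x \<in> nc_space d" for x
    proof -
      have "lvl x \<ge> 1" using nc_space_lvl that assms(1) by blast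
      then have "fpmat_eval \<delta> x = blockm k l (lvl x) (\<lambda>a c. fp_eval (\<delta> $$ (a, c)) x)"
        by (simp add: fpmat_eval_blockm) (simp add: \<delta>_def)
      also have "\<dots> = blockm k l (lvl x) (\<lambda>a c. G a c x)"
        using p that by (intro blockm_cong) (simp add: \<delta>_def)
      finally show ?thesis by simp
    qed
    then show ?thesis by (auto simp: base_set_def B_delta_def)
  qed
  moreover have "elements_mat \<delta> \<subseteq> free_polys d" using p by (auto simp: \<delta>_def elements_mat_def)
  moreover have "0 < dim_row \<delta>" "0 < dim_col \<delta>" using assms by (auto simp: \<delta>_def)
  ultimately show ?thesis unfolding free_base_def by blast
qed

lemma free_baseE:
  assumes "B \<in> free_base d" "0 < d"
  obtains k l G where "0 < k" "0 < l" "\<And>a c. a < k \<Longrightarrow> c < l \<Longrightarrow> polyfun d (G a c)" "B = base_set d k l G"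
proof -
  obtain \<delta> where \<delta>: "B = B_delta d \<delta>" "0 < dim_row \<delta>" "0 < dim_col \<delta>" "elements_mat \<delta> \<subseteq> free_polys d"
    using assms unfolding free_base_def by blast
  have 1: "polyfun d (fp_eval (\<delta> $$ (a, c)))" if "a < dim_row \<delta>" "c < dim_col \<delta>" for a c
    by (rule polyfun_fp_eval[OF subsetD[OF \<delta>(4)] assms(2)]) (use that in \<open>force simp: elements_mat_def\<close>)
  have B: "B = base_set d (dim_row \<delta>) (dim_col \<delta>) (\<lambda>a c. fp_eval (\<delta> $$ (a, c)))"
    unfolding \<delta>(1) B_delta_def base_set_def using nc_space_lvl assms(2) by (auto simp: fpmat_eval_blockm)
  show thesis by (rule that[OF \<delta>(2,3) 1 B])
qed

lemma free_base_subset: "B \<in> free_base d \<Longrightarrow> B \<subseteq> nc_space d"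
  by (auto simp: free_base_def B_delta_def)

text \<open>By \<open>opnorm_blockm_dsum\<close> the defining norm of a sum is the larger of the two
  norms. Both directions are used: sums stay in the set, and the summands of a member are
  recovered.\<close>

lemma free_base_dsum:
  assumes "B \<in> free_base d" "0 < d" "x \<in> nc_space d" "y \<in> nc_space d"
  shows "pt_dsum x y \<in> B \<longleftrightarrow> x \<in> B \<and> y \<in> B"
proof -
  obtain k l G where G: "0 < k" "0 < l" "\<And>a c. a < k \<Longrightarrow> c < l \<Longrightarrow> polyfun d (G a c)" "B = base_set d k l G"
    by (rule free_baseE[OF assms(1,2)]) (rule that)
  define n m where "n = lvl x" "m = lvl y"
  have l: "x \<in> level d n" "y \<in> level d m" "n \<ge> 1" "m \<ge> 1" using assms nc_space_lvl by (auto simp: n_m_def)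
  have "blockm k l (n + m) (\<lambda>a c. G a c (pt_dsum x y)) = blockm k l (n + m) (\<lambda>a c. mat_dsum (G a c x) (G a c y))"
    by (rule blockm_cong, rule polyfun_dsum[OF G(3) l(1,2) assms(2) l(3,4)])
  moreover have "opnorm (blockm k l (n + m) (\<lambda>a c. mat_dsum (G a c x) (G a c y))) = max (opnorm (blockm k l n (\<lambda>a c. G a c x))) (opnorm (blockm k l m (\<lambda>a c. G a c y)))"
    by (rule opnorm_blockm_dsum[OF l(3,4)])
      (rule polyfun_carrier[OF G(3) l(1) assms(2) l(3)] polyfun_carrier[OF G(3) l(2) assms(2) l(4)]; assumption)+
  moreover have "lvl (pt_dsum x y) = n + m" using lvl_level[OF pt_dsum_level[OF l(1,2)] assms(2)] .
  ultimately show ?thesis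
    unfolding G(4) base_set_def using assms pt_dsum_nc_space by (simp add: n_m_def)
qed

lemma free_base_nc_set: "B \<in> free_base d \<Longrightarrow> 0 < d \<Longrightarrow> nc_set d B"
  using free_base_dsum free_base_subset unfolding nc_set_def by blast

lemma opens_of_base_iff: "D \<in> opens_of_base \<B> \<longleftrightarrow> (\<forall>x\<in>D. \<exists>B\<in>\<B>. x \<in> B \<and> B \<subseteq> D)"
proof
  assume "D \<in> opens_of_base \<B>"
  then obtain \<U> where "\<U> \<subseteq> \<B>" "D = \<Union>\<U>"
    by (auto simp: opens_of_base_def union_of_def arbitrary_def)
  then show "\<forall>x\<in>D. \<exists>B\<in>\<B>. x \<in> B \<and> B \<subseteq> D" by blast
next
  assume *: "\<forall>x\<in>D. \<exists>B\<in>\<B>. x \<in> B \<and> B \<subseteq> D"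
  have "D = \<Union>{B \<in> \<B>. B \<subseteq> D}" using * by blast
  then show "D \<in> opens_of_base \<B>"
    unfolding opens_of_base_def union_of_def arbitrary_def by (auto intro!: exI[of _ "{B \<in> \<B>. B \<subseteq> D}"])
qed

lemma free_top_iff: "D \<in> free_top d \<longleftrightarrow> (\<forall>x\<in>D. \<exists>B\<in>free_base d. x \<in> B \<and> B \<subseteq> D)"
  by (simp add: free_top_def opens_of_base_iff)

lemma free_topE:
  assumes "D \<in> free_top d" "x \<in> D"
  obtains B where "B \<in> free_base d" "x \<in> B" "B \<subseteq> D"
  using assms by (auto simp: free_top_iff)

lemma free_base_open: "B \<in> free_base d \<Longrightarrow> B \<in> free_top d"
  by (auto simp: free_top_iff)

lemma free_top_subset: "D \<in> free_top d \<Longrightarrow> D \<subseteq> nc_space d"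
  using free_base_subset by (fastforce simp: free_top_iff)

lemma free_base_Int:
  assumes "B \<in> free_base d" "B' \<in> free_base d" "0 < d"
  shows "B \<inter> B' \<in> free_base d"
proof -
  obtain k l G where G: "0 < k" "0 < l" "\<And>a c. a < k \<Longrightarrow> c < l \<Longrightarrow> polyfun d (G a c)" "B = base_set d k l G"
    by (rule free_baseE[OF assms(1,3)]) (rule that)
  obtain k' l' H where H: "0 < k'" "0 < l'" "\<And>a c. a < k' \<Longrightarrow> c < l' \<Longrightarrow> polyfun d (H a c)" "B' = base_set d k' l' H"
    by (rule free_baseE[OF assms(2,3)]) (rule that)
  define F where "F a c = (\<lambda>x. if a < k then if c < l then G a c x else 0\<^sub>m (lvl x) (lvl x)
      else if c < l then 0\<^sub>m (lvl x) (lvl x) else H (a - k) (c - l) x)" for a c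
  have "B \<inter> B' = base_set d (k + k') (l + l') F"
  proof -
    have "opnorm (blockm (k + k') (l + l') (lvl x) (\<lambda>a c. F a c x)) = max (opnorm (blockm k l (lvl x) (\<lambda>a c. G a c x))) (opnorm (blockm k' l' (lvl x) (\<lambda>a c. H a c x)))"
      if "x \<in> nc_space d" for x
      unfolding F_def using nc_space_lvl[OF that assms(3)] by (subst blockm_diag) (auto simp: opnorm_dsum)
    then show ?thesis unfolding G(4) H(4) base_set_def by auto
  qed
  moreover have "polyfun d (F a c)" if "a < k + k'" "c < l + l'" for a c
    using that G(3) H(3) polyfun_zero[of d] unfolding F_def by (cases "a < k"; cases "c < l") auto
  ultimately show ?thesis using base_set_in_free_base[OF assms(3), of "k + k'" "l + l'" F] G H by simp
qed

lemma free_top_Int: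
  assumes "D \<in> free_top d" "D' \<in> free_top d" "0 < d" shows "D \<inter> D' \<in> free_top d"
  unfolding free_top_iff
proof
  fix x assume x: "x \<in> D \<inter> D'"
  obtain B where B: "B \<in> free_base d" "x \<in> B" "B \<subseteq> D" using free_topE assms(1) x by blast
  obtain B' where B': "B' \<in> free_base d" "x \<in> B'" "B' \<subseteq> D'" using free_topE assms(2) x by blast
  show "\<exists>B\<in>free_base d. x \<in> B \<and> B \<subseteq> D \<inter> D'"
    using free_base_Int[OF B(1) B'(1) assms(3)] B B' by (intro bexI[of _ "B \<inter> B'"]) auto
qed

lemma norm_ball_free_base:
  assumes "polyfun d G" "0 < d"
  shows "{x \<in> nc_space d. opnorm (G x) < 1} \<in> free_base d"
proof -
  have "opnorm (blockm 1 1 (lvl x) (\<lambda>a c. G x)) = opnorm (G x)" if "x \<in> nc_space d" for x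
  proof -
    have "G x \<in> carrier_mat (lvl x) (lvl x)" using polyfun_carrier assms nc_space_lvl that by blast
    then have "blockm 1 1 (lvl x) (\<lambda>a c. G x) = G x" by (auto simp: blockm_def intro!: eq_matI)
    then show ?thesis by simp
  qed
  then have "{x \<in> nc_space d. opnorm (G x) < 1} = base_set d 1 1 (\<lambda>_ _. G)" by (auto simp: base_set_def)
  then show ?thesis using base_set_in_free_base[of d 1 1 "\<lambda>_ _. G"] assms by simp
qed

lemma norm_ball_scaled_free_base:
  assumes "polyfun d G" "0 < d" "0 < K"
  shows "{x \<in> nc_space d. opnorm (G x) < K} \<in> free_base d"
proof -
  have "{x \<in> nc_space d. opnorm (G x) < K} = {x \<in> nc_space d. opnorm (complex_of_real (1 / K) \<cdot>\<^sub>m G x) < 1}"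
    using assms(3) by (auto simp: opnorm_smult norm_divide field_simps)
  then show ?thesis using norm_ball_free_base[OF polyfun_smult[OF assms(1,2)] assms(2)] by simp
qed

lemma blockm_diff_le:
  assumes "n \<ge> 1" "\<And>a c. a < k \<Longrightarrow> c < l \<Longrightarrow> G a c \<in> carrier_mat n n" "\<And>a c. a < k \<Longrightarrow> c < l \<Longrightarrow> H a c \<in> carrier_mat n n"
  shows "opnorm (blockm k l n H) \<le> opnorm (blockm k l n G) + (\<Sum>a<k. \<Sum>c<l. opnorm (H a c - G a c))"
proof -
  have "blockm k l n H = blockm k l n G + blockm k l n (\<lambda>a c. H a c - G a c)"
  proof (rule eq_matI)
    fix i j assume "i < dim_row (blockm k l n G + blockm k l n (\<lambda>a c. H a c - G a c))" "j < dim_col (blockm k l n G + blockm k l n (\<lambda>a c. H a c - G a c))"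
    then have ij: "i < k * n" "j < l * n" by auto
    then have "i div n < k" "j div n < l" by (auto simp: less_mult_imp_div_less)
    from assms(2)[OF this] assms(3)[OF this] show "blockm k l n H $$ (i, j) = (blockm k l n G + blockm k l n (\<lambda>a c. H a c - G a c)) $$ (i, j)"
      using ij assms(1) by (simp add: blockm_def)
  qed simp_all
  then have "opnorm (blockm k l n H) \<le> opnorm (blockm k l n G) + opnorm (blockm k l n (\<lambda>a c. H a c - G a c))"
    using opnorm_add[OF blockm_carrier blockm_carrier] by simp
  also have "opnorm (blockm k l n (\<lambda>a c. H a c - G a c)) \<le> (\<Sum>a<k. \<Sum>c<l. opnorm (H a c - G a c))"
    using assms by (intro opnorm_blockm_le minus_carrier_mat) auto
  finally show ?thesis by simp
qed

text \<open>\<open>L\<close> is chosen before the level; this lets one polynomial neighbourhood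
  serve all \<open>n\<close> in \<open>omega_preimage_open\<close>.\<close>

lemma block_lipschitz:
  assumes "0 < d" "0 \<le> R" "\<And>a c. a < k \<Longrightarrow> c < l \<Longrightarrow> polyfun d (G a c)"
  obtains L where "L \<ge> 0" "\<And>n x y e. n \<ge> 1 \<Longrightarrow> x \<in> level d n \<Longrightarrow> y \<in> level d n \<Longrightarrow> 0 \<le> e \<Longrightarrow> pbounded R x \<Longrightarrow> pbounded R y \<Longrightarrow> pclose e x y \<Longrightarrow>
    opnorm (blockm k l n (\<lambda>a c. G a c y)) \<le> opnorm (blockm k l n (\<lambda>a c. G a c x)) + L * e"
proof -
  have "\<exists>L\<ge>0. \<forall>n\<ge>1. \<forall>x\<in>level d n. \<forall>y\<in>level d n. \<forall>e\<ge>0. pbounded R x \<longrightarrow> pbounded R y \<longrightarrow> pclose e x y \<longrightarrow> opnorm (G a c x - G a c y) \<le> L * e"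
    if "a < k" "c < l" for a c using polyfun_lipschitz[OF assms(3)[OF that] assms(1,2)] .
  then obtain L where L: "\<And>a c. a < k \<Longrightarrow> c < l \<Longrightarrow> L a c \<ge> 0 \<and> (\<forall>n\<ge>1. \<forall>x\<in>level d n. \<forall>y\<in>level d n. \<forall>e\<ge>0. pbounded R x \<longrightarrow> pbounded R y \<longrightarrow> pclose e x y \<longrightarrow> opnorm (G a c x - G a c y) \<le> L a c * e)"
    by metis
  show thesis
  proof (rule that[of "\<Sum>a<k. \<Sum>c<l. L a c"])
    show "0 \<le> (\<Sum>a<k. \<Sum>c<l. L a c)" using L by (intro sum_nonneg) auto
    fix n x y and e :: real
    assume A: "n \<ge> 1" "x \<in> level d n" "y \<in> level d n" "0 \<le> e" "pbounded R x" "pbounded R y" "pclose e x y"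
    have cx: "G a c x \<in> carrier_mat n n" "G a c y \<in> carrier_mat n n" if "a < k" "c < l" for a c
      using polyfun_carrier assms that A by blast+
    have "opnorm (G a c y - G a c x) \<le> L a c * e" if "a < k" "c < l" for a c
    proof -
      have "G a c y - G a c x = - (G a c x - G a c y)" using cx[OF that] by (intro eq_matI) auto
      then show ?thesis using L[OF that] A by (simp add: opnorm_uminus)
    qed
    then have "(\<Sum>a<k. \<Sum>c<l. opnorm (G a c y - G a c x)) \<le> (\<Sum>a<k. \<Sum>c<l. L a c * e)"
      by (intro sum_mono) auto
    then show "opnorm (blockm k l n (\<lambda>a c. G a c y)) \<le> opnorm (blockm k l n (\<lambda>a c. G a c x)) + (\<Sum>a<k. \<Sum>c<l. L a c) * e"
      using blockm_diff_le[of n k l "\<lambda>a c. G a c x" "\<lambda>a c. G a c y"] A cx by (simp add: sum_distrib_right)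
  qed
qed

lemma pbounded_ex: obtains R where "R \<ge> 0" "pbounded R x"
proof (rule that[of "\<Sum>i<length x. opnorm (x ! i)"])
  show "pbounded (\<Sum>i<length x. opnorm (x ! i)) x"
    unfolding pbounded_def using member_le_sum[of _ "{..<length x}" "\<lambda>i. opnorm (x ! i)"] by auto
qed (simp add: sum_nonneg)

lemma pbounded_close:
  assumes "x \<in> level d n" "y \<in> level d n" "pbounded R x" "pclose e x y" shows "pbounded (R + e) y"
  unfolding pbounded_def
proof (intro allI impI)
  fix i assume "i < length y"
  then have i: "i < d" using assms by (simp add: levelD)
  have c: "x ! i \<in> carrier_mat n n" "y ! i \<in> carrier_mat n n" using assms i by (auto simp: levelD)
  have "y ! i = x ! i - (x ! i - y ! i)" using c by (intro eq_matI) auto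
  then have "opnorm (y ! i) \<le> opnorm (x ! i) + opnorm (x ! i - y ! i)"
    using opnorm_diff[OF c(1) minus_carrier_mat[OF c(2)], of "x ! i"] by simp
  then show "opnorm (y ! i) \<le> R + e" using assms i by (fastforce simp: pbounded_def pclose_def levelD)
qed

lemma free_base_finitely_open:
  assumes B: "B \<in> free_base d" and d: "0 < d" and x: "x \<in> B" "x \<in> level d n" and n: "n \<ge> 1"
  obtains e where "e > 0" "\<And>y. y \<in> level d n \<Longrightarrow> pclose e x y \<Longrightarrow> y \<in> B"
proof -
  obtain k l G where G: "0 < k" "0 < l" "\<And>a c. a < k \<Longrightarrow> c < l \<Longrightarrow> polyfun d (G a c)" "B = base_set d k l G"
    by (rule free_baseE[OF B d]) (rule that)
  obtain R where R: "R \<ge> 0" "pbounded R x" by (rule pbounded_ex)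
  have R1: "0 \<le> R + 1" using R by simp
  obtain L where L: "L \<ge> 0" "\<And>n x y e. n \<ge> 1 \<Longrightarrow> x \<in> level d n \<Longrightarrow> y \<in> level d n \<Longrightarrow> 0 \<le> e \<Longrightarrow> pbounded (R + 1) x \<Longrightarrow> pbounded (R + 1) y \<Longrightarrow> pclose e x y \<Longrightarrow>
    opnorm (blockm k l n (\<lambda>a c. G a c y)) \<le> opnorm (blockm k l n (\<lambda>a c. G a c x)) + L * e"
    by (rule block_lipschitz[where k = k and l = l and G = G, OF d R1], erule (1) G(3)) (rule that)
  define t where "t = opnorm (blockm k l n (\<lambda>a c. G a c x))"
  have t: "t < 1" using x lvl_level[OF x(2) d] by (simp add: t_def G(4) base_set_def)
  \<comment> \<open>Makes \<open>L * e\<close> smaller than the slack \<open>1 - t\<close>;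
    \<open>L + 1\<close> avoids division by zero, and the cap 1 keeps \<open>y\<close> in the ball
    where \<open>L\<close> is valid.\<close>
  define e where "e = min 1 ((1 - t) / (2 * (L + 1)))"
  have e: "e > 0" "e \<le> 1" "L * e < 1 - t"
  proof -
    show "e > 0" "e \<le> 1" using t L(1) by (auto simp: e_def)
    have "L * e \<le> (L + 1) * ((1 - t) / (2 * (L + 1)))" using L(1) \<open>e > 0\<close> by (intro mult_mono) (auto simp: e_def)
    also have "\<dots> = (1 - t) / 2"
    proof -
      have "q * ((1 - t) / (2 * q)) = (1 - t) / 2" if "q > 0" for q :: real using that by simp
      then show ?thesis by this (use L(1) in simp)
    qed
    finally show "L * e < 1 - t" using t by simp
  qed
  show thesis
  proof (rule that[OF e(1)])
    fix y assume y: "y \<in> level d n" "pclose e x y"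
    have b: "pbounded (R + 1) x" using R by (force simp: pbounded_def)
    have "pbounded (R + e) y" by (rule pbounded_close[OF x(2) y(1) R(2) y(2)])
    then have "pbounded (R + 1) y" using e(2) by (force simp: pbounded_def)
    then have "opnorm (blockm k l n (\<lambda>a c. G a c y)) \<le> t + L * e"
      unfolding t_def using L(2)[OF n x(2) y(1) _ b _ y(2)] e by simp
    then show "y \<in> B" unfolding G(4) base_set_def using e(3) y(1) n lvl_level[OF y(1) d] nc_spaceI by auto
  qed
qed

section \<open>Spectra and functional calculus near a point\<close>

text \<open>Let \<open>p\<close> annihilate \<open>c x\<close>. If \<open>pm p (c y)\<close> is
  small, then \<open>p\<close> is small on the spectrum of \<open>c y\<close>, whereas its modulus
  is bounded below off \<open>V\<close>. One polynomial inequality thus confines the spectrum at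
  every level.\<close>

lemma spectrum_open:
  assumes c: "polyfun d c" and d: "0 < d" and V: "open V"
  shows "{x \<in> nc_space d. spectrum (c x) \<subseteq> V} \<in> free_top d"
  unfolding free_top_iff
proof
  fix x assume x: "x \<in> {x \<in> nc_space d. spectrum (c x) \<subseteq> V}"
  define X where "X = c x"
  have X: "X \<in> carrier_mat (lvl x) (lvl x)" using polyfun_carrier nc_space_lvl x c d unfolding X_def by blast
  have Vx: "spectrum X \<subseteq> V" using x by (simp add: X_def)
  have fin: "finite (spectrum X)" by (rule finite_spectrum[OF X])
  obtain N where N: "kills N X" using ex_kills[OF X] by blast
  define p where "p = (\<Prod>\<mu>\<in>spectrum X. [:-\<mu>, 1:] ^ N :: complex poly)"
  have p0: "pm p X = 0\<^sub>m (lvl x) (lvl x)" using N X by (simp add: kills_def p_def)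
  have "\<exists>e>0. \<forall>\<mu>\<in>spectrum X. ball \<mu> e \<subseteq> V"
  proof -
    have "\<exists>e>0. ball \<mu> e \<subseteq> V" if "\<mu> \<in> spectrum X" for \<mu> using V Vx that openE by blast
    then obtain e where e: "\<And>\<mu>. \<mu> \<in> spectrum X \<Longrightarrow> e \<mu> > 0 \<and> ball \<mu> (e \<mu>) \<subseteq> V" by metis
    show ?thesis
    proof (intro exI conjI ballI)
      show "0 < Min (insert 1 (e ` spectrum X))" using e fin by auto
      fix \<mu> assume \<mu>: "\<mu> \<in> spectrum X"
      have "Min (insert 1 (e ` spectrum X)) \<le> e \<mu>" using fin \<mu> by (intro Min_le) auto
      then show "ball \<mu> (Min (insert 1 (e ` spectrum X))) \<subseteq> V" using e[OF \<mu>] by auto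
    qed
  qed
  then obtain e where e: "e > 0" "\<And>\<mu>. \<mu> \<in> spectrum X \<Longrightarrow> ball \<mu> e \<subseteq> V" by blast
  define K where "K = (\<Prod>\<mu>\<in>spectrum X. e ^ N)"
  have K: "K > 0" using e by (auto simp: K_def intro: prod_pos)
  have out: "K \<le> cmod (poly p z)" if "z \<notin> V" for z
  proof -
    have "e ^ N \<le> cmod (poly ([:-\<mu>, 1:] ^ N) z)" if "\<mu> \<in> spectrum X" for \<mu>
    proof -
      have "z \<notin> ball \<mu> e" using e(2)[OF that] \<open>z \<notin> V\<close> by blast
      then have "e \<le> cmod (z - \<mu>)" by (simp add: dist_norm norm_minus_commute)
      then show ?thesis using e(1) by (simp add: norm_power power_mono)
    qed
    then show ?thesis unfolding K_def p_def poly_prod prod_norm[symmetric] using e(1) by (intro prod_mono) auto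
  qed
  let ?B = "{y \<in> nc_space d. opnorm (pm p (c y)) < K}"
  show "\<exists>B\<in>free_base d. x \<in> B \<and> B \<subseteq> {x \<in> nc_space d. spectrum (c x) \<subseteq> V}"
  proof (intro bexI conjI)
    show "?B \<in> free_base d" by (rule norm_ball_scaled_free_base[OF polyfun_pm[OF c d] d K])
    show "x \<in> ?B" using x p0 K by (simp add: X_def)
    show "?B \<subseteq> {x \<in> nc_space d. spectrum (c x) \<subseteq> V}"
    proof safe
      fix y z assume y: "y \<in> nc_space d" "opnorm (pm p (c y)) < K" "z \<in> spectrum (c y)"
      have Y: "c y \<in> carrier_mat (lvl y) (lvl y)" using polyfun_carrier nc_space_lvl y c d by blast
      have "poly p z \<in> spectrum (pm p (c y))" using y(3) by (simp add: spectrum_pm[OF Y])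
      then have "cmod (poly p z) \<le> opnorm (pm p (c y))" using spectrum_opnorm[of "pm p (c y)" "lvl y"] Y by blast
      then show "z \<in> V" using out[of z] y(2) by linarith
    qed
  qed
qed

lemma hfc_common_poly:
  assumes "finite X" "\<And>x. x \<in> X \<Longrightarrow> \<exists>n. x \<in> carrier_mat n n"
    and "open V" "\<And>x. x \<in> X \<Longrightarrow> spectrum x \<subseteq> V" "g holomorphic_on V"
  shows "\<exists>P. \<forall>x\<in>X. hfc g x = pm P x \<and> (\<forall>l\<in>spectrum x. poly P l = g l)"
proof (rule ex_common_poly[OF assms])
  fix P N assume "\<And>x. x \<in> X \<Longrightarrow> hfc g x = pm P x" "\<And>x l. x \<in> X \<Longrightarrow> l \<in> spectrum x \<Longrightarrow> poly P l = g l"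
  then show ?thesis by blast
qed

text \<open>Near \<open>x\<close> the functional calculus is still a root of \<open>a\<close>, and
  its spectrum stays where \<open>m\<close> nearly inverts it; \<open>sqrt_poly_approx\<close> turns
  this into a norm bound at every level. Applied with the polynomial \<open>z\<close> to square
  roots and with the constant 1 to signs.\<close>

lemma hfc_approx:
  assumes c: "polyfun d c" and d: "0 < d" and V: "open V" and g: "g holomorphic_on V"
    and ga: "\<And>z. z \<in> V \<Longrightarrow> g z * g z = poly a z" "\<And>z. z \<in> V \<Longrightarrow> g z \<noteq> 0"
    and x: "x \<in> nc_space d" "spectrum (c x) \<subseteq> V"
  obtains q R where "R > 0" "\<And>e. e > 0 \<Longrightarrow> \<exists>N\<in>free_top d. x \<in> N \<and>
    (\<forall>y\<in>N. spectrum (c y) \<subseteq> V \<and> opnorm (pm q (c y)) \<le> R \<and> opnorm (hfc g (c y) - pm q (c y)) \<le> e)"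
proof -
  define X where "X = c x"
  have cc: "c y \<in> carrier_mat (lvl y) (lvl y)" if "y \<in> nc_space d" for y
    using polyfun_carrier nc_space_lvl that c d by blast
  have X: "X \<in> carrier_mat (lvl x) (lvl x)" using cc x by (simp add: X_def)
  have h: "(\<lambda>z. inverse (g z)) holomorphic_on V" using g ga(2) by (intro holomorphic_intros) auto
  obtain K where K: "kills K X" using ex_kills[OF X] by blast
  define N where "N = Suc K"
  have N: "kills N X" using kills_mono[OF X K] by (simp add: N_def)
  have Z: "finite (spectrum X)" "spectrum X \<subseteq> V" using finite_spectrum[OF X] x by (auto simp: X_def)
  obtain q where q: "matches N (spectrum X) g q" using ex_matches[OF Z(1) V Z(2) g] by blast
  \<comment> \<open>\<open>m\<close> interpolates \<open>1 / g\<close>, so \<open>m * q\<close> and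
    \<open>a * m * m\<close> are exactly 1 at \<open>c x\<close> and nearly 1 close to it.\<close>
  obtain m where m: "matches N (spectrum X) (\<lambda>z. inverse (g z)) m" using ex_matches[OF Z(1) V Z(2) h] by blast
  have m1: "matches N (spectrum X) (poly 1) (m * q)"
    by (rule matches_cong[OF matches_mult[OF m q] V Z(2)]) (use ga in auto)
  have E3: "pm (m * q - 1) X = 0\<^sub>m (lvl x) (lvl x)"
    using matches_unique[OF X N m1 matches_poly] X by (simp add: pm_minus minus_r_inv_mat[OF pm_carrier])
  have m2: "matches N (spectrum X) (poly 1) (a * m * m)"
  proof (rule matches_cong[OF matches_mult[OF matches_mult[OF matches_poly m] m] V Z(2)])
    fix z assume "z \<in> V"
    then show "poly a z * inverse (g z) * inverse (g z) = poly 1 z" using ga by (simp add: field_simps flip: ga(1))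
  qed
  have E1: "pm (a * m * m - 1) X = 0\<^sub>m (lvl x) (lvl x)"
    using matches_unique[OF X N m2 matches_poly] X by (simp add: pm_minus minus_r_inv_mat[OF pm_carrier])
  \<comment> \<open>While the spectrum stays here, the spectral hypothesis of
    \<open>sqrt_poly_approx\<close> holds for every polynomial that takes the values of
    \<open>g\<close> on it.\<close>
  define V' where "V' = {z \<in> V. cmod (g z * poly m z - 1) < 1/2}"
  have V': "open V'"
  proof -
    have "continuous_on V (\<lambda>z. cmod (g z * poly m z - 1))"
      by (intro continuous_intros holomorphic_on_imp_continuous_on g)
    then have "open (V \<inter> (\<lambda>z. cmod (g z * poly m z - 1)) -` {..<1/2})"
      by (intro continuous_open_preimage V) auto
    moreover have "V' = V \<inter> (\<lambda>z. cmod (g z * poly m z - 1)) -` {..<1/2}" by (auto simp: V'_def)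
    ultimately show ?thesis by simp
  qed
  have XV': "spectrum X \<subseteq> V'"
  proof
    fix l assume l: "l \<in> spectrum X"
    have "poly m l = inverse (g l)" by (rule matches_value[OF m l]) (simp add: N_def)
    then show "l \<in> V'" using Z l ga(2) by (auto simp: V'_def)
  qed
  define R where "R = opnorm (pm q X) + 1"
  have R: "R > 0" unfolding R_def using opnorm_nonneg[of "pm q X"] by linarith
  show thesis
  proof (rule that[OF R])
    fix e :: real assume e: "e > 0"
    define \<epsilon> where "\<epsilon> = min (1/2) (e / (4 * R))"
    have \<epsilon>: "\<epsilon> > 0" "\<epsilon> \<le> 1/2" "4 * R * \<epsilon> \<le> e"
    proof -
      show "\<epsilon> > 0" "\<epsilon> \<le> 1/2" using e R by (auto simp: \<epsilon>_def)
      have "4 * R * \<epsilon> \<le> 4 * R * (e / (4 * R))" using R by (intro mult_left_mono) (auto simp: \<epsilon>_def)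
      then show "4 * R * \<epsilon> \<le> e" using R by simp
    qed
    define M where "M = {y \<in> nc_space d. spectrum (c y) \<subseteq> V'} \<inter> ({y \<in> nc_space d. opnorm (pm (a * m * m - 1) (c y)) < \<epsilon>}
      \<inter> ({y \<in> nc_space d. opnorm (pm (m * q - 1) (c y)) < \<epsilon>} \<inter> {y \<in> nc_space d. opnorm (pm q (c y)) < R}))"
    show "\<exists>N\<in>free_top d. x \<in> N \<and> (\<forall>y\<in>N. spectrum (c y) \<subseteq> V \<and> opnorm (pm q (c y)) \<le> R \<and> opnorm (hfc g (c y) - pm q (c y)) \<le> e)"
    proof (intro bexI[of _ M] conjI ballI)
      show "M \<in> free_top d" unfolding M_def
        by (intro free_top_Int d spectrum_open c V' free_base_open norm_ball_scaled_free_base polyfun_pm \<epsilon> R)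
      show "x \<in> M" using x XV' E1 E3 \<epsilon> by (auto simp: M_def R_def X_def)
      fix y assume y: "y \<in> M"
      then have yn: "y \<in> nc_space d" by (simp add: M_def)
      show yV: "spectrum (c y) \<subseteq> V" using y by (auto simp: M_def V'_def)
      show yR: "opnorm (pm q (c y)) \<le> R" using y by (auto simp: M_def)
      have Y: "c y \<in> carrier_mat (lvl y) (lvl y)" by (rule cc[OF yn])
      obtain P where P: "hfc g (c y) = pm P (c y)" "\<And>l. l \<in> spectrum (c y) \<Longrightarrow> poly P l = g l"
        using hfc_common_poly[of "{c y}" V g] Y V yV g by auto
      have "pm (P * P) (c y) = hfc (\<lambda>z. g z * g z) (c y)"
        unfolding hfc_mult[OF Y V yV g g] P(1) by (rule pm_mult[OF Y])
      also have "\<dots> = pm a (c y)" by (rule hfc_cong_poly[OF Y V yV ga(1)])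
      finally have sq: "pm (P * P) (c y) = pm a (c y)" .
      have "opnorm (pm P (c y) - pm q (c y)) \<le> 4 * R * \<epsilon>"
        by (rule sqrt_poly_approx[OF Y sq _ _ _ yR \<epsilon>(2), where m = m]) (use y P(2) in \<open>auto simp: M_def V'_def\<close>)
      then show "opnorm (hfc g (c y) - pm q (c y)) \<le> e" using \<epsilon>(3) by (simp add: P(1))
    qed
  qed
qed

lemma spectrum_dsum:
  assumes x: "x \<in> carrier_mat n n" and y: "y \<in> carrier_mat m m"
  shows "spectrum (mat_dsum x y) = spectrum x \<union> spectrum y"
proof -
  have mv: "mat_dsum x y *\<^sub>v (a @\<^sub>v b) = (x *\<^sub>v a) @\<^sub>v (y *\<^sub>v b)"
    if "a \<in> carrier_vec n" "b \<in> carrier_vec m" for a b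
    using mult_mat_vec_split[OF x y that] x y by (simp add: mat_dsum_def)
  have sm: "l \<cdot>\<^sub>v (a @\<^sub>v b) = (l \<cdot>\<^sub>v a) @\<^sub>v (l \<cdot>\<^sub>v b)" for l :: complex and a b by (intro eq_vecI) auto
  show ?thesis
  proof safe
    fix l assume "l \<in> spectrum (mat_dsum x y)" "l \<notin> spectrum y"
    obtain v where v: "v \<in> carrier_vec (n + m)" "v \<noteq> 0\<^sub>v (n + m)" "mat_dsum x y *\<^sub>v v = l \<cdot>\<^sub>v v"
      by (rule spectrumE[OF \<open>l \<in> spectrum (mat_dsum x y)\<close> mat_dsum_carrier[OF x y]])
    define a where "a = vec_first v n"
    define b where "b = vec_last v m"
    have ab: "a \<in> carrier_vec n" "b \<in> carrier_vec m" "v = a @\<^sub>v b" using v by (auto simp: a_def b_def)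
    have "(x *\<^sub>v a) @\<^sub>v (y *\<^sub>v b) = (l \<cdot>\<^sub>v a) @\<^sub>v (l \<cdot>\<^sub>v b)" using v(3) unfolding ab(3) mv[OF ab(1,2)] sm .
    moreover have "x *\<^sub>v a \<in> carrier_vec n" "l \<cdot>\<^sub>v a \<in> carrier_vec n" using x ab by auto
    ultimately have e: "x *\<^sub>v a = l \<cdot>\<^sub>v a" "y *\<^sub>v b = l \<cdot>\<^sub>v b" by (auto simp: append_vec_eq[of _ n])
    have "b = 0\<^sub>v m" using spectrumI[OF y ab(2) _ e(2)] \<open>l \<notin> spectrum y\<close> by blast
    have "a \<noteq> 0\<^sub>v n"
    proof
      assume "a = 0\<^sub>v n"
      then have "v = 0\<^sub>v (n + m)" unfolding ab(3) \<open>b = 0\<^sub>v m\<close> by (intro eq_vecI) auto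
      then show False using v(2) by simp
    qed
    then show "l \<in> spectrum x" using spectrumI[OF x ab(1) _ e(1)] by blast
  next
    fix l assume l: "l \<in> spectrum x"
    obtain a where a: "a \<in> carrier_vec n" "a \<noteq> 0\<^sub>v n" "x *\<^sub>v a = l \<cdot>\<^sub>v a" by (rule spectrumE[OF l x])
    show "l \<in> spectrum (mat_dsum x y)"
    proof (rule spectrumI[OF mat_dsum_carrier[OF x y], of "a @\<^sub>v 0\<^sub>v m"])
      show "a @\<^sub>v 0\<^sub>v m \<noteq> 0\<^sub>v (n + m)"
      proof
        assume "a @\<^sub>v 0\<^sub>v m = 0\<^sub>v (n + m)"
        then have "vec_index (a @\<^sub>v 0\<^sub>v m) i = 0" if "i < n" for i using that by simp
        then have "a = 0\<^sub>v n" using a(1) by (intro eq_vecI) force+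
        then show False using a by simp
      qed
      have "y *\<^sub>v 0\<^sub>v m = l \<cdot>\<^sub>v 0\<^sub>v m" using y by (intro eq_vecI) auto
      then show "mat_dsum x y *\<^sub>v (a @\<^sub>v 0\<^sub>v m) = l \<cdot>\<^sub>v (a @\<^sub>v 0\<^sub>v m)" using a by (simp add: mv sm)
    qed (use a in auto)
  next
    fix l assume l: "l \<in> spectrum y"
    obtain b where b: "b \<in> carrier_vec m" "b \<noteq> 0\<^sub>v m" "y *\<^sub>v b = l \<cdot>\<^sub>v b" by (rule spectrumE[OF l y])
    show "l \<in> spectrum (mat_dsum x y)"
    proof (rule spectrumI[OF mat_dsum_carrier[OF x y], of "0\<^sub>v n @\<^sub>v b"])
      show "0\<^sub>v n @\<^sub>v b \<noteq> 0\<^sub>v (n + m)"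
      proof
        assume 0: "0\<^sub>v n @\<^sub>v b = 0\<^sub>v (n + m)"
        have "vec_index b i = 0" if "i < m" for i
          using arg_cong[OF 0, of "\<lambda>v. vec_index v (n + i)"] that b(1) by simp
        then have "b = 0\<^sub>v m" using b(1) by (intro eq_vecI) auto
        then show False using b by simp
      qed
      have "x *\<^sub>v 0\<^sub>v n = l \<cdot>\<^sub>v 0\<^sub>v n" using x by (intro eq_vecI) auto
      then show "mat_dsum x y *\<^sub>v (0\<^sub>v n @\<^sub>v b) = l \<cdot>\<^sub>v (0\<^sub>v n @\<^sub>v b)" using b by (simp add: mv sm)
    qed (use b in auto)
  qed
qed

lemma mat_conj_minv:
  assumes "s \<in> GLn n" "A \<in> carrier_mat n n" shows "mat_conj (minv s) (mat_conj s A) = A"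
proof -
  note s = GLnD[OF assms(1)]
  have "s * (minv s * A * s) = s * (minv s * A) * s" by (rule assoc_mult_mat[symmetric, of _ n n _ n _ n]) (use s assms in auto)
  also have "s * (minv s * A) = s * minv s * A" by (rule assoc_mult_mat[symmetric, of _ n n _ n _ n]) (use s assms in auto)
  also have "s * minv s * A * s * minv s = A * (s * minv s)" unfolding s(3) using s assms
    by (simp add: assoc_mult_mat[of _ n n _ n _ n])
  finally show ?thesis unfolding mat_conj_def minv_minv[OF assms(1)] using s assms by simp
qed

lemma spectrum_conj_subset:
  assumes s: "s \<in> GLn n" and x: "x \<in> carrier_mat n n"
  shows "spectrum x \<subseteq> spectrum (mat_conj s x)"
proof
  fix l assume l: "l \<in> spectrum x"
  obtain v where v: "v \<in> carrier_vec n" "v \<noteq> 0\<^sub>v n" "x *\<^sub>v v = l \<cdot>\<^sub>v v" by (rule spectrumE[OF l x])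
  note S = GLnD[OF s]
  let ?w = "minv s *\<^sub>v v"
  have w: "?w \<in> carrier_vec n" using S v by simp
  have sw: "s *\<^sub>v ?w = v" using assoc_mult_mat_vec[OF S(1,2) v(1)] v S by simp
  have "?w \<noteq> 0\<^sub>v n"
  proof
    assume "?w = 0\<^sub>v n"
    then have "s *\<^sub>v 0\<^sub>v n = v" using sw by simp
    moreover have "s *\<^sub>v 0\<^sub>v n = 0\<^sub>v n" using S by (intro eq_vecI) auto
    ultimately show False using v by simp
  qed
  moreover have "mat_conj s x *\<^sub>v ?w = l \<cdot>\<^sub>v ?w"
  proof -
    have "mat_conj s x *\<^sub>v ?w = (minv s * x) *\<^sub>v (s *\<^sub>v ?w)"
      unfolding mat_conj_def by (rule assoc_mult_mat_vec[OF mult_carrier_mat[OF S(2) x] S(1) w])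
    also have "\<dots> = minv s *\<^sub>v (x *\<^sub>v v)" unfolding sw by (rule assoc_mult_mat_vec[OF S(2) x v(1)])
    also have "\<dots> = l \<cdot>\<^sub>v ?w" unfolding v(3) by (rule mult_mat_vec[OF S(2) v(1)])
    finally show ?thesis .
  qed
  ultimately show "l \<in> spectrum (mat_conj s x)" by (intro spectrumI[OF mat_conj_carrier[OF s x] w])
qed

lemma spectrum_conj:
  assumes s: "s \<in> GLn n" and x: "x \<in> carrier_mat n n"
  shows "spectrum (mat_conj s x) = spectrum x"
  using spectrum_conj_subset[OF s x] spectrum_conj_subset[OF minv_GLn[OF s] mat_conj_carrier[OF s x]]
  unfolding mat_conj_minv[OF s x] by blast

lemma pm_conj:
  assumes "s \<in> GLn n" "x \<in> carrier_mat n n"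
  shows "pm p (mat_conj s x) = mat_conj s (pm p x)"
proof -
  note s = GLnD[OF assms(1)]
  have c: "mat_conj s x \<in> carrier_mat n n" using assms by simp
  have "s * mat_conj s x = x * s"
  proof -
    have "s * mat_conj s x = s * (minv s * (x * s))" unfolding mat_conj_def using s assms
      by (simp add: assoc_mult_mat[of _ n n _ n _ n])
    also have "\<dots> = s * minv s * (x * s)" by (rule assoc_mult_mat[symmetric, of _ n n _ n _ n]) (use s assms in auto)
    finally show ?thesis using s assms by simp
  qed
  then have "s * pm p (mat_conj s x) = pm p x * s" by (rule pm_commute[OF s(1) c assms(2)])
  then have "mat_conj s (pm p x) = minv s * (s * pm p (mat_conj s x))"
    unfolding mat_conj_def using s assms by (simp add: assoc_mult_mat[of _ n n _ n _ n] pm_carrier)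
  also have "\<dots> = minv s * s * pm p (mat_conj s x)" by (rule assoc_mult_mat[symmetric, of _ n n _ n _ n]) (use s c in auto)
  finally show ?thesis unfolding s(4) using left_mult_one_mat[OF pm_carrier[OF c]] by simp
qed

lemma hfc_dsum:
  assumes x: "x \<in> carrier_mat n n" and y: "y \<in> carrier_mat m m" and V: "open V" "spectrum x \<subseteq> V" "spectrum y \<subseteq> V" "g holomorphic_on V"
  shows "hfc g (mat_dsum x y) = mat_dsum (hfc g x) (hfc g y)"
proof -
  have "\<exists>P. \<forall>z\<in>{x, y, mat_dsum x y}. hfc g z = pm P z \<and> (\<forall>l\<in>spectrum z. poly P l = g l)"
    by (rule hfc_common_poly[OF _ _ V(1) _ V(4)]) (use x y V spectrum_dsum[OF x y] in auto)
  then obtain P where "hfc g x = pm P x" "hfc g y = pm P y" "hfc g (mat_dsum x y) = pm P (mat_dsum x y)" by auto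
  then show ?thesis by (simp add: pm_dsum[OF x y])
qed

lemma hfc_conj:
  assumes s: "s \<in> GLn n" and x: "x \<in> carrier_mat n n" and V: "open V" "spectrum x \<subseteq> V" "g holomorphic_on V"
  shows "hfc g (mat_conj s x) = mat_conj s (hfc g x)"
proof -
  have "\<exists>P. \<forall>z\<in>{x, mat_conj s x}. hfc g z = pm P z \<and> (\<forall>l\<in>spectrum z. poly P l = g l)"
    by (rule hfc_common_poly[OF _ _ V(1) _ V(3)]) (use x s V spectrum_conj[OF s x] in auto)
  then obtain P where "hfc g x = pm P x" "hfc g (mat_conj s x) = pm P (mat_conj s x)" by auto
  then show ?thesis by (simp add: pm_conj[OF s x])
qed

lemma hfc_poly:
  assumes x: "x \<in> carrier_mat n n" and V: "open V" "spectrum x \<subseteq> V" "g holomorphic_on V"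
  obtains P where "hfc g x = pm P x" "\<And>l. l \<in> spectrum x \<Longrightarrow> poly P l = g l"
  using hfc_common_poly[of "{x}" V g] x V by auto

text \<open>Along the line \<open>u1 + t E\<close> each entry of a commutator is affine in
  \<open>t\<close>. For every matrix treated so far some entry is not identically zero, by the
  earlier step or by the choice of \<open>E\<close>, so only finitely many \<open>t\<close>
  fail.\<close>

lemma noncommuting_perturbation:
  assumes "finite \<J>" "\<And>J. J \<in> \<J> \<Longrightarrow> J \<in> carrier_mat n n \<and> (\<exists>E\<in>carrier_mat n n. E * J \<noteq> J * E)"
    and "u \<in> carrier_mat n n" "\<eta> > 0"
  shows "\<exists>u'\<in>carrier_mat n n. opnorm (u - u') \<le> \<eta> \<and> (\<forall>J\<in>\<J>. u' * J \<noteq> (J * u' :: complex mat))"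
  using assms(1,2,4)
proof (induction arbitrary: \<eta>)
  case empty
  then show ?case using assms(3) by (intro bexI[of _ u]) (auto simp: minus_r_inv_mat[OF assms(3)])
next
  case (insert J \<J>)
  then obtain u1 where u1: "u1 \<in> carrier_mat n n" "opnorm (u - u1) \<le> \<eta> / 2" "\<forall>J\<in>\<J>. u1 * J \<noteq> J * u1"
    using insert.IH[of "\<eta> / 2"] by auto
  obtain E where E: "E \<in> carrier_mat n n" "E * J \<noteq> J * E" and J: "J \<in> carrier_mat n n" using insert.prems by blast
  define f where "f K t = (u1 + t \<cdot>\<^sub>m E) * K - K * (u1 + t \<cdot>\<^sub>m E)" for K t
  have comm: "(u1 + t \<cdot>\<^sub>m E) * K - K * (u1 + t \<cdot>\<^sub>m E) = (u1 * K - K * u1) + t \<cdot>\<^sub>m (E * K - K * E)"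
    if K: "K \<in> carrier_mat n n" for K t
  proof -
    have tE: "t \<cdot>\<^sub>m E \<in> carrier_mat n n" using E by simp
    show ?thesis
      unfolding add_mult_distrib_mat[OF u1(1) tE K] mult_add_distrib_mat[OF K u1(1) tE]
        mult_smult_assoc_mat[OF E(1) K] mult_smult_distrib[OF K E(1)]
      using u1(1) E(1) K by (intro eq_matI) (auto simp del: index_mult_mat(1) simp: algebra_simps)
  qed
  have eqd: "A = B \<longleftrightarrow> A - B = 0\<^sub>m n n" if c: "A \<in> carrier_mat n n" "B \<in> carrier_mat n n" for A B :: "complex mat"
  proof
    assume 0: "A - B = 0\<^sub>m n n"
    have "(A - B) $$ (i, j) = 0" if "i < n" "j < n" for i j unfolding 0 using that by simp
    then show "A = B" using c by (intro eq_matI) auto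
  qed (use c in auto)
  have bad: "finite {t. t \<noteq> 0 \<and> (u1 + t \<cdot>\<^sub>m E) * K = K * (u1 + t \<cdot>\<^sub>m E)}" if K: "K \<in> insert J \<J>" for K
  proof -
    have Kc: "K \<in> carrier_mat n n" using K insert.prems by blast
    have cA: "u1 * K \<in> carrier_mat n n" "K * u1 \<in> carrier_mat n n" "E * K \<in> carrier_mat n n" "K * E \<in> carrier_mat n n"
      "\<And>t. (u1 + t \<cdot>\<^sub>m E) * K \<in> carrier_mat n n" "\<And>t. K * (u1 + t \<cdot>\<^sub>m E) \<in> carrier_mat n n"
      using Kc u1(1) E(1) by (auto intro!: mult_carrier_mat)
    have entry: "((u1 + t \<cdot>\<^sub>m E) * K - K * (u1 + t \<cdot>\<^sub>m E)) $$ (i, j) = (u1 * K - K * u1) $$ (i, j) + t * (E * K - K * E) $$ (i, j)"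
      if "i < n" "j < n" for i j t
      unfolding comm[OF Kc] using that Kc E(1) u1(1) by (simp del: index_mult_mat(1) index_minus_mat(1))
    have non0: "\<exists>i<n. \<exists>j<n. (A - B) $$ (i, j) \<noteq> 0" if "A \<noteq> B" "A \<in> carrier_mat n n" "B \<in> carrier_mat n n" for A B :: "complex mat"
    proof (rule ccontr)
      assume "\<not> ?thesis"
      then have "A - B = 0\<^sub>m n n" using that by (intro eq_matI) auto
      then show False using eqd that by blast
    qed
    have "u1 * K \<noteq> K * u1 \<or> E * K \<noteq> K * E" using K u1(3) E(2) by auto
    then obtain i j where ij: "i < n" "j < n" "(u1 * K - K * u1) $$ (i, j) \<noteq> 0 \<or> (E * K - K * E) $$ (i, j) \<noteq> 0"
      using non0[OF _ cA(1,2)] non0[OF _ cA(3,4)] by blast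
    let ?a = "(u1 * K - K * u1) $$ (i, j)" and ?b = "(E * K - K * E) $$ (i, j)"
    have "{t. t \<noteq> 0 \<and> (u1 + t \<cdot>\<^sub>m E) * K = K * (u1 + t \<cdot>\<^sub>m E)} \<subseteq> {t. t \<noteq> 0 \<and> ?a + t * ?b = 0}"
    proof safe
      fix t assume "(u1 + t \<cdot>\<^sub>m E) * K = K * (u1 + t \<cdot>\<^sub>m E)"
      then have "(u1 + t \<cdot>\<^sub>m E) * K - K * (u1 + t \<cdot>\<^sub>m E) = 0\<^sub>m n n" using eqd[OF cA(5,6)] by simp
      then show "?a + t * ?b = 0" using entry[OF ij(1,2), of t] ij by simp
    qed
    also have "\<dots> \<subseteq> {- ?a / ?b}"
    proof -
      have "t = - a / b" if "t \<noteq> 0" "a + t * b = 0" "a \<noteq> 0 \<or> b \<noteq> 0" for a b t :: complex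
      proof -
        have "b \<noteq> 0" using that by auto
        moreover have "t * b = - a" using that(2) by (simp add: eq_neg_iff_add_eq_0 add.commute)
        ultimately show ?thesis using nonzero_eq_divide_eq[of b t "- a"] by blast
      qed
      from this[OF _ _ ij(3)] show ?thesis by blast
    qed
    finally show ?thesis using finite_subset by blast
  qed
  define T where "T = (\<Union>K\<in>insert J \<J>. {t. t \<noteq> 0 \<and> (u1 + t \<cdot>\<^sub>m E) * K = K * (u1 + t \<cdot>\<^sub>m E)}) \<union> {0}"
  have "finite T" using bad insert.hyps by (auto simp: T_def)
  define \<delta> where "\<delta> = \<eta> / (2 * (opnorm E + 1))"
  have \<delta>: "\<delta> > 0" unfolding \<delta>_def
  proof (rule divide_pos_pos[OF insert.prems(2)])
    show "0 < 2 * (opnorm E + 1)" by (intro mult_pos_pos add_nonneg_pos opnorm_nonneg) auto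
  qed
  have "infinite (ball (0::complex) \<delta>)" using \<delta> uncountable_ball countable_finite by blast
  then obtain t where t: "t \<in> ball 0 \<delta>" "t \<notin> T" using \<open>finite T\<close> by (meson finite_subset subsetI)
  show ?case
  proof (intro bexI conjI ballI)
    show c: "u1 + t \<cdot>\<^sub>m E \<in> carrier_mat n n" using u1 E by simp
    fix K assume "K \<in> insert J \<J>"
    then show "(u1 + t \<cdot>\<^sub>m E) * K \<noteq> K * (u1 + t \<cdot>\<^sub>m E)" using t(2) by (auto simp: T_def)
  next
    have eq: "u - (u1 + t \<cdot>\<^sub>m E) = (u - u1) - t \<cdot>\<^sub>m E" using assms(3) u1 E by (intro eq_matI) auto
    have tE: "t \<cdot>\<^sub>m E \<in> carrier_mat n n" using E by simp
    have "opnorm (u - (u1 + t \<cdot>\<^sub>m E)) \<le> opnorm (u - u1) + opnorm (t \<cdot>\<^sub>m E)"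
      unfolding eq by (rule opnorm_diff[OF minus_carrier_mat[OF u1(1)] tE])
    also have "opnorm (t \<cdot>\<^sub>m E) \<le> \<eta> / 2"
    proof -
      have "cmod t * opnorm E \<le> \<delta> * (opnorm E + 1)" using t(1) \<delta> by (intro mult_mono) auto
      also have "\<dots> = \<eta> / 2" unfolding \<delta>_def using opnorm_nonneg[of E]
        by (simp add: divide_simps) (simp add: add_nonneg_eq_0_iff)
      finally show ?thesis by (simp add: opnorm_smult)
    qed
    finally show "opnorm (u - (u1 + t \<cdot>\<^sub>m E)) \<le> \<eta>" using u1(2) by simp
  qed
qed

section \<open>Half sum and half difference of a pair\<close>

text \<open>In these coordinates \<open>pi_map\<close> sends a pair to
  \<open>[u, d * d, d * u * d]\<close>, and \<open>flip\<close> only changes the sign of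
  \<open>d\<close>.\<close>

definition uu :: "point \<Rightarrow> complex mat" where "uu w = (1/2) \<cdot>\<^sub>m (w ! 0 + w ! 1)"
definition dd :: "point \<Rightarrow> complex mat" where "dd w = (1/2) \<cdot>\<^sub>m (w ! 0 - w ! 1)"
definition mk :: "complex mat \<Rightarrow> complex mat \<Rightarrow> point" where "mk u d = [u + d, u - d]"

lemma level2E:
  assumes "w \<in> level 2 n"
  obtains a b where "w = [a, b]" "a \<in> carrier_mat n n" "b \<in> carrier_mat n n"
proof -
  have "length w = 2" using assms by (simp add: level_def)
  then obtain a b where "w = [a, b]" by (metis (no_types, opaque_lifting) One_nat_def Suc_1 length_0_conv length_Suc_conv)
  then show thesis using that assms by (auto simp: level_def)
qed

lemma level2I [intro]: "a \<in> carrier_mat n n \<Longrightarrow> b \<in> carrier_mat n n \<Longrightarrow> [a, b] \<in> level 2 n"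
  by (auto simp: level_def)

lemma level2_iff: "[a, b] \<in> level 2 n \<longleftrightarrow> a \<in> carrier_mat n n \<and> b \<in> carrier_mat n n"
  by (auto simp: level_def)

lemma uu_carrier [simp, intro]: "w \<in> level 2 n \<Longrightarrow> uu w \<in> carrier_mat n n"
  and dd_carrier [simp, intro]: "w \<in> level 2 n \<Longrightarrow> dd w \<in> carrier_mat n n"
  by (auto elim!: level2E simp: uu_def dd_def)

lemma mk_level: "u \<in> carrier_mat n n \<Longrightarrow> d \<in> carrier_mat n n \<Longrightarrow> mk u d \<in> level 2 n"
  by (auto simp: mk_def)

lemma uu_mk: "u \<in> carrier_mat n n \<Longrightarrow> d \<in> carrier_mat n n \<Longrightarrow> uu (mk u d) = u"
  and dd_mk: "u \<in> carrier_mat n n \<Longrightarrow> d \<in> carrier_mat n n \<Longrightarrow> dd (mk u d) = d"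
  by (auto simp: uu_def dd_def mk_def intro!: eq_matI)

lemma mk_uu_dd: "w \<in> level 2 n \<Longrightarrow> mk (uu w) (dd w) = w"
  by (auto elim!: level2E simp: uu_def dd_def mk_def intro!: eq_matI) (simp_all add: field_simps)

lemma flip_level: "w \<in> level 2 n \<Longrightarrow> flip w \<in> level 2 n"
  by (auto elim!: level2E simp: flip_def)

lemma uu_flip: "w \<in> level 2 n \<Longrightarrow> uu (flip w) = uu w"
  and dd_flip: "w \<in> level 2 n \<Longrightarrow> dd (flip w) = - dd w"
  by (auto elim!: level2E simp: flip_def uu_def dd_def intro!: eq_matI) (simp_all add: diff_divide_distrib)

lemma smult_smult_mat: "a \<cdot>\<^sub>m (b \<cdot>\<^sub>m A) = (a * b) \<cdot>\<^sub>m A" for a b :: complex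
  by (intro eq_matI) auto

lemma pi_map_mk:
  assumes u: "u \<in> carrier_mat n n" and d: "d \<in> carrier_mat n n"
  shows "pi_map (mk u d) = [u, d * d, d * u * d]"
proof -
  have 1: "u + d - (u - d) = 2 \<cdot>\<^sub>m d" "u + d + (u - d) = 2 \<cdot>\<^sub>m u" using u d by (auto intro!: eq_matI)
  have 2: "(2 \<cdot>\<^sub>m d) * (2 \<cdot>\<^sub>m d) = 4 \<cdot>\<^sub>m (d * d)"
    using d by (simp add: mult_smult_distrib[of _ n n _ n] mult_smult_assoc_mat[of _ n n _ n] smult_smult_mat)
  have 3: "(2 \<cdot>\<^sub>m d) * (2 \<cdot>\<^sub>m u) * (2 \<cdot>\<^sub>m d) = 8 \<cdot>\<^sub>m (d * u * d)"
  proof -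
    have "(2 \<cdot>\<^sub>m d) * (2 \<cdot>\<^sub>m u) = 4 \<cdot>\<^sub>m (d * u)"
      using u d by (simp add: mult_smult_distrib[of _ n n _ n] mult_smult_assoc_mat[of _ n n _ n] smult_smult_mat)
    moreover have "(4 \<cdot>\<^sub>m (d * u)) * (2 \<cdot>\<^sub>m d) = 8 \<cdot>\<^sub>m (d * u * d)"
      using mult_smult_assoc_mat[of "d * u" n n "2 \<cdot>\<^sub>m d" n 4] mult_smult_distrib[of "d * u" n n d n 2] u d
      by (simp add: smult_smult_mat)
    ultimately show ?thesis by simp
  qed
  have s: "(1/4) \<cdot>\<^sub>m (4 \<cdot>\<^sub>m A) = A" "(1/2) \<cdot>\<^sub>m (2 \<cdot>\<^sub>m A) = A" "(1/8) \<cdot>\<^sub>m (8 \<cdot>\<^sub>m A) = A" for A :: "complex mat" by (auto intro!: eq_matI)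
  show ?thesis unfolding pi_map_def mk_def Let_def by (simp add: 1 2 3 s)
qed

lemma pi_map_coords: "w \<in> level 2 n \<Longrightarrow> pi_map w = [uu w, dd w * dd w, dd w * uu w * dd w]"
  using pi_map_mk[of "uu w" n "dd w"] mk_uu_dd[of w n] by simp

lemma pi_map_level: assumes w: "w \<in> level 2 n" shows "pi_map w \<in> level 3 n"
proof -
  have c: "uu w \<in> carrier_mat n n" "dd w \<in> carrier_mat n n" using w by auto
  show ?thesis unfolding pi_map_coords[OF w] level_def
    using c mult_carrier_mat[OF c(2,2)] mult_carrier_mat[OF mult_carrier_mat[OF c(2,1)] c(2)] by simp
qed

lemma pi_map_flip: assumes w: "w \<in> level 2 n" shows "pi_map (flip w) = pi_map w"
proof -
  have "dd w \<in> carrier_mat n n" "uu w \<in> carrier_mat n n" using w by auto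
  then show ?thesis unfolding pi_map_coords[OF w] pi_map_coords[OF flip_level[OF w]] uu_flip[OF w] dd_flip[OF w]
    by (simp add: uminus_mult_left_mat uminus_mult_right_mat)
qed

lemma uu_dsum: "w \<in> level 2 n \<Longrightarrow> w' \<in> level 2 m \<Longrightarrow> uu (pt_dsum w w') = mat_dsum (uu w) (uu w')"
  and dd_dsum: "w \<in> level 2 n \<Longrightarrow> w' \<in> level 2 m \<Longrightarrow> dd (pt_dsum w w') = mat_dsum (dd w) (dd w')"
  by (auto elim!: level2E simp: pt_dsum_def uu_def dd_def mat_dsum_add[of _ n _ m] mat_dsum_smult)

lemma uu_conj: "s \<in> GLn n \<Longrightarrow> w \<in> level 2 n \<Longrightarrow> uu (pt_conj s w) = mat_conj s (uu w)"
  and dd_conj: "s \<in> GLn n \<Longrightarrow> w \<in> level 2 n \<Longrightarrow> dd (pt_conj s w) = mat_conj s (dd w)"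
  by (auto elim!: level2E simp: pt_conj_def uu_def dd_def mat_conj_add[of s n] mat_conj_smult[of s n])

lemma pi_map_dsum:
  assumes "w \<in> level 2 n" "w' \<in> level 2 m" shows "pi_map (pt_dsum w w') = pt_dsum (pi_map w) (pi_map w')"
proof -
  have c: "dd w \<in> carrier_mat n n" "uu w \<in> carrier_mat n n" "dd w' \<in> carrier_mat m m" "uu w' \<in> carrier_mat m m" using assms by auto
  then have c': "dd w * uu w \<in> carrier_mat n n" "dd w' * uu w' \<in> carrier_mat m m" by auto
  show ?thesis unfolding pi_map_coords[OF assms(1)] pi_map_coords[OF assms(2)] pi_map_coords[OF pt_dsum_level[OF assms]]
    uu_dsum[OF assms] dd_dsum[OF assms] using c c' by (simp add: pt_dsum_def mat_dsum_mult[of _ n _ m])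
qed

lemma pi_map_conj:
  assumes "s \<in> GLn n" "w \<in> level 2 n" shows "pi_map (pt_conj s w) = pt_conj s (pi_map w)"
proof -
  have c: "dd w \<in> carrier_mat n n" "uu w \<in> carrier_mat n n" using assms by auto
  then have c': "dd w * uu w \<in> carrier_mat n n" by auto
  show ?thesis unfolding pi_map_coords[OF assms(2)] pi_map_coords[OF pt_conj_level[OF assms]]
    uu_conj[OF assms] dd_conj[OF assms] using c c' by (simp add: pt_conj_def mat_conj_mult[OF assms(1)])
qed

section \<open>Branches of the square root\<close>

lemma D_gam_iff: "x \<in> D_gam r \<gamma> \<longleftrightarrow> (\<exists>n\<ge>1. x \<in> carrier_mat n n) \<and> spectrum x \<subseteq> discs r \<gamma>"
  by (simp add: D_gam_def)

lemma nc_space2_iff: "[u, x] \<in> nc_space 2 \<longleftrightarrow> (\<exists>n\<ge>1. u \<in> carrier_mat n n \<and> x \<in> carrier_mat n n)"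
  by (auto simp: nc_space_def level2_iff)

lemma nc_space2E:
  assumes "w \<in> nc_space 2"
  obtains n a b where "n \<ge> 1" "w \<in> level 2 n" "w = [a, b]" "a \<in> carrier_mat n n" "b \<in> carrier_mat n n"
proof -
  obtain n where n: "n \<ge> 1" "w \<in> level 2 n" by (rule nc_spaceE[OF assms])
  show thesis by (rule level2E[OF n(2)]) (rule that[OF n])
qed

lemma W_gam_iff: "w \<in> W_gam r \<gamma> \<longleftrightarrow> w \<in> nc_space 2 \<and> spectrum (w ! 1) \<subseteq> discs r \<gamma>"
proof
  assume "w \<in> W_gam r \<gamma>"
  then show "w \<in> nc_space 2 \<and> spectrum (w ! 1) \<subseteq> discs r \<gamma>" by (auto simp: W_gam_def D_gam_iff)
next
  assume w: "w \<in> nc_space 2 \<and> spectrum (w ! 1) \<subseteq> discs r \<gamma>"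
  then obtain n a b where "n \<ge> 1" "w = [a, b]" "a \<in> carrier_mat n n" "b \<in> carrier_mat n n" by (blast elim: nc_space2E)
  then show "w \<in> W_gam r \<gamma>" using w by (auto simp: W_gam_def D_gam_iff)
qed

lemma U_gam_iff: "w \<in> U_gam r \<gamma> \<longleftrightarrow> w \<in> W_gam r \<gamma> \<and>
  (\<forall>\<tau>\<in>nonconst_signs \<gamma>. w ! 0 * I_mat r \<gamma> \<tau> (w ! 1) \<noteq> I_mat r \<gamma> \<tau> (w ! 1) * w ! 0)"
proof
  assume "w \<in> U_gam r \<gamma>"
  then show "w \<in> W_gam r \<gamma> \<and> (\<forall>\<tau>\<in>nonconst_signs \<gamma>. w ! 0 * I_mat r \<gamma> \<tau> (w ! 1) \<noteq> I_mat r \<gamma> \<tau> (w ! 1) * w ! 0)"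
    by (auto simp: U_gam_def)
next
  assume w: "w \<in> W_gam r \<gamma> \<and> (\<forall>\<tau>\<in>nonconst_signs \<gamma>. w ! 0 * I_mat r \<gamma> \<tau> (w ! 1) \<noteq> I_mat r \<gamma> \<tau> (w ! 1) * w ! 0)"
  then obtain a b where "w = [a, b]" by (auto simp: W_gam_def)
  then show "w \<in> U_gam r \<gamma>" using w by (auto simp: U_gam_def)
qed

lemma nonconst_signs_subset: "\<tau> \<in> nonconst_signs \<gamma> \<Longrightarrow> \<tau> \<in> signs \<gamma>"
  by (simp add: nonconst_signs_def)

lemma finite_signs: "\<gamma> \<in> Gam \<Longrightarrow> finite (signs \<gamma>)" and finite_nonconst_signs: "\<gamma> \<in> Gam \<Longrightarrow> finite (nonconst_signs \<gamma>)"
proof -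
  assume "\<gamma> \<in> Gam"
  then show "finite (signs \<gamma>)" unfolding signs_def by (intro finite_PiE) (auto simp: Gam_def)
  then show "finite (nonconst_signs \<gamma>)" by (rule rev_finite_subset) (auto simp: nonconst_signs_def)
qed

lemma blockm_smult: "n \<ge> 1 \<Longrightarrow> (\<And>a b. a < k \<Longrightarrow> b < l \<Longrightarrow> G a b \<in> carrier_mat n n) \<Longrightarrow>
  blockm k l n (\<lambda>a b. c \<cdot>\<^sub>m G a b) = c \<cdot>\<^sub>m blockm k l n G"
proof (rule eq_matI)
  fix i j assume A: "n \<ge> 1" "\<And>a b. a < k \<Longrightarrow> b < l \<Longrightarrow> G a b \<in> carrier_mat n n"
    and "i < dim_row (c \<cdot>\<^sub>m blockm k l n G)" "j < dim_col (c \<cdot>\<^sub>m blockm k l n G)"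
  then have ij: "i < k * n" "j < l * n" by auto
  then have "G (i div n) (j div n) \<in> carrier_mat n n" by (intro A) (auto simp: less_mult_imp_div_less)
  then show "blockm k l n (\<lambda>a b. c \<cdot>\<^sub>m G a b) $$ (i, j) = (c \<cdot>\<^sub>m blockm k l n G) $$ (i, j)"
    using ij A(1) by (simp add: blockm_def)
qed simp_all

lemma block_ball_free_base:
  assumes "0 < d" "0 < k" "0 < l" "\<And>a c. a < k \<Longrightarrow> c < l \<Longrightarrow> polyfun d (G a c)" "0 < K"
  shows "{x \<in> nc_space d. opnorm (blockm k l (lvl x) (\<lambda>a c. G a c x)) < K} \<in> free_base d"
proof -
  have "{x \<in> nc_space d. opnorm (blockm k l (lvl x) (\<lambda>a c. G a c x)) < K} = base_set d k l (\<lambda>a c x. complex_of_real (1 / K) \<cdot>\<^sub>m G a c x)"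
  proof -
    have "blockm k l (lvl x) (\<lambda>a c. complex_of_real (1 / K) \<cdot>\<^sub>m G a c x) = complex_of_real (1 / K) \<cdot>\<^sub>m blockm k l (lvl x) (\<lambda>a c. G a c x)"
      if "x \<in> nc_space d" for x
    proof (rule blockm_smult)
      show "1 \<le> lvl x" using nc_space_lvl that assms(1) by blast
      show "G a b x \<in> carrier_mat (lvl x) (lvl x)" if "a < k" "b < l" for a b
        using polyfun_carrier[OF assms(4)[OF that]] nc_space_lvl[OF \<open>x \<in> nc_space d\<close> assms(1)] assms(1) by blast
    qed
    then show ?thesis using assms(5) by (auto simp: base_set_def opnorm_smult norm_divide)
  qed
  also have "\<dots> \<in> free_base d" using assms by (intro base_set_in_free_base polyfun_smult) auto
  finally show ?thesis .
qed

locale radii_branches =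
  fixes r :: "complex set \<Rightarrow> real" and sq :: "complex set \<Rightarrow> complex \<Rightarrow> complex"
  assumes radii: "admissible_radii r" and branches: "sqrt_branches r sq"
begin

text \<open>The branch of the square root selected by \<open>\<tau>\<close>; \<open>S_mat\<close> is
  its functional calculus.\<close>

definition gg :: "complex set \<Rightarrow> (complex \<Rightarrow> complex) \<Rightarrow> complex \<Rightarrow> complex" where
  "gg \<gamma> \<tau> z = sq \<gamma> z * iota r \<gamma> \<tau> z"

text \<open>The range of \<open>gg \<gamma> \<tau>\<close>: the numbers that the chosen branch
  recovers from their squares. For \<open>\<gamma> \<in> Gam\<close> it never contains both
  \<open>z\<close> and \<open>- z\<close>.\<close>

definition VV :: "complex set \<Rightarrow> (complex \<Rightarrow> complex) \<Rightarrow> complex set" where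
  "VV \<gamma> \<tau> = {z. z\<^sup>2 \<in> discs r \<gamma> \<and> gg \<gamma> \<tau> (z\<^sup>2) = z}"

lemma open_discs: "open (discs r \<gamma>)" by (auto simp: discs_def)

lemma zero_notin_discs: "\<gamma> \<in> Gam \<Longrightarrow> 0 \<notin> discs r \<gamma>"
  using radii by (fastforce simp: discs_def admissible_radii_def)

text \<open>The radii are below a quarter of the distances between centres, so the discs are
  disjoint and \<open>THE\<close> has a unique candidate.\<close>

lemma iota_eq:
  assumes "\<gamma> \<in> Gam" "c \<in> \<gamma>" "z \<in> ball c (r \<gamma>)" shows "iota r \<gamma> \<tau> z = \<tau> c"
proof -
  have "(THE c. c \<in> \<gamma> \<and> z \<in> ball c (r \<gamma>)) = c"
  proof (rule the_equality)
    fix e assume e: "e \<in> \<gamma> \<and> z \<in> ball e (r \<gamma>)"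
    show "e = c"
    proof (rule ccontr)
      assume "e \<noteq> c"
      then have lt: "r \<gamma> < cmod (e - c) / 4" using radii assms e unfolding admissible_radii_def by blast
      have "dist e c \<le> dist e z + dist c z" by (metis dist_commute dist_triangle)
      also have "\<dots> < r \<gamma> + r \<gamma>" using assms e by (intro add_strict_mono) auto
      finally show False using lt radii assms(1) by (fastforce simp: dist_norm admissible_radii_def)
    qed
  qed (use assms in auto)
  then show ?thesis by (simp add: iota_def)
qed

lemma iota_cases:
  assumes "\<gamma> \<in> Gam" "\<tau> \<in> signs \<gamma>" "z \<in> discs r \<gamma>" shows "iota r \<gamma> \<tau> z = 1 \<or> iota r \<gamma> \<tau> z = -1"
proof -
  obtain c where c: "c \<in> \<gamma>" "z \<in> ball c (r \<gamma>)" using assms by (auto simp: discs_def)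
  show ?thesis unfolding iota_eq[OF assms(1) c] using assms(2) c by (auto simp: signs_def)
qed

lemma iota_holo: "\<gamma> \<in> Gam \<Longrightarrow> iota r \<gamma> \<tau> holomorphic_on discs r \<gamma>"
  unfolding discs_def
proof (rule holomorphic_on_UN_open)
  fix c assume c: "\<gamma> \<in> Gam" "c \<in> \<gamma>"
  show "iota r \<gamma> \<tau> holomorphic_on ball c (r \<gamma>)"
    by (rule holomorphic_transform[OF holomorphic_on_const[of "\<tau> c"]]) (use iota_eq c in auto)
qed auto

lemma sq_holo: "\<gamma> \<in> Gam \<Longrightarrow> sq \<gamma> holomorphic_on discs r \<gamma>"
  and sq_sq: "\<gamma> \<in> Gam \<Longrightarrow> z \<in> discs r \<gamma> \<Longrightarrow> sq \<gamma> z * sq \<gamma> z = z"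
  using branches by (auto simp: sqrt_branches_def power2_eq_square)

lemma gg_holo: "\<gamma> \<in> Gam \<Longrightarrow> gg \<gamma> \<tau> holomorphic_on discs r \<gamma>"
  unfolding gg_def by (intro holomorphic_on_mult sq_holo iota_holo)

lemma gg_sq: "\<gamma> \<in> Gam \<Longrightarrow> \<tau> \<in> signs \<gamma> \<Longrightarrow> z \<in> discs r \<gamma> \<Longrightarrow> gg \<gamma> \<tau> z * gg \<gamma> \<tau> z = z"
  using iota_cases[of \<gamma> \<tau> z] sq_sq[of \<gamma> z] by (auto simp: gg_def)

lemma gg_nonzero: "\<gamma> \<in> Gam \<Longrightarrow> \<tau> \<in> signs \<gamma> \<Longrightarrow> z \<in> discs r \<gamma> \<Longrightarrow> gg \<gamma> \<tau> z \<noteq> 0"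
  using gg_sq[of \<gamma> \<tau> z] zero_notin_discs[of \<gamma>] by auto

text \<open>At \<open>z\<^sup>2\<close> the branch can only take the values \<open>z\<close> and
  \<open>- z\<close>, and these differ. The defining equation is thus equivalent to the open
  condition \<open>gg \<gamma> \<tau> (z\<^sup>2) + z \<noteq> 0\<close>.\<close>

lemma open_VV: assumes "\<gamma> \<in> Gam" "\<tau> \<in> signs \<gamma>" shows "open (VV \<gamma> \<tau>)"
proof -
  define A where "A = (\<lambda>z :: complex. z\<^sup>2) -` discs r \<gamma>"
  have A: "open A" unfolding A_def by (intro continuous_open_vimage open_discs continuous_intros)
  have "continuous_on (discs r \<gamma>) (gg \<gamma> \<tau>)" using gg_holo[OF assms(1)] by (rule holomorphic_on_imp_continuous_on)
  then have "continuous_on A (\<lambda>z. gg \<gamma> \<tau> (z\<^sup>2))"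
    by (rule continuous_on_compose2) (auto simp: A_def intro!: continuous_intros)
  then have "open (A \<inter> (\<lambda>z. gg \<gamma> \<tau> (z\<^sup>2) + z) -` (- {0}))"
    by (intro continuous_open_preimage A continuous_intros) auto
  moreover have "A \<inter> (\<lambda>z. gg \<gamma> \<tau> (z\<^sup>2) + z) -` (- {0}) = VV \<gamma> \<tau>"
  proof -
    have "gg \<gamma> \<tau> (z\<^sup>2) + z \<noteq> 0 \<longleftrightarrow> gg \<gamma> \<tau> (z\<^sup>2) = z" if z: "z\<^sup>2 \<in> discs r \<gamma>" for z
    proof -
      have "(gg \<gamma> \<tau> (z\<^sup>2) + z) * (gg \<gamma> \<tau> (z\<^sup>2) - z) = 0"
        using gg_sq[OF assms z] by (simp add: algebra_simps power2_eq_square)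
      moreover have "z \<noteq> 0" using z zero_notin_discs[OF assms(1)] by auto
      ultimately show ?thesis by auto
    qed
    then show ?thesis by (auto simp: A_def VV_def)
  qed
  ultimately show ?thesis by simp
qed

lemma VV_regular: "\<gamma> \<in> Gam \<Longrightarrow> \<tau> \<in> signs \<gamma> \<Longrightarrow> z \<in> VV \<gamma> \<tau> \<Longrightarrow> - z \<notin> VV \<gamma> \<tau>"
  using zero_notin_discs[of \<gamma>] by (auto simp: VV_def)

text \<open>Distinct points of \<open>Z\<close> have distinct squares, so \<open>\<tau>\<close> can
  correct the sign of \<open>sq \<gamma>\<close> at each square separately.\<close>

lemma regular_VV:
  assumes Z: "finite Z" "\<And>z. z \<in> Z \<Longrightarrow> - z \<notin> Z"
  defines "\<gamma> \<equiv> (\<lambda>z. z\<^sup>2) ` Z"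
  shows "\<gamma> \<in> Gam" "\<exists>\<tau>\<in>signs \<gamma>. Z \<subseteq> VV \<gamma> \<tau>"
proof -
  have "0 \<notin> Z" using Z(2)[of 0] by auto
  then show G: "\<gamma> \<in> Gam" using Z by (auto simp: Gam_def \<gamma>_def)
  define \<tau> where "\<tau> = (\<lambda>c\<in>\<gamma>. if sq \<gamma> c \<in> Z then 1 else -1 :: complex)"
  have \<tau>: "\<tau> \<in> signs \<gamma>" by (auto simp: \<tau>_def signs_def)
  have "Z \<subseteq> VV \<gamma> \<tau>"
  proof
    fix z assume z: "z \<in> Z"
    then have c: "z\<^sup>2 \<in> \<gamma>" by (simp add: \<gamma>_def)
    have rp: "r \<gamma> > 0" using radii G by (auto simp: admissible_radii_def)
    then have cb: "z\<^sup>2 \<in> ball (z\<^sup>2) (r \<gamma>)" by simp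
    have cd: "z\<^sup>2 \<in> discs r \<gamma>" unfolding discs_def by (rule UN_I[of "z\<^sup>2" \<gamma> "z\<^sup>2" "\<lambda>c. ball c (r \<gamma>)", OF c cb])
    have "(sq \<gamma> (z\<^sup>2) - z) * (sq \<gamma> (z\<^sup>2) + z) = 0" using sq_sq[OF G cd] by (simp add: algebra_simps power2_eq_square)
    then have "sq \<gamma> (z\<^sup>2) = z \<or> sq \<gamma> (z\<^sup>2) = - z" by (auto simp: add_eq_0_iff2)
    then have "gg \<gamma> \<tau> (z\<^sup>2) = z"
      unfolding gg_def iota_eq[OF G c cb] using z Z(2)[OF z] c by (auto simp: \<tau>_def)
    then show "z \<in> VV \<gamma> \<tau>" using cd by (simp add: VV_def)
  qed
  then show "\<exists>\<tau>\<in>signs \<gamma>. Z \<subseteq> VV \<gamma> \<tau>" using \<tau> by blast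
qed

lemma S_mat_hfc:
  assumes "\<gamma> \<in> Gam" "x \<in> carrier_mat n n" "spectrum x \<subseteq> discs r \<gamma>"
  shows "S_mat r sq \<gamma> \<tau> x = hfc (gg \<gamma> \<tau>) x"
  unfolding S_mat_def gg_def using assms
  by (intro hfc_mult[OF assms(2) open_discs assms(3), symmetric] sq_holo iota_holo)

lemma S_mat_carrier: "x \<in> carrier_mat n n \<Longrightarrow> S_mat r sq \<gamma> \<tau> x \<in> carrier_mat n n"
  unfolding S_mat_def by (rule mult_carrier_mat[OF hfc_carrier hfc_carrier])

lemma S_mat_sq:
  assumes "\<gamma> \<in> Gam" "\<tau> \<in> signs \<gamma>" "x \<in> carrier_mat n n" "spectrum x \<subseteq> discs r \<gamma>"
  shows "S_mat r sq \<gamma> \<tau> x * S_mat r sq \<gamma> \<tau> x = x"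
proof -
  have "S_mat r sq \<gamma> \<tau> x * S_mat r sq \<gamma> \<tau> x = hfc (\<lambda>z. gg \<gamma> \<tau> z * gg \<gamma> \<tau> z) x"
    unfolding S_mat_hfc[OF assms(1,3,4)] by (rule hfc_mult[OF assms(3) open_discs assms(4) gg_holo gg_holo, symmetric]) (rule assms(1))+
  also have "\<dots> = pm [:0, 1:] x" by (rule hfc_cong_poly[OF assms(3) open_discs assms(4)]) (simp add: gg_sq[OF assms(1,2)])
  finally show ?thesis using assms(3) by (simp add: pm_X)
qed

lemma S_mat_poly:
  assumes "\<gamma> \<in> Gam" "x \<in> carrier_mat n n" "spectrum x \<subseteq> discs r \<gamma>"
  obtains P where "S_mat r sq \<gamma> \<tau> x = pm P x" "\<And>l. l \<in> spectrum x \<Longrightarrow> poly P l = gg \<gamma> \<tau> l"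
  unfolding S_mat_hfc[OF assms] using hfc_poly[OF assms(2) open_discs assms(3) gg_holo[OF assms(1)]] that by blast

lemma spectrum_S_mat:
  assumes "\<gamma> \<in> Gam" "\<tau> \<in> signs \<gamma>" "x \<in> carrier_mat n n" "spectrum x \<subseteq> discs r \<gamma>"
  shows "spectrum (S_mat r sq \<gamma> \<tau> x) \<subseteq> VV \<gamma> \<tau>"
proof -
  obtain P where P: "S_mat r sq \<gamma> \<tau> x = pm P x" "\<And>l. l \<in> spectrum x \<Longrightarrow> poly P l = gg \<gamma> \<tau> l"
    by (rule S_mat_poly[OF assms(1,3,4)]) (rule that)
  have "gg \<gamma> \<tau> l \<in> VV \<gamma> \<tau>" if "l \<in> spectrum x" for l
    using gg_sq[OF assms(1,2), of l] assms(4) that by (auto simp: VV_def power2_eq_square)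
  then show ?thesis unfolding P(1) spectrum_pm[OF assms(3)] using P(2) by auto
qed

lemma square_spectrum:
  fixes d :: "complex mat"
  assumes "d \<in> carrier_mat n n" shows "spectrum (d * d) = (\<lambda>z. z\<^sup>2) ` spectrum d"
proof -
  have "d * d = pm ([:0, 1:] * [:0, 1:]) d" unfolding pm_mult[OF assms] pm_X[OF assms] ..
  then show ?thesis unfolding spectrum_pm[OF assms, symmetric] using spectrum_pm[OF assms, of "[:0, 1:] * [:0, 1:]"]
    by (auto simp: power2_eq_square image_iff)
qed

text \<open>The root \<open>e\<close> of \<open>d * d\<close> given by the branch is a polynomial of
  \<open>d * d\<close> and commutes with \<open>d\<close>. On an eigenvector of \<open>d\<close> it
  has the same eigenvalue, by the spectral hypothesis; hence \<open>e + d\<close> is injective and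
  \<open>(e + d) * (e - d) = 0\<close> gives \<open>e = d\<close>.\<close>

lemma S_mat_square:
  assumes "\<gamma> \<in> Gam" "\<tau> \<in> signs \<gamma>" "d \<in> carrier_mat n n" "spectrum d \<subseteq> VV \<gamma> \<tau>"
  shows "spectrum (d * d) \<subseteq> discs r \<gamma>" "S_mat r sq \<gamma> \<tau> (d * d) = d"
proof -
  have dd: "d * d \<in> carrier_mat n n" using assms by simp
  show sp: "spectrum (d * d) \<subseteq> discs r \<gamma>" unfolding square_spectrum[OF assms(3)] using assms(4) by (auto simp: VV_def)
  define e where "e = S_mat r sq \<gamma> \<tau> (d * d)"
  have e: "e \<in> carrier_mat n n" unfolding e_def by (rule S_mat_carrier[OF dd])
  obtain P where P0: "S_mat r sq \<gamma> \<tau> (d * d) = pm P (d * d)" "\<And>l. l \<in> spectrum (d * d) \<Longrightarrow> poly P l = gg \<gamma> \<tau> l"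
    by (rule S_mat_poly[OF assms(1) dd sp]) (rule that)
  note P = P0[folded e_def]
  have ee: "e * e = d * d" unfolding e_def by (rule S_mat_sq[OF assms(1,2) dd sp])
  have de: "d * e = e * d" unfolding P(1)
    by (rule pm_commute[OF assms(3) dd dd]) (use assms(3) in \<open>simp add: assoc_mult_mat[of _ n n _ n _ n]\<close>)
  have M: "e + d \<in> carrier_mat n n" "(e + d) * d = d * (e + d)"
    using assms(3) e de by (auto simp: add_mult_distrib_mat[of _ n n _ _ n] mult_add_distrib_mat[of _ n n _ n])
  have "(e + d) * (e - d) = (e * e + d * e) - (e * d + d * d)"
    using assms(3) e by (simp add: add_mult_distrib_mat[of _ n n _ _ n] mult_minus_distrib_mat[of _ n n _ n])
  also have "\<dots> = 0\<^sub>m n n" unfolding ee de using assms(3) e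
    by (intro eq_matI) (auto simp del: index_mult_mat(1))
  finally have 0: "(e + d) * (e - d) = 0\<^sub>m n n" .
  have "e - d = 0\<^sub>m n n"
  proof (rule inj_cancel[OF M(1) _ 0])
    fix v :: "complex vec" assume v: "v \<in> carrier_vec n" "v \<noteq> 0\<^sub>v n"
    show "(e + d) *\<^sub>v v \<noteq> 0\<^sub>v n"
    proof
      assume k: "(e + d) *\<^sub>v v = 0\<^sub>v n"
      obtain w l where w: "w \<in> carrier_vec n" "w \<noteq> 0\<^sub>v n" "d *\<^sub>v w = l \<cdot>\<^sub>v w" "(e + d) *\<^sub>v w = 0\<^sub>v n" "l \<in> spectrum d"
        by (rule common_eigenvector[OF assms(3) M v k])
      have "(d * d) *\<^sub>v w = l\<^sup>2 \<cdot>\<^sub>v w"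
        unfolding assoc_mult_mat_vec[OF assms(3,3) w(1)] w(3) mult_mat_vec[OF assms(3) w(1)]
        by (intro eq_vecI) (auto simp: power2_eq_square)
      then have "e *\<^sub>v w = poly P (l\<^sup>2) \<cdot>\<^sub>v w" unfolding P(1) by (rule pm_eigen[OF dd w(1)])
      also have "poly P (l\<^sup>2) = l" using P(2)[of "l\<^sup>2"] w(5) assms(4) by (auto simp: square_spectrum[OF assms(3)] VV_def)
      finally have ew: "e *\<^sub>v w = l \<cdot>\<^sub>v w" .
      have 2: "l \<cdot>\<^sub>v w + l \<cdot>\<^sub>v w = 0\<^sub>v n" using w(4) unfolding add_mult_distrib_mat_vec[OF e assms(3) w(1)] ew w(3) .
      have "w = 0\<^sub>v n"
      proof (rule eq_vecI)
        fix i assume "i < dim_vec (0\<^sub>v n :: complex vec)"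
        then have i: "i < n" by simp
        have "vec_index (l \<cdot>\<^sub>v w + l \<cdot>\<^sub>v w) i = 0" unfolding 2 using i by simp
        then have "l * vec_index w i = 0" using i w(1) by simp
        moreover have "l \<noteq> 0" using w(5) assms(4) zero_notin_discs[OF assms(1)] by (auto simp: VV_def)
        ultimately show "vec_index w i = vec_index (0\<^sub>v n) i" using i by simp
      qed (use w(1) in simp)
      then show False using w(2) by simp
    qed
  qed (use assms(3) in simp)
  then have "(e - d) $$ (i, j) = 0" if "i < n" "j < n" for i j using that by simp
  then show "S_mat r sq \<gamma> \<tau> (d * d) = d" unfolding e_def[symmetric] using e assms(3) by (intro eq_matI) auto
qed

lemma omega_mk: "omega r sq \<gamma> \<tau> p = mk (p ! 0) (S_mat r sq \<gamma> \<tau> (p ! 1))"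
  by (simp add: omega_def mk_def Let_def)

lemma W_gamE:
  assumes "p \<in> W_gam r \<gamma>"
  obtains n where "n \<ge> 1" "p \<in> level 2 n" "p ! 0 \<in> carrier_mat n n" "p ! 1 \<in> carrier_mat n n" "spectrum (p ! 1) \<subseteq> discs r \<gamma>"
proof -
  have p: "p \<in> nc_space 2" "spectrum (p ! 1) \<subseteq> discs r \<gamma>" using assms by (auto simp: W_gam_iff)
  obtain n where n: "n \<ge> 1" "p \<in> level 2 n" by (rule nc_spaceE[OF p(1)])
  show thesis by (rule that[OF n _ _ p(2)]) (use n levelD in auto)
qed

lemma omega_coords:
  assumes "\<gamma> \<in> Gam" "\<tau> \<in> signs \<gamma>" "p \<in> W_gam r \<gamma>" "p \<in> level 2 n"
  shows "omega r sq \<gamma> \<tau> p \<in> level 2 n" "uu (omega r sq \<gamma> \<tau> p) = p ! 0" "dd (omega r sq \<gamma> \<tau> p) = S_mat r sq \<gamma> \<tau> (p ! 1)"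
    "dd (omega r sq \<gamma> \<tau> p) * dd (omega r sq \<gamma> \<tau> p) = p ! 1" "spectrum (dd (omega r sq \<gamma> \<tau> p)) \<subseteq> VV \<gamma> \<tau>"
proof -
  have c: "p ! 0 \<in> carrier_mat n n" "p ! 1 \<in> carrier_mat n n" using levelD(2)[OF assms(4)] by auto
  have sp: "spectrum (p ! 1) \<subseteq> discs r \<gamma>" using assms(3) by (simp add: W_gam_iff)
  note S = S_mat_carrier[OF c(2), of \<gamma> \<tau>]
  show "omega r sq \<gamma> \<tau> p \<in> level 2 n" unfolding omega_mk by (rule mk_level[OF c(1) S])
  show "uu (omega r sq \<gamma> \<tau> p) = p ! 0" unfolding omega_mk by (rule uu_mk[OF c(1) S])
  show d: "dd (omega r sq \<gamma> \<tau> p) = S_mat r sq \<gamma> \<tau> (p ! 1)" unfolding omega_mk by (rule dd_mk[OF c(1) S])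
  show "dd (omega r sq \<gamma> \<tau> p) * dd (omega r sq \<gamma> \<tau> p) = p ! 1" unfolding d by (rule S_mat_sq[OF assms(1,2) c(2) sp])
  show "spectrum (dd (omega r sq \<gamma> \<tau> p)) \<subseteq> VV \<gamma> \<tau>" unfolding d by (rule spectrum_S_mat[OF assms(1,2) c(2) sp])
qed

lemma omega_inv:
  assumes "\<gamma> \<in> Gam" "\<tau> \<in> signs \<gamma>" "w \<in> level 2 n" "n \<ge> 1" "spectrum (dd w) \<subseteq> VV \<gamma> \<tau>"
  shows "[uu w, dd w * dd w] \<in> W_gam r \<gamma>" "omega r sq \<gamma> \<tau> [uu w, dd w * dd w] = w"
proof -
  have c: "dd w \<in> carrier_mat n n" "uu w \<in> carrier_mat n n" using assms(3) by auto
  show "[uu w, dd w * dd w] \<in> W_gam r \<gamma>"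
    unfolding W_gam_iff nc_space2_iff using S_mat_square(1)[OF assms(1,2) c(1) assms(5)] c assms(4) by auto
  show "omega r sq \<gamma> \<tau> [uu w, dd w * dd w] = w"
    using S_mat_square(2)[OF assms(1,2) c(1) assms(5)] mk_uu_dd[OF assms(3)] by (simp add: omega_mk)
qed

text \<open>Trades the image of a functional calculus for a condition on the spectrum of the half
  difference, which direct sums and similarities visibly respect.\<close>

lemma omega_W_iff:
  assumes "\<gamma> \<in> Gam" "\<tau> \<in> signs \<gamma>"
  shows "w \<in> omega r sq \<gamma> \<tau> ` W_gam r \<gamma> \<longleftrightarrow> w \<in> nc_space 2 \<and> spectrum (dd w) \<subseteq> VV \<gamma> \<tau>"
proof
  assume "w \<in> omega r sq \<gamma> \<tau> ` W_gam r \<gamma>"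
  then obtain p where p: "p \<in> W_gam r \<gamma>" "w = omega r sq \<gamma> \<tau> p" by blast
  obtain n where n: "n \<ge> 1" "p \<in> level 2 n" by (rule W_gamE[OF p(1)])
  show "w \<in> nc_space 2 \<and> spectrum (dd w) \<subseteq> VV \<gamma> \<tau>"
    unfolding p(2) using omega_coords[OF assms p(1) n(2)] nc_spaceI n(1) by blast
next
  assume w: "w \<in> nc_space 2 \<and> spectrum (dd w) \<subseteq> VV \<gamma> \<tau>"
  then obtain n where n: "n \<ge> 1" "w \<in> level 2 n" by (blast elim: nc_spaceE)
  show "w \<in> omega r sq \<gamma> \<tau> ` W_gam r \<gamma>" using omega_inv[OF assms n(2,1)] w by (metis imageI)
qed

lemma omega_U_iff:
  assumes "\<gamma> \<in> Gam" "\<tau> \<in> signs \<gamma>"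
  shows "w \<in> omega r sq \<gamma> \<tau> ` U_gam r \<gamma> \<longleftrightarrow> w \<in> nc_space 2 \<and> spectrum (dd w) \<subseteq> VV \<gamma> \<tau> \<and> [uu w, dd w * dd w] \<in> U_gam r \<gamma>"
proof
  assume "w \<in> omega r sq \<gamma> \<tau> ` U_gam r \<gamma>"
  then obtain p where p: "p \<in> U_gam r \<gamma>" "w = omega r sq \<gamma> \<tau> p" by blast
  then have pW: "p \<in> W_gam r \<gamma>" by (simp add: U_gam_iff)
  obtain n where n: "n \<ge> 1" "p \<in> level 2 n" by (rule W_gamE[OF pW])
  note oc = omega_coords[OF assms pW n(2)]
  have "p = [p ! 0, p ! 1]" by (rule level2E[OF n(2)]) simp
  then have eq: "[uu w, dd w * dd w] = p" unfolding p(2) oc(2,4) by simp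
  have "w \<in> nc_space 2" unfolding p(2) by (rule nc_spaceI[OF n(1) oc(1)])
  moreover have "spectrum (dd w) \<subseteq> VV \<gamma> \<tau>" unfolding p(2) by (rule oc(5))
  ultimately show "w \<in> nc_space 2 \<and> spectrum (dd w) \<subseteq> VV \<gamma> \<tau> \<and> [uu w, dd w * dd w] \<in> U_gam r \<gamma>"
    using p(1) unfolding eq by simp
next
  assume w: "w \<in> nc_space 2 \<and> spectrum (dd w) \<subseteq> VV \<gamma> \<tau> \<and> [uu w, dd w * dd w] \<in> U_gam r \<gamma>"
  then obtain n where n: "n \<ge> 1" "w \<in> level 2 n" by (blast elim: nc_spaceE)
  show "w \<in> omega r sq \<gamma> \<tau> ` U_gam r \<gamma>" using omega_inv[OF assms n(2,1)] w by (metis imageI)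
qed

text \<open>Radii and branches drop out, because any finite set disjoint from its negative fits into
  some \<open>VV \<gamma> \<tau>\<close>.\<close>

lemma S_o_iff: "w \<in> S_o r sq S \<longleftrightarrow> w \<in> S \<and> w \<in> nc_space 2 \<and> (\<forall>z\<in>spectrum (dd w). - z \<notin> spectrum (dd w))"
proof
  assume "w \<in> S_o r sq S"
  then obtain \<gamma> \<tau> where g: "\<gamma> \<in> Gam" "\<tau> \<in> signs \<gamma>" "w \<in> S" "w \<in> omega r sq \<gamma> \<tau> ` W_gam r \<gamma>" by (auto simp: S_o_def)
  then have "w \<in> nc_space 2" "spectrum (dd w) \<subseteq> VV \<gamma> \<tau>" using omega_W_iff[OF g(1,2)] by blast+
  then show "w \<in> S \<and> w \<in> nc_space 2 \<and> (\<forall>z\<in>spectrum (dd w). - z \<notin> spectrum (dd w))"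
    using VV_regular[OF g(1,2)] g(3) by blast
next
  assume w: "w \<in> S \<and> w \<in> nc_space 2 \<and> (\<forall>z\<in>spectrum (dd w). - z \<notin> spectrum (dd w))"
  then obtain n where n: "n \<ge> 1" "w \<in> level 2 n" by (blast elim: nc_spaceE)
  then have fin: "finite (spectrum (dd w))" using finite_spectrum dd_carrier by blast
  obtain \<tau> where g: "(\<lambda>z. z\<^sup>2) ` spectrum (dd w) \<in> Gam" "\<tau> \<in> signs ((\<lambda>z. z\<^sup>2) ` spectrum (dd w))" "spectrum (dd w) \<subseteq> VV ((\<lambda>z. z\<^sup>2) ` spectrum (dd w)) \<tau>"
    using regular_VV[OF fin] w by blast
  then show "w \<in> S_o r sq S" using omega_W_iff[OF g(1,2), of w] w unfolding S_o_def by blast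
qed

lemma I_mat_carrier: "x \<in> carrier_mat n n \<Longrightarrow> I_mat r \<gamma> \<tau> x \<in> carrier_mat n n"
  by (simp add: I_mat_def)

lemma I_mat_dsum:
  assumes "\<gamma> \<in> Gam" "x \<in> carrier_mat n n" "y \<in> carrier_mat m m" "spectrum x \<subseteq> discs r \<gamma>" "spectrum y \<subseteq> discs r \<gamma>"
  shows "I_mat r \<gamma> \<tau> (mat_dsum x y) = mat_dsum (I_mat r \<gamma> \<tau> x) (I_mat r \<gamma> \<tau> y)"
  unfolding I_mat_def by (rule hfc_dsum[OF assms(2,3) open_discs assms(4,5) iota_holo[OF assms(1)]])

lemma I_mat_conj:
  assumes "\<gamma> \<in> Gam" "s \<in> GLn n" "x \<in> carrier_mat n n" "spectrum x \<subseteq> discs r \<gamma>"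
  shows "I_mat r \<gamma> \<tau> (mat_conj s x) = mat_conj s (I_mat r \<gamma> \<tau> x)"
  unfolding I_mat_def by (rule hfc_conj[OF assms(2,3) open_discs assms(4) iota_holo[OF assms(1)]])

lemma S_mat_dsum:
  assumes "\<gamma> \<in> Gam" "x \<in> carrier_mat n n" "y \<in> carrier_mat m m" "spectrum x \<subseteq> discs r \<gamma>" "spectrum y \<subseteq> discs r \<gamma>"
  shows "S_mat r sq \<gamma> \<tau> (mat_dsum x y) = mat_dsum (S_mat r sq \<gamma> \<tau> x) (S_mat r sq \<gamma> \<tau> y)"
proof -
  have sp: "spectrum (mat_dsum x y) \<subseteq> discs r \<gamma>" using spectrum_dsum assms by auto
  show ?thesis unfolding S_mat_hfc[OF assms(1,2,4)] S_mat_hfc[OF assms(1,3,5)] S_mat_hfc[OF assms(1) mat_dsum_carrier[OF assms(2,3)] sp]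
    by (rule hfc_dsum[OF assms(2,3) open_discs assms(4,5) gg_holo[OF assms(1)]])
qed

lemma S_mat_conj:
  assumes "\<gamma> \<in> Gam" "s \<in> GLn n" "x \<in> carrier_mat n n" "spectrum x \<subseteq> discs r \<gamma>"
  shows "S_mat r sq \<gamma> \<tau> (mat_conj s x) = mat_conj s (S_mat r sq \<gamma> \<tau> x)"
proof -
  have sp: "spectrum (mat_conj s x) \<subseteq> discs r \<gamma>" using spectrum_conj assms by auto
  show ?thesis unfolding S_mat_hfc[OF assms(1,3,4)] S_mat_hfc[OF assms(1) mat_conj_carrier[OF assms(2,3)] sp]
    by (rule hfc_conj[OF assms(2,3) open_discs assms(4) gg_holo[OF assms(1)]])
qed

lemma W_gam_dsum:
  assumes "p \<in> W_gam r \<gamma>" "q \<in> W_gam r \<gamma>" shows "pt_dsum p q \<in> W_gam r \<gamma>"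
proof -
  obtain n where n: "n \<ge> 1" "p \<in> level 2 n" "p ! 0 \<in> carrier_mat n n" "p ! 1 \<in> carrier_mat n n" "spectrum (p ! 1) \<subseteq> discs r \<gamma>" by (rule W_gamE[OF assms(1)])
  obtain m where m: "m \<ge> 1" "q \<in> level 2 m" "q ! 0 \<in> carrier_mat m m" "q ! 1 \<in> carrier_mat m m" "spectrum (q ! 1) \<subseteq> discs r \<gamma>" by (rule W_gamE[OF assms(2)])
  show ?thesis unfolding W_gam_iff
    using pt_dsum_nc_space[OF nc_spaceI[OF n(1,2)] nc_spaceI[OF m(1,2)]] pt_dsum_nth[OF n(2) m(2), of 1] spectrum_dsum[OF n(4) m(4)] n(5) m(5) by simp
qed

text \<open>The commutator of block-diagonal matrices vanishes only if it vanishes in each block, so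
  one generic summand is enough.\<close>

lemma U_gam_dsum:
  assumes g: "\<gamma> \<in> Gam" and p: "p \<in> W_gam r \<gamma>" and q: "q \<in> W_gam r \<gamma>" and pq: "p \<in> U_gam r \<gamma> \<or> q \<in> U_gam r \<gamma>"
  shows "pt_dsum p q \<in> U_gam r \<gamma>"
proof -
  obtain n where n: "n \<ge> 1" "p \<in> level 2 n" "p ! 0 \<in> carrier_mat n n" "p ! 1 \<in> carrier_mat n n" "spectrum (p ! 1) \<subseteq> discs r \<gamma>" by (rule W_gamE[OF p])
  obtain m where m: "m \<ge> 1" "q \<in> level 2 m" "q ! 0 \<in> carrier_mat m m" "q ! 1 \<in> carrier_mat m m" "spectrum (q ! 1) \<subseteq> discs r \<gamma>" by (rule W_gamE[OF q])
  have nth: "pt_dsum p q ! 0 = mat_dsum (p ! 0) (q ! 0)" "pt_dsum p q ! 1 = mat_dsum (p ! 1) (q ! 1)"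
    using pt_dsum_nth[OF n(2) m(2)] by auto
  have "pt_dsum p q ! 0 * I_mat r \<gamma> \<tau> (pt_dsum p q ! 1) \<noteq> I_mat r \<gamma> \<tau> (pt_dsum p q ! 1) * pt_dsum p q ! 0"
    if t: "\<tau> \<in> nonconst_signs \<gamma>" for \<tau>
  proof
    assume eq: "pt_dsum p q ! 0 * I_mat r \<gamma> \<tau> (pt_dsum p q ! 1) = I_mat r \<gamma> \<tau> (pt_dsum p q ! 1) * pt_dsum p q ! 0"
    note I = I_mat_carrier[OF n(4), of \<gamma> \<tau>] I_mat_carrier[OF m(4), of \<gamma> \<tau>]
    have "mat_dsum (p ! 0 * I_mat r \<gamma> \<tau> (p ! 1)) (q ! 0 * I_mat r \<gamma> \<tau> (q ! 1)) = mat_dsum (I_mat r \<gamma> \<tau> (p ! 1) * p ! 0) (I_mat r \<gamma> \<tau> (q ! 1) * q ! 0)"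
      using eq unfolding nth I_mat_dsum[OF g n(4) m(4) n(5) m(5)] mat_dsum_mult[OF n(3) m(3) I] mat_dsum_mult[OF I n(3) m(3)] .
    then have "p ! 0 * I_mat r \<gamma> \<tau> (p ! 1) = I_mat r \<gamma> \<tau> (p ! 1) * p ! 0 \<and> q ! 0 * I_mat r \<gamma> \<tau> (q ! 1) = I_mat r \<gamma> \<tau> (q ! 1) * q ! 0"
      by (subst (asm) mat_dsum_inject[OF mult_carrier_mat[OF n(3) I(1)] mult_carrier_mat[OF m(3) I(2)] mult_carrier_mat[OF I(1) n(3)] mult_carrier_mat[OF I(2) m(3)]])
    then show False using pq t unfolding U_gam_iff by blast
  qed
  then show ?thesis unfolding U_gam_iff using W_gam_dsum[OF p q] by blast
qed

lemma U_gam_conj: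
  assumes g: "\<gamma> \<in> Gam" and p: "p \<in> U_gam r \<gamma>" "p \<in> level 2 n" and s: "s \<in> GLn n"
  shows "pt_conj s p \<in> U_gam r \<gamma>"
proof -
  have pW: "p \<in> W_gam r \<gamma>" using p by (simp add: U_gam_iff)
  have c: "p ! 0 \<in> carrier_mat n n" "p ! 1 \<in> carrier_mat n n" using levelD(2)[OF p(2)] by auto
  have sp: "spectrum (p ! 1) \<subseteq> discs r \<gamma>" and nc: "p \<in> nc_space 2" using pW by (auto simp: W_gam_iff)
  have n1: "n \<ge> 1" using nc_space_lvl[OF nc] lvl_level[OF p(2)] by simp
  have nth: "pt_conj s p ! 0 = mat_conj s (p ! 0)" "pt_conj s p ! 1 = mat_conj s (p ! 1)"
    using pt_conj_nth[OF p(2)] by auto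
  have W: "pt_conj s p \<in> W_gam r \<gamma>"
    unfolding W_gam_iff nth spectrum_conj[OF s c(2)] using sp nc_spaceI[OF n1 pt_conj_level[OF s p(2)]] by blast
  have "mat_conj s (p ! 0) * I_mat r \<gamma> \<tau> (mat_conj s (p ! 1)) \<noteq> I_mat r \<gamma> \<tau> (mat_conj s (p ! 1)) * mat_conj s (p ! 0)"
    if t: "\<tau> \<in> nonconst_signs \<gamma>" for \<tau>
  proof
    note I = I_mat_carrier[OF c(2), of \<gamma> \<tau>]
    assume "mat_conj s (p ! 0) * I_mat r \<gamma> \<tau> (mat_conj s (p ! 1)) = I_mat r \<gamma> \<tau> (mat_conj s (p ! 1)) * mat_conj s (p ! 0)"
    then have "mat_conj s (p ! 0 * I_mat r \<gamma> \<tau> (p ! 1)) = mat_conj s (I_mat r \<gamma> \<tau> (p ! 1) * p ! 0)"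
      unfolding I_mat_conj[OF g s c(2) sp] mat_conj_mult[OF s c(1) I] mat_conj_mult[OF s I c(1)] .
    then have "p ! 0 * I_mat r \<gamma> \<tau> (p ! 1) = I_mat r \<gamma> \<tau> (p ! 1) * p ! 0"
      using mat_conj_minv[OF s mult_carrier_mat[OF c(1) I]] mat_conj_minv[OF s mult_carrier_mat[OF I c(1)]] by metis
    then show False using p(1) t unfolding U_gam_iff by blast
  qed
  then show ?thesis unfolding U_gam_iff nth using W by blast
qed

text \<open>With \<open>\<gamma>\<close> equal to the spectrum, a nonconstant \<open>\<tau>\<close>
  gives \<open>I_mat\<close> both eigenvalues 1 and -1. It is then not scalar, and
  \<open>noncommuting_perturbation\<close> applies.\<close>

lemma U_gam_perturbation:
  assumes x: "x \<in> carrier_mat n n" "n \<ge> 1" and g: "\<gamma> \<in> Gam" "spectrum x = \<gamma>" and u: "u \<in> carrier_mat n n" and e: "\<eta> > 0"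
  obtains u' where "u' \<in> carrier_mat n n" "opnorm (u - u') \<le> \<eta>" "[u', x] \<in> U_gam r \<gamma>"
proof -
  have rp: "r \<gamma> > 0" using radii g by (auto simp: admissible_radii_def)
  have sp: "spectrum x \<subseteq> discs r \<gamma>" using g rp by (auto simp: discs_def)
  have "\<exists>E\<in>carrier_mat n n. E * I_mat r \<gamma> \<tau> x \<noteq> I_mat r \<gamma> \<tau> x * E" if t: "\<tau> \<in> nonconst_signs \<gamma>" for \<tau>
  proof -
    obtain c e where ce: "c \<in> \<gamma>" "e \<in> \<gamma>" "\<tau> c \<noteq> \<tau> e" using t by (auto simp: nonconst_signs_def)
    define J where "J = I_mat r \<gamma> \<tau> x"
    have J: "J \<in> carrier_mat n n" unfolding J_def by (rule I_mat_carrier[OF x(1)])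
    obtain P where P0: "hfc (iota r \<gamma> \<tau>) x = pm P x" "\<And>l. l \<in> spectrum x \<Longrightarrow> poly P l = iota r \<gamma> \<tau> l"
      by (rule hfc_poly[OF x(1) open_discs sp iota_holo[OF g(1)]]) (rule that)
    note P = P0[folded I_mat_def, folded J_def]
    have pv: "poly P l = \<tau> l" if "l \<in> \<gamma>" for l using P(2)[of l] iota_eq[OF g(1) that, of l] rp that g(2) by simp
    have cs: "c \<in> spectrum x" "e \<in> spectrum x" using ce g(2) by auto
    obtain v where v: "v \<in> carrier_vec n" "v \<noteq> 0\<^sub>v n" "x *\<^sub>v v = c \<cdot>\<^sub>v v" by (rule spectrumE[OF cs(1) x(1)])
    obtain w where w: "w \<in> carrier_vec n" "w \<noteq> 0\<^sub>v n" "x *\<^sub>v w = e \<cdot>\<^sub>v w" by (rule spectrumE[OF cs(2) x(1)])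
    have Jv: "J *\<^sub>v v = \<tau> c \<cdot>\<^sub>v v" "J *\<^sub>v w = \<tau> e \<cdot>\<^sub>v w"
      unfolding P(1) pv[OF ce(1), symmetric] pv[OF ce(2), symmetric] by (rule pm_eigen[OF x(1) v(1,3)], rule pm_eigen[OF x(1) w(1,3)])
    obtain i where i: "i < n" "vec_index v i \<noteq> 0" using v(1,2) by (metis carrier_vecD eq_vecI index_zero_vec)
    obtain j where j: "j < n" "vec_index w j \<noteq> 0" using w(1,2) by (metis carrier_vecD eq_vecI index_zero_vec)
    \<comment> \<open>A rank-one matrix taking the eigenvector \<open>v\<close> to \<open>w\<close>;
      their eigenvalues under \<open>J\<close> differ, so \<open>E\<close> and \<open>J\<close> do
      not commute.\<close>
    define E where "E = Matrix.mat n n (\<lambda>(a, b). if b = i then vec_index w a / vec_index v i else 0)"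
    have E: "E \<in> carrier_mat n n" by (simp add: E_def)
    have Ev: "E *\<^sub>v v = w"
    proof (rule eq_vecI)
      fix a assume "a < dim_vec w"
      then have a: "a < n" using w(1) by simp
      have "vec_index (E *\<^sub>v v) a = (\<Sum>b<n. (if b = i then vec_index w a / vec_index v i else 0) * vec_index v b)"
        using a v(1) by (simp add: E_def scalar_prod_def atLeast0LessThan)
      also have "\<dots> = (\<Sum>b<n. if b = i then vec_index w a else 0)" using i by (intro sum.cong) auto
      also have "\<dots> = vec_index w a" using i by simp
      finally show "vec_index (E *\<^sub>v v) a = vec_index w a" .
    qed (use w(1) E in simp)
    have "E * J \<noteq> J * E"
    proof
      assume "E * J = J * E"
      then have "(E * J) *\<^sub>v v = (J * E) *\<^sub>v v" by simp
      then have "\<tau> c \<cdot>\<^sub>v w = \<tau> e \<cdot>\<^sub>v w"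
        unfolding assoc_mult_mat_vec[OF E J v(1)] assoc_mult_mat_vec[OF J E v(1)] Jv(1) mult_mat_vec[OF E v(1)] Ev Jv(2) .
      then have "vec_index (\<tau> c \<cdot>\<^sub>v w) j = vec_index (\<tau> e \<cdot>\<^sub>v w) j" by simp
      then show False using j w(1) ce(3) by simp
    qed
    then show ?thesis using E unfolding J_def by blast
  qed
  then have "\<And>J. J \<in> (\<lambda>\<tau>. I_mat r \<gamma> \<tau> x) ` nonconst_signs \<gamma> \<Longrightarrow> J \<in> carrier_mat n n \<and> (\<exists>E\<in>carrier_mat n n. E * J \<noteq> J * E)"
    using I_mat_carrier[OF x(1)] by blast
  from noncommuting_perturbation[OF finite_imageI[OF finite_nonconst_signs[OF g(1)]] this u e]
  obtain u' where u': "u' \<in> carrier_mat n n" "opnorm (u - u') \<le> \<eta>" "\<forall>J\<in>(\<lambda>\<tau>. I_mat r \<gamma> \<tau> x) ` nonconst_signs \<gamma>. u' * J \<noteq> J * u'" by blast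
  show thesis
  proof (rule that[OF u'(1,2)])
    have "[u', x] \<in> W_gam r \<gamma>" unfolding W_gam_iff nc_space2_iff using u'(1) x sp by auto
    then show "[u', x] \<in> U_gam r \<gamma>" unfolding U_gam_iff using u'(3) by auto
  qed
qed

end

section \<open>Freely and Zariski-freely open sets\<close>

context radii_branches begin

text \<open>The delicate point is the local bound: \<open>iota\<close> is a square root of 1, so
  \<open>hfc_approx\<close> bounds \<open>I_mat\<close> on a free neighbourhood at all levels at
  once. These functions cut out the varieties that are removed to leave the generic points.\<close>

lemma commutator_holo:
  assumes g: "\<gamma> \<in> Gam" "\<tau> \<in> signs \<gamma>" and D: "D \<in> free_top 2" and a: "polyfun 2 a" and c: "polyfun 2 c"
    and sp: "\<And>w. w \<in> D \<Longrightarrow> spectrum (c w) \<subseteq> discs r \<gamma>"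
  shows "holo 2 (free_top 2) D (\<lambda>w. a w * I_mat r \<gamma> \<tau> (c w) - I_mat r \<gamma> \<tau> (c w) * a w)"
proof -
  define h where "h w = a w * I_mat r \<gamma> \<tau> (c w) - I_mat r \<gamma> \<tau> (c w) * a w" for w
  have cc: "a w \<in> carrier_mat n n" "c w \<in> carrier_mat n n" "I_mat r \<gamma> \<tau> (c w) \<in> carrier_mat n n"
    if "w \<in> level 2 n" "n \<ge> 1" for w n
    using polyfun_carrier[OF a that(1) _ that(2)] polyfun_carrier[OF c that(1) _ that(2)] I_mat_carrier by auto
  have hc: "h w \<in> carrier_mat n n" if "w \<in> level 2 n" "n \<ge> 1" for w n
    unfolding h_def using cc[OF that] by (intro minus_carrier_mat mult_carrier_mat)
  have graded: "graded 2 E h" for E using hc by (auto simp: graded_def)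
  have nc: "nc_function 2 B h" if B: "B \<in> free_base 2" "B \<subseteq> D" for B
    unfolding nc_function_def
  proof (intro conjI ballI)
    show "nc_set 2 B" by (rule free_base_nc_set[OF B(1)]) simp
    show "graded 2 B h" by (rule graded)
    fix x y assume xy: "x \<in> B" "y \<in> B"
    obtain n where n: "n \<ge> 1" "x \<in> level 2 n" using xy(1) free_base_subset[OF B(1)] by (blast elim: nc_spaceE)
    obtain m where m: "m \<ge> 1" "y \<in> level 2 m" using xy(2) free_base_subset[OF B(1)] by (blast elim: nc_spaceE)
    note x = cc[OF n(2,1)] and y = cc[OF m(2,1)]
    have "a (pt_dsum x y) = mat_dsum (a x) (a y)" "c (pt_dsum x y) = mat_dsum (c x) (c y)"
      using polyfun_dsum[OF a n(2) m(2) _ n(1) m(1)] polyfun_dsum[OF c n(2) m(2) _ n(1) m(1)] by auto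
    moreover have "I_mat r \<gamma> \<tau> (mat_dsum (c x) (c y)) = mat_dsum (I_mat r \<gamma> \<tau> (c x)) (I_mat r \<gamma> \<tau> (c y))"
      by (rule I_mat_dsum[OF g(1) x(2) y(2)]) (use sp xy B(2) in blast)+
    ultimately show "h (pt_dsum x y) = mat_dsum (h x) (h y)"
      unfolding h_def
      by (simp only: mat_dsum_mult[OF x(1) y(1) x(3) y(3)] mat_dsum_mult[OF x(3) y(3) x(1) y(1)]
          mat_dsum_add(2)[OF mult_carrier_mat[OF x(1,3)] mult_carrier_mat[OF y(1,3)] mult_carrier_mat[OF x(3,1)] mult_carrier_mat[OF y(3,1)]])
  next
    show "similarity_preserving 2 B h"
      unfolding similarity_preserving_def
    proof (intro allI impI ballI)
      fix n x s assume n: "1 \<le> n" and x: "x \<in> B \<inter> level 2 n" and s: "s \<in> GLn n" and "pt_conj s x \<in> B"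
      have xl: "x \<in> level 2 n" using x by simp
      note X = cc[OF xl n]
      have 1: "a (pt_conj s x) = mat_conj s (a x)" "c (pt_conj s x) = mat_conj s (c x)"
        using polyfun_conj[OF a xl s _ n] polyfun_conj[OF c xl s _ n] by auto
      have 2: "I_mat r \<gamma> \<tau> (mat_conj s (c x)) = mat_conj s (I_mat r \<gamma> \<tau> (c x))"
        by (rule I_mat_conj[OF g(1) s X(2)]) (use sp x B(2) in blast)
      show "h (pt_conj s x) = mat_conj s (h x)"
        unfolding h_def 1 2 mat_conj_mult[OF s X(1,3)] mat_conj_mult[OF s X(3,1)]
          mat_conj_add(2)[OF s mult_carrier_mat[OF X(1,3)] mult_carrier_mat[OF X(3,1)]] ..
    qed
  qed
  have bdd: "\<exists>U\<in>free_top 2. w \<in> U \<and> U \<subseteq> D \<and> bounded_on U h" if w: "w \<in> D" for w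
  proof -
    have wn: "w \<in> nc_space 2" using free_top_subset[OF D] w by blast
    have two: "0 < (2::nat)" by simp
    have i2: "iota r \<gamma> \<tau> z * iota r \<gamma> \<tau> z = poly 1 z" "iota r \<gamma> \<tau> z \<noteq> 0" if "z \<in> discs r \<gamma>" for z
      using iota_cases[OF g that] by auto
    obtain q R where R: "R > 0" "\<And>e. e > 0 \<Longrightarrow> \<exists>N\<in>free_top 2. w \<in> N \<and>
      (\<forall>y\<in>N. spectrum (c y) \<subseteq> discs r \<gamma> \<and> opnorm (pm q (c y)) \<le> R \<and> opnorm (hfc (iota r \<gamma> \<tau>) (c y) - pm q (c y)) \<le> e)"
      by (rule hfc_approx[OF c two open_discs iota_holo[OF g(1)] i2 wn sp[OF w]]) (assumption, assumption, rule that)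
    obtain N where N: "N \<in> free_top 2" "w \<in> N" "\<And>y. y \<in> N \<Longrightarrow> opnorm (pm q (c y)) \<le> R \<and> opnorm (hfc (iota r \<gamma> \<tau>) (c y) - pm q (c y)) \<le> 1"
      using R(2)[of 1] by auto
    define A where "A = opnorm (a w) + 1"
    have A: "A > 0" unfolding A_def by (intro add_nonneg_pos) auto
    define U where "U = D \<inter> (N \<inter> {y \<in> nc_space 2. opnorm (a y) < A})"
    have U: "U \<in> free_top 2" unfolding U_def
      by (intro free_top_Int D N(1) free_base_open norm_ball_scaled_free_base a A) auto
    have "opnorm (h y) \<le> 2 * (A * (R + 1))" if y: "y \<in> U" for y
    proof -
      have "y \<in> nc_space 2" using y by (simp add: U_def)
      then obtain n where n: "n \<ge> 1" "y \<in> level 2 n" by (rule nc_spaceE)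
      note Y = cc[OF n(2,1)]
      have aA: "opnorm (a y) \<le> A" using y by (simp add: U_def)
      have q: "opnorm (pm q (c y)) \<le> R" "opnorm (hfc (iota r \<gamma> \<tau>) (c y) - pm q (c y)) \<le> 1" using N(3)[of y] y by (auto simp: U_def)
      have qc: "pm q (c y) \<in> carrier_mat n n" by (rule pm_carrier[OF Y(2)])
      have "I_mat r \<gamma> \<tau> (c y) = (I_mat r \<gamma> \<tau> (c y) - pm q (c y)) + pm q (c y)"
        using Y qc by (intro eq_matI) auto
      then have "opnorm (I_mat r \<gamma> \<tau> (c y)) \<le> opnorm (I_mat r \<gamma> \<tau> (c y) - pm q (c y)) + opnorm (pm q (c y))"
        using opnorm_add[OF minus_carrier_mat[OF qc] qc, of "I_mat r \<gamma> \<tau> (c y)"] by simp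
      then have I: "opnorm (I_mat r \<gamma> \<tau> (c y)) \<le> R + 1" using q unfolding I_mat_def by simp
      have p1: "opnorm (a y * I_mat r \<gamma> \<tau> (c y)) \<le> A * (R + 1)"
        by (rule order_trans[OF opnorm_mult[OF Y(1,3)] mult_mono[OF aA I]]) (use A in auto)
      have "opnorm (I_mat r \<gamma> \<tau> (c y) * a y) \<le> (R + 1) * A"
        by (rule order_trans[OF opnorm_mult[OF Y(3,1)] mult_mono[OF I aA]]) (use R(1) in auto)
      then show ?thesis unfolding h_def
        using p1 opnorm_diff[OF mult_carrier_mat[OF Y(1,3)] mult_carrier_mat[OF Y(3,1)]] by (simp add: mult.commute)
    qed
    then have "bounded_on U h" unfolding bounded_on_def by blast
    moreover have "w \<in> U" "U \<subseteq> D" using w N(2) wn A by (auto simp: U_def A_def)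
    ultimately show ?thesis using U by blast
  qed
  have "holo 2 (free_top 2) D h"
    unfolding holo_def
  proof (intro conjI ballI)
    fix w assume w: "w \<in> D"
    obtain B where B: "B \<in> free_base 2" "w \<in> B" "B \<subseteq> D" by (rule free_topE[OF D w])
    show "\<exists>U\<in>free_top 2. w \<in> U \<and> U \<subseteq> D \<and> nc_set 2 U \<and> nc_function 2 U h"
      by (rule bexI[of _ B]) (use B nc[OF B(1,3)] free_base_open free_base_nc_set[OF B(1)] in auto)
  qed (use D graded bdd in auto)
  then show ?thesis by (simp add: h_def[abs_def])
qed

text \<open>The functions \<open>a\<close> and \<open>c\<close> are kept general: they are the
  coordinates of a chart point in one application, and \<open>uu\<close> and the square of
  \<open>dd\<close> in the other.\<close>

lemma noncommuting_zariski_base: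
  assumes g: "\<gamma> \<in> Gam" and D: "D \<in> free_top 2" and a: "polyfun 2 a" and c: "polyfun 2 c"
    and sp: "\<And>w. w \<in> D \<Longrightarrow> spectrum (c w) \<subseteq> discs r \<gamma>"
  shows "{w \<in> D. \<forall>\<tau>\<in>nonconst_signs \<gamma>. a w * I_mat r \<gamma> \<tau> (c w) \<noteq> I_mat r \<gamma> \<tau> (c w) * a w} \<in> zariski_base 2"
proof -
  define h where "h \<tau> w = a w * I_mat r \<gamma> \<tau> (c w) - I_mat r \<gamma> \<tau> (c w) * a w" for \<tau> w
  define T where "T \<tau> = {w \<in> D. \<forall>f\<in>{h \<tau>}. f w = 0\<^sub>m (lvl w) (lvl w)}" for \<tau>
  have T: "free_variety 2 D (T \<tau>)" if "\<tau> \<in> nonconst_signs \<gamma>" for \<tau>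
    unfolding free_variety_def T_def h_def[abs_def]
    by (rule exI, rule conjI[OF _ refl]) (use commutator_holo[OF g nonconst_signs_subset[OF that] D a c sp] in blast)
  have eq: "w \<in> T \<tau> \<longleftrightarrow> a w * I_mat r \<gamma> \<tau> (c w) = I_mat r \<gamma> \<tau> (c w) * a w" if w: "w \<in> D" for w \<tau>
  proof -
    define n where "n = lvl w"
    have n: "w \<in> level 2 n" "n \<ge> 1" using free_top_subset[OF D] w nc_space_lvl by (auto simp: n_def)
    have cc: "a w \<in> carrier_mat n n" "I_mat r \<gamma> \<tau> (c w) \<in> carrier_mat n n"
      using polyfun_carrier[OF a n(1) _ n(2)] polyfun_carrier[OF c n(1) _ n(2)] I_mat_carrier by auto
    define A B where "A = a w * I_mat r \<gamma> \<tau> (c w)" "B = I_mat r \<gamma> \<tau> (c w) * a w"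
    note AB = this
    have AB_c: "A \<in> carrier_mat n n" "B \<in> carrier_mat n n" unfolding AB using cc by auto
    have "A - B = 0\<^sub>m n n \<longleftrightarrow> A = B"
    proof
      assume 0: "A - B = 0\<^sub>m n n"
      have "(A - B) $$ (i, j) = 0" if "i < n" "j < n" for i j unfolding 0 using that by simp
      then show "A = B" using AB_c by (intro eq_matI) auto
    qed (use AB_c in auto)
    then show ?thesis using w by (simp add: T_def h_def AB n_def)
  qed
  have "{w \<in> D. \<forall>\<tau>\<in>nonconst_signs \<gamma>. a w * I_mat r \<gamma> \<tau> (c w) \<noteq> I_mat r \<gamma> \<tau> (c w) * a w} = D - \<Union>(T ` nonconst_signs \<gamma>)"
    using eq by auto
  moreover have "D - \<Union>(T ` nonconst_signs \<gamma>) \<in> zariski_base 2"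
    unfolding zariski_base_def using D T finite_nonconst_signs[OF g] by blast
  ultimately show ?thesis by simp
qed

lemma polyfun_uu: "polyfun 2 uu" and polyfun_dd: "polyfun 2 dd"
proof -
  have 2: "polyfun 2 (\<lambda>w. w ! 0)" "polyfun 2 (\<lambda>w. w ! 1)" by (intro polyfun_coord; simp)+
  show "polyfun 2 uu" unfolding uu_def[abs_def] by (intro polyfun_smult polyfun_add 2) auto
  show "polyfun 2 dd" unfolding dd_def[abs_def] by (intro polyfun_smult polyfun_diff 2) auto
qed

lemma omega_U_zariski_base:
  assumes g: "\<gamma> \<in> Gam" "\<tau> \<in> signs \<gamma>" and O: "O' \<in> free_top 2"
  shows "omega r sq \<gamma> \<tau> ` U_gam r \<gamma> \<inter> O' \<in> zariski_base 2"
proof -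
  define D where "D = O' \<inter> {w \<in> nc_space 2. spectrum (dd w) \<subseteq> VV \<gamma> \<tau>}"
  have D: "D \<in> free_top 2" unfolding D_def
    by (intro free_top_Int O spectrum_open polyfun_dd open_VV g) auto
  have pd: "polyfun 2 (\<lambda>w. dd w * dd w)" by (intro polyfun_mult polyfun_dd) auto
  have Dsp: "[uu w, dd w * dd w] \<in> W_gam r \<gamma>" if w: "w \<in> D" for w
  proof -
    have "w \<in> nc_space 2" "spectrum (dd w) \<subseteq> VV \<gamma> \<tau>" using w by (auto simp: D_def)
    then obtain n where n: "n \<ge> 1" "w \<in> level 2 n" by (blast elim: nc_spaceE)
    show ?thesis by (rule omega_inv(1)[OF g n(2,1)]) fact
  qed
  have "omega r sq \<gamma> \<tau> ` U_gam r \<gamma> \<inter> O' = {w \<in> D. \<forall>\<tau>'\<in>nonconst_signs \<gamma>. uu w * I_mat r \<gamma> \<tau>' (dd w * dd w) \<noteq> I_mat r \<gamma> \<tau>' (dd w * dd w) * uu w}"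
  proof -
    have "w \<in> omega r sq \<gamma> \<tau> ` U_gam r \<gamma> \<inter> O' \<longleftrightarrow> w \<in> D \<and> [uu w, dd w * dd w] \<in> U_gam r \<gamma>" for w
      using omega_U_iff[OF g, of w] by (auto simp: D_def)
    then show ?thesis using Dsp by (auto simp: U_gam_iff)
  qed
  also have "\<dots> \<in> zariski_base 2"
    by (rule noncommuting_zariski_base[OF g(1) D polyfun_uu pd]) (use Dsp in \<open>auto simp: W_gam_iff\<close>)
  finally show ?thesis .
qed

text \<open>\<open>omega\<close> is not polynomial, so a basic set cannot be pulled back directly.
  It is pulled back along a polynomial approximation \<open>om'\<close>, and the uniform Lipschitz
  bound transfers the defining inequality between \<open>om'\<close> and
  \<open>omega\<close>.\<close>

lemma omega_preimage_open:
  assumes g: "\<gamma> \<in> Gam" "\<tau> \<in> signs \<gamma>" and O: "O' \<in> free_top 2"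
  shows "{p \<in> W_gam r \<gamma>. omega r sq \<gamma> \<tau> p \<in> O'} \<in> free_top 2" (is "?D \<in> _")
proof -
  have two: "0 < (2::nat)" by simp
  have a: "polyfun 2 (\<lambda>p. p ! 0)" and c: "polyfun 2 (\<lambda>p. p ! 1)" by (intro polyfun_coord; simp)+
  have nbhd: "\<exists>N\<in>free_top 2. p0 \<in> N \<and> N \<subseteq> ?D" if p0: "p0 \<in> ?D" for p0
  proof -
    have p0W: "p0 \<in> W_gam r \<gamma>" and p0O: "omega r sq \<gamma> \<tau> p0 \<in> O'" using p0 by auto
    have p0n: "p0 \<in> nc_space 2" "spectrum (p0 ! 1) \<subseteq> discs r \<gamma>" using p0W by (auto simp: W_gam_iff)
    obtain B where B: "B \<in> free_base 2" "omega r sq \<gamma> \<tau> p0 \<in> B" "B \<subseteq> O'" by (rule free_topE[OF O p0O])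
    obtain k l G where G: "0 < k" "0 < l" "\<And>a c. a < k \<Longrightarrow> c < l \<Longrightarrow> polyfun 2 (G a c)" "B = base_set 2 k l G"
      by (rule free_baseE[OF B(1) two]) (rule that)
    have gsq: "gg \<gamma> \<tau> z * gg \<gamma> \<tau> z = poly [:0, 1:] z" "gg \<gamma> \<tau> z \<noteq> 0" if "z \<in> discs r \<gamma>" for z
      using gg_sq[OF g that] gg_nonzero[OF g that] by auto
    obtain q R where R: "R > 0" "\<And>e. e > 0 \<Longrightarrow> \<exists>N\<in>free_top 2. p0 \<in> N \<and>
      (\<forall>y\<in>N. spectrum (y ! 1) \<subseteq> discs r \<gamma> \<and> opnorm (pm q (y ! 1)) \<le> R \<and> opnorm (hfc (gg \<gamma> \<tau>) (y ! 1) - pm q (y ! 1)) \<le> e)"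
      by (rule hfc_approx[OF c two open_discs gg_holo[OF g(1)] gsq p0n]) (assumption, assumption, rule that)
    define A where "A = opnorm (p0 ! 0) + 1"
    have A: "A > 0" unfolding A_def by (intro add_nonneg_pos) auto
    define RR where "RR = A + (R + 1)"
    have RR: "0 \<le> RR" using A R(1) by (simp add: RR_def)
    obtain L where L: "L \<ge> 0" "\<And>n x y e. n \<ge> 1 \<Longrightarrow> x \<in> level 2 n \<Longrightarrow> y \<in> level 2 n \<Longrightarrow> 0 \<le> e \<Longrightarrow> pbounded RR x \<Longrightarrow> pbounded RR y \<Longrightarrow> pclose e x y \<Longrightarrow>
      opnorm (blockm k l n (\<lambda>a c. G a c y)) \<le> opnorm (blockm k l n (\<lambda>a c. G a c x)) + L * e"
      by (rule block_lipschitz[where k = k and l = l and G = G, OF two RR], erule (1) G(3)) (rule that)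
    define om' where "om' p = mk (p ! 0) (pm q (p ! 1))" for p
    define F where "F b d p = G b d [p ! 0 + pm q (p ! 1), p ! 0 - pm q (p ! 1)]" for b d p
    have F: "polyfun 2 (F b d)" if "b < k" "d < l" for b d
      unfolding F_def[abs_def] by (intro polyfun_subst2 G(3) that polyfun_add polyfun_diff polyfun_pm a c) auto
    have F': "F b d p = G b d (om' p)" for b d p by (simp add: F_def om'_def mk_def)
    have est: "opnorm (blockm k l n (\<lambda>b d. G b d (om' p))) \<le> opnorm (blockm k l n (\<lambda>b d. G b d (omega r sq \<gamma> \<tau> p))) + L * e \<and>
        opnorm (blockm k l n (\<lambda>b d. G b d (omega r sq \<gamma> \<tau> p))) \<le> opnorm (blockm k l n (\<lambda>b d. G b d (om' p))) + L * e"
      if p: "n \<ge> 1" "p \<in> level 2 n" "spectrum (p ! 1) \<subseteq> discs r \<gamma>" "opnorm (p ! 0) \<le> A" "opnorm (pm q (p ! 1)) \<le> R"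
        "opnorm (hfc (gg \<gamma> \<tau>) (p ! 1) - pm q (p ! 1)) \<le> e" "e \<le> 1" for n p e
    proof -
      have pc: "p ! 0 \<in> carrier_mat n n" "p ! 1 \<in> carrier_mat n n" using levelD(2)[OF p(2)] by auto
      define S Q where "S = S_mat r sq \<gamma> \<tau> (p ! 1)" "Q = pm q (p ! 1)"
      note SQ = this
      have Sc: "S \<in> carrier_mat n n" "Q \<in> carrier_mat n n" unfolding SQ using S_mat_carrier[OF pc(2)] pm_carrier[OF pc(2)] by auto
      have SQe: "opnorm (S - Q) \<le> e" unfolding SQ S_mat_hfc[OF g(1) pc(2) p(3)] by (rule p(6))
      have QR: "opnorm Q \<le> R" using p(5) by (simp add: SQ)
      have "S = (S - Q) + Q" using Sc by (intro eq_matI) auto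
      then have "opnorm S \<le> opnorm (S - Q) + opnorm Q" using opnorm_add[OF minus_carrier_mat[OF Sc(2)] Sc(2), of S] by simp
      then have SR: "opnorm S \<le> R + 1" using SQe QR p(7) by simp
      have QR': "opnorm Q \<le> R + 1" using QR by simp
      have e0: "0 \<le> e" using SQe opnorm_nonneg by (rule order_trans[rotated])
      have b: "pbounded RR (mk (p ! 0) X)" if X: "X \<in> carrier_mat n n" "opnorm X \<le> R + 1" for X
        using opnorm_add[OF pc(1) X(1)] opnorm_diff[OF pc(1) X(1)] p(4) X(2)
        by (auto simp: pbounded_def mk_def RR_def less_Suc_eq)
      have cl: "pclose e (mk (p ! 0) X) (mk (p ! 0) Y)" if XY: "X \<in> carrier_mat n n" "Y \<in> carrier_mat n n" "opnorm (X - Y) \<le> e" for X Y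
      proof -
        have "p ! 0 + X - (p ! 0 + Y) = X - Y" "p ! 0 - X - (p ! 0 - Y) = - (X - Y)"
          using pc(1) XY by (auto intro!: eq_matI)
        then show ?thesis using XY(3) by (auto simp: pclose_def mk_def less_Suc_eq opnorm_uminus)
      qed
      have QSe: "opnorm (Q - S) \<le> e"
      proof -
        have "Q - S = - (S - Q)" using Sc by (intro eq_matI) auto
        then show ?thesis using SQe by (simp add: opnorm_uminus)
      qed
      have lv: "mk (p ! 0) S \<in> level 2 n" "mk (p ! 0) Q \<in> level 2 n" using mk_level pc(1) Sc by auto
      have om: "omega r sq \<gamma> \<tau> p = mk (p ! 0) S" "om' p = mk (p ! 0) Q" by (simp_all add: omega_mk SQ om'_def)
      show ?thesis unfolding om
        using L(2)[OF p(1) lv(1,2) e0 b[OF Sc(1) SR] b[OF Sc(2) QR'] cl[OF Sc(1,2) SQe]]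
          L(2)[OF p(1) lv(2,1) e0 b[OF Sc(2) QR'] b[OF Sc(1) SR] cl[OF Sc(2,1) QSe]] by simp
    qed
    define n0 where "n0 = lvl p0"
    have n0: "n0 \<ge> 1" "p0 \<in> level 2 n0" using nc_space_lvl[OF p0n(1)] by (auto simp: n0_def)
    define t where "t = opnorm (blockm k l n0 (\<lambda>b d. G b d (omega r sq \<gamma> \<tau> p0)))"
    have om0: "omega r sq \<gamma> \<tau> p0 \<in> level 2 n0" by (rule omega_coords(1)[OF g p0W n0(2)])
    have t: "t < 1" using B(2) lvl_level[OF om0] unfolding G(4) base_set_def t_def by simp
    have t0: "0 \<le> t" by (simp add: t_def)
    \<comment> \<open>The approximation error may change the defining norm by at most a quarter of
      the slack \<open>1 - t\<close>.\<close>
    define e where "e = min 1 ((1 - t) / (4 * (L + 1)))"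
    have L1: "L + 1 > 0" using L(1) by simp
    have e: "e > 0" "e \<le> 1" "L * e \<le> (1 - t) / 4"
    proof -
      show e0: "e > 0" "e \<le> 1" using t L1 by (auto simp: e_def)
      have "L * e \<le> (L + 1) * ((1 - t) / (4 * (L + 1)))" using L(1) e0 by (intro mult_mono) (auto simp: e_def)
      also have "\<dots> = (1 - t) / 4"
      proof -
        have "y * (x / (4 * y)) = x / 4" if "y > 0" for x y :: real using that by simp
        then show ?thesis by this (rule L1)
      qed
      finally show "L * e \<le> (1 - t) / 4" .
    qed
    obtain N where N: "N \<in> free_top 2" "p0 \<in> N"
      "\<And>y. y \<in> N \<Longrightarrow> spectrum (y ! 1) \<subseteq> discs r \<gamma> \<and> opnorm (pm q (y ! 1)) \<le> R \<and> opnorm (hfc (gg \<gamma> \<tau>) (y ! 1) - pm q (y ! 1)) \<le> e"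
      using R(2)[OF e(1)] by blast
    \<comment> \<open>Halfway between \<open>t\<close> and 1: a quarter of the slack admits
      \<open>p0\<close>, and another quarter still keeps every point of the neighbourhood below
      1.\<close>
    define K where "K = t + (1 - t) / 2"
    have "K = (1 + t) / 2" by (simp add: K_def field_simps)
    then have K: "K > 0" using t0 by simp
    define U where "U = N \<inter> ({p \<in> nc_space 2. opnorm (p ! 0) < A} \<inter> {p \<in> nc_space 2. opnorm (blockm k l (lvl p) (\<lambda>b d. F b d p)) < K})"
    have U: "U \<in> free_top 2" unfolding U_def
      by (intro free_top_Int N(1) free_base_open norm_ball_scaled_free_base block_ball_free_base a A K G(1,2) F two)
    have a0: "opnorm (p0 ! 0) < A" by (simp add: A_def)
    have "p0 \<in> U"
    proof -
      have "opnorm (blockm k l n0 (\<lambda>b d. G b d (om' p0))) \<le> t + L * e"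
        using est[OF n0 p0n(2), of e] a0 N(3)[OF N(2)] e(2) unfolding t_def by auto
      then have "opnorm (blockm k l n0 (\<lambda>b d. F b d p0)) < K" unfolding F' K_def using e(3) t by argo
      then show ?thesis using N(2) p0n(1) a0 by (simp add: U_def n0_def)
    qed
    moreover have "U \<subseteq> ?D"
    proof
      fix p assume p: "p \<in> U"
      have pn: "p \<in> nc_space 2" using p by (simp add: U_def)
      define n where "n = lvl p"
      have n: "n \<ge> 1" "p \<in> level 2 n" using nc_space_lvl[OF pn] by (auto simp: n_def)
      have pN: "spectrum (p ! 1) \<subseteq> discs r \<gamma>" "opnorm (pm q (p ! 1)) \<le> R" "opnorm (hfc (gg \<gamma> \<tau>) (p ! 1) - pm q (p ! 1)) \<le> e"
        using N(3)[of p] p by (auto simp: U_def)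
      have pA: "opnorm (p ! 0) \<le> A" using p by (simp add: U_def)
      have pW: "p \<in> W_gam r \<gamma>" using pn pN by (simp add: W_gam_iff)
      have pK: "opnorm (blockm k l n (\<lambda>b d. G b d (om' p))) < K" using p unfolding U_def F' by (simp add: n_def)
      have "opnorm (blockm k l n (\<lambda>b d. G b d (omega r sq \<gamma> \<tau> p))) < 1"
        using est[OF n pN(1) pA pN(2,3) e(2)] pK e(3) t unfolding K_def by argo
      moreover have om: "omega r sq \<gamma> \<tau> p \<in> level 2 n" by (rule omega_coords(1)[OF g pW n(2)])
      ultimately have "omega r sq \<gamma> \<tau> p \<in> B" unfolding G(4) base_set_def
        using lvl_level[OF om] nc_spaceI[OF n(1) om] by simp
      then show "p \<in> ?D" using pW B(3) by blast
    qed
    ultimately show ?thesis using U by blast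
  qed
  show ?thesis unfolding free_top_iff
  proof
    fix p0 assume "p0 \<in> ?D"
    then obtain N where N: "N \<in> free_top 2" "p0 \<in> N" "N \<subseteq> ?D" using nbhd by blast
    obtain B where "B \<in> free_base 2" "p0 \<in> B" "B \<subseteq> N" by (rule free_topE[OF N(1,2)])
    then show "\<exists>B\<in>free_base 2. p0 \<in> B \<and> B \<subseteq> ?D" using N(3) by blast
  qed
qed

lemma omega_preimage_zariski_base:
  assumes g: "\<gamma> \<in> Gam" "\<tau> \<in> signs \<gamma>" and O: "O' \<in> free_top 2"
  shows "{p \<in> U_gam r \<gamma>. omega r sq \<gamma> \<tau> p \<in> O'} \<in> zariski_base 2"
proof -
  have a: "polyfun 2 (\<lambda>p. p ! 0)" and c: "polyfun 2 (\<lambda>p. p ! 1)" by (intro polyfun_coord; simp)+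
  have "{p \<in> U_gam r \<gamma>. omega r sq \<gamma> \<tau> p \<in> O'} = {p \<in> {p \<in> W_gam r \<gamma>. omega r sq \<gamma> \<tau> p \<in> O'}.
    \<forall>\<tau>'\<in>nonconst_signs \<gamma>. p ! 0 * I_mat r \<gamma> \<tau>' (p ! 1) \<noteq> I_mat r \<gamma> \<tau>' (p ! 1) * p ! 0}"
    by (auto simp: U_gam_iff)
  also have "\<dots> \<in> zariski_base 2"
    by (rule noncommuting_zariski_base[OF g(1) omega_preimage_open[OF g O] a c]) (auto simp: W_gam_iff)
  finally show ?thesis .
qed

lemma zariski_base_open: "B \<in> zariski_base d \<Longrightarrow> B \<in> zariski_top d"
  by (auto simp: zariski_top_def opens_of_base_iff)

end

section \<open>Conditionally nc functions\<close>

definition swapm :: "nat \<Rightarrow> nat \<Rightarrow> complex mat" where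
  "swapm n m = four_block_mat (0\<^sub>m n m) (1\<^sub>m n) (1\<^sub>m m) (0\<^sub>m m n)"

definition upperm :: "nat \<Rightarrow> nat \<Rightarrow> complex mat \<Rightarrow> complex mat" where
  "upperm n m L = four_block_mat (1\<^sub>m n) L (0\<^sub>m m n) (1\<^sub>m m)"

lemma swapm_carrier: "swapm n m \<in> carrier_mat (n + m) (n + m)"
  unfolding swapm_def by (rule carrier_matI) auto

lemma swapm_mult: "swapm n m * swapm m n = 1\<^sub>m (n + m)"
proof -
  have "swapm n m * swapm m n = four_block_mat (0\<^sub>m n m * 0\<^sub>m m n + 1\<^sub>m n * 1\<^sub>m n) (0\<^sub>m n m * 1\<^sub>m m + 1\<^sub>m n * 0\<^sub>m n m)
    (1\<^sub>m m * 0\<^sub>m m n + 0\<^sub>m m n * 1\<^sub>m n) (1\<^sub>m m * 1\<^sub>m m + 0\<^sub>m m n * 0\<^sub>m n m)"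
    unfolding swapm_def by (rule mult_four_block_mat[of _ n m _ n _ m]) auto
  also have "\<dots> = four_block_mat (1\<^sub>m n) (0\<^sub>m n m) (0\<^sub>m m n) (1\<^sub>m m)"
    by (intro cong_four_block_mat) auto
  finally show ?thesis by simp
qed

lemma swapm_GLn: "swapm n m \<in> GLn (n + m)" and minv_swapm: "minv (swapm n m) = swapm m n"
proof -
  have "swapm m n \<in> carrier_mat (n + m) (n + m)" using swapm_carrier[of m n] by (simp only: add.commute[of m n])
  from GLnI[OF swapm_carrier[of n m] this swapm_mult[of n m]]
  show "swapm n m \<in> GLn (n + m)" "minv (swapm n m) = swapm m n" by simp_all
qed

lemma mat_conj_swapm:
  assumes A: "A \<in> carrier_mat n n" and B: "B \<in> carrier_mat m m"
  shows "mat_conj (swapm n m) (mat_dsum A B) = mat_dsum B A"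
proof -
  have dims: "dim_row A = n" "dim_col A = n" "dim_row B = m" "dim_col B = m" using A B by auto
  have "swapm m n * mat_dsum A B = four_block_mat (0\<^sub>m m n * A + 1\<^sub>m m * 0\<^sub>m m n) (0\<^sub>m m n * 0\<^sub>m n m + 1\<^sub>m m * B)
    (1\<^sub>m n * A + 0\<^sub>m n m * 0\<^sub>m m n) (1\<^sub>m n * 0\<^sub>m n m + 0\<^sub>m n m * B)"
    unfolding swapm_def mat_dsum_def dims by (rule mult_four_block_mat[of _ m n _ m _ n]) (use A B in auto)
  also have "\<dots> = four_block_mat (0\<^sub>m m n) B A (0\<^sub>m n m)" by (intro cong_four_block_mat) (use A B in auto)
  finally have 1: "swapm m n * mat_dsum A B = four_block_mat (0\<^sub>m m n) B A (0\<^sub>m n m)" .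
  have "four_block_mat (0\<^sub>m m n) B A (0\<^sub>m n m) * swapm n m = four_block_mat (0\<^sub>m m n * 0\<^sub>m n m + B * 1\<^sub>m m) (0\<^sub>m m n * 1\<^sub>m n + B * 0\<^sub>m m n)
    (A * 0\<^sub>m n m + 0\<^sub>m n m * 1\<^sub>m m) (A * 1\<^sub>m n + 0\<^sub>m n m * 0\<^sub>m m n)"
    unfolding swapm_def by (rule mult_four_block_mat[of _ m n _ m _ n]) (use A B in auto)
  also have "\<dots> = four_block_mat B (0\<^sub>m m n) (0\<^sub>m n m) A" by (intro cong_four_block_mat) (use A B in auto)
  finally show ?thesis unfolding mat_conj_def minv_swapm 1 by (simp add: mat_dsum_def dims)
qed

lemma upperm_carrier: "upperm n m L \<in> carrier_mat (n + m) (n + m)"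
  unfolding upperm_def by (rule carrier_matI) auto

lemma upperm_GLn: assumes L: "L \<in> carrier_mat n m"
  shows "upperm n m L \<in> GLn (n + m)" "minv (upperm n m L) = upperm n m (- L)"
proof -
  have mL: "- L \<in> carrier_mat n m" using L by simp
  have "upperm n m L * upperm n m (- L) = four_block_mat (1\<^sub>m n * 1\<^sub>m n + L * 0\<^sub>m m n) (1\<^sub>m n * (- L) + L * 1\<^sub>m m)
    (0\<^sub>m m n * 1\<^sub>m n + 1\<^sub>m m * 0\<^sub>m m n) (0\<^sub>m m n * (- L) + 1\<^sub>m m * 1\<^sub>m m)"
    unfolding upperm_def by (rule mult_four_block_mat[of _ n n _ m _ m]) (use L in auto)
  also have "\<dots> = four_block_mat (1\<^sub>m n) (0\<^sub>m n m) (0\<^sub>m m n) (1\<^sub>m m)"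
    by (intro cong_four_block_mat) (use L in auto)
  finally have "upperm n m L * upperm n m (- L) = 1\<^sub>m (n + m)" by simp
  then show "upperm n m L \<in> GLn (n + m)" "minv (upperm n m L) = upperm n m (- L)"
    using GLnI[OF upperm_carrier upperm_carrier] by auto
qed

text \<open>The corner \<open>A * L - L * B\<close> serves twice: it vanishes for intertwiners, and
  for a large multiple of the identity it magnifies \<open>A - B\<close>.\<close>

lemma mat_conj_upperm:
  assumes A: "A \<in> carrier_mat n n" and B: "B \<in> carrier_mat m m" and L: "L \<in> carrier_mat n m"
  shows "mat_conj (upperm n m L) (mat_dsum A B) = four_block_mat A (A * L - L * B) (0\<^sub>m m n) B"
proof -
  have dims: "dim_row A = n" "dim_col A = n" "dim_row B = m" "dim_col B = m" using A B by auto
  have "upperm n m (- L) * mat_dsum A B = four_block_mat (1\<^sub>m n * A + - L * 0\<^sub>m m n) (1\<^sub>m n * 0\<^sub>m n m + - L * B)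
    (0\<^sub>m m n * A + 1\<^sub>m m * 0\<^sub>m m n) (0\<^sub>m m n * 0\<^sub>m n m + 1\<^sub>m m * B)"
    unfolding upperm_def mat_dsum_def dims by (rule mult_four_block_mat[of _ n n _ m _ m]) (use A B L in auto)
  also have "\<dots> = four_block_mat A (- (L * B)) (0\<^sub>m m n) B" by (intro cong_four_block_mat) (use A B L in auto)
  finally have 1: "upperm n m (- L) * mat_dsum A B = four_block_mat A (- (L * B)) (0\<^sub>m m n) B" .
  have "four_block_mat A (- (L * B)) (0\<^sub>m m n) B * upperm n m L = four_block_mat (A * 1\<^sub>m n + - (L * B) * 0\<^sub>m m n) (A * L + - (L * B) * 1\<^sub>m m)
    (0\<^sub>m m n * 1\<^sub>m n + B * 0\<^sub>m m n) (0\<^sub>m m n * L + B * 1\<^sub>m m)"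
    unfolding upperm_def by (rule mult_four_block_mat[of _ n n _ m _ m]) (use A B L in auto)
  also have "\<dots> = four_block_mat A (A * L - L * B) (0\<^sub>m m n) B"
  proof (intro cong_four_block_mat)
    have LB: "L * B \<in> carrier_mat n m" using L B by simp
    have AL: "A * L \<in> carrier_mat n m" using A L by simp
    show "A * L + - (L * B) * 1\<^sub>m m = A * L - L * B"
      using right_mult_one_mat[of "- (L * B)" n m] LB add_uminus_minus_mat[OF AL LB] by simp
  qed (use A B L in auto)
  finally show ?thesis unfolding mat_conj_def upperm_GLn(2)[OF L] 1 .
qed

lemma pt_conj_swapm:
  assumes x: "x \<in> level 2 n" and y: "y \<in> level 2 m"
  shows "pt_conj (swapm n m) (pt_dsum x y) = pt_dsum y x"
proof -
  obtain a b where a: "x = [a, b]" "a \<in> carrier_mat n n" "b \<in> carrier_mat n n" by (rule level2E[OF x])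
  obtain a' b' where b: "y = [a', b']" "a' \<in> carrier_mat m m" "b' \<in> carrier_mat m m" by (rule level2E[OF y])
  show ?thesis using a b by (simp add: pt_conj_def pt_dsum_def mat_conj_swapm)
qed

text \<open>Comparing \<open>x \<oplus> y\<close> with \<open>y \<oplus> x\<close> through the swap
  shows that the hat function agrees with \<open>f\<close> at \<open>y\<close>; for this both sums
  are assumed to lie in \<open>T\<close>.\<close>

lemma cond_nc_dsum:
  assumes f: "cond_nc 2 T f" and x: "x \<in> T" "x \<in> level 2 n" "n \<ge> 1" and y: "y \<in> T" "y \<in> level 2 m" "m \<ge> 1"
    and xy: "pt_dsum x y \<in> T" "pt_dsum y x \<in> T"
  shows "f (pt_dsum x y) = mat_dsum (f x) (f y)"
proof -
  obtain fh where fh: "graded 2 (hat 2 T) fh" "\<forall>x\<in>T. \<forall>y\<in>nc_space 2. pt_dsum x y \<in> T \<longrightarrow> f (pt_dsum x y) = mat_dsum (f x) (fh y)"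
    using f unfolding cond_nc_def by blast
  have nc: "x \<in> nc_space 2" "y \<in> nc_space 2" using x y nc_spaceI by blast+
  have hx: "x \<in> hat 2 T" "y \<in> hat 2 T" using nc x y xy unfolding hat_def by blast+
  have c: "f x \<in> carrier_mat n n" "f y \<in> carrier_mat m m" "fh x \<in> carrier_mat n n" "fh y \<in> carrier_mat m m"
    using f fh(1) x y hx unfolding cond_nc_def graded_def by auto
  have 1: "f (pt_dsum x y) = mat_dsum (f x) (fh y)" "f (pt_dsum y x) = mat_dsum (f y) (fh x)" using fh(2) x y nc xy by auto
  note conj = pt_conj_swapm[OF x(2) y(2)]
  have "f (pt_conj (swapm n m) (pt_dsum x y)) = mat_conj (swapm n m) (f (pt_dsum x y))"
  proof -
    have sp: "similarity_preserving 2 T f" using f by (simp add: cond_nc_def)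
    have "1 \<le> n + m" using x by simp
    then show ?thesis
      using sp[unfolded similarity_preserving_def, rule_format, of "n + m" "pt_dsum x y" "swapm n m"] xy pt_dsum_level[OF x(2) y(2)] swapm_GLn[of n m] conj
      by simp
  qed
  then have "mat_dsum (f y) (fh x) = mat_dsum (fh y) (f x)" unfolding conj 1 mat_conj_swapm[OF c(1,4)] .
  then have "f y = fh y" using mat_dsum_inject[OF c(2,3,4,1)] by simp
  then show ?thesis using 1 by simp
qed

lemma cond_nc_upper:
  assumes f: "cond_nc 2 T f" and x: "x \<in> T" "x \<in> level 2 n" "n \<ge> 1" and y: "y \<in> T" "y \<in> level 2 m" "m \<ge> 1"
    and xy: "pt_dsum x y \<in> T" "pt_dsum y x \<in> T" and L: "L \<in> carrier_mat n m" and e: "pt_conj (upperm n m L) (pt_dsum x y) \<in> T"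
  shows "f (pt_conj (upperm n m L) (pt_dsum x y)) = four_block_mat (f x) (f x * L - L * f y) (0\<^sub>m m n) (f y)"
proof -
  have c: "f x \<in> carrier_mat n n" "f y \<in> carrier_mat m m" using f x y unfolding cond_nc_def graded_def by auto
  have sp: "similarity_preserving 2 T f" using f by (simp add: cond_nc_def)
  have "f (pt_conj (upperm n m L) (pt_dsum x y)) = mat_conj (upperm n m L) (f (pt_dsum x y))"
  proof -
    have "1 \<le> n + m" using x by simp
    then show ?thesis
      using sp[unfolded similarity_preserving_def, rule_format, of "n + m" "pt_dsum x y" "upperm n m L"] xy pt_dsum_level[OF x(2) y(2)] upperm_GLn(1)[OF L] e
      by simp
  qed
  then show ?thesis unfolding cond_nc_dsum[OF f x y xy] mat_conj_upperm[OF c L] .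
qed

text \<open>For an intertwiner \<open>L\<close> the unipotent conjugation fixes
  \<open>x \<oplus> y\<close>, so the corner of the value must vanish.\<close>

lemma cond_nc_intertwine:
  assumes f: "cond_nc 2 T f" and x: "x \<in> T" "x \<in> level 2 n" "n \<ge> 1" and y: "y \<in> T" "y \<in> level 2 m" "m \<ge> 1"
    and xy: "pt_dsum x y \<in> T" "pt_dsum y x \<in> T" and L: "L \<in> carrier_mat n m"
    and int: "x ! 0 * L = L * y ! 0" "x ! 1 * L = L * y ! 1"
  shows "f x * L = L * f y"
proof -
  have c: "f x \<in> carrier_mat n n" "f y \<in> carrier_mat m m" using f x y unfolding cond_nc_def graded_def by auto
  obtain a b where a: "x = [a, b]" "a \<in> carrier_mat n n" "b \<in> carrier_mat n n" by (rule level2E[OF x(2)])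
  obtain a' b' where b: "y = [a', b']" "a' \<in> carrier_mat m m" "b' \<in> carrier_mat m m" by (rule level2E[OF y(2)])
  have "mat_conj (upperm n m L) (mat_dsum A B) = mat_dsum A B" if AB: "A \<in> carrier_mat n n" "B \<in> carrier_mat m m" "A * L = L * B" for A B
  proof -
    have "L * B \<in> carrier_mat n m" using L AB by simp
    then show ?thesis unfolding mat_conj_upperm[OF AB(1,2) L] AB(3) using AB by (simp add: mat_dsum_def minus_r_inv_mat[of _ n m])
  qed
  then have e: "pt_conj (upperm n m L) (pt_dsum x y) = pt_dsum x y"
    using a b int by (simp add: pt_conj_def pt_dsum_def)
  have "mat_dsum (f x) (f y) = four_block_mat (f x) (f x * L - L * f y) (0\<^sub>m m n) (f y)"
    using cond_nc_upper[OF f x y xy L] unfolding e using xy cond_nc_dsum[OF f x y xy] by simp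
  then have eq: "mat_dsum (f x) (f y) $$ (i, n + j) = four_block_mat (f x) (f x * L - L * f y) (0\<^sub>m m n) (f y) $$ (i, n + j)" for i j by simp
  have fl: "f x * L \<in> carrier_mat n m" "L * f y \<in> carrier_mat n m" using c L by auto
  show ?thesis
  proof (rule eq_matI)
    fix i j assume "i < dim_row (L * f y)" "j < dim_col (L * f y)"
    then have ij: "i < n" "j < m" using c L by auto
    define X where "X = f x * L"
    define Y where "Y = L * f y"
    have XY: "X \<in> carrier_mat n m" "Y \<in> carrier_mat n m" using fl by (simp_all add: X_def Y_def)
    have "(X - Y) $$ (i, j) = 0" using eq[of i j] ij c unfolding X_def[symmetric] Y_def[symmetric] by (simp add: mat_dsum_def)
    moreover have "(X - Y) $$ (i, j) = X $$ (i, j) - Y $$ (i, j)" using ij XY by (intro index_minus_mat) auto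
    ultimately have "X $$ (i, j) = Y $$ (i, j)" by simp
    then show "(f x * L) $$ (i, j) = (L * f y) $$ (i, j)" unfolding X_def Y_def .
  qed (use c L in auto)
qed

text \<open>Rectangular, because the second summand outgrows the first once an auxiliary generic
  point is attached to it.\<close>

definition diagm :: "nat \<Rightarrow> nat \<Rightarrow> complex \<Rightarrow> complex mat" where
  "diagm n m c = Matrix.mat n m (\<lambda>(i, j). if i = j then c else 0)"

lemma diagm_carrier: "diagm n m c \<in> carrier_mat n m" by (simp add: diagm_def)

lemma diagm_commutator_index:
  assumes A: "A \<in> carrier_mat n n" and B: "B \<in> carrier_mat m m" and nm: "n \<le> m" and ij: "i < n" "j < m"
  shows "(A * diagm n m c - diagm n m c * B) $$ (i, j) = c * ((if j < n then A $$ (i, j) else 0) - B $$ (i, j))"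
proof -
  have 1: "(A * diagm n m c) $$ (i, j) = (if j < n then A $$ (i, j) * c else 0)"
  proof -
    have "(A * diagm n m c) $$ (i, j) = (\<Sum>k<n. A $$ (i, k) * (if k = j then c else 0))"
      using A ij by (simp add: diagm_def scalar_prod_def atLeast0LessThan)
    also have "\<dots> = (\<Sum>k<n. if k = j then A $$ (i, j) * c else 0)" by (intro sum.cong) auto
    also have "\<dots> = (if j < n then A $$ (i, j) * c else 0)" by simp
    finally show ?thesis .
  qed
  have 2: "(diagm n m c * B) $$ (i, j) = c * B $$ (i, j)"
  proof -
    have "(diagm n m c * B) $$ (i, j) = (\<Sum>k<m. (if i = k then c else 0) * B $$ (k, j))"
      using B ij by (simp add: diagm_def scalar_prod_def atLeast0LessThan)
    also have "\<dots> = (\<Sum>k<m. if i = k then c * B $$ (i, j) else 0)" by (intro sum.cong) auto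
    also have "\<dots> = c * B $$ (i, j)" using ij nm by simp
    finally show ?thesis .
  qed
  have "(A * diagm n m c - diagm n m c * B) $$ (i, j) = (A * diagm n m c) $$ (i, j) - (diagm n m c * B) $$ (i, j)"
    using A B ij diagm_carrier[of n m c] by (intro index_minus_mat) auto
  then show ?thesis unfolding 1 2 by (simp add: algebra_simps)
qed

text \<open>Only the leading n by n part of \<open>f y\<close> is compared; for
  \<open>y = v' \<oplus> z\<close> this part is \<open>f v'\<close>.\<close>

lemma cond_nc_estimate:
  assumes f: "cond_nc 2 T f" and C: "\<And>w. w \<in> T \<Longrightarrow> opnorm (f w) \<le> C"
    and x: "x \<in> T" "x \<in> level 2 n" "n \<ge> 1" and y: "y \<in> T" "y \<in> level 2 m" "m \<ge> 1" and nm: "n \<le> m"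
    and xy: "pt_dsum x y \<in> T" "pt_dsum y x \<in> T" and e: "pt_conj (upperm n m (diagm n m c)) (pt_dsum x y) \<in> T"
    and ij: "i < n" "j < n"
  shows "cmod c * cmod (f x $$ (i, j) - f y $$ (i, j)) \<le> C"
proof -
  have c: "f x \<in> carrier_mat n n" "f y \<in> carrier_mat m m" using f x y unfolding cond_nc_def graded_def by auto
  let ?e = "pt_conj (upperm n m (diagm n m c)) (pt_dsum x y)"
  have fe: "f ?e = four_block_mat (f x) (f x * diagm n m c - diagm n m c * f y) (0\<^sub>m m n) (f y)"
    by (rule cond_nc_upper[OF f x y xy diagm_carrier e])
  have "f ?e $$ (i, n + j) = (f x * diagm n m c - diagm n m c * f y) $$ (i, j)" unfolding fe using c ij nm by simp
  also have "\<dots> = c * (f x $$ (i, j) - f y $$ (i, j))" using diagm_commutator_index[OF c nm ij(1), of j c] ij nm by simp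
  finally have "cmod (f ?e $$ (i, n + j)) = cmod c * cmod (f x $$ (i, j) - f y $$ (i, j))" by (simp add: norm_mult)
  moreover have "cmod (f ?e $$ (i, n + j)) \<le> opnorm (f ?e)" by (rule opnorm_entry) (unfold fe, use c ij nm in auto)
  ultimately show ?thesis using C[OF e] by simp
qed

section \<open>Closeness of points at one level\<close>

lemma pclose_mono: "pclose e x y \<Longrightarrow> e \<le> e' \<Longrightarrow> pclose e' x y"
  by (force simp: pclose_def)

lemma pclose_trans:
  assumes "x \<in> level d n" "y \<in> level d n" "z \<in> level d n" "pclose e x y" "pclose e' y z"
  shows "pclose (e + e') x z"
  unfolding pclose_def
proof (intro allI impI)
  fix i assume "i < length x"
  then have i: "i < d" using assms by (simp add: levelD)
  have c: "x ! i \<in> carrier_mat n n" "y ! i \<in> carrier_mat n n" "z ! i \<in> carrier_mat n n" using assms i by (auto simp: levelD)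
  have "x ! i - z ! i = (x ! i - y ! i) + (y ! i - z ! i)" using c by (intro eq_matI) auto
  then have "opnorm (x ! i - z ! i) \<le> opnorm (x ! i - y ! i) + opnorm (y ! i - z ! i)"
    using opnorm_add[OF minus_carrier_mat[OF c(2)] minus_carrier_mat[OF c(3)]] by simp
  then show "opnorm (x ! i - z ! i) \<le> e + e'" using assms i by (fastforce simp: pclose_def levelD)
qed

lemma pclose_dsum:
  assumes "x \<in> level d n" "x' \<in> level d n" "y \<in> level d m" "y' \<in> level d m" "pclose e x x'" "pclose e y y'"
  shows "pclose e (pt_dsum x y) (pt_dsum x' y')"
  unfolding pclose_def
proof (intro allI impI)
  fix i assume "i < length (pt_dsum x y)"
  then have i: "i < d" using pt_dsum_level[OF assms(1,3)] by (simp add: levelD)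
  have c: "x ! i \<in> carrier_mat n n" "x' ! i \<in> carrier_mat n n" "y ! i \<in> carrier_mat m m" "y' ! i \<in> carrier_mat m m"
    using assms i by (auto simp: levelD)
  show "opnorm (pt_dsum x y ! i - pt_dsum x' y' ! i) \<le> e"
    unfolding pt_dsum_nth[OF assms(1,3) i] pt_dsum_nth[OF assms(2,4) i] mat_dsum_add(2)[OF c(1,3,2,4)] opnorm_dsum
    using assms i by (auto simp: pclose_def levelD)
qed

lemma pclose_refl: "x \<in> level d n \<Longrightarrow> 0 \<le> e \<Longrightarrow> pclose e x x"
  unfolding pclose_def by (auto simp: levelD minus_r_inv_mat[OF levelD(2)])

text \<open>The price of a large \<open>c\<close>: the point moves by at most a multiple of
  \<open>c * e\<close>. The \<open>else 0\<close> asks that the first \<open>n\<close> rows of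
  \<open>y\<close> nearly vanish beyond column \<open>n\<close>, as they do for a direct
  sum.\<close>

lemma pclose_upper:
  assumes x: "x \<in> level 2 n" and y: "y \<in> level 2 m" and nm: "n \<le> m" and e: "0 \<le> e"
    and close: "\<And>k i j. k < 2 \<Longrightarrow> i < n \<Longrightarrow> j < m \<Longrightarrow> cmod ((if j < n then (x ! k) $$ (i, j) else 0) - (y ! k) $$ (i, j)) \<le> e"
  shows "pclose (real (n * m) * (cmod c * e)) (pt_dsum x y) (pt_conj (upperm n m (diagm n m c)) (pt_dsum x y))"
  unfolding pclose_def
proof (intro allI impI)
  fix k assume "k < length (pt_dsum x y)"
  then have k: "k < 2" using pt_dsum_level[OF x y] by (simp add: levelD)
  have cc: "x ! k \<in> carrier_mat n n" "y ! k \<in> carrier_mat m m" using x y k by (auto simp: levelD)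
  let ?D = "x ! k * diagm n m c - diagm n m c * y ! k"
  have D: "?D \<in> carrier_mat n m" using cc diagm_carrier[of n m c] by (intro minus_carrier_mat mult_carrier_mat)
  let ?M = "pt_dsum x y ! k - pt_conj (upperm n m (diagm n m c)) (pt_dsum x y) ! k"
  have M: "?M = four_block_mat (0\<^sub>m n n) (- ?D) (0\<^sub>m m n) (0\<^sub>m m m)"
    unfolding pt_conj_nth[OF pt_dsum_level[OF x y] k] pt_dsum_nth[OF x y k] mat_conj_upperm[OF cc diagm_carrier]
    using cc D by (intro eq_matI) (auto simp: mat_dsum_def simp del: index_minus_mat(1), auto)
  have "opnorm ?M \<le> real (n * m) * (cmod c * e)"
  proof (rule opnorm_leI)
    show "0 \<le> real (n * m) * (cmod c * e)" using e by simp
    fix v :: "complex vec" assume "v \<in> carrier_vec (dim_col ?M)"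
    then have v: "v \<in> carrier_vec (n + m)" unfolding M by simp
    define a where "a = vec_first v n"
    define b where "b = vec_last v m"
    have ab: "a \<in> carrier_vec n" "b \<in> carrier_vec m" "v = a @\<^sub>v b" using v by (auto simp: a_def b_def)
    have mD: "- ?D \<in> carrier_mat n m" using D by (rule uminus_carrier_mat)
    have "?M *\<^sub>v v = (0\<^sub>m n n *\<^sub>v a + (- ?D) *\<^sub>v b) @\<^sub>v (0\<^sub>m m n *\<^sub>v a + 0\<^sub>m m m *\<^sub>v b)"
      unfolding M ab(3) by (rule four_block_mat_mult_vec[OF _ mD _ _ ab(1,2)]) auto
    also have "0\<^sub>m n n *\<^sub>v a = 0\<^sub>v n" using ab by (intro eq_vecI) auto
    also have "0\<^sub>v n + (- ?D) *\<^sub>v b = (- ?D) *\<^sub>v b" by (rule left_zero_vec) (rule mult_mat_vec_carrier[OF mD ab(2)])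
    also have "0\<^sub>m m n *\<^sub>v a + 0\<^sub>m m m *\<^sub>v b = 0\<^sub>v m" using ab by (intro eq_vecI) auto
    finally have Mv: "(vnorm (?M *\<^sub>v v))\<^sup>2 = (vnorm ((- ?D) *\<^sub>v b))\<^sup>2" by (simp add: vnorm_append)
    then have "vnorm (?M *\<^sub>v v) = vnorm ((- ?D) *\<^sub>v b)" by (simp add: power2_eq_iff_nonneg)
    also have "\<dots> \<le> (\<Sum>i<dim_row (- ?D). \<Sum>j<dim_col (- ?D). cmod ((- ?D) $$ (i, j))) * vnorm b"
      by (rule vnorm_mult_mat_vec) (use ab mD in auto)
    also have "\<dots> \<le> (real (n * m) * (cmod c * e)) * vnorm v"
    proof (rule mult_mono)
      have "(\<Sum>i<dim_row (- ?D). \<Sum>j<dim_col (- ?D). cmod ((- ?D) $$ (i, j))) \<le> (\<Sum>i<n. \<Sum>j<m. cmod c * e)"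
      proof -
        have "cmod ((- ?D) $$ (i, j)) \<le> cmod c * e" if ij: "i < n" "j < m" for i j
        proof -
          have "(- ?D) $$ (i, j) = - (?D $$ (i, j))" by (rule index_uminus_mat) (use D ij in auto)
          then have "cmod ((- ?D) $$ (i, j)) = cmod c * cmod ((if j < n then (x ! k) $$ (i, j) else 0) - (y ! k) $$ (i, j))"
            unfolding diagm_commutator_index[OF cc nm ij] by (simp add: norm_mult)
          then show ?thesis using close[OF k ij] by (simp add: mult_left_mono)
        qed
        moreover have "dim_row (- ?D) = n" "dim_col (- ?D) = m" using mD by (rule carrier_matD)+
        ultimately show ?thesis by (simp only:) (intro sum_mono, auto)
      qed
      then show "(\<Sum>i<dim_row (- ?D). \<Sum>j<dim_col (- ?D). cmod ((- ?D) $$ (i, j))) \<le> real (n * m) * (cmod c * e)" by (simp add: mult.assoc)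
      have "(vnorm b)\<^sup>2 \<le> (vnorm v)\<^sup>2" unfolding ab(3) vnorm_append by simp
      then show "vnorm b \<le> vnorm v" by (rule power2_le_imp_le) simp
    qed (use e in auto)
    finally show "vnorm (?M *\<^sub>v v) \<le> real (n * m) * (cmod c * e) * vnorm v" .
  qed
  then show "opnorm ?M \<le> real (n * m) * (cmod c * e)" .
qed

lemma mlim_dsum:
  assumes "mlim n X L" "mlim m Y M" shows "mlim (n + m) (\<lambda>k. mat_dsum (X k) (Y k)) (mat_dsum L M)"
proof (rule mlimI)
  note c = mlimD(1,2)[OF assms(1)] mlimD(1,2)[OF assms(2)]
  fix i j assume ij: "i < n + m" "j < n + m"
  have idx: "mat_dsum A B $$ (i, j) = (if i < n then if j < n then A $$ (i, j) else 0 else if j < n then 0 else B $$ (i - n, j - n))"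
    if "A \<in> carrier_mat n n" "B \<in> carrier_mat m m" for A B using that ij by (auto simp: mat_dsum_def)
  show "(\<lambda>k. mat_dsum (X k) (Y k) $$ (i, j)) \<longlonglongrightarrow> mat_dsum L M $$ (i, j)"
    unfolding idx[OF c(1,3)] idx[OF c(2,4)] using ij mlimD(3)[OF assms(1), of i j] mlimD(3)[OF assms(2), of "i - n" "j - n"] by auto
qed (use mlimD(1,2)[OF assms(1)] mlimD(1,2)[OF assms(2)] in auto)

section \<open>Moving a point to a generic one\<close>

text \<open>Excludes 0 in particular. For the half difference of a point it means that some branch
  of the square root recovers this matrix from its square.\<close>

definition regular :: "complex set \<Rightarrow> bool" where
  "regular Z \<longleftrightarrow> (\<forall>z\<in>Z. - z \<notin> Z)"

text \<open>The scalar is added to the half difference only, and the same scalar serves both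
  summands of a direct sum.\<close>

definition shift :: "complex \<Rightarrow> point \<Rightarrow> point" where
  "shift t w = mk (uu w) (dd w + t \<cdot>\<^sub>m 1\<^sub>m (lvl w))"

lemma shift_level: assumes "w \<in> level 2 n" shows "shift t w \<in> level 2 n" "uu (shift t w) = uu w" "dd (shift t w) = dd w + t \<cdot>\<^sub>m 1\<^sub>m n"
proof -
  have l: "lvl w = n" using lvl_level[OF assms] by simp
  have c: "dd w + t \<cdot>\<^sub>m 1\<^sub>m n \<in> carrier_mat n n" using assms by simp
  show "shift t w \<in> level 2 n" "uu (shift t w) = uu w" "dd (shift t w) = dd w + t \<cdot>\<^sub>m 1\<^sub>m n"
    unfolding shift_def l using mk_level[OF uu_carrier[OF assms] c] uu_mk[OF uu_carrier[OF assms] c] dd_mk[OF uu_carrier[OF assms] c] by auto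
qed

lemma point_eq_coords: "v \<in> level 2 n \<Longrightarrow> w \<in> level 2 n \<Longrightarrow> uu v = uu w \<Longrightarrow> dd v = dd w \<Longrightarrow> v = w"
  using mk_uu_dd by metis

lemma shift_dsum:
  assumes x: "x \<in> level 2 n" and y: "y \<in> level 2 m"
  shows "shift t (pt_dsum x y) = pt_dsum (shift t x) (shift t y)"
proof (rule point_eq_coords)
  note xy = pt_dsum_level[OF x y]
  note sx = shift_level[OF x, of t] and sy = shift_level[OF y, of t] and sxy = shift_level[OF xy, of t]
  show "shift t (pt_dsum x y) \<in> level 2 (n + m)" "pt_dsum (shift t x) (shift t y) \<in> level 2 (n + m)"
    using sxy(1) pt_dsum_level[OF sx(1) sy(1)] by auto
  show "uu (shift t (pt_dsum x y)) = uu (pt_dsum (shift t x) (shift t y))"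
    unfolding sxy(2) uu_dsum[OF x y] uu_dsum[OF sx(1) sy(1)] sx(2) sy(2) ..
  have "mat_dsum (dd x) (dd y) + t \<cdot>\<^sub>m 1\<^sub>m (n + m) = mat_dsum (dd x + t \<cdot>\<^sub>m 1\<^sub>m n) (dd y + t \<cdot>\<^sub>m 1\<^sub>m m)"
    unfolding mat_dsum_one[symmetric] mat_dsum_smult by (rule mat_dsum_add(1)[OF dd_carrier[OF x] dd_carrier[OF y]]) auto
  then show "dd (shift t (pt_dsum x y)) = dd (pt_dsum (shift t x) (shift t y))"
    unfolding sxy(3) dd_dsum[OF x y] dd_dsum[OF sx(1) sy(1)] sx(3) sy(3) .
qed

lemma pclose_mk:
  assumes "w \<in> level 2 n" "u \<in> carrier_mat n n" "d \<in> carrier_mat n n" "opnorm (uu w - u) \<le> a" "opnorm (dd w - d) \<le> b"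
  shows "pclose (a + b) w (mk u d)"
proof -
  define U D where "U = uu w" "D = dd w"
  note UD = this
  have c: "U \<in> carrier_mat n n" "D \<in> carrier_mat n n" unfolding UD using assms(1) by auto
  have w: "w = mk U D" unfolding UD using mk_uu_dd[OF assms(1)] by simp
  have 1: "U + D - (u + d) = (U - u) + (D - d)" and 2: "U - D - (u - d) = (U - u) - (D - d)"
    using c assms(2,3) by (auto intro!: eq_matI)
  have "opnorm (U + D - (u + d)) \<le> a + b" "opnorm (U - D - (u - d)) \<le> a + b" unfolding 1 2
    using opnorm_add[OF minus_carrier_mat[OF assms(2)] minus_carrier_mat[OF assms(3)], of U D]
      opnorm_diff[OF minus_carrier_mat[OF assms(2)] minus_carrier_mat[OF assms(3)], of U D] assms(4,5) unfolding UD by auto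
  then show ?thesis unfolding w by (auto simp: pclose_def mk_def less_Suc_eq)
qed

lemma pclose_shift: assumes w: "w \<in> level 2 n" shows "pclose (cmod t) w (shift t w)"
proof -
  have c: "dd w + t \<cdot>\<^sub>m 1\<^sub>m n \<in> carrier_mat n n" using w by simp
  have l: "lvl w = n" using lvl_level[OF w] by simp
  have "dd w - (dd w + t \<cdot>\<^sub>m 1\<^sub>m n) = (- t) \<cdot>\<^sub>m 1\<^sub>m n" using dd_carrier[OF w] by (intro eq_matI) auto
  then have "opnorm (dd w - (dd w + t \<cdot>\<^sub>m 1\<^sub>m n)) = cmod t * opnorm (1\<^sub>m n)"
    using opnorm_smult[of "- t" "1\<^sub>m n"] by simp
  also have "\<dots> \<le> cmod t * 1" by (rule mult_left_mono[OF opnorm_one]) simp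
  finally have "opnorm (dd w - (dd w + t \<cdot>\<^sub>m 1\<^sub>m n)) \<le> cmod t * 1" .
  moreover have "opnorm (uu w - uu w) \<le> 0" using minus_r_inv_mat[OF uu_carrier[OF w]] by simp
  ultimately have "pclose (0 + cmod t * 1) w (mk (uu w) (dd w + t \<cdot>\<^sub>m 1\<^sub>m n))" by (intro pclose_mk[OF w uu_carrier[OF w] c])
  then show ?thesis unfolding shift_def l by simp
qed

lemma spectrum_shift:
  fixes d :: "complex mat"
  assumes d: "d \<in> carrier_mat n n" shows "spectrum (d + t \<cdot>\<^sub>m 1\<^sub>m n) = (\<lambda>z. z + t) ` spectrum d"
proof -
  have "d + t \<cdot>\<^sub>m 1\<^sub>m n = pm [:t, 1:] d" unfolding pm_linear[OF d] using d by (intro eq_matI) auto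
  then show ?thesis using spectrum_pm[OF d, of "[:t, 1:]"] by (simp add: add.commute)
qed

text \<open>Each failure, \<open>- (z + t) = z' + t\<close> or \<open>z + t \<in> Z\<close>,
  determines \<open>t\<close>, so finitely many scalars are excluded.\<close>

lemma ex_shift:
  assumes w: "w \<in> level 2 n" and Z: "finite Z" and e: "\<eta> > 0"
  obtains t where "cmod t \<le> \<eta>" "regular (spectrum (dd (shift t w)))" "spectrum (dd (shift t w)) \<inter> Z = {}"
proof -
  define A where "A = spectrum (dd w)"
  have A: "finite A" unfolding A_def by (rule finite_spectrum[OF dd_carrier[OF w]])
  define X where "X = (\<lambda>(z, z'). - (z + z') / 2) ` (A \<times> A) \<union> (\<lambda>(z, b). b - z) ` (A \<times> Z)"
  have "finite X" unfolding X_def using A Z by auto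
  moreover have "infinite (ball (0 :: complex) \<eta>)"
    using uncountable_ball[OF e] uncountable_infinite by blast
  ultimately obtain t where t: "t \<in> ball 0 \<eta>" "t \<notin> X" by (meson finite_subset subsetI)
  have sp: "spectrum (dd (shift t w)) = (\<lambda>z. z + t) ` A"
    unfolding shift_level(3)[OF w] spectrum_shift[OF dd_carrier[OF w]] A_def ..
  have "- (z + t) \<noteq> z' + t" if "z \<in> A" "z' \<in> A" for z z'
  proof
    assume "- (z + t) = z' + t"
    then have "2 * t = - (z + z')" by (simp add: algebra_simps eq_neg_iff_add_eq_0)
    then have "t = - (z + z') / 2" by (simp add: field_simps)
    then show False using t(2) that unfolding X_def by force
  qed
  then have "regular ((\<lambda>z. z + t) ` A)" unfolding regular_def by auto
  moreover have "(\<lambda>z. z + t) ` A \<inter> Z = {}"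
  proof -
    have "z + t \<noteq> b" if "z \<in> A" "b \<in> Z" for z b
    proof
      assume "z + t = b"
      then have "t = b - z" by auto
      then show False using t(2) that unfolding X_def by force
    qed
    then show ?thesis by auto
  qed
  ultimately show thesis using that[of t] t(1) unfolding sp by (simp add: less_imp_le)
qed

lemma regular_mono: "regular Z \<Longrightarrow> Z' \<subseteq> Z \<Longrightarrow> regular Z'"
  by (auto simp: regular_def)

lemma pclose_flip: "x \<in> level 2 n \<Longrightarrow> y \<in> level 2 n \<Longrightarrow> pclose e x y \<Longrightarrow> pclose e (flip x) (flip y)"
  by (auto simp: pclose_def flip_def less_Suc_eq levelD)

lemma pclose_conj:
  assumes s: "s \<in> GLn n" and x: "x \<in> level d n" and y: "y \<in> level d n" and "pclose e x y"
  shows "pclose (opnorm (minv s) * e * opnorm s) (pt_conj s x) (pt_conj s y)"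
  unfolding pclose_def
proof (intro allI impI)
  fix i assume "i < length (pt_conj s x)"
  then have i: "i < d" using x by (simp add: pt_conj_def levelD)
  note c = levelD(2)[OF x i] levelD(2)[OF y i] and sc = GLnD(1,2)[OF s]
  have xy: "x ! i - y ! i \<in> carrier_mat n n" using c by simp
  have "pt_conj s x ! i - pt_conj s y ! i = minv s * (x ! i - y ! i) * s"
    unfolding pt_conj_nth[OF x i] pt_conj_nth[OF y i] mat_conj_add(2)[OF s c, symmetric] by (simp add: mat_conj_def)
  also have "opnorm \<dots> \<le> opnorm (minv s * (x ! i - y ! i)) * opnorm s"
    by (rule opnorm_mult[OF mult_carrier_mat[OF sc(2) xy] sc(1)])
  also have "\<dots> \<le> (opnorm (minv s) * opnorm (x ! i - y ! i)) * opnorm s"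
    by (rule mult_right_mono[OF opnorm_mult[OF sc(2) xy]]) simp
  also have "\<dots> \<le> opnorm (minv s) * e * opnorm s"
    using assms(4) i x by (intro mult_right_mono mult_left_mono) (auto simp: pclose_def levelD)
  finally show "opnorm (pt_conj s x ! i - pt_conj s y ! i) \<le> opnorm (minv s) * e * opnorm s" .
qed

lemma pt_dsum_assoc: "pt_dsum x (pt_dsum y z) = pt_dsum (pt_dsum x y) z"
  by (rule nth_equalityI) (simp_all add: pt_dsum_def mat_dsum_assoc)

context radii_branches
begin

text \<open>\<open>OW\<close> and \<open>OU\<close> are the images of \<open>W_gam\<close> and \<open>U_gam\<close> under \<open>omega\<close>.  Unlike the set of all generic
  points, \<open>OU \<gamma> \<tau>\<close> is closed under direct sums with elements of \<open>OW \<gamma> \<tau>\<close>.\<close>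
definition OW :: "complex set \<Rightarrow> (complex \<Rightarrow> complex) \<Rightarrow> point set" where
  "OW \<gamma> \<tau> = omega r sq \<gamma> \<tau> ` W_gam r \<gamma>"

definition OU :: "complex set \<Rightarrow> (complex \<Rightarrow> complex) \<Rightarrow> point set" where
  "OU \<gamma> \<tau> = omega r sq \<gamma> \<tau> ` U_gam r \<gamma>"

lemma OU_subset_OW: "OU \<gamma> \<tau> \<subseteq> OW \<gamma> \<tau>"
  unfolding OU_def OW_def by (auto simp: U_gam_iff)

lemma OW_iff: "\<gamma> \<in> Gam \<Longrightarrow> \<tau> \<in> signs \<gamma> \<Longrightarrow> w \<in> OW \<gamma> \<tau> \<longleftrightarrow> w \<in> nc_space 2 \<and> spectrum (dd w) \<subseteq> VV \<gamma> \<tau>"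
  unfolding OW_def by (rule omega_W_iff)

lemma OU_iff: "\<gamma> \<in> Gam \<Longrightarrow> \<tau> \<in> signs \<gamma> \<Longrightarrow> w \<in> OU \<gamma> \<tau> \<longleftrightarrow> w \<in> nc_space 2 \<and> spectrum (dd w) \<subseteq> VV \<gamma> \<tau> \<and> [uu w, dd w * dd w] \<in> U_gam r \<gamma>"
  unfolding OU_def by (rule omega_U_iff)

lemma OW_coords: assumes "\<gamma> \<in> Gam" "\<tau> \<in> signs \<gamma>" "w \<in> OW \<gamma> \<tau>" shows "[uu w, dd w * dd w] \<in> W_gam r \<gamma>"
proof -
  have w: "w \<in> nc_space 2" "spectrum (dd w) \<subseteq> VV \<gamma> \<tau>" using assms by (auto simp: OW_iff)
  obtain n where n: "n \<ge> 1" "w \<in> level 2 n" by (rule nc_spaceE[OF w(1)])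
  show ?thesis by (rule omega_inv(1)[OF assms(1,2) n(2,1) w(2)])
qed

lemma coords_dsum:
  assumes "x \<in> level 2 n" "y \<in> level 2 m"
  shows "[uu (pt_dsum x y), dd (pt_dsum x y) * dd (pt_dsum x y)] = pt_dsum [uu x, dd x * dd x] [uu y, dd y * dd y]"
  unfolding uu_dsum[OF assms] dd_dsum[OF assms] mat_dsum_mult[OF dd_carrier[OF assms(1)] dd_carrier[OF assms(2)] dd_carrier[OF assms(1)] dd_carrier[OF assms(2)]]
  by (simp add: pt_dsum_def)

lemma OW_dsum:
  assumes g: "\<gamma> \<in> Gam" "\<tau> \<in> signs \<gamma>" and x: "x \<in> OW \<gamma> \<tau>" and y: "y \<in> OW \<gamma> \<tau>" shows "pt_dsum x y \<in> OW \<gamma> \<tau>"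
proof -
  have nc: "x \<in> nc_space 2" "spectrum (dd x) \<subseteq> VV \<gamma> \<tau>" "y \<in> nc_space 2" "spectrum (dd y) \<subseteq> VV \<gamma> \<tau>" using x y g by (auto simp: OW_iff)
  obtain n where n: "n \<ge> 1" "x \<in> level 2 n" by (rule nc_spaceE[OF nc(1)])
  obtain m where m: "m \<ge> 1" "y \<in> level 2 m" by (rule nc_spaceE[OF nc(3)])
  show ?thesis unfolding OW_iff[OF g] dd_dsum[OF n(2) m(2)] spectrum_dsum[OF dd_carrier[OF n(2)] dd_carrier[OF m(2)]]
    using pt_dsum_nc_space[OF nc(1,3)] nc by simp
qed

lemma OU_dsum:
  assumes g: "\<gamma> \<in> Gam" "\<tau> \<in> signs \<gamma>" and x: "x \<in> OW \<gamma> \<tau>" and y: "y \<in> OW \<gamma> \<tau>" and xy: "x \<in> OU \<gamma> \<tau> \<or> y \<in> OU \<gamma> \<tau>"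
  shows "pt_dsum x y \<in> OU \<gamma> \<tau>"
proof -
  have nc: "x \<in> nc_space 2" "y \<in> nc_space 2" using x y g by (auto simp: OW_iff)
  obtain n where n: "n \<ge> 1" "x \<in> level 2 n" by (rule nc_spaceE[OF nc(1)])
  obtain m where m: "m \<ge> 1" "y \<in> level 2 m" by (rule nc_spaceE[OF nc(2)])
  have "[uu (pt_dsum x y), dd (pt_dsum x y) * dd (pt_dsum x y)] \<in> U_gam r \<gamma>" unfolding coords_dsum[OF n(2) m(2)]
    by (rule U_gam_dsum[OF g(1) OW_coords[OF g x] OW_coords[OF g y]]) (use xy g in \<open>auto simp: OU_iff\<close>)
  then show ?thesis using OW_dsum[OF g x y] unfolding OW_iff[OF g] OU_iff[OF g] by simp
qed

lemma coords_conj: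
  assumes "x \<in> level 2 n" "s \<in> GLn n"
  shows "[uu (pt_conj s x), dd (pt_conj s x) * dd (pt_conj s x)] = pt_conj s [uu x, dd x * dd x]"
  unfolding uu_conj[OF assms(2,1)] dd_conj[OF assms(2,1)] mat_conj_mult[OF assms(2) dd_carrier[OF assms(1)] dd_carrier[OF assms(1)]]
  by (simp add: pt_conj_def)

lemma OU_conj:
  assumes g: "\<gamma> \<in> Gam" "\<tau> \<in> signs \<gamma>" and x: "x \<in> OU \<gamma> \<tau>" "x \<in> level 2 n" and s: "s \<in> GLn n"
  shows "pt_conj s x \<in> OU \<gamma> \<tau>"
proof -
  have nc: "x \<in> nc_space 2" "spectrum (dd x) \<subseteq> VV \<gamma> \<tau>" "[uu x, dd x * dd x] \<in> U_gam r \<gamma>" using x g by (auto simp: OU_iff)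
  have n: "n \<ge> 1" using nc_space_lvl[OF nc(1)] lvl_level[OF x(2)] by simp
  have l: "[uu x, dd x * dd x] \<in> level 2 n" using x by (intro level2I uu_carrier mult_carrier_mat[of _ n n] dd_carrier)
  show ?thesis unfolding OU_iff[OF g] coords_conj[OF x(2) s]
    using nc_spaceI[OF n pt_conj_level[OF s x(2)]] spectrum_conj[OF s dd_carrier[OF x(2)]] nc(2) U_gam_conj[OF g(1) nc(3) l s]
    by (simp add: dd_conj[OF s x(2)])
qed

lemma OW_conj:
  assumes g: "\<gamma> \<in> Gam" "\<tau> \<in> signs \<gamma>" and x: "x \<in> OW \<gamma> \<tau>" "x \<in> level 2 n" and s: "s \<in> GLn n"
  shows "pt_conj s x \<in> OW \<gamma> \<tau>"
proof -
  have nc: "x \<in> nc_space 2" "spectrum (dd x) \<subseteq> VV \<gamma> \<tau>" using x g by (auto simp: OW_iff)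
  have n: "n \<ge> 1" using nc_space_lvl[OF nc(1)] lvl_level[OF x(2)] by simp
  show ?thesis unfolding OW_iff[OF g] 
    using nc_spaceI[OF n pt_conj_level[OF s x(2)]] spectrum_conj[OF s dd_carrier[OF x(2)]] nc(2)
    by (simp add: dd_conj[OF s x(2)])
qed

lemma spectrum_uminus: assumes d: "d \<in> carrier_mat n n" shows "spectrum (- d) = uminus ` spectrum (d :: complex mat)"
proof -
  have "- d = pm (- [:0, 1:]) d" unfolding pm_uminus[OF d] pm_X[OF d] ..
  then show ?thesis using spectrum_pm[OF d, of "- [:0, 1:]"] by simp
qed

text \<open>The flip negates the half difference and so leads to the opposite branch.\<close>

definition neg_signs :: "complex set \<Rightarrow> (complex \<Rightarrow> complex) \<Rightarrow> complex \<Rightarrow> complex" where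
  "neg_signs \<gamma> \<tau> = (\<lambda>c\<in>\<gamma>. - \<tau> c)"

lemma neg_signs: assumes "\<gamma> \<in> Gam" "\<tau> \<in> signs \<gamma>" shows "neg_signs \<gamma> \<tau> \<in> signs \<gamma>" "z \<in> VV \<gamma> \<tau> \<Longrightarrow> - z \<in> VV \<gamma> (neg_signs \<gamma> \<tau>)"
proof -
  have "- \<tau> c \<in> {-1, 1}" if "c \<in> \<gamma>" for c
  proof -
    have "\<tau> c \<in> {-1, 1}" by (rule PiE_mem[OF _ that]) (use assms(2) in \<open>simp add: signs_def\<close>)
    then show ?thesis by (elim insertE) simp_all
  qed
  then show "neg_signs \<gamma> \<tau> \<in> signs \<gamma>" unfolding signs_def neg_signs_def restrict_PiE_iff by blast
  assume z: "z \<in> VV \<gamma> \<tau>"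
  then obtain c where c: "c \<in> \<gamma>" "z\<^sup>2 \<in> ball c (r \<gamma>)" by (auto simp: VV_def discs_def)
  have "gg \<gamma> (neg_signs \<gamma> \<tau>) (z\<^sup>2) = - gg \<gamma> \<tau> (z\<^sup>2)"
    unfolding gg_def iota_eq[OF assms(1) c] using c by (simp add: neg_signs_def)
  then show "- z \<in> VV \<gamma> (neg_signs \<gamma> \<tau>)" using z by (simp add: VV_def)
qed

lemma OU_flip: assumes g: "\<gamma> \<in> Gam" "\<tau> \<in> signs \<gamma>" and x: "x \<in> OU \<gamma> \<tau>" shows "flip x \<in> OU \<gamma> (neg_signs \<gamma> \<tau>)"
proof -
  have nc: "x \<in> nc_space 2" "spectrum (dd x) \<subseteq> VV \<gamma> \<tau>" "[uu x, dd x * dd x] \<in> U_gam r \<gamma>" using x g by (auto simp: OU_iff)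
  obtain n where n: "n \<ge> 1" "x \<in> level 2 n" by (rule nc_spaceE[OF nc(1)])
  have "- dd x * - dd x = dd x * dd x" using dd_carrier[OF n(2)] by simp
  then show ?thesis unfolding OU_iff[OF g(1) neg_signs(1)[OF g]] uu_flip[OF n(2)] dd_flip[OF n(2)] spectrum_uminus[OF dd_carrier[OF n(2)]]
    using nc neg_signs(2)[OF g] nc_spaceI[OF n(1) flip_level[OF n(2)]] by auto
qed

text \<open>Only the half sum is moved. The half difference stays the same, so \<open>z\<close> lies
  in the same \<open>OW \<gamma> \<tau>\<close> as \<open>v\<close> and the two can be
  added.\<close>

lemma OU_near:
  assumes v: "v \<in> level 2 n" "n \<ge> 1" and reg: "regular (spectrum (dd v))" and e: "\<eta> > 0"
  obtains \<gamma> \<tau> z where "\<gamma> \<in> Gam" "\<tau> \<in> signs \<gamma>" "spectrum (dd v) \<subseteq> VV \<gamma> \<tau>" "z \<in> OU \<gamma> \<tau>" "z \<in> level 2 n" "pclose \<eta> v z" "dd z = dd v"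
proof -
  define \<gamma> where "\<gamma> = (\<lambda>z. z\<^sup>2) ` spectrum (dd v)"
  note fin = finite_spectrum[OF dd_carrier[OF v(1)]]
  have reg': "- z \<notin> spectrum (dd v)" if "z \<in> spectrum (dd v)" for z using reg that by (auto simp: regular_def)
  have g: "\<gamma> \<in> Gam" "\<exists>\<tau>\<in>signs \<gamma>. spectrum (dd v) \<subseteq> VV \<gamma> \<tau>" unfolding \<gamma>_def by (rule regular_VV[OF fin]; fact reg')+
  then obtain \<tau> where t: "\<tau> \<in> signs \<gamma>" "spectrum (dd v) \<subseteq> VV \<gamma> \<tau>" by blast
  have x: "dd v * dd v \<in> carrier_mat n n" by (rule mult_carrier_mat[OF dd_carrier[OF v(1)] dd_carrier[OF v(1)]])
  have sx: "spectrum (dd v * dd v) = \<gamma>" unfolding \<gamma>_def by (rule square_spectrum[OF dd_carrier[OF v(1)]])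
  obtain u' where u: "u' \<in> carrier_mat n n" "opnorm (uu v - u') \<le> \<eta>" "[u', dd v * dd v] \<in> U_gam r \<gamma>"
    by (rule U_gam_perturbation[OF x v(2) g(1) sx uu_carrier[OF v(1)] e]) (rule that)
  define z where "z = mk u' (dd v)"
  have z: "z \<in> level 2 n" "uu z = u'" "dd z = dd v"
    unfolding z_def using mk_level[OF u(1) dd_carrier[OF v(1)]] uu_mk[OF u(1) dd_carrier[OF v(1)]] dd_mk[OF u(1) dd_carrier[OF v(1)]] by auto
  have "z \<in> OU \<gamma> \<tau>" unfolding OU_iff[OF g(1) t(1)] z(2,3) using nc_spaceI[OF v(2) z(1)] t(2) u(3) by simp
  moreover have "pclose \<eta> v z"
  proof -
    have "opnorm (dd v - dd v) \<le> 0" using minus_r_inv_mat[OF dd_carrier[OF v(1)]] by simp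
    from pclose_mk[OF v(1) u(1) dd_carrier[OF v(1)] u(2) this] show ?thesis unfolding z_def by simp
  qed
  ultimately show thesis using that[OF g(1) t(1,2)] z by blast
qed

end

section \<open>Extension from generic points\<close>

locale sym_dom = radii_branches +
  fixes S :: "point set"
  assumes free_domain: "S \<in> free_top 2" and symmetric: "symmetric_set S"
    and similar_sum: "\<lbrakk>w1 \<in> S; w2 \<in> S; similar_points (pi_map w1) (pi_map w2)\<rbrakk> \<Longrightarrow> pt_dsum w1 w2 \<in> S"
begin

abbreviation "So \<equiv> S_o r sq S"
abbreviation "Soo \<equiv> S_oo r sq S"

lemma Soo_iff_OU: "w \<in> Soo \<longleftrightarrow> w \<in> S \<and> (\<exists>\<gamma>\<in>Gam. \<exists>\<tau>\<in>signs \<gamma>. w \<in> OU \<gamma> \<tau>)"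
  by (auto simp: S_oo_def OU_def)

lemma So_iff_OW: "w \<in> So \<longleftrightarrow> w \<in> S \<and> (\<exists>\<gamma>\<in>Gam. \<exists>\<tau>\<in>signs \<gamma>. w \<in> OW \<gamma> \<tau>)"
  by (auto simp: S_o_def OW_def)

lemma SooI: "\<gamma> \<in> Gam \<Longrightarrow> \<tau> \<in> signs \<gamma> \<Longrightarrow> w \<in> OU \<gamma> \<tau> \<Longrightarrow> w \<in> S \<Longrightarrow> w \<in> Soo"
  and SoI: "\<gamma> \<in> Gam \<Longrightarrow> \<tau> \<in> signs \<gamma> \<Longrightarrow> w \<in> OW \<gamma> \<tau> \<Longrightarrow> w \<in> S \<Longrightarrow> w \<in> So"
  by (auto simp: Soo_iff_OU So_iff_OW)

lemma S_nc: "w \<in> S \<Longrightarrow> w \<in> nc_space 2"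
  using free_top_subset[OF free_domain] by blast

lemma Soo_S: "w \<in> Soo \<Longrightarrow> w \<in> S" and So_S: "w \<in> So \<Longrightarrow> w \<in> S" and Soo_So: "w \<in> Soo \<Longrightarrow> w \<in> So"
  using OU_subset_OW unfolding Soo_iff_OU So_iff_OW by blast+

lemma So_regular: "w \<in> So \<longleftrightarrow> w \<in> S \<and> regular (spectrum (dd w))"
  using S_nc by (auto simp: S_o_iff regular_def)

lemma level_pos: assumes "w \<in> S" "w \<in> level 2 n" shows "n \<ge> 1"
  using nc_space_lvl[OF S_nc[OF assms(1)]] lvl_level[OF assms(2)] by simp

lemma lvl_S: "w \<in> S \<Longrightarrow> w \<in> level 2 (lvl w)"
  using nc_space_lvl[OF S_nc] by simp

text \<open>A member lies in a basic set inside \<open>S\<close>, and such a set contains the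
  summands of its members and their sum in either order.\<close>

lemma S_dsumD:
  assumes "pt_dsum x y \<in> S" "x \<in> nc_space 2" "y \<in> nc_space 2"
  shows "x \<in> S" "y \<in> S" "pt_dsum y x \<in> S"
proof -
  obtain B where B: "B \<in> free_base 2" "pt_dsum x y \<in> B" "B \<subseteq> S" by (rule free_topE[OF free_domain assms(1)])
  then have "x \<in> B" "y \<in> B" using free_base_dsum[OF B(1) _ assms(2,3)] by auto
  moreover from this have "pt_dsum y x \<in> B" using free_base_dsum[OF B(1) _ assms(3,2)] by auto
  ultimately show "x \<in> S" "y \<in> S" "pt_dsum y x \<in> S" using B(3) by auto
qed

lemma flip_S: "w \<in> S \<Longrightarrow> flip w \<in> S"
  using symmetric by (simp add: symmetric_set_def)

lemma flip_Soo: "w \<in> Soo \<Longrightarrow> flip w \<in> Soo"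
  unfolding Soo_iff_OU using flip_S OU_flip neg_signs(1) by blast

lemma flip_So: assumes "w \<in> So" shows "flip w \<in> So"
proof -
  have w: "w \<in> S" "regular (spectrum (dd w))" using assms by (auto simp: So_regular)
  have "regular (spectrum (dd (flip w)))"
    unfolding dd_flip[OF lvl_S[OF w(1)]] spectrum_uminus[OF dd_carrier[OF lvl_S[OF w(1)]]] using w(2) unfolding regular_def by auto
  then show ?thesis using flip_S w by (simp add: So_regular)
qed

lemma pt_conj_Soo: assumes "w \<in> Soo" "w \<in> level 2 n" "s \<in> GLn n" "pt_conj s w \<in> S" shows "pt_conj s w \<in> Soo"
  using assms OU_conj[of _ _ w n s] unfolding Soo_iff_OU by blast

lemma S_nbhd:
  assumes "w \<in> S" "w \<in> level 2 n"
  obtains e where "e > 0" "\<And>y. y \<in> level 2 n \<Longrightarrow> pclose e w y \<Longrightarrow> y \<in> S"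
proof -
  obtain B where B: "B \<in> free_base 2" "w \<in> B" "B \<subseteq> S" by (rule free_topE[OF free_domain assms(1)])
  obtain e where "e > 0" "\<And>y. y \<in> level 2 n \<Longrightarrow> pclose e w y \<Longrightarrow> y \<in> B"
    by (rule free_base_finitely_open[OF B(1) _ B(2) assms(2) level_pos[OF assms]]) (simp, rule that)
  then show thesis using that B(3) by blast
qed

text \<open>The finite set \<open>Z\<close> of forbidden eigenvalues is what \<open>cauchy\<close>
  needs to find a point compatible with two given ones.\<close>

lemma Soo_dense:
  assumes w: "w \<in> S" "w \<in> level 2 n" and e: "\<eta> > 0" and Z: "finite Z"
  obtains v where "v \<in> Soo" "v \<in> level 2 n" "pclose \<eta> w v" "spectrum (dd v) \<inter> Z = {}"
proof -
  obtain e0 where e0: "e0 > 0" "\<And>y. y \<in> level 2 n \<Longrightarrow> pclose e0 w y \<Longrightarrow> y \<in> S" by (rule S_nbhd[OF w]) (rule that)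
  define h where "h = min \<eta> e0 / 2"
  have h: "h > 0" "h + h \<le> \<eta>" "h + h \<le> e0" using e e0 by (auto simp: h_def)
  obtain t where t: "cmod t \<le> h" "regular (spectrum (dd (shift t w)))" "spectrum (dd (shift t w)) \<inter> Z = {}"
    by (rule ex_shift[OF w(2) Z h(1)]) (rule that)
  note sl = shift_level(1)[OF w(2), of t]
  obtain \<gamma> \<tau> v where v: "\<gamma> \<in> Gam" "\<tau> \<in> signs \<gamma>" "v \<in> OU \<gamma> \<tau>" "v \<in> level 2 n" "pclose h (shift t w) v" "dd v = dd (shift t w)"
    by (rule OU_near[OF sl level_pos[OF w] t(2) h(1)]) (rule that)
  have hh: "pclose (h + h) w v" by (rule pclose_trans[OF w(2) sl v(4) pclose_mono[OF pclose_shift[OF w(2)] t(1)] v(5)])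
  have "v \<in> S" by (rule e0(2)[OF v(4) pclose_mono[OF hh h(3)]])
  then show thesis using that[OF SooI[OF v(1,2,3)] v(4) pclose_mono[OF hh h(2)]] t(3) v(6) by simp
qed

text \<open>For \<open>v, v'\<close> near \<open>w\<close>, conjugating \<open>v \<oplus> v' \<oplus> z\<close> by a unipotent matrix whose off-diagonal
  block is a large scalar \<open>c\<close> moves the point only slightly, while the value of \<open>f\<close> acquires the off-diagonal
  block \<open>c (f v - f v')\<close>, which the bound on \<open>f\<close> controls.  The third summand \<open>z\<close>, a generic point near
  \<open>v \<oplus> v'\<close>, is there because \<open>v \<oplus> v'\<close> itself may fail to be generic.\<close>
lemma cauchy_regular:
  assumes f: "cond_nc 2 Soo f" and C: "\<And>w. w \<in> Soo \<Longrightarrow> opnorm (f w) \<le> C"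
    and w: "w \<in> S" "w \<in> level 2 n" and e: "\<epsilon> > 0"
  obtains \<eta> where "\<eta> > 0" "\<And>v v' i j. v \<in> Soo \<Longrightarrow> v \<in> level 2 n \<Longrightarrow> v' \<in> Soo \<Longrightarrow> v' \<in> level 2 n \<Longrightarrow>
    regular (spectrum (dd v) \<union> spectrum (dd v')) \<Longrightarrow> pclose \<eta> w v \<Longrightarrow> pclose \<eta> w v' \<Longrightarrow> i < n \<Longrightarrow> j < n \<Longrightarrow>
    cmod (f v $$ (i, j) - f v' $$ (i, j)) \<le> \<epsilon>"
proof -
  note n = level_pos[OF w] and wnc = S_nc[OF w(1)]
  obtain B where B: "B \<in> free_base 2" "w \<in> B" "B \<subseteq> S" by (rule free_topE[OF free_domain w(1)])
  have Bd: "pt_dsum x y \<in> B \<longleftrightarrow> x \<in> B \<and> y \<in> B" if "x \<in> nc_space 2" "y \<in> nc_space 2" for x y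
    using free_base_dsum[OF B(1) _ that] by simp
  \<comment> \<open>The level of \<open>v' \<oplus> z\<close>, where \<open>z\<close> has the size
    of \<open>v \<oplus> v'\<close>.\<close>
  define m where "m = n + (n + n)"
  define W where "W = pt_dsum w (pt_dsum w (pt_dsum w w))"
  have nn: "n \<le> m" "1 \<le> m" "1 \<le> n + m" "1 \<le> n + n" using n by (auto simp: m_def)
  have Wl: "W \<in> level 2 (n + m)" unfolding W_def m_def by (intro pt_dsum_level w(2))
  have WB: "W \<in> B" unfolding W_def using B(2) by (simp add: Bd pt_dsum_nc_space wnc)
  obtain e0 where e0: "e0 > 0" "\<And>y. y \<in> level 2 (n + m) \<Longrightarrow> pclose e0 W y \<Longrightarrow> y \<in> B"
    by (rule free_base_finitely_open[OF B(1) _ WB Wl nn(3)]) (simp, rule that)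
  \<comment> \<open>So large that a corner bounded by \<open>C\<close> forces entries to differ by
    at most \<open>\<epsilon>\<close>; the added 1 keeps \<open>c\<close> positive.\<close>
  define c where "c = (\<bar>C\<bar> + 1) / \<epsilon>"
  have c: "c > 0" using e by (auto simp: c_def)
  define K where "K = real (n * m) * c"
  have K: "K \<ge> 0" using c by (simp add: K_def)
  \<comment> \<open>The move from \<open>W\<close> to \<open>v \<oplus> y\<close> costs
    \<open>2 * \<eta>\<close> and the conjugation at most \<open>K * (2 * \<eta>)\<close>; together
    this is the radius \<open>e0\<close>.\<close>
  define \<eta> where "\<eta> = e0 / (2 * (1 + K))"
  have h: "\<eta> > 0" using e0 K by (simp add: \<eta>_def)
  have h2: "2 * \<eta> + K * (2 * \<eta>) = e0" using K by (simp add: \<eta>_def field_simps add_nonneg_eq_0_iff)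
  have h3: "2 * \<eta> \<le> e0" using h2 K h by (metis add.commute le_add_same_cancel2 less_eq_real_def mult_nonneg_nonneg zero_le_mult_iff zero_le_numeral)
  show thesis
  proof (rule that[OF h])
    fix v v' i j
    assume v: "v \<in> Soo" "v \<in> level 2 n" and v': "v' \<in> Soo" "v' \<in> level 2 n"
      and reg: "regular (spectrum (dd v) \<union> spectrum (dd v'))" and cl: "pclose \<eta> w v" "pclose \<eta> w v'" and ij: "i < n" "j < n"
    have nc: "v \<in> nc_space 2" "v' \<in> nc_space 2" using S_nc Soo_S v v' by auto
    note vv = pt_dsum_level[OF v(2) v'(2)]
    have sp: "spectrum (dd (pt_dsum v v')) = spectrum (dd v) \<union> spectrum (dd v')"
      unfolding dd_dsum[OF v(2) v'(2)] by (rule spectrum_dsum[OF dd_carrier[OF v(2)] dd_carrier[OF v'(2)]])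
    have reg': "regular (spectrum (dd (pt_dsum v v')))" using reg by (simp add: sp)
    obtain \<gamma> \<tau> z where z: "\<gamma> \<in> Gam" "\<tau> \<in> signs \<gamma>" "spectrum (dd (pt_dsum v v')) \<subseteq> VV \<gamma> \<tau>" "z \<in> OU \<gamma> \<tau>" "z \<in> level 2 (n + n)" "pclose \<eta> (pt_dsum v v') z"
      by (rule OU_near[OF vv nn(4) reg' h]) (rule that)
    note g = z(1,2)
    have OW: "v \<in> OW \<gamma> \<tau>" "v' \<in> OW \<gamma> \<tau>" "z \<in> OW \<gamma> \<tau>" using nc z(3) subsetD[OF OU_subset_OW z(4)] by (simp_all add: OW_iff[OF g] sp)
    have znc: "z \<in> nc_space 2" using z(4) by (simp add: OU_iff[OF g])
    define y where "y = pt_dsum v' z"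
    have yl: "y \<in> level 2 m" unfolding y_def m_def by (rule pt_dsum_level[OF v'(2) z(5)])
    have ync: "y \<in> nc_space 2" unfolding y_def by (rule pt_dsum_nc_space[OF nc(2) znc])
    have yU: "y \<in> OU \<gamma> \<tau>" "pt_dsum z v' \<in> OU \<gamma> \<tau>" unfolding y_def using OU_dsum[OF g OW(2,3)] OU_dsum[OF g OW(3,2)] z(4) by auto
    have yW: "y \<in> OW \<gamma> \<tau>" using yU OU_subset_OW by blast
    have vyU: "pt_dsum v y \<in> OU \<gamma> \<tau>" "pt_dsum y v \<in> OU \<gamma> \<tau>" using OU_dsum[OF g OW(1) yW] OU_dsum[OF g yW OW(1)] yU by auto
    note vyl = pt_dsum_level[OF v(2) yl]
    have "pclose (\<eta> + \<eta>) (pt_dsum w w) z"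
      by (rule pclose_trans[OF pt_dsum_level[OF w(2) w(2)] vv z(5) pclose_dsum[OF w(2) v(2) w(2) v'(2) cl] z(6)])
    then have c1: "pclose (2 * \<eta>) (pt_dsum w w) z" by simp
    have c2: "pclose (2 * \<eta>) w v" "pclose (2 * \<eta>) w v'" using cl pclose_mono h by auto
    have c3: "pclose (2 * \<eta>) W (pt_dsum v y)" unfolding W_def y_def
      by (rule pclose_dsum[OF w(2) v(2) pt_dsum_level[OF w(2) pt_dsum_level[OF w(2) w(2)]] pt_dsum_level[OF v'(2) z(5)] c2(1)
            pclose_dsum[OF w(2) v'(2) pt_dsum_level[OF w(2) w(2)] z(5) c2(2) c1]])
    have vyB: "pt_dsum v y \<in> B" by (rule e0(2)[OF vyl pclose_mono[OF c3 h3]])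
    have vB: "v \<in> B" "y \<in> B" using vyB Bd[OF nc(1) ync] by auto
    have v'B: "v' \<in> B" "z \<in> B" using vB(2) Bd[OF nc(2) znc] by (auto simp: y_def)
    have yvB: "pt_dsum y v \<in> B" "pt_dsum z v' \<in> B" using vB v'B Bd[OF ync nc(1)] Bd[OF znc nc(2)] by auto
    define Q where "Q = pt_conj (upperm n m (diagm n m (of_real c))) (pt_dsum v y)"
    note gl = upperm_GLn(1)[OF diagm_carrier[of n m "of_real c"]]
    have Ql: "Q \<in> level 2 (n + m)" unfolding Q_def by (rule pt_conj_level[OF gl vyl])
    have entry: "cmod ((if j < n then (v ! k) $$ (i, j) else 0) - (y ! k) $$ (i, j)) \<le> 2 * \<eta>" if k: "k < 2" and ij: "i < n" "j < m" for k i j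
    proof -
      note cv = levelD(2)[OF v(2) k] levelD(2)[OF v'(2) k] levelD(2)[OF z(5) k] levelD(2)[OF w(2) k]
      have yk: "y ! k = mat_dsum (v' ! k) (z ! k)" unfolding y_def by (rule pt_dsum_nth[OF v'(2) z(5) k])
      show ?thesis
      proof (cases "j < n")
        case True
        have "cmod ((w ! k - v ! k) $$ (i, j)) \<le> opnorm (w ! k - v ! k)" "cmod ((w ! k - v' ! k) $$ (i, j)) \<le> opnorm (w ! k - v' ! k)"
          by (rule opnorm_entry; use cv ij True in simp)+
        moreover have "opnorm (w ! k - v ! k) \<le> \<eta>" "opnorm (w ! k - v' ! k) \<le> \<eta>" using cl k w(2) by (auto simp: pclose_def levelD)
        moreover have "(w ! k - v ! k) $$ (i, j) = (w ! k) $$ (i, j) - (v ! k) $$ (i, j)" "(w ! k - v' ! k) $$ (i, j) = (w ! k) $$ (i, j) - (v' ! k) $$ (i, j)"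
          using cv ij True by auto
        ultimately have "cmod ((w ! k) $$ (i, j) - (v ! k) $$ (i, j)) \<le> \<eta>" "cmod ((w ! k) $$ (i, j) - (v' ! k) $$ (i, j)) \<le> \<eta>" by auto
        then have "cmod (((w ! k) $$ (i, j) - (v' ! k) $$ (i, j)) - ((w ! k) $$ (i, j) - (v ! k) $$ (i, j))) \<le> \<eta> + \<eta>"
          using norm_triangle_ineq4[of "(w ! k) $$ (i, j) - (v' ! k) $$ (i, j)" "(w ! k) $$ (i, j) - (v ! k) $$ (i, j)"] by linarith
        then show ?thesis using True cv ij by (simp add: yk mat_dsum_def)
      next
        case False
        then show ?thesis using cv ij h by (simp add: yk mat_dsum_def m_def)
      qed
    qed
    have "pclose (real (n * m) * (cmod (of_real c) * (2 * \<eta>))) (pt_dsum v y) Q" unfolding Q_def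
      by (rule pclose_upper[OF v(2) yl nn(1)]) (use h entry in auto)
    then have "pclose (K * (2 * \<eta>)) (pt_dsum v y) Q" using c by (simp add: K_def mult.assoc)
    from pclose_trans[OF Wl vyl Ql c3 this] have "pclose e0 W Q" unfolding h2 .
    then have QB: "Q \<in> B" by (rule e0(2)[OF Ql])
    have QU: "Q \<in> OU \<gamma> \<tau>" unfolding Q_def by (rule OU_conj[OF g vyU(1) vyl gl])
    note I = SooI[OF g _ subsetD[OF B(3)]]
    have est: "cmod (of_real c) * cmod (f v $$ (i, j) - f y $$ (i, j)) \<le> C"
      by (rule cond_nc_estimate[OF f C v n I[OF yU(1) vB(2)] yl nn(2,1) I[OF vyU(1) vyB] I[OF vyU(2) yvB(1)] I[OF QU QB, unfolded Q_def] ij])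
    have fy: "f y = mat_dsum (f v') (f z)" unfolding y_def
      by (rule cond_nc_dsum[OF f v' n I[OF z(4) v'B(2)] z(5) nn(4) I[OF yU(1) vB(2), unfolded y_def] I[OF yU(2) yvB(2)]])
    have "f v' \<in> carrier_mat n n" "f z \<in> carrier_mat (n + n) (n + n)"
      using f v' n nn(4) I[OF z(4) v'B(2)] z(5) unfolding cond_nc_def graded_def by auto
    then have "f y $$ (i, j) = f v' $$ (i, j)" unfolding fy using ij by (simp add: mat_dsum_def)
    then have "c * cmod (f v $$ (i, j) - f v' $$ (i, j)) \<le> \<bar>C\<bar> + 1" using est c by simp
    then have "cmod (f v $$ (i, j) - f v' $$ (i, j)) \<le> (\<bar>C\<bar> + 1) / c" using c by (simp add: pos_le_divide_eq mult.commute)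
    also have "\<dots> = \<epsilon>" using e by (simp add: c_def field_simps add_nonneg_eq_0_iff)
    finally show "cmod (f v $$ (i, j) - f v' $$ (i, j)) \<le> \<epsilon>" .
  qed
qed

text \<open>A direct comparison needs the union of the two spectra to be regular. An intermediate
  generic point whose eigenvalues avoid the negatives of both spectra splits the estimate into two
  regular ones.\<close>

lemma cauchy:
  assumes f: "cond_nc 2 Soo f" and C: "\<And>w. w \<in> Soo \<Longrightarrow> opnorm (f w) \<le> C"
    and w: "w \<in> S" "w \<in> level 2 n" and e: "\<epsilon> > 0"
  obtains \<eta> where "\<eta> > 0" "\<And>v v' i j. v \<in> Soo \<Longrightarrow> v \<in> level 2 n \<Longrightarrow> v' \<in> Soo \<Longrightarrow> v' \<in> level 2 n \<Longrightarrow>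
    pclose \<eta> w v \<Longrightarrow> pclose \<eta> w v' \<Longrightarrow> i < n \<Longrightarrow> j < n \<Longrightarrow> cmod (f v $$ (i, j) - f v' $$ (i, j)) \<le> \<epsilon>"
proof -
  have e2: "\<epsilon> / 2 > 0" using e by simp
  obtain \<eta> where h: "\<eta> > 0" and H: "\<And>v v' i j. v \<in> Soo \<Longrightarrow> v \<in> level 2 n \<Longrightarrow> v' \<in> Soo \<Longrightarrow> v' \<in> level 2 n \<Longrightarrow>
    regular (spectrum (dd v) \<union> spectrum (dd v')) \<Longrightarrow> pclose \<eta> w v \<Longrightarrow> pclose \<eta> w v' \<Longrightarrow> i < n \<Longrightarrow> j < n \<Longrightarrow>
    cmod (f v $$ (i, j) - f v' $$ (i, j)) \<le> \<epsilon> / 2"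
    by (rule cauchy_regular[OF f C w e2]) (assumption, rule that)
  show thesis
  proof (rule that[OF h])
    fix v v' i j
    assume v: "v \<in> Soo" "v \<in> level 2 n" and v': "v' \<in> Soo" "v' \<in> level 2 n"
      and cl: "pclose \<eta> w v" "pclose \<eta> w v'" and ij: "i < n" "j < n"
    have fin: "finite (uminus ` (spectrum (dd v) \<union> spectrum (dd v')))"
      using finite_spectrum[OF dd_carrier[OF v(2)]] finite_spectrum[OF dd_carrier[OF v'(2)]] by simp
    obtain u where u: "u \<in> Soo" "u \<in> level 2 n" "pclose \<eta> w u" "spectrum (dd u) \<inter> uminus ` (spectrum (dd v) \<union> spectrum (dd v')) = {}"
      by (rule Soo_dense[OF w h fin]) (rule that)
    have r: "regular (spectrum (dd v))" "regular (spectrum (dd v'))" "regular (spectrum (dd u))"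
      using Soo_So v v' u by (auto simp: So_regular)
    have "z \<notin> spectrum (dd u) \<or> - z \<notin> spectrum (dd v) \<union> spectrum (dd v')" for z
      using u(4) by (metis IntI empty_iff image_eqI minus_minus)
    then have "regular (spectrum (dd v) \<union> spectrum (dd u))" "regular (spectrum (dd u) \<union> spectrum (dd v'))"
      using r unfolding regular_def by (metis UnE UnI1 UnI2 minus_minus)+
    then have "cmod (f v $$ (i, j) - f u $$ (i, j)) \<le> \<epsilon> / 2" "cmod (f u $$ (i, j) - f v' $$ (i, j)) \<le> \<epsilon> / 2"
      using H v v' u cl ij by auto
    then have "cmod ((f v $$ (i, j) - f u $$ (i, j)) + (f u $$ (i, j) - f v' $$ (i, j))) \<le> \<epsilon> / 2 + \<epsilon> / 2"
      using norm_triangle_ineq[of "f v $$ (i, j) - f u $$ (i, j)" "f u $$ (i, j) - f v' $$ (i, j)"] by linarith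
    then show "cmod (f v $$ (i, j) - f v' $$ (i, j)) \<le> \<epsilon>" by simp
  qed
qed

text \<open>A rate with a free constant \<open>K\<close> instead of mere convergence: conjugating a
  sequence only changes the constant.\<close>

definition approx :: "point \<Rightarrow> (nat \<Rightarrow> point) \<Rightarrow> bool" where
  "approx w v \<longleftrightarrow> (\<exists>K. \<forall>k. v k \<in> Soo \<and> v k \<in> level 2 (lvl w) \<and> pclose (K / real (Suc k)) w (v k))"

text \<open>The limit is demanded along all approximating sequences, so that the sequence can be
  adapted to each identity to be proved.\<close>

definition ext :: "ncfun \<Rightarrow> ncfun" where
  "ext f w = (THE L. \<forall>v. approx w v \<longrightarrow> mlim (lvl w) (\<lambda>k. f (v k)) L)"

lemma approx_ex:
  assumes w: "w \<in> S" and e: "\<eta> > 0"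
  obtains v where "approx w v" "\<And>k. pclose \<eta> w (v k)"
proof -
  have "\<exists>v. v \<in> Soo \<and> v \<in> level 2 (lvl w) \<and> pclose (min \<eta> (1 / real (Suc k))) w v" for k
  proof -
    have "min \<eta> (1 / real (Suc k)) > 0" using e by simp
    then show ?thesis by (rule Soo_dense[OF w lvl_S[OF w] _ finite.emptyI]) blast
  qed
  then obtain v where v: "\<And>k. v k \<in> Soo \<and> v k \<in> level 2 (lvl w) \<and> pclose (min \<eta> (1 / real (Suc k))) w (v k)" by metis
  have "approx w v" unfolding approx_def
    by (rule exI[of _ 1]) (use v pclose_mono[OF _ min.cobounded2] in blast)
  moreover have "pclose \<eta> w (v k)" for k using v pclose_mono[OF _ min.cobounded1] by blast
  ultimately show thesis by (rule that)
qed

lemma approx_cauchy: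
  assumes f: "cond_nc 2 Soo f" and C: "\<And>w. w \<in> Soo \<Longrightarrow> opnorm (f w) \<le> C"
    and w: "w \<in> S" and v: "approx w v" "approx w v'" and ij: "i < lvl w" "j < lvl w" and e: "\<epsilon> > 0"
  shows "\<exists>N. \<forall>k\<ge>N. \<forall>l\<ge>N. cmod (f (v k) $$ (i, j) - f (v' l) $$ (i, j)) \<le> \<epsilon>"
proof -
  obtain \<eta> where h: "\<eta> > 0" and H: "\<And>v v' i j. v \<in> Soo \<Longrightarrow> v \<in> level 2 (lvl w) \<Longrightarrow> v' \<in> Soo \<Longrightarrow> v' \<in> level 2 (lvl w) \<Longrightarrow>
    pclose \<eta> w v \<Longrightarrow> pclose \<eta> w v' \<Longrightarrow> i < lvl w \<Longrightarrow> j < lvl w \<Longrightarrow> cmod (f v $$ (i, j) - f v' $$ (i, j)) \<le> \<epsilon>"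
    by (rule cauchy[OF f C w lvl_S[OF w] e]) (assumption, rule that)
  obtain K where K: "\<And>k. v k \<in> Soo \<and> v k \<in> level 2 (lvl w) \<and> pclose (K / real (Suc k)) w (v k)" using v(1) unfolding approx_def by blast
  obtain K' where K': "\<And>k. v' k \<in> Soo \<and> v' k \<in> level 2 (lvl w) \<and> pclose (K' / real (Suc k)) w (v' k)" using v(2) unfolding approx_def by blast
  define M where "M = max \<bar>K\<bar> \<bar>K'\<bar>"
  obtain N :: nat where N: "real N > M / \<eta>" using reals_Archimedean2 by blast
  have le: "K / real (Suc k) \<le> \<eta>" "K' / real (Suc k) \<le> \<eta>" if "k \<ge> N" for k
  proof -
    have "M < real N * \<eta>" using N h by (simp add: pos_divide_less_eq)
    also have "\<dots> \<le> real (Suc k) * \<eta>" using that h by (intro mult_right_mono) auto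
    finally have "K \<le> real (Suc k) * \<eta>" "K' \<le> real (Suc k) * \<eta>" unfolding M_def by auto
    then show "K / real (Suc k) \<le> \<eta>" "K' / real (Suc k) \<le> \<eta>" by (simp_all add: pos_divide_le_eq mult.commute del: of_nat_Suc)
  qed
  show ?thesis
  proof (intro exI allI impI)
    fix k l assume "k \<ge> N" "l \<ge> N"
    then have "pclose \<eta> w (v k)" "pclose \<eta> w (v' l)" using K K' le pclose_mono by blast+
    then show "cmod (f (v k) $$ (i, j) - f (v' l) $$ (i, j)) \<le> \<epsilon>" using H K K' ij by blast
  qed
qed

text \<open>One sequence defines \<open>L\<close> entrywise; the Cauchy estimate between two
  sequences shows that all others share this limit.\<close>

lemma ext_mlim:
  assumes f: "cond_nc 2 Soo f" and C: "\<And>w. w \<in> Soo \<Longrightarrow> opnorm (f w) \<le> C"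
    and w: "w \<in> S" and v: "approx w v"
  shows "mlim (lvl w) (\<lambda>k. f (v k)) (ext f w)"
proof -
  define n where "n = lvl w"
  define L where "L = Matrix.mat n n (\<lambda>(i, j). lim (\<lambda>k. f (v k) $$ (i, j)))"
  have n: "n \<ge> 1" unfolding n_def using nc_space_lvl[OF S_nc[OF w]] by simp
  have lim: "mlim n (\<lambda>k. f (v' k)) L" if v': "approx w v'" for v'
  proof (rule mlimI)
    show "f (v' k) \<in> carrier_mat n n" for k
      using v' f n unfolding approx_def cond_nc_def graded_def n_def by blast
    fix i j assume ij: "i < n" "j < n"
    have "Cauchy (\<lambda>k. f (v k) $$ (i, j))"
    proof (rule metric_CauchyI)
      fix e :: real assume "e > 0"
      then have e: "e / 2 > 0" "e / 2 < e" by simp_all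
      have "\<exists>N. \<forall>k\<ge>N. \<forall>l\<ge>N. cmod (f (v k) $$ (i, j) - f (v l) $$ (i, j)) \<le> e / 2"
        by (rule approx_cauchy[OF f C w v v ij[unfolded n_def] e(1)])
      then show "\<exists>M. \<forall>m\<ge>M. \<forall>n\<ge>M. dist (f (v m) $$ (i, j)) (f (v n) $$ (i, j)) < e"
        unfolding dist_norm using e(2) le_less_trans by blast
    qed
    then have c: "(\<lambda>k. f (v k) $$ (i, j)) \<longlonglongrightarrow> L $$ (i, j)"
      using ij by (simp add: L_def convergent_LIMSEQ_iff[symmetric] Cauchy_convergent_iff)
    have "(\<lambda>k. f (v' k) $$ (i, j) - f (v k) $$ (i, j)) \<longlonglongrightarrow> 0"
    proof (rule LIMSEQ_I)
      fix e :: real assume "e > 0"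
      then have e: "e / 2 > 0" "e / 2 < e" by simp_all
      have "\<exists>N. \<forall>k\<ge>N. \<forall>l\<ge>N. cmod (f (v' k) $$ (i, j) - f (v l) $$ (i, j)) \<le> e / 2"
        by (rule approx_cauchy[OF f C w v' v ij[unfolded n_def] e(1)])
      then show "\<exists>no. \<forall>n\<ge>no. norm (f (v' n) $$ (i, j) - f (v n) $$ (i, j) - 0) < e"
        unfolding diff_zero using e(2) le_less_trans by blast
    qed
    from tendsto_add[OF this c] show "(\<lambda>k. f (v' k) $$ (i, j)) \<longlonglongrightarrow> L $$ (i, j)" by simp
  qed (simp add: L_def)
  have "ext f w = L" unfolding ext_def n_def[symmetric]
    by (rule the_equality) (use lim v mlim_unique in blast)+
  then show ?thesis using lim[OF v] unfolding n_def by simp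
qed

end

section \<open>Chart maps under direct sums and similarities\<close>

lemma mlim_conj:
  assumes "mlim n X L" "s \<in> GLn n" shows "mlim n (\<lambda>k. mat_conj s (X k)) (mat_conj s L)"
  unfolding mat_conj_def by (intro mlim_mult mlim_const assms GLnD[OF assms(2)])

lemma mk_dsum:
  assumes "a \<in> carrier_mat n n" "b \<in> carrier_mat m m" "c \<in> carrier_mat n n" "d \<in> carrier_mat m m"
  shows "mk (mat_dsum a b) (mat_dsum c d) = pt_dsum (mk a c) (mk b d)"
  by (simp add: mk_def pt_dsum_def mat_dsum_add[OF assms])

lemma mk_conj:
  assumes "s \<in> GLn n" "u \<in> carrier_mat n n" "d \<in> carrier_mat n n"
  shows "mk (mat_conj s u) (mat_conj s d) = pt_conj s (mk u d)"
  by (simp add: mk_def pt_conj_def mat_conj_add[OF assms])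

lemma cond_nc_graded: "cond_nc d T f \<Longrightarrow> x \<in> T \<Longrightarrow> x \<in> level d n \<Longrightarrow> n \<ge> 1 \<Longrightarrow> f x \<in> carrier_mat n n"
  by (auto simp: cond_nc_def graded_def)

lemma cond_nc_conj:
  assumes "cond_nc d T f" "x \<in> T" "x \<in> level d n" "n \<ge> 1" "s \<in> GLn n" "pt_conj s x \<in> T"
  shows "f (pt_conj s x) = mat_conj s (f x)"
proof -
  have "similarity_preserving d T f" using assms(1) by (simp add: cond_nc_def)
  from this[unfolded similarity_preserving_def, rule_format, of n x s] assms show ?thesis by simp
qed

context radii_branches
begin

lemma omega_dsum:
  assumes g: "\<gamma> \<in> Gam" and p: "p \<in> W_gam r \<gamma>" and q: "q \<in> W_gam r \<gamma>"
  shows "omega r sq \<gamma> \<tau> (pt_dsum p q) = pt_dsum (omega r sq \<gamma> \<tau> p) (omega r sq \<gamma> \<tau> q)"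
proof -
  obtain n where n: "p \<in> level 2 n" "p ! 0 \<in> carrier_mat n n" "p ! 1 \<in> carrier_mat n n" "spectrum (p ! 1) \<subseteq> discs r \<gamma>"
    by (rule W_gamE[OF p]) (rule that)
  obtain m where m: "q \<in> level 2 m" "q ! 0 \<in> carrier_mat m m" "q ! 1 \<in> carrier_mat m m" "spectrum (q ! 1) \<subseteq> discs r \<gamma>"
    by (rule W_gamE[OF q]) (rule that)
  have i: "pt_dsum p q ! 0 = mat_dsum (p ! 0) (q ! 0)" "pt_dsum p q ! 1 = mat_dsum (p ! 1) (q ! 1)"
    using pt_dsum_nth[OF n(1) m(1)] by auto
  show ?thesis unfolding omega_mk i S_mat_dsum[OF g n(3) m(3) n(4) m(4)]
    by (rule mk_dsum[OF n(2) m(2) S_mat_carrier[OF n(3)] S_mat_carrier[OF m(3)]])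
qed

lemma omega_conj:
  assumes g: "\<gamma> \<in> Gam" and p: "p \<in> W_gam r \<gamma>" "p \<in> level 2 n" and s: "s \<in> GLn n"
  shows "omega r sq \<gamma> \<tau> (pt_conj s p) = pt_conj s (omega r sq \<gamma> \<tau> p)"
proof -
  have n: "p ! 0 \<in> carrier_mat n n" "p ! 1 \<in> carrier_mat n n" using levelD(2)[OF p(2)] by auto
  have sp: "spectrum (p ! 1) \<subseteq> discs r \<gamma>" using p(1) by (simp add: W_gam_iff)
  have i: "pt_conj s p ! 0 = mat_conj s (p ! 0)" "pt_conj s p ! 1 = mat_conj s (p ! 1)"
    using pt_conj_nth[OF p(2)] by auto
  show ?thesis unfolding omega_mk i S_mat_conj[OF g s n(2) sp]
    by (rule mk_conj[OF s n(1) S_mat_carrier[OF n(2)]])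
qed

end

section \<open>The extension is conditionally nc\<close>

context sym_dom
begin

lemma ext_eq:
  assumes f: "cond_nc 2 Soo f" and C: "\<And>w. w \<in> Soo \<Longrightarrow> opnorm (f w) \<le> C" and w: "w \<in> Soo"
  shows "ext f w = f w"
proof -
  have wS: "w \<in> S" by (rule Soo_S[OF w])
  have a: "approx w (\<lambda>_. w)" unfolding approx_def by (rule exI[of _ 0]) (simp add: w lvl_S[OF wS] pclose_refl[OF lvl_S[OF wS]])
  have c: "f w \<in> carrier_mat (lvl w) (lvl w)" by (rule cond_nc_graded[OF f w lvl_S[OF wS] level_pos[OF wS lvl_S[OF wS]]])
  have m: "mlim (lvl w) (\<lambda>k. f w) (ext f w)" by (rule ext_mlim[OF f C wS a])
  show ?thesis by (rule mlim_unique[OF m mlim_const[OF c]])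
qed

lemma ext_carrier:
  assumes f: "cond_nc 2 Soo f" and C: "\<And>w. w \<in> Soo \<Longrightarrow> opnorm (f w) \<le> C" and w: "w \<in> S" "w \<in> level 2 n"
  shows "ext f w \<in> carrier_mat n n" "opnorm (ext f w) \<le> C"
proof -
  have one: "(0::real) < 1" by simp
  obtain v where v: "approx w v" by (rule approx_ex[OF w(1) one]) (rule that)
  have m: "mlim (lvl w) (\<lambda>k. f (v k)) (ext f w)" by (rule ext_mlim[OF f C w(1) v])
  have l: "lvl w = n" using lvl_level[OF w(2)] by simp
  show "ext f w \<in> carrier_mat n n" using mlimD(1)[OF m] l by simp
  show "opnorm (ext f w) \<le> C" by (rule mlim_opnorm_le[OF m]) (use v C in \<open>auto simp: approx_def\<close>)
qed

lemma ext_flip: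
  assumes f: "cond_nc 2 Soo f" and C: "\<And>w. w \<in> Soo \<Longrightarrow> opnorm (f w) \<le> C" and sym: "symmetric_on Soo f" and w: "w \<in> S"
  shows "ext f (flip w) = ext f w"
proof -
  have one: "(0::real) < 1" by simp
  obtain v where v: "approx w v" by (rule approx_ex[OF w one]) (rule that)
  note l = lvl_S[OF w]
  have lf: "lvl (flip w) = lvl w" by (rule lvl_level[OF flip_level[OF l]]) simp
  obtain K where K: "\<And>k. v k \<in> Soo \<and> v k \<in> level 2 (lvl w) \<and> pclose (K / real (Suc k)) w (v k)" using v unfolding approx_def by blast
  have a: "approx (flip w) (\<lambda>k. flip (v k))" unfolding approx_def lf
    by (rule exI[of _ K]) (use K flip_Soo flip_level pclose_flip[OF l] in blast)
  have m1: "mlim (lvl w) (\<lambda>k. f (v k)) (ext f w)" by (rule ext_mlim[OF f C w v])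
  have m2: "mlim (lvl (flip w)) (\<lambda>k. f (flip (v k))) (ext f (flip w))" by (rule ext_mlim[OF f C flip_S[OF w] a])
  have "f (flip (v k)) = f (v k)" for k using sym K by (simp add: symmetric_on_def)
  then show ?thesis using mlim_unique[OF m2[unfolded lf]] m1 by simp
qed

text \<open>Conjugation distorts distances by at most \<open>opnorm (minv s) * opnorm s\<close>, so
  the approximants are taken close enough for their conjugates to remain in \<open>S\<close>;
  genericity is invariant under similarity.\<close>

lemma ext_conj:
  assumes f: "cond_nc 2 Soo f" and C: "\<And>w. w \<in> Soo \<Longrightarrow> opnorm (f w) \<le> C" and w: "w \<in> S" "w \<in> level 2 n"
    and s: "s \<in> GLn n" and sw: "pt_conj s w \<in> S"
  shows "ext f (pt_conj s w) = mat_conj s (ext f w)"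
proof -
  have l: "lvl w = n" "lvl (pt_conj s w) = n" using lvl_level w(2) pt_conj_level[OF s w(2)] by auto
  obtain e where e: "e > 0" "\<And>y. y \<in> level 2 n \<Longrightarrow> pclose e (pt_conj s w) y \<Longrightarrow> y \<in> S"
    by (rule S_nbhd[OF sw pt_conj_level[OF s w(2)]]) (rule that)
  define P where "P = opnorm (minv s) * opnorm s"
  have P: "P \<ge> 0" by (simp add: P_def)
  define \<eta> where "\<eta> = e / (P + 1)"
  have h: "\<eta> > 0" using e P by (simp add: \<eta>_def add_nonneg_pos)
  have "P * \<eta> \<le> (P + 1) * \<eta>" using h by (intro mult_right_mono) auto
  also have "\<dots> = e" using P by (simp add: \<eta>_def add_nonneg_eq_0_iff)
  finally have Ph: "opnorm (minv s) * \<eta> * opnorm s \<le> e" by (simp add: P_def mult.commute mult.left_commute)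
  obtain v where v: "approx w v" "\<And>k. pclose \<eta> w (v k)" by (rule approx_ex[OF w(1) h]) (rule that)
  obtain K where K: "\<And>k. v k \<in> Soo \<and> v k \<in> level 2 n \<and> pclose (K / real (Suc k)) w (v k)" using v(1) unfolding approx_def l by blast
  have cS: "pt_conj s (v k) \<in> S" for k
    by (rule e(2)[OF pt_conj_level[OF s] pclose_mono[OF pclose_conj[OF s w(2) _ v(2)] Ph]]) (use K in auto)
  have cSoo: "pt_conj s (v k) \<in> Soo" for k by (rule pt_conj_Soo[OF _ _ s cS]) (use K in auto)
  have a: "approx (pt_conj s w) (\<lambda>k. pt_conj s (v k))" unfolding approx_def l
  proof (intro exI[of _ "opnorm (minv s) * K * opnorm s"] allI conjI cSoo)
    fix k
    show "pt_conj s (v k) \<in> level 2 n" by (rule pt_conj_level[OF s]) (use K in auto)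
    have "pclose (opnorm (minv s) * (K / real (Suc k)) * opnorm s) (pt_conj s w) (pt_conj s (v k))"
      by (rule pclose_conj[OF s w(2)]) (use K in auto)
    then show "pclose (opnorm (minv s) * K * opnorm s / real (Suc k)) (pt_conj s w) (pt_conj s (v k))" by (simp del: of_nat_Suc)
  qed
  have m1: "mlim (lvl w) (\<lambda>k. f (v k)) (ext f w)" by (rule ext_mlim[OF f C w(1) v(1)])
  have m2: "mlim (lvl (pt_conj s w)) (\<lambda>k. f (pt_conj s (v k))) (ext f (pt_conj s w))" by (rule ext_mlim[OF f C sw a])
  have "f (pt_conj s (v k)) = mat_conj s (f (v k))" for k
    by (rule cond_nc_conj[OF f _ _ level_pos[OF w] s cSoo]) (use K in auto)
  then show ?thesis using mlim_unique[OF m2[unfolded l]] mlim_conj[OF m1[unfolded l] s] by simp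
qed

text \<open>Generic approximants \<open>x'\<close> and \<open>y'\<close> need not have a generic
  sum. A third summand \<open>z\<close>, generic and near \<open>x \<oplus> y\<close>, repairs this,
  and the identity for triples passes to the limit.\<close>

lemma ext_dsum3:
  assumes f: "cond_nc 2 Soo f" and C: "\<And>w. w \<in> Soo \<Longrightarrow> opnorm (f w) \<le> C"
    and x: "x \<in> S" "x \<in> level 2 n" and y: "y \<in> S" "y \<in> level 2 m" and xy: "pt_dsum x y \<in> S"
  defines "X \<equiv> pt_dsum x y"
  shows "pt_dsum x (pt_dsum y X) \<in> S"
    "ext f (pt_dsum x (pt_dsum y X)) = mat_dsum (ext f x) (mat_dsum (ext f y) (ext f X))"
proof -
  note n = level_pos[OF x] and m = level_pos[OF y]
  note nc = S_nc[OF x(1)] S_nc[OF y(1)]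
  have XS: "X \<in> S" using xy by (simp add: X_def)
  have Xl: "X \<in> level 2 (n + m)" unfolding X_def by (rule pt_dsum_level[OF x(2) y(2)])
  obtain B where B: "B \<in> free_base 2" "X \<in> B" "B \<subseteq> S" by (rule free_topE[OF free_domain XS])
  have Bd: "pt_dsum a b \<in> B \<longleftrightarrow> a \<in> B \<and> b \<in> B" if "a \<in> nc_space 2" "b \<in> nc_space 2" for a b
    using free_base_dsum[OF B(1) _ that] by simp
  have xyB: "x \<in> B" "y \<in> B" using B(2) Bd[OF nc] by (auto simp: X_def)
  define W where "W = pt_dsum x (pt_dsum y X)"
  have WB: "W \<in> B" unfolding W_def using B(2) xyB by (simp add: Bd pt_dsum_nc_space nc S_nc[OF XS])
  then show WS: "pt_dsum x (pt_dsum y X) \<in> S" using B(3) by (auto simp: W_def)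
  have yXl: "pt_dsum y X \<in> level 2 (m + (n + m))" by (rule pt_dsum_level[OF y(2) Xl])
  have Wl: "W \<in> level 2 (n + (m + (n + m)))" unfolding W_def by (rule pt_dsum_level[OF x(2) yXl])
  have nn: "1 \<le> n + m" "1 \<le> n + (m + (n + m))" using n by auto
  obtain e0 where e0: "e0 > 0" "\<And>y. y \<in> level 2 (n + (m + (n + m))) \<Longrightarrow> pclose e0 W y \<Longrightarrow> y \<in> B"
    by (rule free_base_finitely_open[OF B(1) _ WB Wl nn(2)]) (simp, rule that)
  have step: "\<exists>x' y' z. x' \<in> Soo \<and> x' \<in> level 2 n \<and> pclose (2 * h) x x' \<and> y' \<in> Soo \<and> y' \<in> level 2 m \<and> pclose (2 * h) y y' \<and>
      z \<in> Soo \<and> z \<in> level 2 (n + m) \<and> pclose (2 * h) X z \<and> pt_dsum x' (pt_dsum y' z) \<in> Soo \<and>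
      f (pt_dsum x' (pt_dsum y' z)) = mat_dsum (f x') (mat_dsum (f y') (f z))" if h: "h > 0" "2 * h \<le> e0" for h
  proof -
    \<comment> \<open>One shift for the whole sum: its regularity places \<open>x'\<close>,
      \<open>y'\<close> and \<open>z\<close> in a common \<open>OW \<gamma> \<tau>\<close>, although
      \<open>x'\<close> and \<open>y'\<close> are generic with respect to charts of their
      own.\<close>
    obtain t where t: "cmod t \<le> h" "regular (spectrum (dd (shift t X)))"
      by (rule ex_shift[OF Xl finite.emptyI h(1)]) (rule that)
    note sx = shift_level(1)[OF x(2), of t] and sy = shift_level(1)[OF y(2), of t] and sX = shift_level(1)[OF Xl, of t]
    have sXd: "shift t X = pt_dsum (shift t x) (shift t y)" unfolding X_def by (rule shift_dsum[OF x(2) y(2)])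
    have sp: "spectrum (dd (shift t X)) = spectrum (dd (shift t x)) \<union> spectrum (dd (shift t y))"
      unfolding sXd dd_dsum[OF sx sy] by (rule spectrum_dsum[OF dd_carrier[OF sx] dd_carrier[OF sy]])
    have reg: "regular (spectrum (dd (shift t x)))" "regular (spectrum (dd (shift t y)))" using t(2) regular_mono unfolding sp by blast+
    obtain \<gamma>1 \<tau>1 x' where x': "\<gamma>1 \<in> Gam" "\<tau>1 \<in> signs \<gamma>1" "x' \<in> OU \<gamma>1 \<tau>1" "x' \<in> level 2 n" "pclose h (shift t x) x'" "dd x' = dd (shift t x)"
      by (rule OU_near[OF sx n reg(1) h(1)]) (rule that)
    obtain \<gamma>2 \<tau>2 y' where y': "\<gamma>2 \<in> Gam" "\<tau>2 \<in> signs \<gamma>2" "y' \<in> OU \<gamma>2 \<tau>2" "y' \<in> level 2 m" "pclose h (shift t y) y'" "dd y' = dd (shift t y)"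
      by (rule OU_near[OF sy m reg(2) h(1)]) (rule that)
    obtain \<gamma> \<tau> z where z: "\<gamma> \<in> Gam" "\<tau> \<in> signs \<gamma>" "spectrum (dd (shift t X)) \<subseteq> VV \<gamma> \<tau>" "z \<in> OU \<gamma> \<tau>" "z \<in> level 2 (n + m)" "pclose h (shift t X) z"
      by (rule OU_near[OF sX nn(1) t(2) h(1)]) (rule that)
    note g = z(1,2)
    have cl: "pclose (2 * h) x x'" "pclose (2 * h) y y'" "pclose (2 * h) X z"
      unfolding mult_2 by (fact pclose_trans[OF x(2) sx x'(4) pclose_mono[OF pclose_shift[OF x(2)] t(1)] x'(5)]
        pclose_trans[OF y(2) sy y'(4) pclose_mono[OF pclose_shift[OF y(2)] t(1)] y'(5)]
        pclose_trans[OF Xl sX z(5) pclose_mono[OF pclose_shift[OF Xl] t(1)] z(6)])+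
    have nc': "x' \<in> nc_space 2" "y' \<in> nc_space 2" "z \<in> nc_space 2"
      using nc_spaceI[OF n x'(4)] nc_spaceI[OF m y'(4)] nc_spaceI[OF nn(1) z(5)] by auto
    have OW: "x' \<in> OW \<gamma> \<tau>" "y' \<in> OW \<gamma> \<tau>" "z \<in> OW \<gamma> \<tau>"
      using nc' z(3) subsetD[OF OU_subset_OW z(4)] x'(6) y'(6) by (simp_all add: OW_iff[OF g] sp)
    define q where "q = pt_dsum y' z"
    have ql: "q \<in> level 2 (m + (n + m))" unfolding q_def by (rule pt_dsum_level[OF y'(4) z(5)])
    have qnc: "q \<in> nc_space 2" unfolding q_def by (rule pt_dsum_nc_space[OF nc'(2,3)])
    have qU: "q \<in> OU \<gamma> \<tau>" "pt_dsum z y' \<in> OU \<gamma> \<tau>" unfolding q_def using OU_dsum[OF g OW(2,3)] OU_dsum[OF g OW(3,2)] z(4) by auto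
    have qW: "q \<in> OW \<gamma> \<tau>" using qU OU_subset_OW by blast
    have pU: "pt_dsum x' q \<in> OU \<gamma> \<tau>" "pt_dsum q x' \<in> OU \<gamma> \<tau>" using OU_dsum[OF g OW(1) qW] OU_dsum[OF g qW OW(1)] qU by auto
    have c3: "pclose (2 * h) W (pt_dsum x' q)" unfolding W_def q_def
      by (rule pclose_dsum[OF x(2) x'(4) yXl pt_dsum_level[OF y'(4) z(5)] cl(1) pclose_dsum[OF y(2) y'(4) Xl z(5) cl(2,3)]])
    have pB: "pt_dsum x' q \<in> B" by (rule e0(2)[OF pt_dsum_level[OF x'(4) ql] pclose_mono[OF c3 h(2)]])
    have xB: "x' \<in> B" "q \<in> B" using pB Bd[OF nc'(1) qnc] by auto
    have yB: "y' \<in> B" "z \<in> B" using xB(2) Bd[OF nc'(2,3)] by (auto simp: q_def)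
    have qB: "pt_dsum q x' \<in> B" "pt_dsum z y' \<in> B" using xB yB Bd[OF qnc nc'(1)] Bd[OF nc'(3,2)] by auto
    note I = SooI[OF g _ subsetD[OF B(3)]]
    have Soo: "x' \<in> Soo" "y' \<in> Soo" "z \<in> Soo"
      using SooI[OF x'(1-3) subsetD[OF B(3) xB(1)]] SooI[OF y'(1-3) subsetD[OF B(3) yB(1)]] I[OF z(4) yB(2)] by auto
    have m1: "1 \<le> m + (n + m)" using m by simp
    have "f (pt_dsum x' q) = mat_dsum (f x') (f q)"
      by (rule cond_nc_dsum[OF f Soo(1) x'(4) n I[OF qU(1) xB(2)] ql m1 I[OF pU(1) pB] I[OF pU(2) qB(1)]])
    moreover have "f q = mat_dsum (f y') (f z)" unfolding q_def
      by (rule cond_nc_dsum[OF f Soo(2) y'(4) m Soo(3) z(5) nn(1) I[OF qU(1) xB(2), unfolded q_def] I[OF qU(2) qB(2)]])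
    ultimately show ?thesis using Soo x'(4) y'(4) z(5) cl I[OF pU(1) pB] unfolding q_def by metis
  qed
  have "\<exists>p. fst p \<in> Soo \<and> fst p \<in> level 2 n \<and> pclose (2 / real (Suc k)) x (fst p) \<and>
      fst (snd p) \<in> Soo \<and> fst (snd p) \<in> level 2 m \<and> pclose (2 / real (Suc k)) y (fst (snd p)) \<and>
      snd (snd p) \<in> Soo \<and> snd (snd p) \<in> level 2 (n + m) \<and> pclose (2 / real (Suc k)) X (snd (snd p)) \<and>
      pt_dsum (fst p) (pt_dsum (fst (snd p)) (snd (snd p))) \<in> Soo \<and>
      f (pt_dsum (fst p) (pt_dsum (fst (snd p)) (snd (snd p)))) = mat_dsum (f (fst p)) (mat_dsum (f (fst (snd p))) (f (snd (snd p))))" for k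
  proof -
    define h where "h = min (e0 / 2) (1 / real (Suc k))"
    have h: "h > 0" "2 * h \<le> e0" "2 * h \<le> 2 / real (Suc k)" using e0 by (auto simp: h_def min_def)
    obtain x' y' z where s: "x' \<in> Soo" "x' \<in> level 2 n" "pclose (2 * h) x x'" "y' \<in> Soo" "y' \<in> level 2 m" "pclose (2 * h) y y'"
      "z \<in> Soo" "z \<in> level 2 (n + m)" "pclose (2 * h) X z" "pt_dsum x' (pt_dsum y' z) \<in> Soo"
      "f (pt_dsum x' (pt_dsum y' z)) = mat_dsum (f x') (mat_dsum (f y') (f z))" using step[OF h(1,2)] by blast
    show ?thesis
      by (rule exI[of _ "(x', y', z)"]) (simp only: fst_conv snd_conv s pclose_mono[OF s(3) h(3)] pclose_mono[OF s(6) h(3)] pclose_mono[OF s(9) h(3)] simp_thms)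
  qed
  then obtain p where p: "\<And>k. fst (p k) \<in> Soo \<and> fst (p k) \<in> level 2 n \<and> pclose (2 / real (Suc k)) x (fst (p k)) \<and>
      fst (snd (p k)) \<in> Soo \<and> fst (snd (p k)) \<in> level 2 m \<and> pclose (2 / real (Suc k)) y (fst (snd (p k))) \<and>
      snd (snd (p k)) \<in> Soo \<and> snd (snd (p k)) \<in> level 2 (n + m) \<and> pclose (2 / real (Suc k)) X (snd (snd (p k))) \<and>
      pt_dsum (fst (p k)) (pt_dsum (fst (snd (p k))) (snd (snd (p k)))) \<in> Soo \<and>
      f (pt_dsum (fst (p k)) (pt_dsum (fst (snd (p k))) (snd (snd (p k))))) = mat_dsum (f (fst (p k))) (mat_dsum (f (fst (snd (p k)))) (f (snd (snd (p k)))))"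
    by metis
  define a b c where "a k = fst (p k)" "b k = fst (snd (p k))" "c k = snd (snd (p k))" for k
  note P = p[folded a_b_c_def]
  have l: "lvl x = n" "lvl y = m" "lvl X = n + m" "lvl W = n + (m + (n + m))" using lvl_level x(2) y(2) Xl Wl by auto
  have ap: "approx x a" "approx y b" "approx X c" unfolding approx_def l by (rule exI[of _ 2], use P in blast)+
  have apW: "approx W (\<lambda>k. pt_dsum (a k) (pt_dsum (b k) (c k)))" unfolding approx_def l
  proof (intro exI[of _ 2] allI conjI)
    fix k
    show "pt_dsum (a k) (pt_dsum (b k) (c k)) \<in> Soo" using P by blast
    have lv: "a k \<in> level 2 n" "b k \<in> level 2 m" "c k \<in> level 2 (n + m)" using P by blast+
    show "pt_dsum (a k) (pt_dsum (b k) (c k)) \<in> level 2 (n + (m + (n + m)))" by (intro pt_dsum_level lv)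
    show "pclose (2 / real (Suc k)) W (pt_dsum (a k) (pt_dsum (b k) (c k)))" unfolding W_def
      by (rule pclose_dsum[OF x(2) lv(1) yXl pt_dsum_level[OF lv(2,3)] _ pclose_dsum[OF y(2) lv(2) Xl lv(3)]]) (use P in blast)+
  qed
  have ma: "mlim n (\<lambda>k. f (a k)) (ext f x)" using ext_mlim[OF f C x(1) ap(1)] unfolding l by this
  have mb: "mlim m (\<lambda>k. f (b k)) (ext f y)" using ext_mlim[OF f C y(1) ap(2)] unfolding l by this
  have mc: "mlim (n + m) (\<lambda>k. f (c k)) (ext f X)" using ext_mlim[OF f C XS ap(3)] unfolding l by this
  have mW: "mlim (n + (m + (n + m))) (\<lambda>k. f (pt_dsum (a k) (pt_dsum (b k) (c k)))) (ext f W)"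
  proof -
    have "W \<in> S" using WS by (simp add: W_def)
    from ext_mlim[OF f C this apW] show ?thesis unfolding l by this
  qed
  have "f (pt_dsum (a k) (pt_dsum (b k) (c k))) = mat_dsum (f (a k)) (mat_dsum (f (b k)) (f (c k)))" for k using P by blast
  then have "mlim (n + (m + (n + m))) (\<lambda>k. mat_dsum (f (a k)) (mat_dsum (f (b k)) (f (c k)))) (ext f W)" using mW by simp
  from mlim_unique[OF this mlim_dsum[OF ma mlim_dsum[OF mb mc]]]
  show "ext f (pt_dsum x (pt_dsum y X)) = mat_dsum (ext f x) (mat_dsum (ext f y) (ext f X))" unfolding W_def .
qed

text \<open>With \<open>X = x \<oplus> y\<close>, the extension \<open>g\<close> satisfies \<open>g (X \<oplus> X) = (g x \<oplus> g y) \<oplus> g X\<close>, and \<open>X \<oplus> X\<close> is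
  invariant under interchanging the two summands.\<close>
lemma ext_dsum:
  assumes f: "cond_nc 2 Soo f" and C: "\<And>w. w \<in> Soo \<Longrightarrow> opnorm (f w) \<le> C"
    and x: "x \<in> S" "x \<in> level 2 n" and y: "y \<in> S" "y \<in> level 2 m" and xy: "pt_dsum x y \<in> S"
  shows "ext f (pt_dsum x y) = mat_dsum (ext f x) (ext f y)"
proof -
  define X where "X = pt_dsum x y"
  define G where "G = mat_dsum (ext f x) (ext f y)"
  have Xl: "X \<in> level 2 (n + m)" unfolding X_def by (rule pt_dsum_level[OF x(2) y(2)])
  have XS: "X \<in> S" using xy by (simp add: X_def)
  have d3: "pt_dsum x (pt_dsum y X) \<in> S" "ext f (pt_dsum x (pt_dsum y X)) = mat_dsum (ext f x) (mat_dsum (ext f y) (ext f X))"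
    unfolding X_def by (rule ext_dsum3[OF f C x y xy]; assumption)+
  have as: "pt_dsum x (pt_dsum y X) = pt_dsum X X" unfolding pt_dsum_assoc by (simp add: X_def)
  have XX: "pt_dsum X X \<in> S" "ext f (pt_dsum X X) = mat_dsum G (ext f X)"
    using d3 unfolding as by (simp_all add: G_def mat_dsum_assoc)
  have c: "ext f x \<in> carrier_mat n n" "ext f y \<in> carrier_mat m m" "ext f X \<in> carrier_mat (n + m) (n + m)"
    by (rule ext_carrier(1)[OF f C x], assumption, rule ext_carrier(1)[OF f C y], assumption, rule ext_carrier(1)[OF f C XS Xl], assumption)
  have G: "G \<in> carrier_mat (n + m) (n + m)" unfolding G_def using c by auto
  note sw = pt_conj_swapm[OF Xl Xl]
  have "ext f (pt_conj (swapm (n + m) (n + m)) (pt_dsum X X)) = mat_conj (swapm (n + m) (n + m)) (ext f (pt_dsum X X))"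
    by (rule ext_conj[OF f C XX(1) pt_dsum_level[OF Xl Xl] swapm_GLn]) (simp_all add: sw XX(1))
  then have "mat_dsum G (ext f X) = mat_dsum (ext f X) G" unfolding sw XX(2) mat_conj_swapm[OF G c(3)] .
  then have "G = ext f X" by (rule conjunct1[OF iffD1[OF mat_dsum_inject[OF G c(3) c(3) G]]])
  then show ?thesis by (simp add: G_def X_def)
qed

text \<open>The extension is its own hat function, since summands of members of \<open>S\<close> lie
  in \<open>S\<close>.\<close>

lemma ext_cond_nc:
  assumes f: "cond_nc 2 Soo f" and C: "\<And>w. w \<in> Soo \<Longrightarrow> opnorm (f w) \<le> C"
  shows "cond_nc 2 S (ext f)"
  unfolding cond_nc_def
proof (intro conjI exI[of _ "ext f"] ballI impI)
  have hS: "hat 2 S \<subseteq> S" using S_dsumD(2) S_nc unfolding hat_def by blast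
  show "graded 2 S (ext f)" unfolding graded_def using ext_carrier(1)[OF f C] by blast
  then show "graded 2 (hat 2 S) (ext f)" using hS unfolding graded_def by blast
  show "similarity_preserving 2 S (ext f)" unfolding similarity_preserving_def using ext_conj[OF f C] by blast
  fix x y assume x: "x \<in> S" and y: "y \<in> nc_space 2" and xy: "pt_dsum x y \<in> S"
  have yS: "y \<in> S" by (rule S_dsumD(2)[OF xy S_nc[OF x] y])
  show "ext f (pt_dsum x y) = mat_dsum (ext f x) (ext f y)"
    by (rule ext_dsum[OF f C x lvl_S[OF x] yS lvl_S[OF yS] xy])
qed

end

section \<open>The quotient map\<close>

text \<open>With \<open>k = J\<close> and \<open>k = - J\<close> and the various signs of
  \<open>d\<close> and \<open>e\<close>, this produces all intertwining relations of
  \<open>pi_fibre\<close>.\<close>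

lemma intertwine_add:
  assumes c: "u \<in> carrier_mat n n" "a \<in> carrier_mat n n" "b \<in> carrier_mat n n" "k \<in> carrier_mat n n"
    and h: "k * u = u * k" "a * k = b" "k * b = (a :: complex mat)"
  shows "(u + a) * (1\<^sub>m n + k) = (1\<^sub>m n + k) * (u + b)"
proof -
  have one: "1\<^sub>m n \<in> carrier_mat n n" by simp
  have uk: "u * k \<in> carrier_mat n n" by (rule mult_carrier_mat[OF c(1,4)])
  have "(u + a) * (1\<^sub>m n + k) = (u + a) * 1\<^sub>m n + (u + a) * k"
    by (rule mult_add_distrib_mat[OF add_carrier_mat[OF c(2)] one c(4)])
  also have "\<dots> = (u + a) + (u * k + b)"
    unfolding right_mult_one_mat[OF add_carrier_mat[OF c(2)]] add_mult_distrib_mat[OF c(1,2,4)] h(2) ..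
  also have "\<dots> = (u + b) + (u * k + a)" using c uk by (intro eq_matI) auto
  also have "\<dots> = 1\<^sub>m n * (u + b) + k * (u + b)"
    unfolding left_mult_one_mat[OF add_carrier_mat[OF c(3)]] mult_add_distrib_mat[OF c(4,1,3)] h(1,3) ..
  also have "\<dots> = (1\<^sub>m n + k) * (u + b)" by (rule add_mult_distrib_mat[OF one c(4) add_carrier_mat[OF c(3)], symmetric])
  finally show ?thesis .
qed

text \<open>The involution is \<open>J = d\<^sup>-\<^sup>1 e\<close>.\<close>
lemma square_root_involution:
  assumes c: "u \<in> carrier_mat n n" "d \<in> GLn n" "e \<in> carrier_mat n n"
    and sq: "d * d = e * e" and comm: "d * e = e * d" and due: "d * u * d = e * u * e"
  obtains J where "J \<in> carrier_mat n n" "J * u = u * J" "d * J = e" "J * e = d"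
proof -
  define I where "I = minv d"
  have I: "d \<in> carrier_mat n n" "I \<in> carrier_mat n n" "d * I = 1\<^sub>m n" "I * d = 1\<^sub>m n" using GLnD[OF c(2)] by (auto simp: I_def)
  define J where "J = I * e"
  have J: "J \<in> carrier_mat n n" unfolding J_def by (rule mult_carrier_mat[OF I(2) c(3)])
  have as: "A * B * C = A * (B * C)" if "A \<in> carrier_mat n n" "B \<in> carrier_mat n n" "C \<in> carrier_mat n n" for A B C :: "complex mat"
    by (rule assoc_mult_mat[OF that])
  have cI: "I * (d * A) = A" "d * (I * A) = A" if "A \<in> carrier_mat n n" for A
    using as[OF I(2,1) that] as[OF I(1,2) that] I(3,4) that by simp_all
  have dJ: "d * J = e" unfolding J_def by (rule cI(2)[OF c(3)])
  have Je: "J * e = d" unfolding J_def as[OF I(2) c(3,3)] sq[symmetric] by (rule cI(1)[OF I(1)])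
  have Jd: "J * d = e" unfolding J_def as[OF I(2) c(3) I(1)] comm[symmetric] by (rule cI(1)[OF c(3)])
  have eJ: "e * J = d"
  proof -
    have "d * (e * J) = (e * d) * J" unfolding comm[symmetric] by (rule as[OF I(1) c(3) J, symmetric])
    also have "\<dots> = e * e" unfolding as[OF c(3) I(1) J] dJ ..
    finally have "I * (d * (e * J)) = I * (d * d)" unfolding sq by simp
    then show ?thesis unfolding cI(1)[OF mult_carrier_mat[OF c(3) J]] cI(1)[OF I(1)] .
  qed
  have ud: "u * d \<in> carrier_mat n n" "u * e \<in> carrier_mat n n" by (rule mult_carrier_mat[OF c(1) I(1)], rule mult_carrier_mat[OF c(1,3)])
  \<comment> \<open>Cancels \<open>d\<close> on the left of \<open>d * u * d = e * u * e\<close>; a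
    second use of \<open>J\<close> then yields commutation with \<open>u\<close>.\<close>
  have 1: "u * d = J * (u * e)"
  proof -
    have "I * (d * (u * d)) = I * (e * (u * e))" using due unfolding as[OF I(1) c(1) I(1)] as[OF c(3,1,3)] by simp
    then show ?thesis unfolding cI(1)[OF ud(1)] J_def as[OF I(2) c(3) ud(2)] .
  qed
  have 2: "u * e = J * (u * d)"
  proof -
    have "u * e = (u * d) * J" unfolding as[OF c(1) I(1) J] dJ ..
    also have "\<dots> = (J * (u * e)) * J" unfolding 1 ..
    also have "\<dots> = J * (u * d)" unfolding as[OF J ud(2) J] as[OF c(1,3) J] eJ ..
    finally show ?thesis .
  qed
  have "(u * J) * d = (J * u) * d" unfolding as[OF c(1) J I(1)] as[OF J c(1) I(1)] Jd by (rule 2)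
  then have "((u * J) * d) * I = ((J * u) * d) * I" by simp
  then have "u * J = J * u"
    unfolding as[OF mult_carrier_mat[OF c(1) J] I(1,2)] as[OF mult_carrier_mat[OF J c(1)] I(1,2)] I(3)
      right_mult_one_mat[OF mult_carrier_mat[OF c(1) J]] right_mult_one_mat[OF mult_carrier_mat[OF J c(1)]] .
  then show thesis using that[OF J _ dJ Je] by simp
qed

lemma pt_dsum_inject:
  assumes "x \<in> level d n" "x' \<in> level d n" "y \<in> level d m" "y' \<in> level d m" "pt_dsum x y = pt_dsum x' y'"
  shows "x = x'" "y = y'"
proof -
  have "x ! i = x' ! i \<and> y ! i = y' ! i" if i: "i < d" for i
  proof -
    note c = levelD(2)[OF assms(1) i] levelD(2)[OF assms(3) i] levelD(2)[OF assms(2) i] levelD(2)[OF assms(4) i]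
    have "mat_dsum (x ! i) (y ! i) = mat_dsum (x' ! i) (y' ! i)"
      unfolding pt_dsum_nth[OF assms(1,3) i, symmetric] pt_dsum_nth[OF assms(2,4) i, symmetric] assms(5) ..
    then show ?thesis using mat_dsum_inject[OF c] by blast
  qed
  then show "x = x'" "y = y'" using assms(1-4) by (auto intro!: nth_equalityI simp: levelD(1))
qed

lemma cond_nc_subset:
  assumes f: "cond_nc d D f" and D: "D' \<subseteq> D" and eq: "\<And>x. x \<in> D' \<Longrightarrow> f' x = f x"
  shows "cond_nc d D' f'"
proof -
  obtain fh where fh: "graded d (hat d D) fh" "\<forall>x\<in>D. \<forall>y\<in>nc_space d. pt_dsum x y \<in> D \<longrightarrow> f (pt_dsum x y) = mat_dsum (f x) (fh y)"
    using f unfolding cond_nc_def by blast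
  have hat: "hat d D' \<subseteq> hat d D" using D unfolding hat_def by blast
  show ?thesis unfolding cond_nc_def
  proof (intro conjI exI[of _ fh] ballI impI)
    have "graded d D f" using f by (simp add: cond_nc_def)
    then show "graded d D' f'" using D eq unfolding graded_def by auto
    have "similarity_preserving d D f" using f by (simp add: cond_nc_def)
    then show "similarity_preserving d D' f'" using D eq unfolding similarity_preserving_def by auto
    show "graded d (hat d D') fh" using fh(1) hat unfolding graded_def by blast
    fix x y assume "x \<in> D'" "y \<in> nc_space d" "pt_dsum x y \<in> D'"
    then show "f' (pt_dsum x y) = mat_dsum (f' x) (fh y)" using fh(2) D eq by auto
  qed
qed

text \<open>\<open>pi_map\<close> respects direct sums and similarities, so the hat function can be
  pulled back as well.\<close>

lemma cond_nc_pi_map: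
  assumes F: "cond_nc 3 (pi_map ` T) F" and T: "T \<subseteq> nc_space 2" and eq: "\<And>w. w \<in> T \<Longrightarrow> f w = F (pi_map w)"
  shows "cond_nc 2 T f"
proof -
  obtain Fh where Fh: "graded 3 (hat 3 (pi_map ` T)) Fh"
    "\<forall>x\<in>pi_map ` T. \<forall>y\<in>nc_space 3. pt_dsum x y \<in> pi_map ` T \<longrightarrow> F (pt_dsum x y) = mat_dsum (F x) (Fh y)"
    using F unfolding cond_nc_def by blast
  have pnc: "pi_map w \<in> nc_space 3" if w: "w \<in> nc_space 2" for w
  proof -
    obtain n where n: "n \<ge> 1" "w \<in> level 2 n" by (rule nc_spaceE[OF w])
    show ?thesis by (rule nc_spaceI[OF n(1) pi_map_level[OF n(2)]])
  qed
  have pd: "pi_map (pt_dsum x y) = pt_dsum (pi_map x) (pi_map y)" if xy: "x \<in> nc_space 2" "y \<in> nc_space 2" for x y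
  proof -
    obtain n where n: "x \<in> level 2 n" by (rule nc_spaceE[OF xy(1)])
    obtain m where m: "y \<in> level 2 m" by (rule nc_spaceE[OF xy(2)])
    show ?thesis by (rule pi_map_dsum[OF n m])
  qed
  show ?thesis unfolding cond_nc_def
  proof (intro conjI exI[of _ "\<lambda>y. Fh (pi_map y)"] ballI impI)
    show "graded 2 T f" unfolding graded_def
    proof (intro allI impI ballI)
      fix n x assume "1 \<le> n" "x \<in> T \<inter> level 2 n"
      then show "f x \<in> carrier_mat n n" using cond_nc_graded[OF F, of "pi_map x" n] pi_map_level[of x n] eq by simp
    qed
    show "similarity_preserving 2 T f" unfolding similarity_preserving_def
    proof (intro allI impI ballI)
      fix n x s assume n: "1 \<le> n" and x: "x \<in> T \<inter> level 2 n" and s: "s \<in> GLn n" and sx: "pt_conj s x \<in> T"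
      have x': "x \<in> T" "x \<in> level 2 n" using x by auto
      note pc = pi_map_conj[OF s x'(2)]
      have "F (pt_conj s (pi_map x)) = mat_conj s (F (pi_map x))"
        by (rule cond_nc_conj[OF F _ pi_map_level[OF x'(2)] n s]) (use x' sx pc in \<open>auto simp flip: pc\<close>)
      then show "f (pt_conj s x) = mat_conj s (f x)" using eq sx x' pc by simp
    qed
    show "graded 2 (hat 2 T) (\<lambda>y. Fh (pi_map y))" unfolding graded_def
    proof (intro allI impI ballI)
      fix n y assume n: "1 \<le> n" and y: "y \<in> hat 2 T \<inter> level 2 n"
      then obtain x where x: "x \<in> T" "pt_dsum x y \<in> T" "y \<in> nc_space 2" "y \<in> level 2 n" unfolding hat_def by blast
      then have "pi_map y \<in> hat 3 (pi_map ` T)" unfolding hat_def using pd[of x y] pnc T by (auto intro!: bexI[of _ x] image_eqI[of _ pi_map "pt_dsum x y"])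
      then show "Fh (pi_map y) \<in> carrier_mat n n" using Fh(1) n pi_map_level[OF x(4)] unfolding graded_def by blast
    qed
    fix x y assume x: "x \<in> T" and y: "y \<in> nc_space 2" and xy: "pt_dsum x y \<in> T"
    have p: "pi_map (pt_dsum x y) = pt_dsum (pi_map x) (pi_map y)" using pd x y T by blast
    have "F (pt_dsum (pi_map x) (pi_map y)) = mat_dsum (F (pi_map x)) (Fh (pi_map y))"
      using Fh(2) x pnc[OF y] imageI[OF xy, of pi_map] unfolding p by blast
    then show "f (pt_dsum x y) = mat_dsum (f x) (Fh (pi_map y))" unfolding eq[OF x] eq[OF xy] p .
  qed
qed

context radii_branches
begin

text \<open>Two such roots of one matrix, even from different branches, are polynomials of it and
  therefore commute.\<close>

lemma square_root_poly:
  assumes g: "\<gamma> \<in> Gam" "\<tau> \<in> signs \<gamma>" and d: "d \<in> carrier_mat n n" "spectrum d \<subseteq> VV \<gamma> \<tau>"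
  obtains P where "d = pm P (d * d)"
proof -
  note sq = S_mat_square[OF g d]
  obtain P where P: "S_mat r sq \<gamma> \<tau> (d * d) = pm P (d * d)"
    by (rule S_mat_poly[OF g(1) mult_carrier_mat[OF d(1) d(1)] sq(1)]) (rule that)
  show thesis using that[of P] P sq(2) by simp
qed

lemma Phi_eq:
  assumes g: "\<gamma> \<in> Gam" "\<tau> \<in> signs \<gamma>" and p: "p \<in> W_gam r \<gamma>"
  shows "Phi r sq \<gamma> \<tau> p = pi_map (omega r sq \<gamma> \<tau> p)"
proof -
  obtain n where n: "p ! 0 \<in> carrier_mat n n" "p ! 1 \<in> carrier_mat n n" "spectrum (p ! 1) \<subseteq> discs r \<gamma>"
    by (rule W_gamE[OF p]) (rule that)
  show ?thesis unfolding omega_mk pi_map_mk[OF n(1) S_mat_carrier[OF n(2)]] S_mat_sq[OF g n(2,3)]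
    by (simp add: Phi_def Let_def)
qed

end

section \<open>Uniqueness of extensions and the fibres of \<open>pi_map\<close>\<close>

context sym_dom
begin

text \<open>Entrywise, \<open>f w\<close> and \<open>g w\<close> are within \<open>C / c\<close> of
  their common value at a nearby generic point, with \<open>c\<close> as large as desired. The last
  hypothesis keeps the auxiliary sums and conjugates inside \<open>T\<close>, which for
  \<open>S_o\<close> takes an argument.\<close>

lemma cond_nc_eqI:
  assumes f: "cond_nc 2 T f" "\<And>w. w \<in> T \<Longrightarrow> opnorm (f w) \<le> C" and g: "cond_nc 2 T g" "\<And>w. w \<in> T \<Longrightarrow> opnorm (g w) \<le> C"
    and T: "T \<subseteq> S" "Soo \<subseteq> T" and eq: "\<And>z. z \<in> Soo \<Longrightarrow> f z = g z" and w: "w \<in> T" "w \<in> level 2 n"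
    and near: "\<And>\<eta>. \<eta> > 0 \<Longrightarrow> \<exists>z\<in>Soo. z \<in> level 2 n \<and> pclose \<eta> w z \<and>
      (\<forall>p. p = pt_dsum w z \<or> p = pt_dsum z w \<or> (\<exists>s\<in>GLn (n + n). p = pt_conj s (pt_dsum w z)) \<longrightarrow> p \<in> S \<longrightarrow> p \<in> T)"
  shows "f w = g w"
proof -
  have wS: "w \<in> S" using w T by blast
  note n = level_pos[OF wS w(2)] and wnc = S_nc[OF wS]
  have cf: "f w \<in> carrier_mat n n" "g w \<in> carrier_mat n n" using cond_nc_graded[OF f(1) w n] cond_nc_graded[OF g(1) w n] .
  obtain B where B: "B \<in> free_base 2" "w \<in> B" "B \<subseteq> S" by (rule free_topE[OF free_domain wS])
  have Bd: "pt_dsum x y \<in> B \<longleftrightarrow> x \<in> B \<and> y \<in> B" if "x \<in> nc_space 2" "y \<in> nc_space 2" for x y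
    using free_base_dsum[OF B(1) _ that] by simp
  define W where "W = pt_dsum w w"
  have Wl: "W \<in> level 2 (n + n)" unfolding W_def by (rule pt_dsum_level[OF w(2) w(2)])
  have WB: "W \<in> B" unfolding W_def using B(2) by (simp add: Bd wnc)
  have nn: "1 \<le> n + n" using n by simp
  obtain e0 where e0: "e0 > 0" "\<And>y. y \<in> level 2 (n + n) \<Longrightarrow> pclose e0 W y \<Longrightarrow> y \<in> B"
    by (rule free_base_finitely_open[OF B(1) _ WB Wl nn]) (simp, rule that)
  have small: "cmod (f w $$ (i, j) - g w $$ (i, j)) \<le> \<epsilon>" if e: "\<epsilon> > 0" and ij: "i < n" "j < n" for \<epsilon> i j
  proof -
    \<comment> \<open>The numerator covers one error \<open>C\<close> for \<open>f\<close> and one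
      for \<open>g\<close>.\<close>
    define c where "c = (2 * \<bar>C\<bar> + 1) / \<epsilon>"
    have c: "c > 0" using e by (auto simp: c_def)
    define K where "K = real (n * n) * c"
    have K: "K \<ge> 0" using c by (simp add: K_def)
    define \<eta> where "\<eta> = e0 / (1 + K)"
    have h: "\<eta> > 0" using e0 K by (simp add: \<eta>_def)
    have h2: "\<eta> + K * \<eta> = e0" using K by (simp add: \<eta>_def field_simps add_nonneg_eq_0_iff)
    have h3: "\<eta> \<le> e0" using h2 mult_nonneg_nonneg[OF K less_imp_le[OF h]] by linarith
    obtain z where z: "z \<in> Soo" "z \<in> level 2 n" "pclose \<eta> w z"
      "\<And>p. p = pt_dsum w z \<or> p = pt_dsum z w \<or> (\<exists>s\<in>GLn (n + n). p = pt_conj s (pt_dsum w z)) \<Longrightarrow> p \<in> S \<Longrightarrow> p \<in> T"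
      using near[OF h] by blast
    have zT: "z \<in> T" using z(1) T by blast
    have znc: "z \<in> nc_space 2" by (rule S_nc[OF Soo_S[OF z(1)]])
    note wzl = pt_dsum_level[OF w(2) z(2)]
    have c1: "pclose \<eta> W (pt_dsum w z)" unfolding W_def
      by (rule pclose_dsum[OF w(2) w(2) w(2) z(2) pclose_refl[OF w(2)] z(3)]) (use h in simp)
    have wzB: "pt_dsum w z \<in> B" by (rule e0(2)[OF wzl pclose_mono[OF c1 h3]])
    have zwB: "pt_dsum z w \<in> B" using wzB Bd[OF wnc znc] Bd[OF znc wnc] by simp
    define Q where "Q = pt_conj (upperm n n (diagm n n (of_real c))) (pt_dsum w z)"
    note gl = upperm_GLn(1)[OF diagm_carrier[of n n "of_real c"]]
    have Ql: "Q \<in> level 2 (n + n)" unfolding Q_def by (rule pt_conj_level[OF gl wzl])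
    have "pclose (real (n * n) * (cmod (of_real c) * \<eta>)) (pt_dsum w z) Q" unfolding Q_def
    proof (rule pclose_upper[OF w(2) z(2) order_refl less_imp_le[OF h]])
      fix k i j :: nat assume k: "k < 2" and ij: "i < n" "j < n"
      note cv = levelD(2)[OF w(2) k] levelD(2)[OF z(2) k]
      have "cmod ((w ! k - z ! k) $$ (i, j)) \<le> opnorm (w ! k - z ! k)" by (rule opnorm_entry) (use cv ij in auto)
      moreover have "opnorm (w ! k - z ! k) \<le> \<eta>" using z(3) k w(2) by (auto simp: pclose_def levelD)
      moreover have "(w ! k - z ! k) $$ (i, j) = (w ! k) $$ (i, j) - (z ! k) $$ (i, j)" using cv ij by auto
      ultimately show "cmod ((if j < n then (w ! k) $$ (i, j) else 0) - (z ! k) $$ (i, j)) \<le> \<eta>" using ij by simp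
    qed
    then have "pclose (K * \<eta>) (pt_dsum w z) Q" using c by (simp add: K_def mult.assoc)
    from pclose_trans[OF Wl wzl Ql c1 this] have "pclose e0 W Q" unfolding h2 .
    then have QB: "Q \<in> B" by (rule e0(2)[OF Ql])
    have inT: "pt_dsum w z \<in> T" "pt_dsum z w \<in> T" using z(4) wzB zwB B(3) by blast+
    have QT: "Q \<in> T" by (rule z(4)) (use gl QB B(3) in \<open>auto simp: Q_def\<close>)
    have "cmod (of_real c) * cmod (f w $$ (i, j) - f z $$ (i, j)) \<le> C"
      by (rule cond_nc_estimate[OF f w n zT z(2) n order_refl inT QT[unfolded Q_def] ij])
    moreover have "cmod (of_real c) * cmod (g w $$ (i, j) - g z $$ (i, j)) \<le> C"
      by (rule cond_nc_estimate[OF g w n zT z(2) n order_refl inT QT[unfolded Q_def] ij])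
    ultimately have "c * cmod (f w $$ (i, j) - f z $$ (i, j)) + c * cmod (g w $$ (i, j) - f z $$ (i, j)) \<le> 2 * \<bar>C\<bar> + 1"
      using c unfolding eq[OF z(1)] by simp
    moreover have "c * cmod (f w $$ (i, j) - g w $$ (i, j)) \<le> c * (cmod (f w $$ (i, j) - f z $$ (i, j)) + cmod (g w $$ (i, j) - f z $$ (i, j)))"
      using c norm_triangle_ineq4[of "f w $$ (i, j) - f z $$ (i, j)" "g w $$ (i, j) - f z $$ (i, j)"] by (intro mult_left_mono) auto
    ultimately have "c * cmod (f w $$ (i, j) - g w $$ (i, j)) \<le> 2 * \<bar>C\<bar> + 1" by (simp add: distrib_left)
    then have "cmod (f w $$ (i, j) - g w $$ (i, j)) \<le> (2 * \<bar>C\<bar> + 1) / c" using c by (simp add: pos_le_divide_eq mult.commute)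
    also have "\<dots> = \<epsilon>" using e by (simp add: c_def add_nonneg_eq_0_iff)
    finally show ?thesis .
  qed
  show ?thesis
  proof (rule eq_matI)
    fix i j assume "i < dim_row (g w)" "j < dim_col (g w)"
    then have ij: "i < n" "j < n" using cf(2) by auto
    have "cmod (f w $$ (i, j) - g w $$ (i, j)) \<le> 0"
      by (rule field_le_epsilon) (unfold add_0, rule small[OF _ ij])
    then show "f w $$ (i, j) = g w $$ (i, j)" by simp
  qed (use cf in auto)
qed

lemma eq_on_S:
  assumes f: "cond_nc 2 S f" "bounded_on S f" and g: "cond_nc 2 S g" "bounded_on S g" and eq: "\<And>z. z \<in> Soo \<Longrightarrow> f z = g z" and w: "w \<in> S"
  shows "f w = g w"
proof -
  obtain C D where CD: "\<And>w. w \<in> S \<Longrightarrow> opnorm (f w) \<le> C" "\<And>w. w \<in> S \<Longrightarrow> opnorm (g w) \<le> D" using f g unfolding bounded_on_def by blast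
  show ?thesis
  proof (rule cond_nc_eqI[where C = "max C D", OF f(1) _ g(1) _ _ _ eq w lvl_S[OF w]])
    show "\<exists>z\<in>Soo. z \<in> level 2 (lvl w) \<and> pclose \<eta> w z \<and>
      (\<forall>p. p = pt_dsum w z \<or> p = pt_dsum z w \<or> (\<exists>s\<in>GLn (lvl w + lvl w). p = pt_conj s (pt_dsum w z)) \<longrightarrow> p \<in> S \<longrightarrow> p \<in> S)" if "\<eta> > 0" for \<eta>
      by (rule Soo_dense[OF w lvl_S[OF w] that finite.emptyI]) blast
  qed (use CD Soo_S in \<open>auto simp: le_max_iff_disj\<close>)
qed

text \<open>The comparison point comes from \<open>OU_near\<close>, which keeps the half difference:
  then \<open>w \<oplus> z\<close>, \<open>z \<oplus> w\<close> and their conjugates stay in one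
  \<open>OW \<gamma> \<tau>\<close>.\<close>

lemma eq_on_So:
  assumes f: "cond_nc 2 So f" "bounded_on So f" and g: "cond_nc 2 So g" "bounded_on So g" and eq: "\<And>z. z \<in> Soo \<Longrightarrow> f z = g z" and w: "w \<in> So"
  shows "f w = g w"
proof -
  obtain C D where CD: "\<And>w. w \<in> So \<Longrightarrow> opnorm (f w) \<le> C" "\<And>w. w \<in> So \<Longrightarrow> opnorm (g w) \<le> D" using f g unfolding bounded_on_def by blast
  have wS: "w \<in> S" and reg: "regular (spectrum (dd w))" using w by (auto simp: So_regular)
  define n where "n = lvl w"
  have wl: "w \<in> level 2 n" unfolding n_def by (rule lvl_S[OF wS])
  show ?thesis
  proof (rule cond_nc_eqI[where C = "max C D", OF f(1) _ g(1) _ _ _ eq w wl])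
    fix \<eta> :: real assume h: "\<eta> > 0"
    obtain e0 where e0: "e0 > 0" "\<And>y. y \<in> level 2 n \<Longrightarrow> pclose e0 w y \<Longrightarrow> y \<in> S" by (rule S_nbhd[OF wS wl]) (rule that)
    have m: "min \<eta> e0 > 0" using h e0 by simp
    obtain \<gamma> \<tau> z where z: "\<gamma> \<in> Gam" "\<tau> \<in> signs \<gamma>" "spectrum (dd w) \<subseteq> VV \<gamma> \<tau>" "z \<in> OU \<gamma> \<tau>" "z \<in> level 2 n" "pclose (min \<eta> e0) w z"
      by (rule OU_near[OF wl level_pos[OF wS wl] reg m]) (rule that)
    note g = z(1,2)
    have W: "w \<in> OW \<gamma> \<tau>" "z \<in> OW \<gamma> \<tau>" using z(3) S_nc[OF wS] subsetD[OF OU_subset_OW z(4)] by (simp_all add: OW_iff[OF g])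
    have d: "pt_dsum w z \<in> OW \<gamma> \<tau>" "pt_dsum z w \<in> OW \<gamma> \<tau>" using OW_dsum[OF g W(1,2)] OW_dsum[OF g W(2,1)] .
    have zS: "z \<in> Soo" by (rule SooI[OF g z(4) e0(2)[OF z(5) pclose_mono[OF z(6)]]]) simp
    have in_So: "p \<in> So" if p: "p = pt_dsum w z \<or> p = pt_dsum z w \<or> (\<exists>s\<in>GLn (n + n). p = pt_conj s (pt_dsum w z))" "p \<in> S" for p
    proof -
      have "p \<in> OW \<gamma> \<tau>" using p(1) d OW_conj[OF g d(1) pt_dsum_level[OF wl z(5)]] by blast
      then show ?thesis using SoI[OF g] p(2) by blast
    qed
    show "\<exists>z\<in>Soo. z \<in> level 2 n \<and> pclose \<eta> w z \<and>
      (\<forall>p. p = pt_dsum w z \<or> p = pt_dsum z w \<or> (\<exists>s\<in>GLn (n + n). p = pt_conj s (pt_dsum w z)) \<longrightarrow> p \<in> S \<longrightarrow> p \<in> So)"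
      by (intro bexI[OF _ zS] conjI z(5) pclose_mono[OF z(6)] allI impI in_So; simp)
  qed (use CD So_S Soo_So in \<open>auto simp: le_max_iff_disj\<close>)
qed

text \<open>The similarity is absorbed into \<open>e\<close>, the conjugated half difference of
  \<open>w2\<close>; the intertwiners \<open>1 + J\<close> and \<open>1 - J\<close> are then
  multiplied by \<open>minv s\<close>, so that they relate \<open>w1\<close> to \<open>w2\<close>
  itself and to its flip.\<close>

lemma pi_fibre:
  assumes f: "cond_nc 2 S f" and sym: "symmetric_on S f" and w1: "w1 \<in> So" "w1 \<in> level 2 n" and w2: "w2 \<in> So" "w2 \<in> level 2 n"
    and s: "s \<in> GLn n" and pi: "pi_map w1 = pt_conj s (pi_map w2)"
  shows "f w1 = mat_conj s (f w2)"
proof -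
  have S12: "w1 \<in> S" "w2 \<in> S" using So_S w1 w2 by auto
  note n = level_pos[OF S12(1) w1(2)]
  note sc = GLnD[OF s]
  define u d e where ude: "u = uu w1" "d = dd w1" "e = mat_conj s (dd w2)"
  have c: "u \<in> carrier_mat n n" "d \<in> carrier_mat n n" "e \<in> carrier_mat n n"
    unfolding ude using w1(2) mat_conj_carrier[OF s dd_carrier[OF w2(2)]] by auto
  note d2 = dd_carrier[OF w2(2)] and u2 = uu_carrier[OF w2(2)]
  have e1: "u = mat_conj s (uu w2)" "d * d = e * e" "d * u * d = e * u * e"
  proof -
    have p: "uu w1 = mat_conj s (uu w2)" "dd w1 * dd w1 = mat_conj s (dd w2 * dd w2)" "dd w1 * uu w1 * dd w1 = mat_conj s (dd w2 * uu w2 * dd w2)"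
      using pi unfolding pi_map_coords[OF w1(2)] pi_map_coords[OF w2(2)] pt_conj_def list.map list.inject by blast+
    show "u = mat_conj s (uu w2)" using p(1) by (simp add: ude)
    show "d * d = e * e" unfolding ude p(2) mat_conj_mult[OF s d2 d2] ..
    have "e * u * e = mat_conj s (dd w2 * uu w2 * dd w2)"
      unfolding ude p(1) mat_conj_mult[OF s d2 u2] mat_conj_mult[OF s mult_carrier_mat[OF d2 u2] d2] ..
    then show "d * u * d = e * u * e" unfolding ude(1,2) using p(3) by metis
  qed
  \<comment> \<open>Both matrices are polynomials of the common square
    \<open>d * d = e * e\<close>.\<close>
  have comm: "d * e = e * d"
  proof -
    obtain \<gamma> \<tau> where g: "\<gamma> \<in> Gam" "\<tau> \<in> signs \<gamma>" "w1 \<in> OW \<gamma> \<tau>" using w1(1) unfolding So_iff_OW by blast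
    obtain \<gamma>' \<tau>' where g': "\<gamma>' \<in> Gam" "\<tau>' \<in> signs \<gamma>'" "w2 \<in> OW \<gamma>' \<tau>'" using w2(1) unfolding So_iff_OW by blast
    have sp: "spectrum d \<subseteq> VV \<gamma> \<tau>" "spectrum e \<subseteq> VV \<gamma>' \<tau>'"
      using g g' unfolding ude spectrum_conj[OF s d2] by (auto simp: OW_iff)
    obtain P where P: "d = pm P (d * d)" by (rule square_root_poly[OF g(1,2) c(2) sp(1)]) (rule that)
    obtain P' where P': "e = pm P' (e * e)" by (rule square_root_poly[OF g'(1,2) c(3) sp(2)]) (rule that)
    have "pm P (d * d) * pm P' (d * d) = pm P' (d * d) * pm P (d * d)" by (rule pm_commute_self(2)[OF mult_carrier_mat[OF c(2,2)]])
    then show ?thesis using P P' unfolding e1(2) by simp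
  qed
  have dG: "d \<in> GLn n"
  proof -
    have "regular (spectrum d)" using w1(1) by (simp add: So_regular ude)
    then have "0 \<notin> spectrum d" unfolding regular_def by fastforce
    then have "pm [:0, 1:] d \<in> GLn n" by (intro pm_GLn[OF c(2)]) auto
    then show ?thesis unfolding pm_X[OF c(2)] .
  qed
  obtain J where J: "J \<in> carrier_mat n n" "J * u = u * J" "d * J = e" "J * e = d"
    by (rule square_root_involution[OF c(1) dG c(3) e1(2) comm e1(3)]) (rule that)
  have mc: "- J \<in> carrier_mat n n" "- d \<in> carrier_mat n n" "- e \<in> carrier_mat n n" using J c by auto
  have neg: "(- J) * u = u * (- J)" "d * (- J) = - e" "(- J) * (- e) = d" "(- d) * (- J) = e" "(- J) * e = - d" "(- d) * J = - e" "J * (- e) = - d"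
    using J c by simp_all
  have w1c: "w1 ! 0 = u + d" "w1 ! 1 = u + (- d)"
  proof -
    have "w1 = mk u d" unfolding ude using mk_uu_dd[OF w1(2)] by simp
    then show "w1 ! 0 = u + d" "w1 ! 1 = u + (- d)" using c by (simp_all add: mk_def add_uminus_minus_mat)
  qed
  have w2c: "mat_conj s (w2 ! 0) = u + e" "mat_conj s (w2 ! 1) = u + (- e)"
  proof -
    have w2m: "w2 = mk (uu w2) (dd w2)" using mk_uu_dd[OF w2(2)] by simp
    have "w2 ! 0 = uu w2 + dd w2" "w2 ! 1 = uu w2 - dd w2" by (subst w2m, simp add: mk_def)+
    then show "mat_conj s (w2 ! 0) = u + e" "mat_conj s (w2 ! 1) = u + (- e)"
      using mat_conj_add[OF s u2 d2] e1(1) c by (simp_all add: ude(3) add_uminus_minus_mat)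
  qed
  \<comment> \<open>Moves the similarity from the second point into the intertwiner.\<close>
  have shift_s: "x * (M * minv s) = (M * minv s) * y"
    if "x \<in> carrier_mat n n" "M \<in> carrier_mat n n" "y \<in> carrier_mat n n" "x * M = M * mat_conj s y" for x M y
  proof -
    have my: "minv s * y \<in> carrier_mat n n" by (rule mult_carrier_mat[OF sc(2) that(3)])
    have "mat_conj s y * minv s = minv s * y"
      unfolding mat_conj_def assoc_mult_mat[OF my sc(1,2)] sc(3) by (rule right_mult_one_mat[OF my])
    moreover have "x * (M * minv s) = M * (mat_conj s y * minv s)"
      unfolding assoc_mult_mat[OF that(1,2) sc(2), symmetric] that(4) by (rule assoc_mult_mat[OF that(2) mat_conj_carrier[OF s that(3)] sc(2)])
    ultimately show ?thesis unfolding assoc_mult_mat[OF that(2) sc(2) that(3)] by simp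
  qed
  have l12: "w1 ! 0 \<in> carrier_mat n n" "w1 ! 1 \<in> carrier_mat n n" "w2 ! 0 \<in> carrier_mat n n" "w2 ! 1 \<in> carrier_mat n n"
    using levelD(2)[OF w1(2)] levelD(2)[OF w2(2)] by auto
  define M N where MN: "M = 1\<^sub>m n + J" "N = 1\<^sub>m n + (- J)"
  have MNc: "M \<in> carrier_mat n n" "N \<in> carrier_mat n n" unfolding MN using J by auto
  have i1: "w1 ! 0 * M = M * mat_conj s (w2 ! 0)" "w1 ! 1 * M = M * mat_conj s (w2 ! 1)"
    unfolding MN w1c w2c using intertwine_add[OF c J(1) J(2) J(3) J(4)] intertwine_add[OF c(1) mc(2,3) J(1) J(2) neg(6,7)] .
  have i2: "w1 ! 0 * N = N * mat_conj s (w2 ! 1)" "w1 ! 1 * N = N * mat_conj s (w2 ! 0)"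
    unfolding MN w1c w2c using intertwine_add[OF c(1,2) mc(3) mc(1) neg(1,2,3)] intertwine_add[OF c(1) mc(2) c(3) mc(1) neg(1,4,5)] .
  have sum: "pt_dsum w1 w \<in> S" "pt_dsum w w1 \<in> S" if w: "w \<in> S" "pi_map w = pi_map w2" for w
  proof -
    have "similar_points (pi_map w1) (pi_map w)" unfolding similar_points_def w(2)
      using pi_map_level[OF w1(2)] pi_map_level[OF w2(2)] s pi by blast
    then show 1: "pt_dsum w1 w \<in> S" by (rule similar_sum[OF S12(1) w(1)])
    show "pt_dsum w w1 \<in> S" by (rule S_dsumD(3)[OF 1 S_nc[OF S12(1)] S_nc[OF w(1)]])
  qed
  note fl = flip_S[OF S12(2)] flip_level[OF w2(2)]
  have f1: "f w1 * (M * minv s) = (M * minv s) * f w2"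
    by (rule cond_nc_intertwine[OF f S12(1) w1(2) n S12(2) w2(2) n sum[OF S12(2) refl] mult_carrier_mat[OF MNc(1) sc(2)]
          shift_s[OF l12(1) MNc(1) l12(3) i1(1)] shift_s[OF l12(2) MNc(1) l12(4) i1(2)]])
  have "f w1 * (N * minv s) = (N * minv s) * f (flip w2)"
  proof (rule cond_nc_intertwine[OF f S12(1) w1(2) n fl n sum[OF fl(1) pi_map_flip[OF w2(2)]] mult_carrier_mat[OF MNc(2) sc(2)]])
    show "w1 ! 0 * (N * minv s) = N * minv s * flip w2 ! 0" "w1 ! 1 * (N * minv s) = N * minv s * flip w2 ! 1"
      using shift_s[OF l12(1) MNc(2) l12(4) i2(1)] shift_s[OF l12(2) MNc(2) l12(3) i2(2)] by (simp_all add: flip_def)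
  qed
  then have f2: "f w1 * (N * minv s) = (N * minv s) * f w2" using sym S12(2) by (simp add: symmetric_on_def)
  have fc: "f w1 \<in> carrier_mat n n" "f w2 \<in> carrier_mat n n"
    using cond_nc_graded[OF f S12(1) w1(2) n] cond_nc_graded[OF f S12(2) w2(2) n] .
  note Mc = mult_carrier_mat[OF MNc(1) sc(2)] mult_carrier_mat[OF MNc(2) sc(2)]
  \<comment> \<open>Either of \<open>M\<close> and \<open>N\<close> may be singular; their sum is
    twice the identity, so the added relation has the invertible intertwiner
    \<open>2 \<cdot>\<^sub>m minv s\<close>.\<close>
  have "M + N = 2 \<cdot>\<^sub>m 1\<^sub>m n" unfolding MN using J(1) by (intro eq_matI) auto
  then have s2: "M * minv s + N * minv s = 2 \<cdot>\<^sub>m minv s"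
    unfolding add_mult_distrib_mat[OF MNc sc(2), symmetric] using sc(2) by (simp add: mult_smult_assoc_mat[OF one_carrier_mat sc(2)])
  have "f w1 * (2 \<cdot>\<^sub>m minv s) = (2 \<cdot>\<^sub>m minv s) * f w2"
    unfolding s2[symmetric] mult_add_distrib_mat[OF fc(1) Mc] add_mult_distrib_mat[OF Mc fc(2)] f1 f2 ..
  then have "2 \<cdot>\<^sub>m (f w1 * minv s) = 2 \<cdot>\<^sub>m (minv s * f w2)"
    unfolding mult_smult_distrib[OF fc(1) sc(2)] mult_smult_assoc_mat[OF sc(2) fc(2)] .
  then have "(1/2) \<cdot>\<^sub>m (2 \<cdot>\<^sub>m (f w1 * minv s)) = (1/2) \<cdot>\<^sub>m (2 \<cdot>\<^sub>m (minv s * f w2))" by simp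
  moreover have "(1/2) \<cdot>\<^sub>m (2 \<cdot>\<^sub>m A) = A" for A :: "complex mat" by (rule eq_matI) auto
  ultimately have eq: "f w1 * minv s = minv s * f w2" by metis
  have "f w1 = (f w1 * minv s) * s" unfolding assoc_mult_mat[OF fc(1) sc(2,1)] sc(4) right_mult_one_mat[OF fc(1)] ..
  then show ?thesis unfolding eq mat_conj_def .
qed

end

section \<open>Descent along \<open>pi_map\<close> and holomorphy in charts\<close>

context sym_dom
begin

lemma pi_level: assumes "w \<in> S" "pi_map w \<in> level 3 n" shows "w \<in> level 2 n"
proof -
  have "lvl (pi_map w) = n" "lvl (pi_map w) = lvl w"
    using lvl_level[OF assms(2)] lvl_level[OF pi_map_level[OF lvl_S[OF assms(1)]]] by auto
  then show ?thesis using lvl_S[OF assms(1)] by simp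
qed

text \<open>The half difference of \<open>w\<close> is the functional calculus of its square, which
  is block diagonal; hence it is block diagonal itself and the point splits.\<close>

lemma pi_split:
  assumes w: "w \<in> So" and x: "x \<in> level 3 n" "n \<ge> 1" and y: "y \<in> level 3 m" "m \<ge> 1" and pi: "pi_map w = pt_dsum x y"
  obtains w' w'' where "w = pt_dsum w' w''" "w' \<in> level 2 n" "w'' \<in> level 2 m" "w' \<in> So" "w'' \<in> So" "pi_map w' = x" "pi_map w'' = y"
proof -
  have wS: "w \<in> S" by (rule So_S[OF w])
  have wl: "w \<in> level 2 (n + m)" by (rule pi_level[OF wS]) (simp add: pi pt_dsum_level[OF x(1) y(1)])
  obtain \<gamma> \<tau> where g: "\<gamma> \<in> Gam" "\<tau> \<in> signs \<gamma>" "w \<in> OW \<gamma> \<tau>" using w unfolding So_iff_OW by blast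
  have sp: "spectrum (dd w) \<subseteq> VV \<gamma> \<tau>" using g by (simp add: OW_iff)
  note cx = levelD(2)[OF x(1)] and cy = levelD(2)[OF y(1)]
  have x01: "x ! 0 \<in> carrier_mat n n" "x ! 1 \<in> carrier_mat n n" "y ! 0 \<in> carrier_mat m m" "y ! 1 \<in> carrier_mat m m"
    using cx cy by auto
  have u: "uu w = mat_dsum (x ! 0) (y ! 0)" and d: "dd w * dd w = mat_dsum (x ! 1) (y ! 1)"
    using pi_map_coords[OF wl] pt_dsum_nth[OF x(1) y(1), of 0] pt_dsum_nth[OF x(1) y(1), of 1] unfolding pi by auto
  note sq = S_mat_square[OF g(1,2) dd_carrier[OF wl] sp]
  have spx: "spectrum (x ! 1) \<subseteq> discs r \<gamma>" "spectrum (y ! 1) \<subseteq> discs r \<gamma>"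
    using sq(1) unfolding d spectrum_dsum[OF x01(2,4)] by auto
  define w' where "w' = mk (x ! 0) (S_mat r sq \<gamma> \<tau> (x ! 1))"
  define w'' where "w'' = mk (y ! 0) (S_mat r sq \<gamma> \<tau> (y ! 1))"
  note Sc = S_mat_carrier[OF x01(2), of \<gamma> \<tau>] S_mat_carrier[OF x01(4), of \<gamma> \<tau>]
  have l: "w' \<in> level 2 n" "w'' \<in> level 2 m" unfolding w'_def w''_def using mk_level x01 Sc by auto
  have ww: "w = pt_dsum w' w''"
  proof -
    have "w = mk (mat_dsum (x ! 0) (y ! 0)) (S_mat r sq \<gamma> \<tau> (mat_dsum (x ! 1) (y ! 1)))"
      using mk_uu_dd[OF wl] sq(2) by (simp add: u d)
    then show ?thesis unfolding w'_def w''_def S_mat_dsum[OF g(1) x01(2,4) spx] mk_dsum[OF x01(1,3) Sc] .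
  qed
  have "pt_dsum (pi_map w') (pi_map w'') = pt_dsum x y" using pi unfolding ww pi_map_dsum[OF l] .
  then have p: "pi_map w' = x" "pi_map w'' = y"
    using pt_dsum_inject[OF pi_map_level[OF l(1)] x(1) pi_map_level[OF l(2)] y(1)] by auto
  have S: "w' \<in> S" "w'' \<in> S"
    using S_dsumD(1,2)[OF wS[unfolded ww] nc_spaceI[OF x(2) l(1)] nc_spaceI[OF y(2) l(2)]] by auto
  have "regular (spectrum (dd w') \<union> spectrum (dd w''))"
    using w unfolding So_regular ww dd_dsum[OF l] spectrum_dsum[OF dd_carrier[OF l(1)] dd_carrier[OF l(2)]] by simp
  then have "w' \<in> So" "w'' \<in> So" using S regular_mono unfolding So_regular by blast+
  then show thesis using that[OF ww l _ _ p] by simp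
qed

text \<open>\<open>F\<close> is its own hat function, because \<open>pi_split\<close> exhibits the
  second summand as an image. Compatibility with similarities is \<open>pi_fibre\<close>.\<close>

lemma cond_nc_G_o:
  assumes f: "cond_nc 2 S f" and sym: "symmetric_on S f" and F: "\<And>w. w \<in> So \<Longrightarrow> F (pi_map w) = f w"
  shows "cond_nc 3 (pi_map ` So) F"
proof -
  have level: "\<exists>w\<in>So. w \<in> level 2 n \<and> pi_map w = p" if "p \<in> pi_map ` So" "p \<in> level 3 n" for p n
    using that pi_level[OF So_S] by blast
  have split: "y \<in> pi_map ` So \<and> F (pt_dsum x y) = mat_dsum (F x) (F y)"
    if x: "x \<in> pi_map ` So" and y: "y \<in> nc_space 3" and xy: "pt_dsum x y \<in> pi_map ` So" for x y
  proof -
    obtain v where v: "v \<in> So" "x = pi_map v" using x by blast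
    have xl: "x \<in> level 3 (lvl v)" unfolding v(2) by (rule pi_map_level[OF lvl_S[OF So_S[OF v(1)]]])
    have n: "lvl v \<ge> 1" by (rule level_pos[OF So_S[OF v(1)] lvl_S[OF So_S[OF v(1)]]])
    obtain m where m: "m \<ge> 1" "y \<in> level 3 m" by (rule nc_spaceE[OF y])
    obtain w where w: "w \<in> So" "pi_map w = pt_dsum x y" using xy by force
    obtain w' w'' where ww: "w = pt_dsum w' w''" "w' \<in> level 2 (lvl v)" "w'' \<in> level 2 m" "w' \<in> So" "w'' \<in> So" "pi_map w' = x" "pi_map w'' = y"
      by (rule pi_split[OF w(1) xl n m(2,1) w(2)]) (rule that)
    have S: "w' \<in> S" "w'' \<in> S" "pt_dsum w' w'' \<in> S" using So_S ww w(1) by auto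
    have "f w = mat_dsum (f w') (f w'')" unfolding ww(1)
      by (rule cond_nc_dsum[OF f S(1) ww(2) n S(2) ww(3) m(1) S(3) S_dsumD(3)[OF S(3) S_nc[OF S(1)] S_nc[OF S(2)]]])
    then have "F (pt_dsum x y) = mat_dsum (F x) (F y)" using F[OF w(1)] F[OF ww(4)] F[OF ww(5)] unfolding w(2) ww(6,7) by simp
    then show ?thesis using ww(5,7) by blast
  qed
  have gr: "graded 3 (pi_map ` So) F" unfolding graded_def
  proof (intro allI impI ballI)
    fix n p assume n: "1 \<le> n" and p: "p \<in> pi_map ` So \<inter> level 3 n"
    then obtain w where w: "w \<in> So" "w \<in> level 2 n" "pi_map w = p" using level by blast
    then show "F p \<in> carrier_mat n n" using F[OF w(1)] cond_nc_graded[OF f So_S[OF w(1)] w(2) n] by simp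
  qed
  show ?thesis unfolding cond_nc_def
  proof (intro conjI exI[of _ F] ballI impI gr)
    have "hat 3 (pi_map ` So) \<subseteq> pi_map ` So" using split unfolding hat_def by blast
    then show "graded 3 (hat 3 (pi_map ` So)) F" using gr unfolding graded_def by blast
    show "similarity_preserving 3 (pi_map ` So) F" unfolding similarity_preserving_def
    proof (intro allI impI ballI)
      fix n p s assume n: "1 \<le> n" and p: "p \<in> pi_map ` So \<inter> level 3 n" and s: "s \<in> GLn n" and sp: "pt_conj s p \<in> pi_map ` So"
      obtain w2 where w2: "w2 \<in> So" "w2 \<in> level 2 n" "pi_map w2 = p" using level p by blast
      have "pt_conj s p \<in> level 3 n" using p pt_conj_level[OF s] by blast
      then obtain w1 where w1: "w1 \<in> So" "w1 \<in> level 2 n" "pi_map w1 = pt_conj s p" using level sp by blast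
      have "f w1 = mat_conj s (f w2)"
        by (rule pi_fibre[OF f sym w1(1,2) w2(1,2) s]) (simp only: w1(3) w2(3))
      then show "F (pt_conj s p) = mat_conj s (F p)" using F[OF w1(1)] F[OF w2(1)] unfolding w1(3) w2(3) by simp
    qed
  qed (use split in blast)
qed

lemma U_chart_eq: "U_chart r sq S \<gamma> \<tau> = {p \<in> U_gam r \<gamma>. omega r sq \<gamma> \<tau> p \<in> S}"
  by (rule U_chart_def)

lemma G_oo_eq: "G_oo r sq S = pi_map ` Soo"
proof -
  have "Phi r sq \<gamma> \<tau> ` U_chart r sq S \<gamma> \<tau> = pi_map ` (omega r sq \<gamma> \<tau> ` U_gam r \<gamma> \<inter> S)" if "\<gamma> \<in> Gam" "\<tau> \<in> signs \<gamma>" for \<gamma> \<tau>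
  proof -
    have "Phi r sq \<gamma> \<tau> p = pi_map (omega r sq \<gamma> \<tau> p)" if "p \<in> U_gam r \<gamma>" for p
      using Phi_eq[OF \<open>\<gamma> \<in> Gam\<close> \<open>\<tau> \<in> signs \<gamma>\<close>] that by (simp add: U_gam_iff)
    then show ?thesis unfolding U_chart_eq by (auto simp: image_iff)
  qed
  then show ?thesis unfolding G_oo_def S_oo_def image_UN by simp
qed

lemma G_o_eq: "G_o r sq S = pi_map ` So"
  by (rule G_o_def)

lemma nc_function_restrict:
  assumes f: "cond_nc 2 T f" and U: "nc_set 2 U" "U \<subseteq> T"
  shows "nc_function 2 U f"
  unfolding nc_function_def
proof (intro conjI U(1) ballI)
  show "graded 2 U f" using f U(2) unfolding cond_nc_def graded_def by blast
  show "similarity_preserving 2 U f" using f U(2) unfolding cond_nc_def similarity_preserving_def by blast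
  fix x y assume x: "x \<in> U" and y: "y \<in> U"
  have nc: "x \<in> nc_space 2" "y \<in> nc_space 2" "pt_dsum x y \<in> U" "pt_dsum y x \<in> U" using x y U(1) unfolding nc_set_def by auto
  obtain n where n: "n \<ge> 1" "x \<in> level 2 n" by (rule nc_spaceE[OF nc(1)])
  obtain m where m: "m \<ge> 1" "y \<in> level 2 m" by (rule nc_spaceE[OF nc(2)])
  show "f (pt_dsum x y) = mat_dsum (f x) (f y)"
    by (rule cond_nc_dsum[OF f _ n(2,1) _ m(2,1)]) (use x y nc U(2) in blast)+
qed

lemma OU_nc_set:
  assumes g: "\<gamma> \<in> Gam" "\<tau> \<in> signs \<gamma>" and B: "B \<in> free_base 2" shows "nc_set 2 (OU \<gamma> \<tau> \<inter> B)"
  unfolding nc_set_def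
proof (intro conjI ballI)
  show "OU \<gamma> \<tau> \<inter> B \<subseteq> nc_space 2" using free_base_subset[OF B] by blast
  have nB: "nc_set 2 B" by (rule free_base_nc_set[OF B]) simp
  fix x y assume x: "x \<in> OU \<gamma> \<tau> \<inter> B" and y: "y \<in> OU \<gamma> \<tau> \<inter> B"
  then have "pt_dsum x y \<in> OU \<gamma> \<tau>" using OU_dsum[OF g] OU_subset_OW by blast
  moreover have "pt_dsum x y \<in> B" using nB x y unfolding nc_set_def by blast
  ultimately show "pt_dsum x y \<in> OU \<gamma> \<tau> \<inter> B" by blast
qed

text \<open>Each generic point has a Zariski-freely open neighbourhood
  \<open>OU \<gamma> \<tau> \<inter> B\<close>. This is an nc-set, and on nc-sets a conditionally nc
  function is nc.\<close>

lemma cond_nc_holo: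
  assumes f: "cond_nc 2 Soo f" and b: "bounded_on Soo f"
  shows "holo 2 (zariski_top 2) Soo f"
proof -
  have base: "OU \<gamma> \<tau> \<inter> D \<in> zariski_base 2" if "\<gamma> \<in> Gam" "\<tau> \<in> signs \<gamma>" "D \<in> free_top 2" for \<gamma> \<tau> D
    unfolding OU_def by (rule omega_U_zariski_base[OF that])
  have top: "Soo \<in> zariski_top 2" unfolding zariski_top_def opens_of_base_iff
  proof
    fix w assume "w \<in> Soo"
    then obtain \<gamma> \<tau> where w: "w \<in> S" "\<gamma> \<in> Gam" "\<tau> \<in> signs \<gamma>" "w \<in> OU \<gamma> \<tau>" unfolding Soo_iff_OU by blast
    have "OU \<gamma> \<tau> \<inter> S \<subseteq> Soo" using SooI[OF w(2,3)] by blast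
    then show "\<exists>B\<in>zariski_base 2. w \<in> B \<and> B \<subseteq> Soo" using base[OF w(2,3) free_domain] w(1,4) by blast
  qed
  have nbhd: "\<exists>U\<in>zariski_top 2. w \<in> U \<and> U \<subseteq> Soo \<and> nc_set 2 U \<and> nc_function 2 U f" if "w \<in> Soo" for w
  proof -
    obtain \<gamma> \<tau> where w: "w \<in> S" "\<gamma> \<in> Gam" "\<tau> \<in> signs \<gamma>" "w \<in> OU \<gamma> \<tau>" using \<open>w \<in> Soo\<close> unfolding Soo_iff_OU by blast
    obtain B where B: "B \<in> free_base 2" "w \<in> B" "B \<subseteq> S" by (rule free_topE[OF free_domain w(1)])
    have U: "OU \<gamma> \<tau> \<inter> B \<subseteq> Soo" using SooI[OF w(2,3)] B(3) by blast
    note nc = OU_nc_set[OF w(2,3) B(1)]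
    show ?thesis
      by (rule bexI[OF _ zariski_base_open[OF base[OF w(2,3) free_base_open[OF B(1)]]]])
        (use w(4) B(2) U nc nc_function_restrict[OF f nc U] in blast)
  qed
  show ?thesis unfolding holo_def using top nbhd b f unfolding cond_nc_def by blast
qed

text \<open>In a chart the nc-neighbourhoods are the preimages \<open>U B\<close> of basic sets;
  \<open>omega_preimage_zariski_base\<close> makes them open.\<close>

lemma chart_holo:
  assumes f: "cond_nc 2 Soo f" and b: "bounded_on Soo f" and g: "\<gamma> \<in> Gam" "\<tau> \<in> signs \<gamma>"
    and G: "\<And>p. p \<in> U_chart r sq S \<gamma> \<tau> \<Longrightarrow> G p = f (omega r sq \<gamma> \<tau> p)"
  shows "holo 2 (zariski_top 2) (U_chart r sq S \<gamma> \<tau>) G"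
proof -
  define U where "U B = {p \<in> U_gam r \<gamma>. omega r sq \<gamma> \<tau> p \<in> B}" for B
  have US: "U_chart r sq S \<gamma> \<tau> = U S" by (simp add: U_chart_eq U_def)
  have open_U: "U D \<in> zariski_top 2" if "D \<in> free_top 2" for D
    unfolding U_def by (rule zariski_base_open[OF omega_preimage_zariski_base[OF g that]])
  have W: "p \<in> W_gam r \<gamma>" "p \<in> nc_space 2" if "p \<in> U_gam r \<gamma>" for p using that by (simp_all add: U_gam_iff W_gam_iff)
  have om: "omega r sq \<gamma> \<tau> p \<in> Soo" if "p \<in> U S" for p
    by (rule SooI[OF g]) (use that in \<open>auto simp: U_def OU_def\<close>)
  have gr: "graded 2 (U S) G" unfolding graded_def
  proof (intro allI impI ballI)
    fix n p assume n: "1 \<le> n" and p: "p \<in> U S \<inter> level 2 n"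
    then have p': "p \<in> U_gam r \<gamma>" "p \<in> level 2 n" "p \<in> U S" by (auto simp: U_def)
    show "G p \<in> carrier_mat n n"
      using G[unfolded US, OF p'(3)] cond_nc_graded[OF f om[OF p'(3)] omega_coords(1)[OF g W(1)[OF p'(1)] p'(2)] n] by simp
  qed
  have nbhd: "\<exists>V\<in>zariski_top 2. p \<in> V \<and> V \<subseteq> U S \<and> nc_set 2 V \<and> nc_function 2 V G" if p: "p \<in> U S" for p
  proof -
    have pS: "omega r sq \<gamma> \<tau> p \<in> S" "p \<in> U_gam r \<gamma>" using p by (auto simp: U_def)
    obtain B where B: "B \<in> free_base 2" "omega r sq \<gamma> \<tau> p \<in> B" "B \<subseteq> S" by (rule free_topE[OF free_domain pS(1)])
    have nB: "nc_set 2 B" by (rule free_base_nc_set[OF B(1)]) simp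
    have sub: "U B \<subseteq> U S" using B(3) by (auto simp: U_def)
    have od: "omega r sq \<gamma> \<tau> (pt_dsum x y) = pt_dsum (omega r sq \<gamma> \<tau> x) (omega r sq \<gamma> \<tau> y)" "pt_dsum x y \<in> U B"
      if "x \<in> U B" "y \<in> U B" for x y
    proof -
      have xy: "x \<in> U_gam r \<gamma>" "y \<in> U_gam r \<gamma>" "omega r sq \<gamma> \<tau> x \<in> B" "omega r sq \<gamma> \<tau> y \<in> B" using that by (auto simp: U_def)
      show 1: "omega r sq \<gamma> \<tau> (pt_dsum x y) = pt_dsum (omega r sq \<gamma> \<tau> x) (omega r sq \<gamma> \<tau> y)" by (rule omega_dsum[OF g(1) W(1)[OF xy(1)] W(1)[OF xy(2)]])
      have "pt_dsum x y \<in> U_gam r \<gamma>" by (rule U_gam_dsum[OF g(1) W(1)[OF xy(1)] W(1)[OF xy(2)]]) (simp add: xy)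
      moreover have "pt_dsum (omega r sq \<gamma> \<tau> x) (omega r sq \<gamma> \<tau> y) \<in> B" using nB xy unfolding nc_set_def by blast
      ultimately show "pt_dsum x y \<in> U B" unfolding U_def 1[symmetric] by simp
    qed
    have nU: "nc_set 2 (U B)" unfolding nc_set_def using od(2) W(2) by (auto simp: U_def)
    have fB: "nc_function 2 (OU \<gamma> \<tau> \<inter> B) f"
      by (rule nc_function_restrict[OF f OU_nc_set[OF g B(1)]]) (use SooI[OF g] B(3) in blast)
    have omB: "omega r sq \<gamma> \<tau> x \<in> OU \<gamma> \<tau> \<inter> B" if "x \<in> U B" for x using that by (auto simp: U_def OU_def)
    have GB: "G x = f (omega r sq \<gamma> \<tau> x)" if "x \<in> U B" for x using G[unfolded US] that sub by blast
    have "nc_function 2 (U B) G" unfolding nc_function_def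
    proof (intro conjI nU ballI)
      show "graded 2 (U B) G" using gr sub unfolding graded_def by blast
      show "similarity_preserving 2 (U B) G" unfolding similarity_preserving_def
      proof (intro allI impI ballI)
        fix n x s assume n: "1 \<le> n" and x: "x \<in> U B \<inter> level 2 n" and s: "s \<in> GLn n" and sx: "pt_conj s x \<in> U B"
        have x': "x \<in> U B" "x \<in> level 2 n" "x \<in> W_gam r \<gamma>" using x W(1) by (auto simp: U_def)
        note oc = omega_conj[OF g(1) x'(3,2) s, of \<tau>]
        have "f (pt_conj s (omega r sq \<gamma> \<tau> x)) = mat_conj s (f (omega r sq \<gamma> \<tau> x))"
          by (rule cond_nc_conj[OF f om omega_coords(1)[OF g x'(3,2)] n s]) (use x'(1) sub om sx in \<open>auto simp flip: oc\<close>)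
        then show "G (pt_conj s x) = mat_conj s (G x)" unfolding GB[OF sx] GB[OF x'(1)] oc .
      qed
      fix x y assume xy: "x \<in> U B" "y \<in> U B"
      have "f (pt_dsum (omega r sq \<gamma> \<tau> x) (omega r sq \<gamma> \<tau> y)) = mat_dsum (f (omega r sq \<gamma> \<tau> x)) (f (omega r sq \<gamma> \<tau> y))"
        using fB omB[OF xy(1)] omB[OF xy(2)] unfolding nc_function_def by blast
      then show "G (pt_dsum x y) = mat_dsum (G x) (G y)" unfolding GB[OF od(2)[OF xy]] GB[OF xy(1)] GB[OF xy(2)] od(1)[OF xy] .
    qed
    moreover have "p \<in> U B" using B(2) pS(2) by (simp add: U_def)
    ultimately show ?thesis by (intro bexI[OF _ open_U[OF free_base_open[OF B(1)]]] conjI sub nU)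
  qed
  have bG: "bounded_on (U S) G"
  proof -
    obtain C where C: "\<And>w. w \<in> Soo \<Longrightarrow> opnorm (f w) \<le> C" using b unfolding bounded_on_def by blast
    show ?thesis unfolding bounded_on_def by (rule exI[of _ C]) (use G[unfolded US] om C in auto)
  qed
  show ?thesis unfolding US holo_def using open_U[OF free_domain] gr nbhd bG by blast
qed

section \<open>The function spaces and the bijections\<close>

lemma symmetric_Soo: "symmetric_set Soo" and symmetric_So: "symmetric_set So"
  unfolding symmetric_set_def using flip_Soo flip_So by blast+

lemma funs_S_D:
  assumes "f \<in> funs_S S"
  shows "f \<in> extensional S" "bounded_on S f" "symmetric_on S f" "cond_nc 2 S f"
  using assms by (auto simp: funs_S_def)

lemma bounded_on_subset: "bounded_on D f \<Longrightarrow> D' \<subseteq> D \<Longrightarrow> (\<And>x. x \<in> D' \<Longrightarrow> f' x = f x) \<Longrightarrow> bounded_on D' f'"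
  unfolding bounded_on_def by (metis subsetD)

lemma ext_funs_S:
  assumes f: "cond_nc 2 Soo f" "bounded_on Soo f" "symmetric_on Soo f"
  shows "restrict (ext f) S \<in> funs_S S" "\<And>w. w \<in> Soo \<Longrightarrow> restrict (ext f) S w = f w"
proof -
  obtain C where C: "\<And>w. w \<in> Soo \<Longrightarrow> opnorm (f w) \<le> C" using f(2) unfolding bounded_on_def by blast
  have "bounded_on S (restrict (ext f) S)" unfolding bounded_on_def
  proof (intro exI ballI)
    fix w assume w: "w \<in> S"
    have "opnorm (ext f w) \<le> C" by (rule ext_carrier(2)[OF f(1) C w lvl_S[OF w]])
    then show "opnorm (restrict (ext f) S w) \<le> C" using w by simp
  qed
  moreover have "symmetric_on S (restrict (ext f) S)" unfolding symmetric_on_def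
  proof (intro conjI symmetric ballI)
    fix w assume w: "w \<in> S"
    have "ext f (flip w) = ext f w" by (rule ext_flip[OF f(1) C f(3) w])
    then show "restrict (ext f) S (flip w) = restrict (ext f) S w" using w flip_S[OF w] by simp
  qed
  moreover have "cond_nc 2 S (restrict (ext f) S)"
    by (rule cond_nc_subset[OF ext_cond_nc[OF f(1) C] order_refl]) simp_all
  ultimately show "restrict (ext f) S \<in> funs_S S" by (simp add: funs_S_def)
  fix w assume w: "w \<in> Soo"
  have "ext f w = f w" by (rule ext_eq[OF f(1) C w])
  then show "restrict (ext f) S w = f w" using Soo_S[OF w] by simp
qed

lemma funs_S_eqI:
  assumes f: "f \<in> funs_S S" and g: "g \<in> funs_S S" and eq: "\<And>w. w \<in> Soo \<Longrightarrow> f w = g w"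
  shows "f = g"
proof (rule extensionalityI[OF funs_S_D(1)[OF f] funs_S_D(1)[OF g]])
  fix w assume w: "w \<in> S"
  show "f w = g w" by (rule eq_on_S[OF funs_S_D(4,2)[OF f] funs_S_D(4,2)[OF g] eq w])
qed

lemma restrict_So:
  assumes f: "f \<in> funs_S S" shows "restrict f So \<in> funs_So r sq S"
proof -
  have sub: "So \<subseteq> S" using So_S by blast
  have "symmetric_on So (restrict f So)" using symmetric_So funs_S_D(3)[OF f] So_S flip_So by (auto simp: symmetric_on_def)
  then show ?thesis using bounded_on_subset[OF funs_S_D(2)[OF f] sub] cond_nc_subset[OF funs_S_D(4)[OF f] sub] by (simp add: funs_So_def)
qed

lemma restrict_Soo:
  assumes f: "f \<in> funs_S S" shows "restrict f Soo \<in> funs_Soo r sq S"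
proof -
  have sub: "Soo \<subseteq> S" using Soo_S by blast
  have s: "symmetric_on Soo (restrict f Soo)" using symmetric_Soo funs_S_D(3)[OF f] Soo_S flip_Soo by (auto simp: symmetric_on_def)
  have b: "bounded_on Soo (restrict f Soo)" by (rule bounded_on_subset[OF funs_S_D(2)[OF f] sub]) simp
  have c: "cond_nc 2 Soo (restrict f Soo)" by (rule cond_nc_subset[OF funs_S_D(4)[OF f] sub]) simp
  show ?thesis using s b c cond_nc_holo[OF c b] by (simp add: funs_Soo_def)
qed

text \<open>The chosen preimage is immaterial, by \<open>pi_fibre\<close> with the identity as
  similarity.\<close>

definition push :: "ncfun \<Rightarrow> ncfun" where
  "push f = (\<lambda>p\<in>pi_map ` So. f (SOME w. w \<in> So \<and> pi_map w = p))"

lemma push_pi: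
  assumes f: "f \<in> funs_S S" and w: "w \<in> So" shows "push f (pi_map w) = f w"
proof -
  define v where "v = (SOME v. v \<in> So \<and> pi_map v = pi_map w)"
  have v: "v \<in> So \<and> pi_map v = pi_map w" unfolding v_def by (rule someI[of _ w]) (simp add: w)
  note wS = So_S[OF w] and vS = So_S[OF conjunct1[OF v]]
  define n where "n = lvl w"
  have wl: "w \<in> level 2 n" unfolding n_def by (rule lvl_S[OF wS])
  have vl: "v \<in> level 2 n" by (rule pi_level[OF vS]) (simp add: v pi_map_level[OF wl])
  have one: "pt_conj (1\<^sub>m n) x = x" if "x \<in> level 3 n" for x
  proof (rule nth_equalityI)
    fix i assume "i < length (pt_conj (1\<^sub>m n) x)"
    then have i: "i < 3" using that by (simp add: pt_conj_def levelD(1))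
    show "pt_conj (1\<^sub>m n) x ! i = x ! i" unfolding pt_conj_nth[OF that i] mat_conj_def minv_one using levelD(2)[OF that i] by simp
  qed (simp add: pt_conj_def)
  have "f v = mat_conj (1\<^sub>m n) (f w)"
    by (rule pi_fibre[OF funs_S_D(4,3)[OF f] conjunct1[OF v] vl w wl one_GLn]) (simp add: v one[OF pi_map_level[OF wl]])
  also have "\<dots> = f w" unfolding mat_conj_def minv_one
    using cond_nc_graded[OF funs_S_D(4)[OF f] wS wl level_pos[OF wS wl]] by simp
  finally show ?thesis using w by (simp add: push_def flip: v_def)
qed

lemma push_funs_Go: assumes f: "f \<in> funs_S S" shows "push f \<in> funs_Go r sq S"
proof -
  have "bounded_on (pi_map ` So) (push f)"
  proof -
    obtain C where C: "\<And>w. w \<in> S \<Longrightarrow> opnorm (f w) \<le> C" using funs_S_D(2)[OF f] unfolding bounded_on_def by blast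
    show ?thesis unfolding bounded_on_def by (rule exI[of _ C]) (use push_pi[OF f] C So_S in auto)
  qed
  moreover have "push f \<in> extensional (pi_map ` So)" by (simp add: push_def)
  ultimately show ?thesis using cond_nc_G_o[OF funs_S_D(4,3)[OF f] push_pi[OF f]] by (simp add: funs_Go_def G_o_eq)
qed

lemma push_funs_Goo: assumes f: "f \<in> funs_S S" shows "restrict (push f) (pi_map ` Soo) \<in> funs_Goo r sq S"
proof -
  have sub: "pi_map ` Soo \<subseteq> pi_map ` So" using Soo_So by blast
  have p: "push f \<in> extensional (pi_map ` So)" "bounded_on (pi_map ` So) (push f)" "cond_nc 3 (pi_map ` So) (push f)"
    using push_funs_Go[OF f] by (auto simp: funs_Go_def G_o_eq)
  have fo: "restrict f Soo \<in> funs_Soo r sq S" by (rule restrict_Soo[OF f])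
  then have c: "cond_nc 2 Soo (restrict f Soo)" "bounded_on Soo (restrict f Soo)" by (auto simp: funs_Soo_def)
  have m: "manifold_holo r sq S (restrict (push f) (pi_map ` Soo))" unfolding manifold_holo_def
  proof (intro ballI)
    fix \<gamma> \<tau> assume g: "\<gamma> \<in> Gam" "\<tau> \<in> signs \<gamma>"
    show "holo 2 (zariski_top 2) (U_chart r sq S \<gamma> \<tau>) (restrict (push f) (pi_map ` Soo) \<circ> Phi r sq \<gamma> \<tau>)"
    proof (rule chart_holo[OF c g])
      fix p assume "p \<in> U_chart r sq S \<gamma> \<tau>"
      then have p: "p \<in> U_gam r \<gamma>" "omega r sq \<gamma> \<tau> p \<in> S" by (auto simp: U_chart_eq)
      have o: "omega r sq \<gamma> \<tau> p \<in> Soo" by (rule SooI[OF g _ p(2)]) (simp add: OU_def p(1))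
      have "p \<in> W_gam r \<gamma>" using p(1) by (simp add: U_gam_iff)
      then show "(restrict (push f) (pi_map ` Soo) \<circ> Phi r sq \<gamma> \<tau>) p = restrict f Soo (omega r sq \<gamma> \<tau> p)"
        using Phi_eq[OF g] o push_pi[OF f Soo_So[OF o]] by simp
    qed
  qed
  show ?thesis using m bounded_on_subset[OF p(2) sub] cond_nc_subset[OF p(3) sub] by (simp add: funs_Goo_def G_oo_eq)
qed

text \<open>Symmetry of the pullback is inherited from the flip invariance of
  \<open>pi_map\<close>.\<close>

lemma pull_Soo:
  assumes F: "cond_nc 3 (pi_map ` Soo) F" "bounded_on (pi_map ` Soo) F"
  shows "cond_nc 2 Soo (F \<circ> pi_map)" "bounded_on Soo (F \<circ> pi_map)" "symmetric_on Soo (F \<circ> pi_map)"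
proof -
  show "cond_nc 2 Soo (F \<circ> pi_map)" by (rule cond_nc_pi_map[OF F(1)]) (use S_nc Soo_S in auto)
  show "bounded_on Soo (F \<circ> pi_map)" using F(2) by (auto simp: bounded_on_def)
  show "symmetric_on Soo (F \<circ> pi_map)" using symmetric_Soo pi_map_flip[OF lvl_S[OF Soo_S]] by (auto simp: symmetric_on_def)
qed

text \<open>A bounded conditionally nc function on \<open>S_o\<close> is determined by its values at
  generic points, so extending its restriction to \<open>S_oo\<close> recovers it.\<close>

lemma bij_So: "bij_betw (\<lambda>f. restrict f So) (funs_S S) (funs_So r sq S)"
proof (rule bij_betw_imageI)
  show "inj_on (\<lambda>f. restrict f So) (funs_S S)"
  proof (rule inj_onI)
    fix f g assume fg: "f \<in> funs_S S" "g \<in> funs_S S" and eq: "restrict f So = restrict g So"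
    show "f = g"
    proof (rule funs_S_eqI[OF fg])
      fix w assume "w \<in> Soo"
      then show "f w = g w" using fun_cong[OF eq, of w] Soo_So[of w] by simp
    qed
  qed
  have "h \<in> (\<lambda>f. restrict f So) ` funs_S S" if "h \<in> funs_So r sq S" for h
  proof -
    have h: "h \<in> extensional So" "bounded_on So h" "symmetric_on So h" "cond_nc 2 So h" using that by (auto simp: funs_So_def)
    have sub: "Soo \<subseteq> So" "So \<subseteq> S" using Soo_So So_S by blast+
    have h': "cond_nc 2 Soo h" "bounded_on Soo h" "symmetric_on Soo h"
      using cond_nc_subset[OF h(4) sub(1)] bounded_on_subset[OF h(2) sub(1)] h(3) symmetric_Soo sub by (auto simp: symmetric_on_def)
    define f where "f = restrict (ext h) S"
    have f: "f \<in> funs_S S" "\<And>w. w \<in> Soo \<Longrightarrow> f w = h w" unfolding f_def by (rule ext_funs_S[OF h'], rule ext_funs_S(2)[OF h'])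
    have "f w = h w" if "w \<in> So" for w
      by (rule eq_on_So[OF cond_nc_subset[OF funs_S_D(4)[OF f(1)] sub(2)] bounded_on_subset[OF funs_S_D(2)[OF f(1)] sub(2)] h(4,2) f(2) that]) simp_all
    then have "h = restrict f So" by (intro extensionalityI[OF h(1)]) simp_all
    then show ?thesis using f(1) by blast
  qed
  then show "(\<lambda>f. restrict f So) ` funs_S S = funs_So r sq S" using restrict_So by blast
qed

lemma bij_Soo: "bij_betw (\<lambda>f. restrict f Soo) (funs_S S) (funs_Soo r sq S)"
proof (rule bij_betw_imageI)
  show "inj_on (\<lambda>f. restrict f Soo) (funs_S S)"
  proof (rule inj_onI)
    fix f g assume fg: "f \<in> funs_S S" "g \<in> funs_S S" and eq: "restrict f Soo = restrict g Soo"
    show "f = g"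
    proof (rule funs_S_eqI[OF fg])
      fix w assume "w \<in> Soo"
      then show "f w = g w" using fun_cong[OF eq, of w] by simp
    qed
  qed
  have "h \<in> (\<lambda>f. restrict f Soo) ` funs_S S" if "h \<in> funs_Soo r sq S" for h
  proof -
    have h: "h \<in> extensional Soo" "bounded_on Soo h" "symmetric_on Soo h" "cond_nc 2 Soo h" using that by (auto simp: funs_Soo_def)
    define f where "f = restrict (ext h) S"
    have f: "f \<in> funs_S S" "\<And>w. w \<in> Soo \<Longrightarrow> f w = h w"
      unfolding f_def by (rule ext_funs_S[OF h(4,2,3)], rule ext_funs_S(2)[OF h(4,2,3)])
    then have "h = restrict f Soo" by (intro extensionalityI[OF h(1)]) simp_all
    then show ?thesis using f(1) by blast
  qed
  then show "(\<lambda>f. restrict f Soo) ` funs_S S = funs_Soo r sq S" using restrict_Soo by blast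
qed

text \<open>For surjectivity, \<open>F\<close> is pulled back to \<open>S_oo\<close>, extended to
  \<open>S\<close> and pushed forward; the result has the values of \<open>F\<close> over generic
  points.\<close>

lemma bij_Goo: "bij_betw (\<lambda>f. restrict (push f) (pi_map ` Soo)) (funs_S S) (funs_Goo r sq S)"
proof (rule bij_betw_imageI)
  have val: "restrict (push f) (pi_map ` Soo) (pi_map w) = f w" if "f \<in> funs_S S" "w \<in> Soo" for f w
    using push_pi[OF that(1) Soo_So[OF that(2)]] that(2) by simp
  show "inj_on (\<lambda>f. restrict (push f) (pi_map ` Soo)) (funs_S S)"
  proof (rule inj_onI)
    fix f g assume fg: "f \<in> funs_S S" "g \<in> funs_S S" and eq: "restrict (push f) (pi_map ` Soo) = restrict (push g) (pi_map ` Soo)"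
    show "f = g" by (rule funs_S_eqI[OF fg]) (use val fg eq in metis)
  qed
  have "F \<in> (\<lambda>f. restrict (push f) (pi_map ` Soo)) ` funs_S S" if "F \<in> funs_Goo r sq S" for F
  proof -
    have F: "F \<in> extensional (pi_map ` Soo)" "bounded_on (pi_map ` Soo) F" "cond_nc 3 (pi_map ` Soo) F"
      using that by (auto simp: funs_Goo_def G_oo_eq)
    define f where "f = restrict (ext (F \<circ> pi_map)) S"
    have f: "f \<in> funs_S S" "\<And>w. w \<in> Soo \<Longrightarrow> f w = F (pi_map w)"
      unfolding f_def by (rule ext_funs_S(1)[OF pull_Soo[OF F(3,2)]]) (use ext_funs_S(2)[OF pull_Soo[OF F(3,2)]] in simp)
    have "F = restrict (push f) (pi_map ` Soo)"
    proof (rule extensionalityI[OF F(1)])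
      fix p assume "p \<in> pi_map ` Soo"
      then obtain w where w: "w \<in> Soo" "p = pi_map w" by blast
      show "F p = restrict (push f) (pi_map ` Soo) p" unfolding w(2) val[OF f(1) w(1)] f(2)[OF w(1)] ..
    qed simp
    then show ?thesis using f(1) by blast
  qed
  then show "(\<lambda>f. restrict (push f) (pi_map ` Soo)) ` funs_S S = funs_Goo r sq S" using push_funs_Goo by blast
qed

text \<open>Surjectivity rests on \<open>bij_So\<close>: the pullback of \<open>F\<close> to
  \<open>S_o\<close> is a restriction of some function on \<open>S\<close>, and pushing that
  function forward gives \<open>F\<close>.\<close>

lemma bij_Go: "bij_betw push (funs_S S) (funs_Go r sq S)"
proof (rule bij_betw_imageI)
  show "inj_on push (funs_S S)"
  proof (rule inj_onI)
    fix f g assume fg: "f \<in> funs_S S" "g \<in> funs_S S" and eq: "push f = push g"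
    show "f = g" by (rule funs_S_eqI[OF fg]) (use push_pi fg eq Soo_So in metis)
  qed
  have "F \<in> push ` funs_S S" if "F \<in> funs_Go r sq S" for F
  proof -
    have F: "F \<in> extensional (pi_map ` So)" "bounded_on (pi_map ` So) F" "cond_nc 3 (pi_map ` So) F"
      using that by (auto simp: funs_Go_def G_o_eq)
    have "restrict (F \<circ> pi_map) So \<in> funs_So r sq S"
    proof -
      have "cond_nc 2 So (restrict (F \<circ> pi_map) So)" by (rule cond_nc_pi_map[OF F(3)]) (use S_nc So_S in auto)
      moreover have "bounded_on So (restrict (F \<circ> pi_map) So)" using F(2) by (auto simp: bounded_on_def)
      moreover have "symmetric_on So (restrict (F \<circ> pi_map) So)"
        using symmetric_So flip_So pi_map_flip[OF lvl_S[OF So_S]] by (auto simp: symmetric_on_def)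
      ultimately show ?thesis by (simp add: funs_So_def)
    qed
    then have "restrict (F \<circ> pi_map) So \<in> (\<lambda>f. restrict f So) ` funs_S S" unfolding bij_betw_imp_surj_on[OF bij_So] .
    then obtain f where f: "restrict (F \<circ> pi_map) So = restrict f So" "f \<in> funs_S S" by (rule imageE)
    have "F = push f"
    proof (rule extensionalityI[OF F(1)])
      show "push f \<in> extensional (pi_map ` So)" by (simp add: push_def)
      fix p assume "p \<in> pi_map ` So"
      then obtain w where w: "w \<in> So" "p = pi_map w" by blast
      show "F p = push f p" unfolding w(2) push_pi[OF f(2) w(1)] using fun_cong[OF f(1), of w] w(1) by simp
    qed
    then show ?thesis using f(2) by blast
  qed
  then show "push ` funs_S S = funs_Go r sq S" using push_funs_Go by blast
qed

end

theorem theorem10p1: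
  fixes r :: "complex set \<Rightarrow> real"
    and sq :: "complex set \<Rightarrow> complex \<Rightarrow> complex"
    and S :: "point set"
  assumes radii: "admissible_radii r"
    and branches: "sqrt_branches r sq"
    and free_domain: "S \<in> free_top 2"
    and symmetric: "symmetric_set S"
    and similar_sum: "\<And>w1 w2. \<lbrakk>w1 \<in> S; w2 \<in> S; similar_points (pi_map w1) (pi_map w2)\<rbrakk> \<Longrightarrow> pt_dsum w1 w2 \<in> S"
  shows "\<exists>to_o to_oo to_Goo to_Go.
     bij_betw to_o (funs_S S) (funs_So r sq S) \<and>
     bij_betw to_oo (funs_S S) (funs_Soo r sq S) \<and>
     bij_betw to_Goo (funs_S S) (funs_Goo r sq S) \<and>
     bij_betw to_Go (funs_S S) (funs_Go r sq S) \<and>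
     (\<forall>f \<in> funs_S S.
        to_o f = restrict f (S_o r sq S) \<and>
        to_oo f = restrict (to_o f) (S_oo r sq S) \<and>
        to_Goo f = restrict (to_Go f) (G_oo r sq S) \<and>
        (\<forall>w \<in> S_o r sq S. to_o f w = to_Go f (pi_map w)) \<and>
        (\<forall>w \<in> S_oo r sq S. to_oo f w = to_Goo f (pi_map w)))"
proof -
  interpret sym_dom r sq S by unfold_locales (fact radii, fact branches, fact free_domain, fact symmetric, fact similar_sum)
  have oo: "restrict f Soo = restrict (restrict f So) Soo" for f :: ncfun
    using Soo_So by (auto simp: fun_eq_iff)
  show ?thesis
    by (rule exI[of _ "\<lambda>f. restrict f So"], rule exI[of _ "\<lambda>f. restrict f Soo"],
        rule exI[of _ "\<lambda>f. restrict (push f) (pi_map ` Soo)"], rule exI[of _ push])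
      (intro conjI ballI bij_So bij_Soo bij_Goo bij_Go refl oo;
        use push_pi Soo_So in \<open>simp add: G_oo_eq\<close>)
qed

end
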